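(* Let $T>0$ and let $\rho^{\rm ini}:\mathbb{T}\to[0,1]$ be a measurable initial profile. For any $t\in[0,T]$, any $\delta>0$, and any smooth test function $\varphi:\mathbb{T}\to\mathbb{R}$, we have $$\lim_{N\to\infty}\mathbb{P}_{\mu^N}\bigg[\bigg|\frac1N\sum_{x\in\mathbb{T}_N}\varphi(\tfrac xN)\eta_x(t)-\int_{\mathbb{T}}\varphi(u)\rho_t(u)\,du\bigg|>\delta\bigg]=0,$$ where $\rho$ is the unique weak solution of $\partial_t\rho=\partial_u^2(\mathcal{H}(\rho))$ with initial condition $\rho_0=\rho^{\rm ini}$.
   Context: $\mathbb{T}_N=\mathbb{Z}/N\mathbb{Z}$, $\mathbb{T}=\mathbb{R}/\mathbb{Z}=[0,1)$, $\Sigma_N=\{0,1\}^{\mathbb{T}_N}$. Facilitated exclusion process: the generator $\mathcal{L}_N$ acts on functions $f:\Sigma_N\to\mathbb{R}$ by $\mathcal{L}_Nf(\eta)=\sum_{x\in\mathbb{T}_N}c_{x,x+1}(\eta)\big(f(\eta^{x,x+1})-f(\eta)\big)$, where $\eta^{x,y}$ is the configuration obtained from $\eta$ by swapping the values at sites $x$ and $y$, and $c_{x,x+1}(\eta)=\eta_{x-1}\eta_x(1-\eta_{x+1})+(1-\eta_x)\eta_{x+1}\eta_{x+2}$. Initial law: $\mu^N$ is the non-homogeneous Bernoulli product measure on $\Sigma_N$ fitting $\rho^{\rm ini}$, i.e. $\mu^N(\eta)=\prod_{x\in\mathbb{T}_N}\big(\rho^{\rm ini}(\tfrac xN)\eta_x+(1-\rho^{\rm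 ini}(\tfrac xN))(1-\eta_x)\big)$. $\{\eta(t)\,;\,t\ge0\}$ is the Markov process driven by the accelerated generator $N^2\mathcal{L}_N$ and initially distributed as $\mu^N$, and $\mathbb{P}_{\mu^N}$ is the corresponding probability measure on the Skorokhod path space $\mathcal{D}([0,T],\Sigma_N)$. Weak solution: for $r\ge0$, $\mathcal{H}(r)=\frac{2r-1}{r}\mathbf{1}_{\{r>1/2\}}$, and $\langle f,g\rangle$ is the inner product of $f$ and $g$ in $L^2(du)$ on $\mathbb{T}$. A measurable function $\rho:(t,u)\mapsto\rho_t(u)$ is a weak solution of $\partial_t\rho=\partial_u^2(\mathcal{H}(\rho))$ with initial condition $\rho_0=\rho^{\rm ini}$ if $\rho_t(u)\in[0,1]$ for any $(t,u)\in[0,T]\times\mathbb{T}$, and for any test function $\varphi\in C^{1,2}([0,T]\times\mathbb{T})$ (of class $C^1$ in the first variable and $C^2$ in the second), $$\langle\rho_T,\varphi_T\rangle=\langle\rho^{\rm ini},\varphi_0\rangle+\int_0^T\langle\rho_t,\partial_t\varphi_t\rangle\,dt+\int_0^T\langle\mathcal{H}(\rho_t),\partial_u^2\varphi_t\rangle\,dt.$$ Existence of a unique weak solution in this sense is taken as known (uniqueness due to Uchiyama).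
   Formalization: Adds that Riemann sums of ψρ^ini over x/N converge to ∫ψρ^ini for smooth ψ (else false, e.g. ρ^ini=1_ℚ; necessary at t=0), and takes ρ to be the version whose weak identity holds up to every time s in [0,T], as ρ_t at a single t<T is otherwise undetermined. *)

theory Defs
  imports "HOL-Probability.Probability"
begin

text \<open>
  The discrete torus \<open>\<int>/N\<int>\<close> is \<open>{..<N}\<close> with arithmetic modulo \<open>N\<close>, and the torus \<open>\<real>/\<int>\<close> is
  \<open>{0..<1}\<close>. Functions on \<open>\<real>/\<int>\<close> whose smoothness matters (the test functions) are 1-periodic
  functions on \<open>\<real>\<close>; of a profile only the values on \<open>{0..<1}\<close> are used.
\<close>

section \<open>The facilitated exclusion process\<close>

definition configs :: "nat \<Rightarrow> (nat \<Rightarrow> nat) set" where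
  "configs N = {..<N} \<rightarrow>\<^sub>E {0, 1}"

definition shift :: "nat \<Rightarrow> nat \<Rightarrow> int \<Rightarrow> nat" where
  "shift N x k = nat ((int x + k) mod int N)"

definition swap_sites :: "nat \<Rightarrow> nat \<Rightarrow> (nat \<Rightarrow> nat) \<Rightarrow> (nat \<Rightarrow> nat)" where
  "swap_sites x y \<eta> = \<eta>(x := \<eta> y, y := \<eta> x)"

definition rate :: "nat \<Rightarrow> nat \<Rightarrow> (nat \<Rightarrow> nat) \<Rightarrow> real" where
  "rate N x \<eta> =
     real (\<eta> (shift N x (-1))) * real (\<eta> x) * (1 - real (\<eta> (shift N x 1)))
     + (1 - real (\<eta> x)) * real (\<eta> (shift N x 1)) * real (\<eta> (shift N x 2))"

definition generator :: "nat \<Rightarrow> ((nat \<Rightarrow> nat) \<Rightarrow> real) \<Rightarrow> (nat \<Rightarrow> nat) \<Rightarrow> real" where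
  "generator N f \<eta> =
     (\<Sum>x<N. rate N x \<eta> * (f (swap_sites x (shift N x 1) \<eta>) - f \<eta>))"

definition accelerated_generator :: "nat \<Rightarrow> ((nat \<Rightarrow> nat) \<Rightarrow> real) \<Rightarrow> (nat \<Rightarrow> nat) \<Rightarrow> real" where
  "accelerated_generator N f \<eta> = (real N)\<^sup>2 * generator N f \<eta>"

text \<open>
  The semigroup \<open>exp (\<tau> G)\<close> of a generator \<open>G\<close>. The series converges absolutely on configurations,
  since the state space is finite.
\<close>

definition semigroup_of ::
    "(('s \<Rightarrow> real) \<Rightarrow> ('s \<Rightarrow> real)) \<Rightarrow> real \<Rightarrow> ('s \<Rightarrow> real) \<Rightarrow> 's \<Rightarrow> real" where
  "semigroup_of G \<tau> f \<eta> = (\<Sum>n. \<tau> ^ n / fact n * (G ^^ n) f \<eta>)"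

definition init_weight :: "(real \<Rightarrow> real) \<Rightarrow> nat \<Rightarrow> (nat \<Rightarrow> nat) \<Rightarrow> real" where
  "init_weight \<rho>ini N \<eta> =
     (\<Prod>x<N. \<rho>ini (real x / real N) * real (\<eta> x)
            + (1 - \<rho>ini (real x / real N)) * (1 - real (\<eta> x)))"

text \<open>
  Paths that are right-continuous with left limits on \<open>[0,T]\<close>, spelled out for the discrete topology
  on the finite set of configurations.
\<close>

definition cadlag_paths :: "real \<Rightarrow> nat \<Rightarrow> (real \<Rightarrow> nat \<Rightarrow> nat) set" where
  "cadlag_paths T N =
     {\<omega> \<in> {0..T} \<rightarrow>\<^sub>E configs N.
        (\<forall>t\<in>{0..<T}. \<forall>\<^sub>F s in at_right t. \<omega> s = \<omega> t) \<and>
        (\<forall>t\<in>{0<..T}. \<exists>\<eta>. \<forall>\<^sub>F s in at_left t. \<omega> s = \<eta>)}"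

text \<open>
  The path space \<open>D([0,T], \<Sigma>\<^sub>N)\<close> with the sigma-algebra generated by the evaluation maps, which is
  the Borel sigma-algebra of the Skorokhod topology. (Only its space and sigma-algebra are used.)
\<close>

definition path_space :: "real \<Rightarrow> nat \<Rightarrow> (real \<Rightarrow> nat \<Rightarrow> nat) measure" where
  "path_space T N =
     restrict_space (\<Pi>\<^sub>M t\<in>{0..T}. count_space (configs N)) (cadlag_paths T N)"

definition past :: "real \<Rightarrow> nat \<Rightarrow> real \<Rightarrow> (real \<Rightarrow> nat \<Rightarrow> nat) measure" where
  "past T N s =
     sigma (cadlag_paths T N)
       {{\<omega> \<in> cadlag_paths T N. \<omega> r = \<eta>} | r \<eta>. r \<in> {0..s} \<and> \<eta> \<in> configs N}"

text \<open>
  \<open>P\<close> is the law on \<open>D([0,T], \<Sigma>\<^sub>N)\<close> of the Markov process with generator \<open>N\<^sup>2 L\<^sub>N\<close> started from the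
  product measure fitting \<open>\<rho>ini\<close>: the evaluation process has this initial law and satisfies
  \<open>E[f(\<eta>(t)) | F\<^sub>s] = (exp ((t - s) N\<^sup>2 L\<^sub>N) f)(\<eta>(s))\<close>.
\<close>

definition FEP_law :: "real \<Rightarrow> nat \<Rightarrow> (real \<Rightarrow> real) \<Rightarrow> (real \<Rightarrow> nat \<Rightarrow> nat) measure \<Rightarrow> bool" where
  "FEP_law T N \<rho>ini P \<longleftrightarrow>
     prob_space P \<and> sets P = sets (path_space T N) \<and>
     (\<forall>\<eta>\<in>configs N. measure P {\<omega> \<in> space P. \<omega> 0 = \<eta>} = init_weight \<rho>ini N \<eta>) \<and>
     (\<forall>s t. 0 \<le> s \<and> s \<le> t \<and> t \<le> T \<longrightarrow>
        (\<forall>f. AE \<omega> in P. real_cond_exp P (past T N s) (\<lambda>\<omega>. f (\<omega> t)) \<omega>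
                 = semigroup_of (accelerated_generator N) (t - s) f (\<omega> s)))"

section \<open>The limit equation\<close>

definition \<H> :: "real \<Rightarrow> real" where
  "\<H> r = (2 * r - 1) / r * indicator {1/2<..} r"

definition torus_integral :: "(real \<Rightarrow> real) \<Rightarrow> real" where
  "torus_integral f = (LINT u:{0..<1}|lborel. f u)"

definition torus_inner :: "(real \<Rightarrow> real) \<Rightarrow> (real \<Rightarrow> real) \<Rightarrow> real" where
  "torus_inner f g = torus_integral (\<lambda>u. f u * g u)"

definition smooth_on_torus :: "(real \<Rightarrow> real) \<Rightarrow> bool" where
  "smooth_on_torus \<phi> \<longleftrightarrow>
     (\<forall>u. \<phi> (u + 1) = \<phi> u) \<and> (\<forall>n. (deriv ^^ n) \<phi> differentiable_on UNIV)"

text \<open>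
  \<open>\<phi>\<close> is of class \<open>C\<^sup>1\<^sup>,\<^sup>2\<close> on \<open>[0,T]\<close> times the torus, with \<open>\<partial>\<^sub>t \<phi> = \<phi>t\<close>, \<open>\<partial>\<^sub>u \<phi> = \<phi>u\<close>,
  \<open>\<partial>\<^sub>u\<^sup>2 \<phi> = \<phi>uu\<close>; time derivatives at \<open>0\<close> and \<open>T\<close> are one-sided.
\<close>

definition C12_test ::
    "real \<Rightarrow> (real \<Rightarrow> real \<Rightarrow> real) \<Rightarrow> (real \<Rightarrow> real \<Rightarrow> real) \<Rightarrow>
     (real \<Rightarrow> real \<Rightarrow> real) \<Rightarrow> (real \<Rightarrow> real \<Rightarrow> real) \<Rightarrow> bool" where
  "C12_test T \<phi> \<phi>t \<phi>u \<phi>uu \<longleftrightarrow>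
     (\<forall>t\<in>{0..T}. \<forall>u.
        \<phi> t (u + 1) = \<phi> t u \<and>
        ((\<lambda>s. \<phi> s u) has_real_derivative \<phi>t t u) (at t within {0..T}) \<and>
        ((\<lambda>v. \<phi> t v) has_real_derivative \<phi>u t u) (at u) \<and>
        ((\<lambda>v. \<phi>u t v) has_real_derivative \<phi>uu t u) (at u)) \<and>
     continuous_on ({0..T} \<times> UNIV) (\<lambda>(t, u). \<phi> t u) \<and>
     continuous_on ({0..T} \<times> UNIV) (\<lambda>(t, u). \<phi>t t u) \<and>
     continuous_on ({0..T} \<times> UNIV) (\<lambda>(t, u). \<phi>u t u) \<and>
     continuous_on ({0..T} \<times> UNIV) (\<lambda>(t, u). \<phi>uu t u)"

definition weak_solution :: "real \<Rightarrow> (real \<Rightarrow> real) \<Rightarrow> (real \<Rightarrow> real \<Rightarrow> real) \<Rightarrow> bool" where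
  "weak_solution T \<rho>ini \<rho> \<longleftrightarrow>
     (\<lambda>(t, u). \<rho> t u) \<in> borel_measurable (restrict_space borel ({0..T} \<times> {0..<1})) \<and>
     (\<forall>t\<in>{0..T}. \<forall>u\<in>{0..<1}. \<rho> t u \<in> {0..1}) \<and>
     (\<forall>\<phi> \<phi>t \<phi>u \<phi>uu. C12_test T \<phi> \<phi>t \<phi>u \<phi>uu \<longrightarrow>
        torus_inner (\<rho> T) (\<phi> T) =
          torus_inner \<rho>ini (\<phi> 0)
          + (LINT t:{0..T}|lborel. torus_inner (\<rho> t) (\<phi>t t))
          + (LINT t:{0..T}|lborel. torus_inner (\<lambda>u. \<H> (\<rho> t u)) (\<phi>uu t)))"

text \<open>
  The weak formulation on \<open>[0,T]\<close> constrains \<open>\<rho>\<^sub>t\<close> for \<open>t < T\<close> only for almost every \<open>t\<close>, so that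
  \<open>\<rho>\<^sub>t\<close> at a fixed \<open>t\<close> is not determined by it. This predicate selects the weakly continuous version,
  for which the identity holds up to every time; it is unique for every \<open>t\<close>, up to null sets of \<open>u\<close>.
\<close>

definition weak_solution_at_all_times ::
    "real \<Rightarrow> (real \<Rightarrow> real) \<Rightarrow> (real \<Rightarrow> real \<Rightarrow> real) \<Rightarrow> bool" where
  "weak_solution_at_all_times T \<rho>ini \<rho> \<longleftrightarrow> (\<forall>s\<in>{0..T}. weak_solution s \<rho>ini \<rho>)"

text \<open>
  The product measures depend on \<open>\<rho>ini\<close> only through its values at rational points, whereas the
  equation depends on it only up to null sets, so the values at the lattice points have to represent
  the profile. (For the indicator of the rationals the process is constantly full, while the
  solution is \<open>0\<close>.) The condition below is necessary for the law of large numbers at time \<open>0\<close>, and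
  holds for every Riemann integrable, i.e. almost everywhere continuous, profile.
\<close>

definition lattice_representative :: "(real \<Rightarrow> real) \<Rightarrow> bool" where
  "lattice_representative \<rho>ini \<longleftrightarrow>
     (\<forall>\<psi>. smooth_on_torus \<psi> \<longrightarrow>
        (\<lambda>N. 1 / real N * (\<Sum>x<N. \<psi> (real x / real N) * \<rho>ini (real x / real N)))
          \<longlonglongrightarrow> torus_integral (\<lambda>u. \<psi> u * \<rho>ini u))"

end

theory Submission imports Defs begin

text \<open>
  The distance between the process and the solution is measured by a discrete \<open>H\<^sup>-\<^sup>1\<close> norm. Testing
  the weak equation with cubic B-splines of mesh \<open>1/N\<close> shows that the spline averages \<open>r\<close> of \<open>\<rho>\<close> solve
  an exact semi-discrete equation \<open>\<partial>\<^sub>t r = N\<^sup>2 \<Delta> h\<close>, where \<open>h\<close> are averages of \<open>\<H>(\<rho>)\<close>. The current of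
  the process is a gradient as well, so the energy of \<open>\<eta> - r\<close> changes, up to \<open>O(1/N)\<close> and the
  fluctuation of the conserved total mass, at the rate
  \<open>- (2/N) E \<Sum> (A - r H - h \<eta> + r h)\<close>, where \<open>H\<close> is the function whose gradient is the current and \<open>A\<close>
  is \<open>H\<close> corrected by half the jump rate, which comes from the quadratic variation.

  No ergodic theorem is needed to see that this rate is asymptotically nonpositive. By an
  \<open>L\<^sup>1\<close> approximation \<open>r\<close> and \<open>h\<close> may be taken constant on space-time cells. On a cell, the
  generator is applied to the sum over the scales \<open>L \<le> M\<close> of \<open>S\<^sub>L ln S\<^sub>L\<close>, with \<open>S\<^sub>L\<close> the mass of a block of
  length \<open>L\<close>. This produces \<open>ln M\<close> times the one-sided bound of \<open>H\<close> by the tangents of the concave function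
  \<open>2 - 1/\<rho>\<close>, plus terms of order \<open>1\<close>, while its own variation in time is of lower order. Jumps
  that are not reversible destroy pairs of adjacent holes, so that their total number is at most \<open>N\<close>.
\<close>

section \<open>Periodic sums and local functions\<close>

text \<open>If \<open>hh\<close> and \<open>AA\<close> had the local means H(\<rho>) and \<rho>
  H(\<rho>), the rate in the energy balance would be minus a sum of (\<rho> - r)(H(\<rho>) - H(r)),
  and monotonicity of H would finish the proof. Two facts replace it. By \<open>AA_eq\<close>,
  \<open>AA\<close> is \<open>2 * qq - 1\<close> up to a gradient in every configuration; so only
  \<open>hh\<close> has to be bounded, and its sign is such that an upper bound is enough. The
  tangent of 2 - 1/\<rho> at r is exactly the bound for which the remaining terms cancel. S ln S is
  chosen because its second difference is about 1/S. Along growing blocks, the mass of the newest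
  site divided by S telescopes to at most a logarithm, whatever the configuration, while 1/S itself
  is bounded below by its tangents. The other terms stay of order one at each site and become small
  after division by ln M. Hence the order of choices: the cells first, then M, then N.\<close>

definition csum :: "nat \<Rightarrow> (int \<Rightarrow> real) \<Rightarrow> real" where
  "csum N f = (\<Sum>x<N. f (int x))"

definition periodic :: "nat \<Rightarrow> (int \<Rightarrow> real) \<Rightarrow> bool" where
  "periodic N f \<longleftrightarrow> (\<forall>x. f (x + int N) = f x)"

lemma periodicD: "periodic N f \<Longrightarrow> f (x + int N) = f x"
  by (simp add: periodic_def)

lemma periodic_mult_nat: "periodic N f \<Longrightarrow> f (x + int N * int k) = f x"
proof (induction k)
  case (Suc k)
  have "f (x + int N * int (Suc k)) = f ((x + int N * int k) + int N)"
    by (simp add: algebra_simps)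
  with Suc show ?case by (simp add: periodicD)
qed simp

lemma periodic_mult:
  assumes "periodic N f" shows "f (x + int N * k) = f x"
proof (cases "k \<ge> 0")
  case True
  then show ?thesis using periodic_mult_nat[OF assms, of x "nat k"] by simp
next
  case False
  then show ?thesis using periodic_mult_nat[OF assms, of "x + int N * k" "nat (-k)"] by simp
qed

lemma periodic_mod: "periodic N f \<Longrightarrow> f (x mod int N) = f x"
  using periodic_mult[of N f "x mod int N" "x div int N"] by (simp add: add.commute)

lemma periodic_dvd: "periodic N f \<Longrightarrow> int N dvd y - x \<Longrightarrow> f y = f x"
  using periodic_mult[of N f x] by (metis add.commute diff_add_cancel dvdE)

lemma periodic_shift: "periodic N f \<Longrightarrow> periodic N (\<lambda>x. f (x + k))"
  by (simp add: periodic_def) (metis add.assoc add.commute)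

lemma periodic_comp2: "periodic N f \<Longrightarrow> periodic N g \<Longrightarrow> periodic N (\<lambda>x. F (f x) (g x))"
  by (simp add: periodic_def)

lemma csum_shift1:
  assumes "periodic N f"
  shows "csum N (\<lambda>x. f (x + 1)) = csum N f"
proof -
  have "(\<Sum>x<Suc N. f (int x)) = f 0 + (\<Sum>x<N. f (int (Suc x)))"
    by (subst sum.lessThan_Suc_shift) simp
  moreover have "f (int N) = f 0"
    using assms unfolding periodic_def by (metis add_0)
  moreover have "(\<Sum>x<N. f (int (Suc x))) = csum N (\<lambda>x. f (x + 1))"
    unfolding csum_def by (intro sum.cong) (auto simp: add.commute)
  ultimately show ?thesis by (simp add: csum_def)
qed

lemma csum_shift:
  assumes "periodic N f"
  shows "csum N (\<lambda>x. f (x + k)) = csum N f"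
proof (induction k rule: int_induct[where k = 0])
  case (step1 i)
  then show ?case using csum_shift1[OF periodic_shift[OF assms, of i]]
    by (simp add: algebra_simps)
next
  case (step2 i)
  then show ?case using csum_shift1[OF periodic_shift[OF assms, of "i - 1"]]
    by (simp add: algebra_simps)
qed simp

lemma csum_shift_diff:
  assumes "periodic N f"
  shows "csum N (\<lambda>x. f (x - k)) = csum N f"
  using csum_shift[OF assms, of "-k"] by simp

lemma csum_add: "csum N (\<lambda>x. f x + g x) = csum N f + csum N g"
  by (simp add: csum_def sum.distrib)
lemma csum_diff: "csum N (\<lambda>x. f x - g x) = csum N f - csum N g"
  by (simp add: csum_def sum_subtractf)
lemma csum_cmult: "csum N (\<lambda>x. a * f x) = a * csum N f"
  by (simp add: csum_def sum_distrib_left)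
lemma csum_multc: "csum N (\<lambda>x. f x * a) = csum N f * a"
  by (simp add: csum_def sum_distrib_right)
lemma csum_mono: "(\<And>x. f x \<le> g x) \<Longrightarrow> csum N f \<le> csum N g"
  by (simp add: csum_def sum_mono)
lemma csum_const: "csum N (\<lambda>x. a) = real N * a"
  by (simp add: csum_def)
lemma csum_nonneg: "(\<And>x. 0 \<le> f x) \<Longrightarrow> 0 \<le> csum N f"
  by (simp add: csum_def sum_nonneg)
lemma csum_abs: "\<bar>csum N f\<bar> \<le> csum N (\<lambda>x. \<bar>f x\<bar>)"
  by (simp add: csum_def)
lemma csum_swap: "csum N (\<lambda>x. csum N (\<lambda>y. f x y)) = csum N (\<lambda>y. csum N (\<lambda>x. f x y))"
  unfolding csum_def by (rule sum.swap)
lemma csum_sum: "csum N (\<lambda>x. \<Sum>i\<in>I. f i x) = (\<Sum>i\<in>I. csum N (f i))"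
  unfolding csum_def by (rule sum.swap)

text \<open>Kronecker delta of the discrete torus. It is real-valued so that an exchange becomes an
  additive perturbation and a sum over bonds picks out values.\<close>

definition ind :: "nat \<Rightarrow> int \<Rightarrow> int \<Rightarrow> real" where
  "ind N j k = of_bool (int N dvd k - j)"

lemma csum_ind:
  assumes "periodic N f" "N \<ge> 1"
  shows "csum N (\<lambda>x. f x * ind N x y) = f y"
proof -
  let ?y = "nat (y mod int N)"
  have "ind N (int x) y = of_bool (x = ?y)" if "x < N" for x
  proof -
    have "int N dvd y - int x \<longleftrightarrow> y mod int N = int x mod int N"
      by (rule mod_eq_dvd_iff[symmetric])
    then show ?thesis using that assms(2) unfolding ind_def by (auto simp: nat_eq_iff2)
  qed
  then have "csum N (\<lambda>x. f x * ind N x y) = (\<Sum>x<N. f (int x) * of_bool (x = ?y))"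
    unfolding csum_def by (intro sum.cong) auto
  also have "\<dots> = f (int ?y)" using assms(2)
    by (simp add: of_bool_def nat_less_iff if_distrib[of "(*) _"] cong: if_cong)
  also have "\<dots> = f y" using assms(2) periodic_mod[OF assms(1)] by simp
  finally show ?thesis .
qed

lemma ind_commute: "ind N x y = ind N y x"
  by (simp add: ind_def dvd_diff_commute)

lemma ind_shift: "ind N (x + k) (y + k) = ind N x y"
  by (simp add: ind_def)

lemma csum_ind':
  assumes "periodic N f" "N \<ge> 1"
  shows "csum N (\<lambda>x. f x * ind N y x) = f y"
  using csum_ind[OF assms, of y] by (simp add: ind_commute)

text \<open>Configurations are handled as periodic functions on \<open>\<int>\<close> with values in \<open>{0, 1}\<close>.\<close>

definition occ :: "nat \<Rightarrow> (nat \<Rightarrow> nat) \<Rightarrow> int \<Rightarrow> real" where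
  "occ N \<eta> k = real (\<eta> (nat (k mod int N)))"

definition cfg :: "nat \<Rightarrow> (int \<Rightarrow> real) set" where
  "cfg N = {e. periodic N e \<and> (\<forall>x. e x = 0 \<or> e x = 1)}"

lemma occ_cfg: "\<eta> \<in> configs N \<Longrightarrow> N \<ge> 1 \<Longrightarrow> occ N \<eta> \<in> cfg N"
proof -
  assume a: "\<eta> \<in> configs N" "N \<ge> 1"
  have "real (\<eta> (nat (k mod int N))) = 0 \<or> real (\<eta> (nat (k mod int N))) = 1" for k
  proof -
    have "nat (k mod int N) < N" using a(2) by (simp add: nat_less_iff)
    then have "\<eta> (nat (k mod int N)) \<in> {0, 1}" using a(1) by (auto simp: configs_def)
    then show ?thesis by auto
  qed
  then show ?thesis by (auto simp: cfg_def occ_def periodic_def)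
qed

definition crate :: "(int \<Rightarrow> real) \<Rightarrow> int \<Rightarrow> real" where
  "crate e x = e (x - 1) * e x * (1 - e (x + 1)) + (1 - e x) * e (x + 1) * e (x + 2)"

text \<open>The exchange as an additive perturbation by a multiple of the difference of two deltas.
  In this form linear and quadratic functionals of the configuration can be expanded
  exactly.\<close>

definition cswap :: "nat \<Rightarrow> int \<Rightarrow> (int \<Rightarrow> real) \<Rightarrow> int \<Rightarrow> real" where
  "cswap N x e k = e k + (e x - e (x + 1)) * (ind N (x + 1) k - ind N x k)"

definition gen :: "nat \<Rightarrow> ((int \<Rightarrow> real) \<Rightarrow> real) \<Rightarrow> (int \<Rightarrow> real) \<Rightarrow> real" where
  "gen N \<Phi> e = csum N (\<lambda>x. crate e x * (\<Phi> (cswap N x e) - \<Phi> e))"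

lemma occ_shift: "N \<ge> 1 \<Longrightarrow> x < N \<Longrightarrow> real (\<eta> (shift N x k)) = occ N \<eta> (int x + k)"
  by (simp add: occ_def shift_def)

lemma rate_occ: "N \<ge> 1 \<Longrightarrow> x < N \<Longrightarrow> rate N x \<eta> = crate (occ N \<eta>) (int x)"
  using occ_shift[of N x \<eta> "0"]
  by (simp add: rate_def crate_def occ_shift, simp add: occ_def)

lemma swap_configs: "x < N \<Longrightarrow> y < N \<Longrightarrow> \<eta> \<in> configs N \<Longrightarrow> swap_sites x y \<eta> \<in> configs N"
  by (auto simp: configs_def swap_sites_def PiE_iff extensional_def)

lemma swap_occ:
  assumes "N \<ge> 2" "x < N"
  shows "occ N (swap_sites x (shift N x 1) \<eta>) = cswap N (int x) (occ N \<eta>)"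
proof
  fix k
  let ?k = "nat (k mod int N)" and ?y = "shift N x 1"
  have k: "?k < N" using assms by (simp add: nat_less_iff)
  have 1: "int N dvd k - int x \<longleftrightarrow> ?k = x"
    using assms mod_eq_dvd_iff[of k "int N" "int x"] by auto
  have 2: "int N dvd k - (int x + 1) \<longleftrightarrow> ?k = ?y"
    using assms mod_eq_dvd_iff[of k "int N" "int x + 1"] by (auto simp: shift_def nat_eq_iff2)
  \<comment> \<open>On a torus with a single site the two ends of a bond would coincide;
    \<open>N \<ge> 2\<close> excludes this.\<close>
  have 3: "?y \<noteq> x"
  proof
    assume "?y = x"
    then have "(int x + 1) mod int N = int x mod int N"
      using assms by (simp add: shift_def nat_eq_iff)
    then have "int N dvd 1" by (simp add: mod_eq_dvd_iff)
    then show False using assms by simp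
  qed
  have "occ N \<eta> (int x) = real (\<eta> x)" "occ N \<eta> (int x + 1) = real (\<eta> ?y)"
    using assms by (simp_all add: occ_def shift_def)
  with 1 2 3 show "occ N (swap_sites x ?y \<eta>) k = cswap N (int x) (occ N \<eta>) k"
    unfolding cswap_def ind_def by (auto simp: occ_def swap_sites_def)
qed

lemma generator_occ:
  assumes "N \<ge> 2"
  shows "generator N (\<lambda>\<eta>. \<Phi> (occ N \<eta>)) \<eta> = gen N \<Phi> (occ N \<eta>)"
  unfolding generator_def gen_def csum_def
  using assms by (intro sum.cong) (simp_all add: rate_occ swap_occ)

text \<open>
  The current through the bond from \<open>x\<close> to \<open>x + 1\<close> is \<open>hh e x - hh e (x + 1)\<close>. A pair of adjacent holes,
  marked by \<open>zz\<close>, is never created by a jump. Counting it as half a particle in \<open>qq\<close> makes every block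
  of length \<open>L\<close> have mass at least \<open>(L - 1) / 2\<close>.
\<close>

definition hh :: "(int \<Rightarrow> real) \<Rightarrow> int \<Rightarrow> real" where
  "hh e x = e (x - 1) * e x + e x * e (x + 1) - e (x - 1) * e x * e (x + 1)"
definition zz :: "(int \<Rightarrow> real) \<Rightarrow> int \<Rightarrow> real" where
  "zz e x = (1 - e x) * (1 - e (x + 1))"
definition qq :: "(int \<Rightarrow> real) \<Rightarrow> int \<Rightarrow> real" where
  "qq e x = e x + zz e x / 2"
definition AA :: "(int \<Rightarrow> real) \<Rightarrow> int \<Rightarrow> real" where
  "AA e x = hh e x - crate e x / 2"
text \<open>Potential of the gradient in \<open>AA_eq\<close>. Its values lie between 0 and 1, so
  that after summation by parts this gradient costs no more than the variation of the
  weight.\<close>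

definition vv :: "(int \<Rightarrow> real) \<Rightarrow> int \<Rightarrow> real" where
  "vv e x = e x - hh e x / 2"

lemma cfg01: "e \<in> cfg N \<Longrightarrow> e x = 0 \<or> e x = 1" by (simp add: cfg_def)
lemma cfg_bounds: assumes "e \<in> cfg N" shows "0 \<le> e x" "e x \<le> 1"
  using cfg01[OF assms, of x] by auto

lemma cfg_periodic [intro]: assumes "e \<in> cfg N"
  shows "periodic N e" "periodic N (hh e)" "periodic N (crate e)" "periodic N (zz e)"
    "periodic N (qq e)" "periodic N (AA e)" "periodic N (vv e)"
proof -
  have p: "e (x + int N) = e x" for x using assms by (simp add: cfg_def periodic_def)
  have p1: "e (x + int N + k) = e (x + k)" "e (x + int N - k) = e (x - k)" for x k
    using p[of "x + k"] p[of "x - k"] by (simp_all add: algebra_simps)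
  show "periodic N e" "periodic N (hh e)" "periodic N (crate e)" "periodic N (zz e)"
    "periodic N (qq e)" "periodic N (AA e)" "periodic N (vv e)"
    unfolding periodic_def hh_def crate_def zz_def qq_def AA_def vv_def by (simp_all add: p p1)
qed

lemma hh01: "e \<in> cfg N \<Longrightarrow> hh e x = 0 \<or> hh e x = 1"
  using cfg01[of e N x] cfg01[of e N "x-1"] cfg01[of e N "x+1"] by (auto simp: hh_def)
lemma crate01: "e \<in> cfg N \<Longrightarrow> crate e x = 0 \<or> crate e x = 1"
  using cfg01[of e N x] cfg01[of e N "x-1"] cfg01[of e N "x+1"] cfg01[of e N "x+2"] by (auto simp: crate_def)
lemma qq_bounds: assumes "e \<in> cfg N" shows "0 \<le> qq e x" "qq e x \<le> 1"
  using cfg01[OF assms, of x] cfg01[OF assms, of "x+1"] by (auto simp: qq_def zz_def)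
lemma zz_bounds: assumes "e \<in> cfg N" shows "0 \<le> zz e x" "zz e x \<le> 1"
  using cfg01[OF assms, of x] cfg01[OF assms, of "x+1"] by (auto simp: zz_def)
lemma vv_bounds: assumes "e \<in> cfg N" shows "0 \<le> vv e x" "vv e x \<le> 1"
  using cfg01[OF assms, of x] cfg01[OF assms, of "x-1"] cfg01[OF assms, of "x+1"]
  by (auto simp: vv_def hh_def)
lemma hq: "e \<in> cfg N \<Longrightarrow> hh e x * qq e x = hh e x"
  using cfg01[of e N x] cfg01[of e N "x-1"] cfg01[of e N "x+1"] by (auto simp: hh_def qq_def zz_def)
lemma he: "e \<in> cfg N \<Longrightarrow> hh e x * e x = hh e x"
  using cfg01[of e N x] cfg01[of e N "x-1"] cfg01[of e N "x+1"] by (auto simp: hh_def)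
lemma current_gradient: "e \<in> cfg N \<Longrightarrow> crate e x * (e x - e (x + 1)) = hh e x - hh e (x + 1)"
  using cfg01[of e N x] cfg01[of e N "x-1"] cfg01[of e N "x+1"] cfg01[of e N "x+2"]
  by (auto simp: hh_def crate_def add.commute)
lemma crate_sq: "e \<in> cfg N \<Longrightarrow> crate e x * (e x - e (x + 1))^2 = crate e x"
  using cfg01[of e N x] cfg01[of e N "x+1"]
  by (auto simp: crate_def)
text \<open>A finite check over the patterns on x - 1, ..., x + 2. It is the reason why no
  equilibrium average of \<open>AA\<close> has to be computed: up to a gradient, \<open>AA\<close>
  is an affine function of the mass \<open>qq\<close> alone.\<close>

lemma AA_eq: "e \<in> cfg N \<Longrightarrow> AA e x = 2 * qq e x - 1 + vv e (x + 1) - vv e x"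
  using cfg01[of e N x] cfg01[of e N "x-1"] cfg01[of e N "x+1"] cfg01[of e N "x+2"]
  by (auto simp: AA_def hh_def crate_def qq_def zz_def vv_def add.commute)

section \<open>Effect of an exchange on occupation and on pairs of holes\<close>

lemma cswap_cfg:
  assumes "e \<in> cfg N" "N \<ge> 2"
  shows "cswap N x e \<in> cfg N"
proof -
  have "cswap N x e k = 0 \<or> cswap N x e k = 1" for k
  proof (cases "int N dvd k - x")
    case True
    have "\<not> int N dvd k - (x + 1)"
    proof
      assume "int N dvd k - (x + 1)"
      with True have "int N dvd (k - x) - (k - (x + 1))" by (rule dvd_diff)
      then show False using assms(2) by simp
    qed
    moreover have "e k = e x" using assms True by (auto simp: cfg_def intro: periodic_dvd)
    ultimately show ?thesis using True cfg01[OF assms(1), of "x+1"] by (simp add: cswap_def ind_def)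
  next
    case F: False
    show ?thesis
    proof (cases "int N dvd k - (x + 1)")
      case True
      moreover have "e k = e (x + 1)" using assms True by (auto simp: cfg_def intro: periodic_dvd)
      ultimately show ?thesis using F cfg01[OF assms(1), of "x"] by (simp add: cswap_def ind_def)
    next
      case False
      then show ?thesis using F cfg01[OF assms(1), of "k"] by (simp add: cswap_def ind_def)
    qed
  qed
  moreover have "periodic N (cswap N x e)"
  proof -
    have "int N dvd k + int N - y \<longleftrightarrow> int N dvd k - y" for k y
      by (metis add.commute add_diff_eq dvd_add_triv_left_iff)
    moreover have "e (k + int N) = e k" for k using assms by (simp add: cfg_def periodic_def)
    ultimately show ?thesis by (simp add: periodic_def cswap_def ind_def)
  qed
  ultimately show ?thesis by (auto simp: cfg_def)
qed

text \<open>The vacated site lies between the particle that has just left it and the particle that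
  made the jump possible, so it has no empty neighbour. Only the pairs starting at x - 1, x, x + 1
  are touched, and all three are absent after the jump. \<open>N \<ge> 4\<close> keeps the sites x -
  1, ..., x + 2 distinct.\<close>

lemma zz_mono:
  assumes e: "e \<in> cfg N" and N: "N \<ge> 4" and c: "crate e x \<noteq> 0"
  shows "zz (cswap N x e) y \<le> zz e y"
proof -
  let ?e = "cswap N x e"
  have e': "?e \<in> cfg N" using e N by (intro cswap_cfg) auto
  have nd: "\<not> int N dvd k" if "0 < k" "k < 4" for k :: int
    using that N zdvd_imp_le[of "int N" k] by auto
  have per: "?e k = ?e l" "e k = e l" if "int N dvd k - l" for k l
    using e e' that by (auto simp: cfg_def intro: periodic_dvd)
  have nx: "ind N x x = 1" "ind N (x+1) x = 0" "ind N (x+1) (x+1) = 1" "ind N x (x+1) = 0"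
     "ind N x (x-1) = 0" "ind N (x+1) (x-1) = 0" "ind N x (x+2) = 0" "ind N (x+1) (x+2) = 0"
    using nd[of 1] nd[of 2] by (simp_all add: ind_def)
  have v: "?e (x-1) = e (x-1)" "?e x = e (x+1)" "?e (x+1) = e x" "?e (x+2) = e (x+2)"
    unfolding cswap_def by (simp_all add: nx)
  consider (a) "int N dvd y - x" | (b) "int N dvd y - (x - 1)" | (c) "int N dvd y - (x + 1)"
    | (d) "\<not> int N dvd y - x" "\<not> int N dvd y - (x - 1)" "\<not> int N dvd y - (x + 1)" by blast
  then show ?thesis
  proof cases
    case a
    have "zz ?e y = zz ?e x" using per[of y x] per[of "y+1" "x+1"] a by (simp add: zz_def)
    also have "\<dots> = 0" using c cfg01[OF e, of x] cfg01[OF e, of "x+1"] by (auto simp: zz_def v crate_def)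
    finally show ?thesis using zz_bounds[OF e] by simp
  next
    case b
    have "zz ?e y = zz ?e (x-1)" using per[of y "x-1"] per[of "y+1" "x"] b
      by (simp add: zz_def algebra_simps)
    also have "\<dots> = 0" using c cfg01[OF e, of x] cfg01[OF e, of "x-1"] cfg01[OF e, of "x+1"]
      by (auto simp: zz_def v crate_def)
    finally show ?thesis using zz_bounds[OF e] by simp
  next
    case c': c
    have "zz ?e y = zz ?e (x+1)" using per[of y "x+1"] per[of "y+1" "x+2"] c'
      by (simp add: zz_def algebra_simps)
    also have "\<dots> = (1 - e x) * (1 - e (x + 2))" using v by (simp add: zz_def add.commute)
    also have "\<dots> = 0" using c cfg01[OF e, of x] cfg01[OF e, of "x+2"] cfg01[OF e, of "x+1"]
      by (auto simp: crate_def)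
    finally show ?thesis using zz_bounds[OF e] by simp
  next
    case d
    have "?e y = e y" "?e (y+1) = e (y+1)"
      using d by (simp_all add: cswap_def ind_def algebra_simps)
    then show ?thesis by (simp add: zz_def)
  qed
qed

section \<open>A discrete negative Sobolev norm\<close>

lemma csum_parts:
  assumes "periodic N f" "periodic N g"
  shows "csum N (\<lambda>x. (f x - f (x + 1)) * g x) = csum N (\<lambda>x. f x * (g x - g (x - 1)))"
proof -
  have "periodic N (\<lambda>x. f x * g (x - 1))"
    using periodic_comp2[OF assms(1) periodic_shift[OF assms(2), of "-1"], of "(*)"] by simp
  from csum_shift[OF this, of 1]
  have "csum N (\<lambda>x. f (x + 1) * g x) = csum N (\<lambda>x. f x * g (x - 1))" by simp
  then show ?thesis by (simp add: left_diff_distrib right_diff_distrib csum_diff)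
qed

text \<open>The Green function of \<open>- \<Delta>\<close>; the constant \<open>1 / 12\<close> gives the constant functions positive energy.\<close>

definition kern :: "nat \<Rightarrow> int \<Rightarrow> real" where
  "kern N z = (let m = of_int (z mod int N) / real N in (m\<^sup>2 - m) / 2 + 1 / 12)"

lemma kern_periodic: "periodic N (kern N)"
  by (simp add: periodic_def kern_def)

lemma kern_uminus:
  assumes "N \<ge> 1" shows "kern N (-z) = kern N z"
proof (cases "z mod int N = 0")
  case True
  then have "(-z) mod int N = 0" by (simp add: zmod_zminus1_eq_if)
  with True show ?thesis by (simp add: kern_def)
next
  case False
  then have *: "(-z) mod int N = int N - z mod int N" by (simp add: zmod_zminus1_eq_if)
  show ?thesis using assms unfolding kern_def * by (simp add: Let_def field_simps power2_eq_square)
qed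

lemma kern_commute: "N \<ge> 1 \<Longrightarrow> kern N (x - y) = kern N (y - x)"
  using kern_uminus[of N "x - y"] by simp

text \<open>A Laplacian has mean zero on the torus, so the delta of weight 1/N is compensated by its
  mean 1/N^2. The three cases are the two sites where the residue wraps around and the
  interior.\<close>

lemma kern_lap:
  assumes "N \<ge> 2"
  shows "kern N (z + 1) + kern N (z - 1) - 2 * kern N z = 1 / (real N)\<^sup>2 - ind N 0 z / real N"
proof -
  define m where "m = z mod int N"
  have m: "0 \<le> m" "m < int N" using assms by (auto simp: m_def)
  have 1: "(z + 1) mod int N = (if m + 1 = int N then 0 else m + 1)"
  proof -
    have "(z + 1) mod int N = (m + 1) mod int N" by (simp add: m_def mod_add_left_eq)
    also have "\<dots> = (if m + 1 = int N then 0 else m + 1)" using m by auto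
    finally show ?thesis .
  qed
  have 2: "(z - 1) mod int N = (if m = 0 then int N - 1 else m - 1)"
  proof -
    have "(z - 1) mod int N = (m - 1) mod int N" by (simp add: m_def mod_diff_left_eq)
    also have "\<dots> = (if m = 0 then int N - 1 else m - 1)"
      using m assms by (auto simp: zmod_minus1)
    finally show ?thesis .
  qed
  have 3: "ind N 0 z = of_bool (m = 0)" by (auto simp: ind_def m_def mod_eq_0_iff_dvd)
  have k: "kern N z = ((of_int m / real N)\<^sup>2 - of_int m / real N) / 2 + 1 / 12"
    by (simp add: kern_def m_def Let_def)
  have N: "real N > 0" using assms by simp
  consider "m = 0" | "m + 1 = int N" "m \<noteq> 0" | "m \<noteq> 0" "m + 1 \<noteq> int N" by blast
  then show ?thesis
  proof cases
    case 1: 1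
    then have "m + 1 \<noteq> int N" using assms by simp
    then show ?thesis using N 1 unfolding k 3 unfolding kern_def \<open>(z + 1) mod int N = _\<close> 2
      by (simp add: Let_def field_simps power2_eq_square)
  next
    case c: 2
    then have r: "real_of_int m = real N - 1" by linarith
    show ?thesis using N c unfolding k 3 unfolding kern_def 1 2
      by (simp add: Let_def r field_simps power2_eq_square)
  next
    case c: 3
    show ?thesis using N c unfolding k 3 unfolding kern_def 1 2
      by (simp add: Let_def field_simps power2_eq_square)
  qed
qed

text \<open>The Laplacian at 0 together with symmetry. Twice this difference is the self-interaction
  of a displacement by one site, the source of the \<open>crate\<close> term in
  \<open>gen_quad\<close>.\<close>

lemma kern_01:
  assumes "N \<ge> 2" shows "2 * (kern N 0 - kern N 1) = 1 / real N - 1 / (real N)\<^sup>2"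
  using kern_lap[OF assms, of 0] kern_uminus[of N 1] assms
  by (simp add: ind_def)

text \<open>\<open>kern\<close> is half the second Bernoulli polynomial at z/N, so this is its
  multiplication formula.\<close>

lemma kern_sum:
  assumes "N \<ge> 1" shows "csum N (kern N) = 1 / (12 * real N)"
proof -
  have s1: "(\<Sum>x<n. real x) = real n * (real n - 1) / 2" for n
    by (induction n) (auto simp: field_simps)
  have s2: "(\<Sum>x<n. (real x)\<^sup>2) = real n * (real n - 1) * (2 * real n - 1) / 6" for n
    by (induction n) (auto simp: field_simps power2_eq_square)
  have "csum N (kern N) = (\<Sum>x<N. (1 / (2 * (real N)\<^sup>2)) * (real x)\<^sup>2 - (1 / (2 * real N)) * real x + 1 / 12)"
    unfolding csum_def kern_def Let_def
    by (intro sum.cong) (auto simp: field_simps power2_eq_square)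
  also have "\<dots> = (1 / (2 * (real N)\<^sup>2)) * (\<Sum>x<N. (real x)\<^sup>2) - (1 / (2 * real N)) * (\<Sum>x<N. real x) + real N / 12"
    by (simp add: sum.distrib sum_subtractf sum_distrib_left)
  also have "\<dots> = 1 / (12 * real N)"
    unfolding s1 s2 using assms by (simp add: field_simps power2_eq_square)
  finally show ?thesis .
qed

lemma abs_le_twelfth: "- 1 / 4 \<le> (u::real) \<Longrightarrow> u \<le> 0 \<Longrightarrow> \<bar>u / 2 + 1 / 12\<bar> \<le> 1 / 12"
  by linarith

lemma kern_bound:
  assumes "N \<ge> 1" shows "\<bar>kern N z\<bar> \<le> 1 / 12"
proof -
  define m where "m = of_int (z mod int N) / real N"
  have m: "0 \<le> m" "m \<le> 1" using assms
    using less_imp_le[OF pos_mod_bound[of "int N" z]]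
    by (auto simp: m_def)
  have "m\<^sup>2 - m = (m - 1/2)\<^sup>2 - 1/4" by (simp add: power2_eq_square algebra_simps)
  then have "m\<^sup>2 - m \<ge> - 1/4" by simp
  moreover have "m\<^sup>2 - m \<le> 0" using m by (simp add: power2_eq_square mult_left_le)
  ultimately show ?thesis unfolding kern_def Let_def m_def[symmetric]
    using abs_le_twelfth by simp
qed

definition pot :: "nat \<Rightarrow> (int \<Rightarrow> real) \<Rightarrow> int \<Rightarrow> real" where
  "pot N a x = csum N (\<lambda>y. kern N (y - x) * a y)"

text \<open>Square of a discrete negative Sobolev norm. Since \<open>kern\<close> is bounded, the
  division by N^2 makes the energy of a bounded field of order one.\<close>

definition energy :: "nat \<Rightarrow> (int \<Rightarrow> real) \<Rightarrow> real" where
  "energy N a = csum N (\<lambda>x. a x * pot N a x) / (real N)\<^sup>2"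

lemma pot_periodic: "periodic N (pot N a)"
proof -
  have "kern N (y - (x + int N)) = kern N (y - x)" for x y
    using periodic_dvd[OF kern_periodic, of N "y - (x + int N)" "y - x"] by simp
  then show ?thesis by (simp add: periodic_def pot_def)
qed

lemma pot_lap:
  assumes "periodic N a" "N \<ge> 2"
  shows "pot N a (x + 1) + pot N a (x - 1) - 2 * pot N a x = csum N a / (real N)\<^sup>2 - a x / real N"
proof -
  have "pot N a (x + 1) + pot N a (x - 1) - 2 * pot N a x
     = csum N (\<lambda>y. (kern N ((y - x) + 1) + kern N ((y - x) - 1) - 2 * kern N (y - x)) * a y)"
    unfolding pot_def csum_cmult[symmetric] csum_diff[symmetric] csum_add[symmetric]
    by (simp add: algebra_simps)
  also have "\<dots> = csum N (\<lambda>y. (1 / (real N)\<^sup>2) * a y - (1 / real N) * (a y * ind N x y))"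
    unfolding kern_lap[OF assms(2)]
    by (rule arg_cong[where f = "csum N"]) (auto simp: ind_def algebra_simps)
  also have "\<dots> = csum N a / (real N)\<^sup>2 - a x / real N"
    unfolding csum_diff csum_cmult using csum_ind'[OF assms(1), of x] assms(2) by simp
  finally show ?thesis .
qed

lemma csum_pot:
  assumes "N \<ge> 1"
  shows "csum N (pot N a) = csum N a / (12 * real N)"
proof -
  have "csum N (\<lambda>x. kern N (y - x)) = 1 / (12 * real N)" for y
  proof -
    have "csum N (\<lambda>x. kern N (y - x)) = csum N (\<lambda>x. kern N (x - y))"
      by (rule arg_cong[where f = "csum N"]) (rule ext, rule kern_commute[OF assms])
    then show ?thesis using csum_shift_diff[OF kern_periodic, of N y] kern_sum[OF assms] by simp
  qed
  then show ?thesis unfolding pot_def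
    using csum_multc[of N a "1 / (12 * real N)"] by (subst csum_swap) (simp add: csum_multc)
qed

text \<open>\<open>pot_lap\<close> solved for a: a field is its mean minus N times the Laplacian of
  its potential. One summation by parts then moves a difference onto b.\<close>

lemma csum_times_field:
  assumes "periodic N a" "periodic N b" "N \<ge> 2"
  shows "csum N (\<lambda>x. b x * a x) = csum N a * csum N b / real N
     + real N * csum N (\<lambda>x. (b (x + 1) - b x) * (pot N a (x + 1) - pot N a x))"
proof -
  let ?w = "pot N a"
  have N: "real N > 0" using assms by simp
  have a: "a x = csum N a / real N - real N * (?w (x + 1) + ?w (x - 1) - 2 * ?w x)" for x
    unfolding pot_lap[OF assms(1,3)] using N by (simp add: field_simps power2_eq_square)
  have p: "periodic N (\<lambda>x. ?w (x + 1) - ?w x)"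
    using periodic_comp2[OF periodic_shift[OF pot_periodic[of N a], of 1] pot_periodic[of N a], of minus] .
  have "csum N (\<lambda>x. b x * a x) = csum N (\<lambda>x. (csum N a / real N) * b x
       - real N * (b x * ((?w (x + 1) - ?w x) - (?w (x - 1 + 1) - ?w (x - 1)))))"
    by (subst a) (rule arg_cong[where f = "csum N"], auto simp: algebra_simps)
  also have "\<dots> = (csum N a / real N) * csum N b
       - real N * csum N (\<lambda>x. (b x - b (x + 1)) * (?w (x + 1) - ?w x))"
    unfolding csum_diff csum_cmult csum_parts[OF assms(2) p] ..
  also have "csum N (\<lambda>x. (b x - b (x + 1)) * (?w (x + 1) - ?w x)) =
    - csum N (\<lambda>x. (b (x + 1) - b x) * (?w (x + 1) - ?w x))"
    unfolding csum_def by (simp add: sum_negf[symmetric] algebra_simps)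
  finally show ?thesis by simp
qed

lemma energy_eq:
  assumes "periodic N a" "N \<ge> 2"
  shows "energy N a = (csum N a)\<^sup>2 / (12 * (real N)^4) + csum N (\<lambda>x. (pot N a (x + 1) - pot N a x)\<^sup>2) / real N"
proof -
  have N: "real N > 0" using assms by simp
  have "csum N (\<lambda>x. a x * pot N a x) = csum N (\<lambda>x. pot N a x * a x)" by (simp add: mult.commute)
  also have "\<dots> = csum N a * (csum N a / (12 * real N)) / real N
      + real N * csum N (\<lambda>x. (pot N a (x + 1) - pot N a x)\<^sup>2)"
    using csum_times_field[OF assms(1) pot_periodic assms(2), of a] csum_pot[of N a] assms
    by (simp add: power2_eq_square)
  finally show ?thesis unfolding energy_def using N
    by (simp add: field_simps power2_eq_square power4_eq_xxxx)
qed

lemma energy_nonneg: "periodic N a \<Longrightarrow> N \<ge> 2 \<Longrightarrow> energy N a \<ge> 0"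
  by (simp add: energy_eq csum_nonneg)

lemma sum_sq_le: "(a + b)\<^sup>2 \<le> 2 * a\<^sup>2 + 2 * (b::real)\<^sup>2"
  using sum_squares_bound[of a b] by (simp add: power2_sum)

lemma power2_mono_abs: "\<bar>a\<bar> \<le> b \<Longrightarrow> a\<^sup>2 \<le> (b::real)\<^sup>2"
  using power_mono[of "\<bar>a\<bar>" b 2] by simp

text \<open>Duality of the two Sobolev norms: the mean of b is paired with the total mass, its
  increments with the gradient of the potential by Cauchy-Schwarz. The mass is a separate term
  because the energy sees its density only with the vanishing weight 1/(12 N^2).\<close>

lemma energy_controls:
  assumes a: "periodic N a" and b: "periodic N b" and N: "N \<ge> 2"
    and B: "\<And>x. \<bar>b x\<bar> \<le> B" and L: "\<And>x. \<bar>b (x + 1) - b x\<bar> \<le> L / real N"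
  shows "(csum N (\<lambda>x. b x * a x) / real N)\<^sup>2 \<le> 2 * B\<^sup>2 * (csum N a / real N)\<^sup>2 + 2 * L\<^sup>2 * energy N a"
proof -
  let ?w = "pot N a"
  define g where "g = csum N (\<lambda>x. (b (x + 1) - b x) * (?w (x + 1) - ?w x))"
  have N0: "real N > 0" using N by simp
  have "\<bar>csum N b\<bar> \<le> csum N (\<lambda>x. B)"
    by (rule order_trans[OF csum_abs]) (rule csum_mono, rule B)
  then have b1: "\<bar>csum N b / real N\<bar> \<le> B" using N0 by (simp add: csum_const field_simps)
  have "csum N (\<lambda>x. (b (x + 1) - b x)\<^sup>2) \<le> csum N (\<lambda>x. (L / real N)\<^sup>2)"
    by (rule csum_mono) (rule power2_mono_abs[OF L])
  also have "\<dots> = L\<^sup>2 / real N" using N0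
    by (simp add: csum_const field_simps power2_eq_square)
  finally have g1: "csum N (\<lambda>x. (b (x + 1) - b x)\<^sup>2) \<le> L\<^sup>2 / real N" .
  have g2: "csum N (\<lambda>x. (?w (x + 1) - ?w x)\<^sup>2) \<le> real N * energy N a"
    using N0 by (simp add: energy_eq[OF a N] field_simps)
  have "g\<^sup>2 \<le> csum N (\<lambda>x. (b (x + 1) - b x)\<^sup>2) * csum N (\<lambda>x. (?w (x + 1) - ?w x)\<^sup>2)"
    unfolding g_def csum_def by (rule Cauchy_Schwarz_ineq_sum)
  also have "\<dots> \<le> (L\<^sup>2 / real N) * (real N * energy N a)"
    by (rule mult_mono[OF g1 g2]) (use N0 in \<open>simp_all add: csum_nonneg\<close>)
  also have "\<dots> = L\<^sup>2 * energy N a" using N0 by simp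
  finally have g: "g\<^sup>2 \<le> L\<^sup>2 * energy N a" .
  have eq: "csum N (\<lambda>x. b x * a x) / real N = (csum N b / real N) * (csum N a / real N) + g"
    unfolding csum_times_field[OF a b N] g_def using N0 by (simp add: field_simps)
  have "(csum N (\<lambda>x. b x * a x) / real N)\<^sup>2 \<le> 2 * ((csum N b / real N) * (csum N a / real N))\<^sup>2 + 2 * g\<^sup>2"
    unfolding eq by (rule sum_sq_le)
  also have "((csum N b / real N) * (csum N a / real N))\<^sup>2 \<le> B\<^sup>2 * (csum N a / real N)\<^sup>2"
    unfolding power_mult_distrib using b1
    by (intro mult_right_mono) (auto simp: abs_le_square_iff[symmetric])
  finally show ?thesis using g by simp
qed

section \<open>The generator on linear and quadratic functionals\<close>

lemma gen_linear:
  assumes e: "e \<in> cfg N" and N: "N \<ge> 2"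
  shows "gen N (\<lambda>e. e y) e = hh e (y + 1) + hh e (y - 1) - 2 * hh e y"
proof -
  have pj: "periodic N (\<lambda>x. hh e x - hh e (x + 1))"
    using periodic_comp2[OF cfg_periodic(2)[OF e] periodic_shift[OF cfg_periodic(2)[OF e]], of minus] .
  have "gen N (\<lambda>e. e y) e = csum N (\<lambda>x. (crate e x * (e x - e (x + 1))) * (ind N (x + 1) y - ind N x y))"
    unfolding gen_def cswap_def by (simp add: mult.assoc)
  also have "\<dots> = csum N (\<lambda>x. (hh e x - hh e (x + 1)) * ind N x (y - 1)) - csum N (\<lambda>x. (hh e x - hh e (x + 1)) * ind N x y)"
    unfolding current_gradient[OF e] using ind_shift[of N _ 1 "y - 1"]
    by (simp add: csum_diff right_diff_distrib)
  also have "\<dots> = hh e (y + 1) + hh e (y - 1) - 2 * hh e y"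
    using csum_ind[OF pj, of y] csum_ind[OF pj, of "y - 1"] N by simp
  finally show ?thesis .
qed

lemma csum_cswap:
  assumes "e \<in> cfg N" "N \<ge> 1" shows "csum N (cswap N x e) = csum N e"
proof -
  have "csum N (\<lambda>k. ind N j k) = 1" for j
    using csum_ind'[of N "\<lambda>_. 1" j] assms by (simp add: periodic_def)
  then show ?thesis unfolding cswap_def by (simp add: csum_add csum_cmult csum_diff)
qed

lemma gen_total:
  assumes "e \<in> cfg N" "N \<ge> 1" shows "gen N (\<lambda>e. \<Phi> (csum N e)) e = 0"
  unfolding gen_def by (simp add: csum_cswap[OF assms] csum_const)

definition quad :: "nat \<Rightarrow> (int \<Rightarrow> real) \<Rightarrow> real" where
  "quad N e = csum N (\<lambda>x. csum N (\<lambda>y. kern N (y - x) * (e x * e y)))"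

lemma quad_pot: "quad N e = csum N (\<lambda>x. e x * pot N e x)"
  unfolding quad_def pot_def csum_cmult[symmetric] by (simp add: algebra_simps)

lemma pot_add: "pot N (\<lambda>k. a k + b k) x = pot N a x + pot N b x"
  unfolding pot_def by (simp add: csum_add distrib_left)
lemma pot_symmetric:
  assumes "N \<ge> 1" shows "csum N (\<lambda>x. a x * pot N b x) = csum N (\<lambda>x. b x * pot N a x)"
proof -
  have "csum N (\<lambda>x. a x * pot N b x) = csum N (\<lambda>x. csum N (\<lambda>y. a x * (kern N (y - x) * b y)))"
    by (simp add: pot_def csum_cmult)
  also have "\<dots> = csum N (\<lambda>y. csum N (\<lambda>x. a x * (kern N (y - x) * b y)))" by (rule csum_swap)
  also have "\<dots> = csum N (\<lambda>y. b y * pot N a y)"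
    using kern_commute[OF assms] by (simp add: pot_def csum_cmult[symmetric] algebra_simps)
  finally show ?thesis .
qed

text \<open>\<open>cswap\<close> adds the field b, so the expansion of the quadratic form is exact:
  the symmetric cross term is a gradient of the potential, and the square of b is its
  self-interaction.\<close>

lemma quad_cswap:
  assumes e: "e \<in> cfg N" and N: "N \<ge> 2"
  shows "quad N (cswap N x e) - quad N e = 2 * (e x - e (x + 1)) * (pot N e (x + 1) - pot N e x)
     + (e x - e (x + 1))\<^sup>2 * (2 * (kern N 0 - kern N 1))"
proof -
  define d where "d = e x - e (x + 1)"
  define b where "b k = d * (ind N (x + 1) k - ind N x k)" for k
  have N1: "N \<ge> 1" using N by simp
  have eb: "cswap N x e = (\<lambda>k. e k + b k)" by (auto simp: cswap_def b_def d_def)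
  have bsum: "csum N (\<lambda>k. b k * g k) = d * (g (x + 1) - g x)" if "periodic N g" for g
  proof -
    have "csum N (\<lambda>k. b k * g k) = d * (csum N (\<lambda>k. g k * ind N (x + 1) k) - csum N (\<lambda>k. g k * ind N x k))"
      unfolding csum_diff[symmetric] csum_cmult[symmetric] by (simp add: b_def algebra_simps)
    then show ?thesis using csum_ind'[OF that N1] by simp
  qed
  have potb: "pot N b y = d * (kern N (x + 1 - y) - kern N (x - y))" for y
  proof -
    have "pot N b y = csum N (\<lambda>k. b k * kern N (k - y))" by (simp add: pot_def mult.commute)
    also have "\<dots> = d * (kern N (x + 1 - y) - kern N (x - y))"
      using bsum[OF periodic_shift[OF kern_periodic, of N "-y"]] by simp
    finally show ?thesis .
  qed
  have "quad N (\<lambda>k. e k + b k) = csum N (\<lambda>k. e k * pot N e k) + csum N (\<lambda>k. e k * pot N b k)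
       + csum N (\<lambda>k. b k * pot N e k) + csum N (\<lambda>k. b k * pot N b k)"
    unfolding quad_pot pot_add by (simp add: csum_add algebra_simps)
  also have "csum N (\<lambda>k. e k * pot N b k) = csum N (\<lambda>k. b k * pot N e k)" by (rule pot_symmetric[OF N1])
  finally have "quad N (\<lambda>k. e k + b k) - quad N e = 2 * csum N (\<lambda>k. b k * pot N e k) + csum N (\<lambda>k. b k * pot N b k)"
    by (simp add: quad_pot)
  also have "\<dots> = 2 * (d * (pot N e (x + 1) - pot N e x)) + d * (pot N b (x + 1) - pot N b x)"
    using bsum[OF pot_periodic] by simp
  also have "pot N b (x + 1) - pot N b x = d * (2 * (kern N 0 - kern N 1))"
    unfolding potb using kern_uminus[OF N1, of 1] by (simp add: algebra_simps)
  finally show ?thesis unfolding eb d_def by (simp add: power2_eq_square algebra_simps)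
qed

text \<open>The gradient form of the current lets the Laplacian act on the potential, where
  \<open>pot_lap\<close> makes it local, and \<open>he\<close> removes the product of
  \<open>hh\<close> and e. So the drift is a sum of local functions, apart from the product of two
  totals.\<close>

lemma gen_quad:
  assumes e: "e \<in> cfg N" and N: "N \<ge> 2"
  shows "gen N (quad N) e = 2 * csum N (hh e) * csum N e / (real N)\<^sup>2 - 2 / real N * csum N (hh e)
     + (1 / real N - 1 / (real N)\<^sup>2) * csum N (crate e)"
proof -
  let ?w = "pot N e"
  have pw: "periodic N (\<lambda>x. ?w (x + 1) - ?w x)"
    using periodic_comp2[OF periodic_shift[OF pot_periodic[of N e], of 1] pot_periodic[of N e], of minus] .
  have "crate e x * (quad N (cswap N x e) - quad N e) =
     2 * ((hh e x - hh e (x + 1)) * (?w (x + 1) - ?w x)) + (1 / real N - 1 / (real N)\<^sup>2) * crate e x" for x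
  proof -
    have "crate e x * (quad N (cswap N x e) - quad N e) =
      2 * ((crate e x * (e x - e (x + 1))) * (?w (x + 1) - ?w x))
      + (crate e x * (e x - e (x + 1))\<^sup>2) * (1 / real N - 1 / (real N)\<^sup>2)"
      unfolding quad_cswap[OF e N] kern_01[OF N] by (simp add: algebra_simps)
    then show ?thesis unfolding current_gradient[OF e] crate_sq[OF e] by simp
  qed
  then have "gen N (quad N) e = 2 * csum N (\<lambda>x. (hh e x - hh e (x + 1)) * (?w (x + 1) - ?w x))
      + (1 / real N - 1 / (real N)\<^sup>2) * csum N (crate e)"
    unfolding gen_def by (simp add: csum_add csum_cmult)
  also have "csum N (\<lambda>x. (hh e x - hh e (x + 1)) * (?w (x + 1) - ?w x)) =
      csum N (\<lambda>x. hh e x * (?w (x + 1) + ?w (x - 1) - 2 * ?w x))"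
    unfolding csum_parts[OF cfg_periodic(2)[OF e] pw] by (simp add: algebra_simps)
  also have "\<dots> = csum N (\<lambda>x. csum N e / (real N)\<^sup>2 * hh e x - 1 / real N * (hh e x * e x))"
    unfolding pot_lap[OF cfg_periodic(1)[OF e] N] by (simp add: algebra_simps)
  also have "\<dots> = csum N e / (real N)\<^sup>2 * csum N (hh e) - 1 / real N * csum N (hh e)"
    unfolding csum_diff csum_cmult he[OF e] ..
  finally show ?thesis by (simp add: algebra_simps)
qed

section \<open>The Lyapunov function\<close>

text \<open>The second difference of \<open>GG\<close> is close to \<open>1 / s\<close>, whose sum over the scales is logarithmic. The shift by \<open>4\<close> keeps the argument away from \<open>0\<close>.\<close>

definition GG :: "real \<Rightarrow> real" where "GG s = (s + 4) * ln (s + 4)"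

lemma GG_deriv: "s > -4 \<Longrightarrow> (GG has_real_derivative ln (s + 4) + 1) (at s)"
  unfolding GG_def by (auto intro!: derivative_eq_intros)

lemma GG_deriv2: "s > -4 \<Longrightarrow> ((\<lambda>s. ln (s + 4) + 1) has_real_derivative 1 / (s + 4)) (at s)"
  by (auto intro!: derivative_eq_intros)

text \<open>The range is that of a block mass in [0, M] displaced by at most one. There s + 4 is at
  least 3, so the logarithm in the derivative is nonnegative and bounded by its value at the upper
  end.\<close>

lemma GG_lipschitz:
  assumes "-1 \<le> a" "a \<le> M + 1" "-1 \<le> b" "b \<le> M + 1"
  shows "\<bar>GG a - GG b\<bar> \<le> (ln (M + 5) + 1) * \<bar>a - b\<bar>"
proof -
  have *: "\<bar>GG a - GG b\<bar> \<le> (ln (M + 5) + 1) * \<bar>a - b\<bar>"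
    if "-1 \<le> b" "b < a" "a \<le> M + 1" for a b
  proof -
    have "(GG has_real_derivative ln (t + 4) + 1) (at t)" if "b \<le> t" "t \<le> a" for t
      using that \<open>-1 \<le> b\<close> by (intro GG_deriv) auto
    from MVT2[OF \<open>b < a\<close> this] obtain z where z: "b < z" "z < a" "GG a - GG b = (a - b) * (ln (z + 4) + 1)"
      by blast
    have "0 \<le> ln (z + 4)" "ln (z + 4) \<le> ln (M + 5)" using z that by auto
    then show ?thesis unfolding z(3) using z that by (simp add: abs_mult mult_right_mono)
  qed
  show ?thesis
    using *[of b a] *[of a b] assms by (cases a b rule: linorder_cases) (auto simp: abs_minus_commute)
qed

text \<open>\<open>G1\<close> is the centred difference and \<open>G2\<close> half the second
  difference. With them GG(S + d) - GG(S) = d G1(S) + d^2 G2(S) holds exactly for d in {-1, 0, 1},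
  the only changes of conserved mass that one jump can cause.\<close>

definition G1 :: "real \<Rightarrow> real" where "G1 s = (GG (s + 1) - GG (s - 1)) / 2"
definition G2 :: "real \<Rightarrow> real" where "G2 s = (GG (s + 1) + GG (s - 1) - 2 * GG s) / 2"

text \<open>Here the minimal mass of a block is decisive: both denominators are at least L/2, so
  replacing an intermediate point by S costs O(1/L^2), which is summable over the scales.\<close>

lemma inverse_close:
  assumes "\<bar>x - S\<bar> \<le> 2" "S \<ge> (real L - 1) / 2" "L \<ge> 1"
  shows "\<bar>1 / (x + 4) - 1 / (S + 4)\<bar> \<le> 8 / (real L)\<^sup>2"
proof -
  have p: "x + 4 \<ge> real L / 2" "S + 4 \<ge> real L / 2" "real L \<ge> 1" using assms by (simp_all add: field_simps)
  then have p': "x + 4 > 0" "S + 4 > 0" by linarith+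
  have "\<bar>1 / (x + 4) - 1 / (S + 4)\<bar> = \<bar>x - S\<bar> / ((x + 4) * (S + 4))"
    using p' by (simp add: diff_divide_eq_iff divide_simps abs_div abs_mult)
  also have "\<dots> \<le> 2 / ((real L / 2) * (real L / 2))"
    using p p' assms by (intro frac_le mult_mono) auto
  finally show ?thesis by (simp add: power2_eq_square)
qed

lemma G2_close:
  assumes "S \<ge> (real L - 1) / 2" "L \<ge> 1"
  shows "\<bar>2 * G2 S - 1 / (S + 4)\<bar> \<le> 8 / (real L)\<^sup>2"
proof -
  have S: "S \<ge> 0" using assms by simp
  have D: "((\<lambda>t. GG (t + 1) - GG t) has_real_derivative (ln (t + 1 + 4) + 1) - (ln (t + 4) + 1)) (at t)"
    if "S - 1 \<le> t" "t \<le> S" for t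
    using that S by (intro DERIV_diff DERIV_shift[THEN iffD1] GG_deriv) auto
  have "S - 1 < S" by simp
  from MVT2[OF this D] obtain z where z: "S - 1 < z" "z < S"
    "(GG (S + 1) - GG S) - (GG (S - 1 + 1) - GG (S - 1)) = (S - (S - 1)) * ((ln (z + 1 + 4) + 1) - (ln (z + 4) + 1))"
    by blast
  have D2: "((\<lambda>s. ln (s + 4) + 1) has_real_derivative 1 / (t + 4)) (at t)" if "z \<le> t" "t \<le> z + 1" for t
    using that z S by (intro GG_deriv2) auto
  have "z < z + 1" by simp
  from MVT2[OF this D2] obtain \<xi> where x: "z < \<xi>" "\<xi> < z + 1"
    "(ln (z + 1 + 4) + 1) - (ln (z + 4) + 1) = (z + 1 - z) * (1 / (\<xi> + 4))"
    by blast
  have "2 * G2 S = (GG (S + 1) - GG S) - (GG (S - 1 + 1) - GG (S - 1))" by (simp add: G2_def)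
  also have "\<dots> = 1 / (\<xi> + 4)" unfolding z(3) x(3) by simp
  finally have "2 * G2 S = 1 / (\<xi> + 4)" .
  then show ?thesis using inverse_close[of \<xi> S L] assms z x by (simp add: abs_le_iff)
qed

text \<open>The derivative of \<open>G1\<close> is half a difference of logarithms at distance two,
  so two applications of the mean value theorem produce 1/(\<xi> + 4) with \<xi> within 2 of
  S.\<close>

lemma G1_close:
  assumes "S \<ge> (real L - 1) / 2" "L \<ge> 1" "\<bar>S - S'\<bar> \<le> 1" "S' \<ge> 0"
  shows "\<bar>G1 S - G1 S' - (S - S') / (S + 4)\<bar> \<le> 8 / (real L)\<^sup>2"
proof -
  have S: "S \<ge> 0" using assms by simp
  have *: "\<exists>\<xi>. \<bar>\<xi> - S\<bar> \<le> 2 \<and> G1 b - G1 a = (b - a) * (1 / (\<xi> + 4))"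
    if "a < b" "a \<ge> 0" "\<bar>a - S\<bar> \<le> 1" "\<bar>b - S\<bar> \<le> 1" for a b
  proof -
    have D: "(G1 has_real_derivative ((ln (t + 1 + 4) + 1) - (ln (t + - 1 + 4) + 1)) / 2) (at t)" if "a \<le> t" "t \<le> b" for t
      unfolding G1_def diff_conv_add_uminus[of _ 1] using that \<open>a \<ge> 0\<close>
      by (intro DERIV_cdivide DERIV_diff DERIV_shift[THEN iffD1] GG_deriv) auto
    from MVT2[OF \<open>a < b\<close> D] obtain z where z: "a < z" "z < b"
      "G1 b - G1 a = (b - a) * (((ln (z + 1 + 4) + 1) - (ln (z + - 1 + 4) + 1)) / 2)"
      by blast
    have D2: "((\<lambda>s. ln (s + 4) + 1) has_real_derivative 1 / (t + 4)) (at t)" if "z - 1 \<le> t" "t \<le> z + 1" for t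
      using that z \<open>a \<ge> 0\<close> by (intro GG_deriv2) auto
    have "z - 1 < z + 1" by simp
    from MVT2[OF this D2] obtain \<xi> where x: "z - 1 < \<xi>" "\<xi> < z + 1"
      "(ln (z + 1 + 4) + 1) - (ln (z - 1 + 4) + 1) = (z + 1 - (z - 1)) * (1 / (\<xi> + 4))"
      by blast
    have "G1 b - G1 a = (b - a) * (((ln (z + 1 + 4) + 1) - (ln (z - 1 + 4) + 1)) / 2)"
      using z(3) by simp
    also have "\<dots> = (b - a) * (1 / (\<xi> + 4))"
    proof -
      have "(z + 1 - (z - 1)) * c / 2 = c" for c by simp
      then show ?thesis unfolding x(3) by (rule arg_cong)
    qed
    finally have "G1 b - G1 a = (b - a) * (1 / (\<xi> + 4))" .
    moreover have "\<bar>\<xi> - S\<bar> \<le> 2" using x z that by (simp add: abs_le_iff)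
    ultimately show ?thesis by blast
  qed
  have "\<exists>\<xi>. \<bar>\<xi> - S\<bar> \<le> 2 \<and> G1 S - G1 S' = (S - S') * (1 / (\<xi> + 4))"
  proof (cases S S' rule: linorder_cases)
    case less
    then obtain \<xi> where "\<bar>\<xi> - S\<bar> \<le> 2" "G1 S' - G1 S = (S' - S) * (1 / (\<xi> + 4))"
      using *[of S S'] assms S by (auto simp: abs_minus_commute)
    then show ?thesis by (intro exI[of _ \<xi>]) (simp add: field_simps minus_divide_left[symmetric],
        metis minus_diff_eq minus_divide_left diff_divide_distrib)
  next
    case equal then show ?thesis by (intro exI[of _ S]) simp
  next
    case greater
    then show ?thesis using *[of S' S] assms S by (auto simp: abs_minus_commute)
  qed
  then obtain \<xi> where x: "\<bar>\<xi> - S\<bar> \<le> 2" "G1 S - G1 S' = (S - S') * (1 / (\<xi> + 4))" by blast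
  have "G1 S - G1 S' - (S - S') / (S + 4) = (S - S') * (1 / (\<xi> + 4) - 1 / (S + 4))"
    unfolding x(2) by (simp add: right_diff_distrib)
  then have "\<bar>G1 S - G1 S' - (S - S') / (S + 4)\<bar> = \<bar>S - S'\<bar> * \<bar>1 / (\<xi> + 4) - 1 / (S + 4)\<bar>"
    by (simp only: abs_mult)
  also have "\<dots> \<le> 1 * (8 / (real L)\<^sup>2)"
    using inverse_close[OF x(1) assms(1,2)] assms(3) by (intro mult_mono) auto
  finally show ?thesis by simp
qed

text \<open>With P the partial sum of p plus 3, the inequality ln a <= a - 1 bounds p(L) / P(L) by
  ln P(L) - ln P(L - 1), and the sum telescopes. The slack of 1 in the hypothesis on R turns the
  shift 4 into 3. The final 2 bounds ln 4.\<close>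

lemma log_sum_upper:
  assumes p: "\<And>j::nat. 0 \<le> p j" "\<And>j. p j \<le> 1" and R: "\<And>L. R L \<ge> (\<Sum>j=1..L. p j) - 1"
    and M: "M \<ge> 1"
  shows "(\<Sum>L=1..M. p L / (R L + 4)) \<le> ln (real M) + 2"
proof -
  have P0: "0 \<le> (\<Sum>j=1..L. p j)" for L by (simp add: p sum_nonneg)
  have "(\<Sum>L=1..m. p L / (R L + 4)) \<le> ln ((\<Sum>j=1..m. p j) + 3) - ln 3" for m
  proof (induction m)
    case (Suc m)
    let ?P = "(\<Sum>j=1..m. p j) + 3" and ?P' = "(\<Sum>j=1..Suc m. p j) + 3"
    have pos: "?P > 0" "?P' > 0" using P0[of m] P0[of "Suc m"] by linarith+
    have "p (Suc m) / (R (Suc m) + 4) \<le> p (Suc m) / ?P'"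
      using R[of "Suc m"] pos p by (intro divide_left_mono mult_pos_pos) auto
    also have "\<dots> = 1 - ?P / ?P'" using pos by (simp add: field_simps)
    also have "\<dots> \<le> ln ?P' - ln ?P"
    proof -
      have "ln (?P / ?P') \<le> ?P / ?P' - 1" using pos by (intro ln_le_minus_one) simp
      then show ?thesis using pos by (simp add: ln_div)
    qed
    finally show ?case using Suc by simp
  qed simp
  from this[of M] have "(\<Sum>L=1..M. p L / (R L + 4)) \<le> ln ((\<Sum>j=1..M. p j) + 3) - ln 3" .
  also have "\<dots> \<le> ln (real M * 4)"
  proof -
    have "(\<Sum>j=1..M. p j) \<le> (\<Sum>j=1..M. 1)" using p by (intro sum_mono)
    then have "(\<Sum>j=1..M. p j) + 3 \<le> real M * 4" using M by simp
    then have "ln ((\<Sum>j=1..M. p j) + 3) \<le> ln (real M * 4)" using P0[of M] M by (subst ln_le_cancel_iff) auto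
    moreover have "ln 3 \<ge> (0::real)" by simp
    ultimately show ?thesis by linarith
  qed
  also have "\<dots> = ln (real M) + ln 4" using M by (simp add: ln_mult)
  also have "ln (4::real) = 2 * ln 2" using ln_realpow[of 2 2] by simp
  also have "2 * ln (2::real) \<le> 2" using ln_le_minus_one[of "2::real"] by simp
  finally show ?thesis by simp
qed

text \<open>Abel summation against a decreasing sequence. The subtracted term at the end is kept
  because the induction needs it.\<close>

lemma abel_bound:
  fixes V g :: "nat \<Rightarrow> real"
  assumes V: "\<And>j::nat. 0 \<le> V j" "\<And>j. V j \<le> 1"
    and g: "\<And>j. 0 \<le> g j" "\<And>j. g (Suc j) \<le> g j" and M: "M \<ge> 1"
  shows "(\<Sum>L=1..M. g L * (V (Suc L) - V L)) \<le> g 1 - g M * (1 - V (Suc M))"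
  using M
proof (induction M rule: dec_induct)
  case base
  have "g 1 * V 1 \<ge> 0" using V(1)[of 1] g(1)[of 1] by simp
  then show ?case by (simp add: algebra_simps numeral_2_eq_2)
next
  case (step M)
  have "g (Suc M) * (1 - V (Suc M)) \<le> g M * (1 - V (Suc M))"
    using g V by (intro mult_right_mono) (auto simp: le_diff_eq)
  with step show ?case by (simp add: algebra_simps)
qed

text \<open>The convex function 1/a lies above its tangent at a = r L; the gap is a square divided
  by a positive number.\<close>

lemma inverse_tangent:
  assumes "r > 0" "L > 0" "a > (0::real)"
  shows "1 / a \<ge> 2 / (r * L) - a / (r * L)\<^sup>2"
proof -
  have "0 \<le> (r * L - a)\<^sup>2 / (a * (r * L)\<^sup>2)" using assms by simp
  also have "(r * L - a)\<^sup>2 / (a * (r * L)\<^sup>2) = 1 / a - (2 / (r * L) - a / (r * L)\<^sup>2)"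
    using assms by (simp add: field_simps power2_eq_square)
  finally show ?thesis by simp
qed

text \<open>Sampling the logarithm of the block density along scales turns correlations of a site
  with remote sites into a multiple of the occupation of that site.\<close>

lemma one_sided_bound:
  fixes p V R :: "nat \<Rightarrow> real" and h :: real
  assumes p: "\<And>j. 0 \<le> p j" "\<And>j. p j \<le> 1" and R: "\<And>L. R L \<ge> (\<Sum>j=1..L. p j) - 1"
    and R0: "\<And>L. 0 \<le> R L" "\<And>L. R L \<le> R (Suc L)"
    and V: "\<And>j. 0 \<le> V j" "\<And>j. V j \<le> 1" and h: "0 \<le> h" "h \<le> 1" and M: "M \<ge> 1"
  shows "(\<Sum>L=1..M. (h * p L - (2 * p L - 1 + (V (Suc L) - V L))) / (R L + 4))
     \<ge> (h - 2) * ln (real M) - 5 + (\<Sum>L=1..M. 1 / (R L + 4))"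
proof -
  have "(\<Sum>L=1..M. (h * p L - (2 * p L - 1 + (V (Suc L) - V L))) / (R L + 4))
    = (h - 2) * (\<Sum>L=1..M. p L / (R L + 4)) + (\<Sum>L=1..M. 1 / (R L + 4))
      - (\<Sum>L=1..M. (1 / (R L + 4)) * (V (Suc L) - V L))"
    unfolding sum_distrib_left sum.distrib[symmetric] sum_subtractf[symmetric]
    by (intro sum.cong) (auto simp: diff_divide_distrib add_divide_distrib algebra_simps)
  \<comment> \<open>The factor \<open>h - 2\<close> is negative, so the upper bound of
    \<open>log_sum_upper\<close> acts from below. Its additive 2 costs at most 4, and the Abel sum
    costs the remaining 1 of the constant 5.\<close>
  moreover have "(h - 2) * (\<Sum>L=1..M. p L / (R L + 4)) \<ge> (h - 2) * (ln (real M) + 2)"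
    using log_sum_upper[OF p R M] h by (intro mult_left_mono_neg) auto
  moreover have "(\<Sum>L=1..M. (1 / (R L + 4)) * (V (Suc L) - V L)) \<le> 1"
  proof -
    have R': "R L + 4 > 0" for L using R0(1)[of L] by linarith
    have "(\<Sum>L=1..M. (1 / (R L + 4)) * (V (Suc L) - V L)) \<le> 1 / (R 1 + 4) - 1 / (R M + 4) * (1 - V (Suc M))"
      using R0 R' by (intro abel_bound V M) (auto intro!: divide_left_mono simp: less_imp_le)
    also have "\<dots> \<le> 1 / (R 1 + 4)" using V R'[of M] by (simp add: less_imp_le)
    also have "\<dots> \<le> 1" using R0(1)[of 1] by (simp add: divide_le_eq_1)
    finally show ?thesis .
  qed
  moreover have "(h - 2) * (ln (real M) + 2) \<ge> (h - 2) * ln (real M) - 4" using h by (simp add: algebra_simps)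
  ultimately show ?thesis by linarith
qed

section \<open>Masses of blocks and their change under a jump\<close>

definition blk :: "(int \<Rightarrow> real) \<Rightarrow> int \<Rightarrow> nat \<Rightarrow> real" where
  "blk e y L = (\<Sum>j=1..L. qq e (y + int j))"

lemma blk_Suc: "blk e y (Suc L) = blk e y L + qq e (y + int L + 1)"
  by (simp add: blk_def algebra_simps)

lemma blk_left: "blk e (y - 1) (Suc L) = qq e y + blk e y L"
proof (induction L)
  case (Suc L)
  have "blk e (y - 1) (Suc (Suc L)) = blk e (y - 1) (Suc L) + qq e (y - 1 + int (Suc L) + 1)"
    by (rule blk_Suc)
  with Suc show ?case using blk_Suc[of e y L] by (simp add: algebra_simps)
qed (simp add: blk_def)

lemma blk_diff: "blk e y L - blk e (y - 1) L = qq e (y + int L) - qq e y"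
  using blk_left[of e y L] blk_Suc[of e "y - 1" L] by simp

lemma blk_lower: "e \<in> cfg N \<Longrightarrow> blk e y L \<ge> (real L - 1) / 2"
proof -
  assume e: "e \<in> cfg N"
  \<comment> \<open>One half plus half a gradient: summed over a block the gradients telescope, and
    the two end values together cost at most 1/2.\<close>
  have q: "qq e x \<ge> (1 + e x - e (x + 1)) / 2" for x
    using cfg01[OF e, of x] cfg01[OF e, of "x+1"] by (auto simp: qq_def zz_def)
  have "blk e y L \<ge> (real L + e (y + 1) - e (y + 1 + int L)) / 2"
  proof (induction L)
    case (Suc L)
    then show ?case using q[of "y + 1 + int L"] unfolding blk_Suc by (simp add: algebra_simps)
  qed (simp add: blk_def)
  then show ?thesis using cfg_bounds[OF e, of "y+1"] cfg_bounds[OF e, of "y + 1 + int L"] by simp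
qed

lemma blk_bounds: assumes "e \<in> cfg N" shows "0 \<le> blk e y L" "blk e y L \<le> real L"
proof -
  show "0 \<le> blk e y L" unfolding blk_def by (simp add: sum_nonneg qq_bounds[OF assms])
  have "blk e y L \<le> (\<Sum>j=1..L. 1)" unfolding blk_def by (intro sum_mono qq_bounds[OF assms])
  then show "blk e y L \<le> real L" by simp
qed

lemma blk_periodic: "e \<in> cfg N \<Longrightarrow> periodic N (\<lambda>y. blk e y L)"
  unfolding periodic_def blk_def
  using cfg_periodic(5)[THEN periodic_dvd] by (intro allI sum.cong) auto

text \<open>A block occupies y + 1, ..., y + L, so particles cross its boundary only through the
  bonds y and y + L. The part of \<open>qq\<close> that counts pairs of holes is not conserved and
  is recorded separately as a loss.\<close>

lemma blk_cswap:
  "blk (cswap N b e) y L = blk e y L + (e b - e (b + 1)) * (ind N b y - ind N b (y + int L))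
     - (\<Sum>j=1..L. zz e (y + int j) - zz (cswap N b e) (y + int j)) / 2"
proof (induction L)
  case (Suc L)
  have "ind N (b + 1) (y + int L + 1) = ind N b (y + int L)" by (rule ind_shift)
  then have "qq (cswap N b e) (y + int L + 1) = qq e (y + int L + 1)
      + (e b - e (b + 1)) * (ind N b (y + int L) - ind N b (y + int L + 1))
      - (zz e (y + int L + 1) - zz (cswap N b e) (y + int L + 1)) / 2"
    by (simp add: qq_def cswap_def[of N b e "y + int L + 1"] diff_divide_distrib)
  then show ?case unfolding blk_Suc Suc by (simp add: algebra_simps diff_divide_distrib add_divide_distrib)
qed (simp add: blk_def)

definition znum :: "nat \<Rightarrow> (int \<Rightarrow> real) \<Rightarrow> real" where
  "znum N e = csum N (zz e)"

definition lip :: "nat \<Rightarrow> real" where "lip M = ln (real M + 5) + 1"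

lemma lip_pos: "lip M \<ge> 1" by (simp add: lip_def)

lemma ind_cases: "ind N a b = 0 \<or> ind N a b = 1" by (simp add: ind_def)

text \<open>The conserved part of the change is expanded exactly, while the mass of destroyed pairs
  is only estimated by the Lipschitz constant. The latter is affordable because the total loss over
  all times is limited.\<close>

lemma jump_estimate:
  assumes e: "e \<in> cfg N" and N: "N \<ge> M + 4" and L: "1 \<le> L" "L \<le> M"
  shows "crate e b * (GG (blk (cswap N b e) y L) - GG (blk e y L)) \<ge>
     (hh e b - hh e (b + 1)) * (ind N b y - ind N b (y + int L)) * G1 (blk e y L)
     + crate e b * (ind N b y + ind N b (y + int L)) * G2 (blk e y L)
     - lip M * (crate e b * (\<Sum>j=1..L. zz e (y + int j) - zz (cswap N b e) (y + int j)))"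
proof (cases "crate e b = 0")
  case True
  then have "hh e b - hh e (b + 1) = 0" using current_gradient[OF e, of b] by simp
  with True show ?thesis by simp
next
  case False
  then have c: "crate e b = 1" using crate01[OF e, of b] by simp
  define S where "S = blk e y L"
  define d where "d = e b - e (b + 1)"
  define i where "i = ind N b y - ind N b (y + int L)"
  define z where "z = (\<Sum>j=1..L. zz e (y + int j) - zz (cswap N b e) (y + int j))"
  have "d\<^sup>2 = 1" using crate_sq[OF e, of b] c by (simp add: d_def)
  then have d: "d = 1 \<or> d = -1" by (simp add: power2_eq_1_iff)
  have z0: "z \<ge> 0" unfolding z_def using zz_mono[OF e _ False] N by (intro sum_nonneg) auto
  \<comment> \<open>Since 1 <= L < N, the two boundary bonds of the block are different sites of the
    torus, so one jump cannot use both.\<close>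
  have disj: "\<not> (ind N b y = 1 \<and> ind N b (y + int L) = 1)"
  proof
    assume "ind N b y = 1 \<and> ind N b (y + int L) = 1"
    then have "int N dvd y + int L - b" "int N dvd y - b" by (auto simp: ind_def)
    then have "int N dvd (y + int L - b) - (y - b)" by (rule dvd_diff)
    then have "int N dvd int L" by simp
    then show False using N L by (auto dest!: dvd_imp_le)
  qed
  have e': "cswap N b e \<in> cfg N" using e N by (intro cswap_cfg) auto
  have S': "blk (cswap N b e) y L = S + d * i - z / 2"
    using blk_cswap[of N b e y L] by (simp add: S_def d_def i_def z_def)
  have S0: "0 \<le> S" "S \<le> real M" using blk_bounds[OF e, of y L] L by (auto simp: S_def)
  have S0': "0 \<le> S + d * i - z / 2" "S + d * i - z / 2 \<le> real M"
    using blk_bounds[OF e', of y L] L by (auto simp: S'[symmetric])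
  have i: "i = 0 \<or> i = 1 \<or> i = -1" "ind N b y + ind N b (y + int L) = i\<^sup>2"
    using disj ind_cases[of N b y] ind_cases[of N b "y + int L"] by (auto simp: i_def)
  have di: "d * i \<in> {0, 1, -1}" using d i(1) by auto
  have "GG (S + d * i) - GG S = d * i * G1 S + i\<^sup>2 * G2 S"
    using d i(1) by (auto simp: G1_def G2_def field_simps)
  \<comment> \<open>The intermediate value \<open>S + d * i\<close> need not be a block mass and may
    leave [0, M] by one unit, which \<open>GG_lipschitz\<close> permits. Half of z is lost, and the
    bound by z is generous.\<close>
  moreover have "\<bar>GG (S + d * i - z / 2) - GG (S + d * i)\<bar> \<le> lip M * z"
  proof -
    have "\<bar>GG (S + d * i - z / 2) - GG (S + d * i)\<bar> \<le> (ln (real M + 5) + 1) * \<bar>(S + d * i - z / 2) - (S + d * i)\<bar>"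
      using S0 S0' di by (intro GG_lipschitz) auto
    also have "\<dots> \<le> lip M * z"
      using z0 lip_pos[of M] by (auto simp: lip_def intro!: mult_left_mono)
    finally show ?thesis .
  qed
  moreover have hd: "hh e b - hh e (b + 1) = d" using current_gradient[OF e, of b] c by (simp add: d_def)
  ultimately show ?thesis
    unfolding c S'[unfolded S_def] S_def[symmetric] z_def[symmetric] i(2) i_def[symmetric] hd mult_1
    by linarith
qed

lemma gen_block:
  assumes e: "e \<in> cfg N" and N: "N \<ge> M + 4" and L: "1 \<le> L" "L \<le> M"
  shows "gen N (\<lambda>e. GG (blk e y L)) e \<ge>
     ((hh e y - hh e (y + int L)) - (hh e (y + 1) - hh e (y + 1 + int L))) * G1 (blk e y L)
     + (crate e y + crate e (y + int L)) * G2 (blk e y L)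
     - lip M * csum N (\<lambda>b. crate e b * (\<Sum>j=1..L. zz e (y + int j) - zz (cswap N b e) (y + int j)))"
proof -
  let ?S = "blk e y L"
  have pj: "periodic N (\<lambda>x. hh e x - hh e (x + 1))"
    using periodic_comp2[OF cfg_periodic(2)[OF e] periodic_shift[OF cfg_periodic(2)[OF e]], of minus] .
  have pc: "periodic N (crate e)" using cfg_periodic[OF e] by simp
  have N1: "N \<ge> 1" using N by simp
  have "gen N (\<lambda>e. GG (blk e y L)) e \<ge> csum N (\<lambda>b.
     (hh e b - hh e (b + 1)) * (ind N b y - ind N b (y + int L)) * G1 ?S
     + crate e b * (ind N b y + ind N b (y + int L)) * G2 ?S
     - lip M * (crate e b * (\<Sum>j=1..L. zz e (y + int j) - zz (cswap N b e) (y + int j))))"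
    unfolding gen_def by (intro csum_mono jump_estimate[OF e N L])
  also have "csum N (\<lambda>b.
     (hh e b - hh e (b + 1)) * (ind N b y - ind N b (y + int L)) * G1 ?S
     + crate e b * (ind N b y + ind N b (y + int L)) * G2 ?S
     - lip M * (crate e b * (\<Sum>j=1..L. zz e (y + int j) - zz (cswap N b e) (y + int j))))
    = (csum N (\<lambda>b. (hh e b - hh e (b + 1)) * ind N b y) - csum N (\<lambda>b. (hh e b - hh e (b + 1)) * ind N b (y + int L))) * G1 ?S
     + (csum N (\<lambda>b. crate e b * ind N b y) + csum N (\<lambda>b. crate e b * ind N b (y + int L))) * G2 ?S
     - lip M * csum N (\<lambda>b. crate e b * (\<Sum>j=1..L. zz e (y + int j) - zz (cswap N b e) (y + int j)))"
    by (simp only: csum_add csum_diff csum_cmult csum_multc right_diff_distrib distrib_left)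
  finally show ?thesis
    unfolding csum_ind[OF pj N1] csum_ind[OF pc N1] by (simp add: algebra_simps)
qed

section \<open>Weights of bounded variation\<close>

definition variation :: "nat \<Rightarrow> (int \<Rightarrow> real) \<Rightarrow> real" where
  "variation N w = csum N (\<lambda>x. \<bar>w x - w (x - 1)\<bar>)"

lemma variation_nonneg: "variation N w \<ge> 0"
  unfolding variation_def by (simp add: csum_nonneg)

lemma variation_shift:
  assumes "periodic N w"
  shows "csum N (\<lambda>x. \<bar>w x - w (x - int L)\<bar>) \<le> real L * variation N w"
proof (induction L)
  case (Suc L)
  have p: "periodic N (\<lambda>x. \<bar>w x - w (x - 1)\<bar>)"
    using periodic_comp2[OF assms periodic_shift[OF assms, of "-1"], of "\<lambda>a b. \<bar>a - b\<bar>"] by simp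
  have "csum N (\<lambda>x. \<bar>w x - w (x - int (Suc L))\<bar>) \<le> csum N (\<lambda>x. \<bar>w x - w (x - int L)\<bar> + \<bar>w (x - int L) - w (x - int L - 1)\<bar>)"
    by (rule csum_mono) (simp add: algebra_simps)
  also have "\<dots> = csum N (\<lambda>x. \<bar>w x - w (x - int L)\<bar>) + variation N w"
    unfolding csum_add variation_def using csum_shift_diff[OF p, of "int L"] by simp
  finally show ?case using Suc by (simp add: algebra_simps)
qed (simp add: csum_const)

text \<open>The shift is transferred from f to w, where each unit step costs one variation.\<close>

lemma csum_shift_weight_nat:
  assumes w: "periodic N w" and f: "periodic N f" and B: "\<And>x. \<bar>f x\<bar> \<le> B"
  shows "\<bar>csum N (\<lambda>x. w x * f (x + int L)) - csum N (\<lambda>x. w x * f x)\<bar> \<le> real L * B * variation N w"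
proof -
  have B0: "B \<ge> 0" using B[of 0] by simp
  have "csum N (\<lambda>x. w x * f (x + int L)) = csum N (\<lambda>x. w (x - int L) * f x)"
  proof -
    have "periodic N (\<lambda>x. w (x - int L) * f x)"
      using periodic_comp2[OF periodic_shift[OF w, of "- int L"] f, of "(*)"] by simp
    from csum_shift[OF this, of "int L"] show ?thesis by simp
  qed
  then have "csum N (\<lambda>x. w x * f (x + int L)) - csum N (\<lambda>x. w x * f x) =
      csum N (\<lambda>x. (w (x - int L) - w x) * f x)"
    by (simp add: csum_diff left_diff_distrib)
  also have "\<bar>\<dots>\<bar> \<le> csum N (\<lambda>x. \<bar>w x - w (x - int L)\<bar> * B)"
    by (rule order_trans[OF csum_abs], rule csum_mono)
      (simp add: abs_mult abs_minus_commute mult_left_mono B)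
  also have "\<dots> \<le> real L * variation N w * B"
    unfolding csum_multc using variation_shift[OF w, of L] B0 by (rule mult_right_mono)
  finally show ?thesis by (simp add: mult.commute mult.left_commute)
qed

lemma csum_shift_weight:
  assumes w: "periodic N w" and f: "periodic N f" and B: "\<And>x. \<bar>f x\<bar> \<le> B"
  shows "\<bar>csum N (\<lambda>x. w x * f (x + k)) - csum N (\<lambda>x. w x * f x)\<bar> \<le> of_int \<bar>k\<bar> * B * variation N w"
proof (cases "k \<ge> 0")
  case True
  then show ?thesis using csum_shift_weight_nat[OF w f B, of "nat k"] by simp
next
  case False
  then show ?thesis
    using csum_shift_weight_nat[where f = "\<lambda>x. f (x + k)" and L = "nat (-k)", OF w periodic_shift[OF f] B]
    by (simp add: abs_minus_commute)
qed

definition Lyap :: "nat \<Rightarrow> nat \<Rightarrow> (int \<Rightarrow> real) \<Rightarrow> (int \<Rightarrow> real) \<Rightarrow> real" where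
  "Lyap N M w e = (\<Sum>L=1..M. csum N (\<lambda>y. w y * GG (blk e y L)))"

lemma gen_sum: "gen N (\<lambda>e. \<Sum>i\<in>I. \<Phi> i e) e = (\<Sum>i\<in>I. gen N (\<Phi> i) e)"
  unfolding gen_def by (simp add: csum_sum[symmetric] sum_distrib_left sum_subtractf[symmetric])

lemma gen_csum: "gen N (\<lambda>e. csum N (\<lambda>y. w y * \<Phi> y e)) e = csum N (\<lambda>y. w y * gen N (\<Phi> y) e)"
proof -
  have "gen N (\<lambda>e. csum N (\<lambda>y. w y * \<Phi> y e)) e =
    csum N (\<lambda>x. csum N (\<lambda>y. w y * (crate e x * (\<Phi> y (cswap N x e) - \<Phi> y e))))"
    unfolding gen_def csum_diff[symmetric] csum_cmult[symmetric] by (simp add: algebra_simps)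
  also have "\<dots> = csum N (\<lambda>y. csum N (\<lambda>x. w y * (crate e x * (\<Phi> y (cswap N x e) - \<Phi> y e))))"
    by (rule csum_swap)
  finally show ?thesis by (simp add: csum_cmult gen_def)
qed

lemma AA_bounds: assumes "e \<in> cfg N" shows "-1 \<le> AA e x" "AA e x \<le> 1"
  using hh01[OF assms, of x] crate01[OF assms, of x] by (auto simp: AA_def)

text \<open>A destroyed pair is seen by the L blocks that contain its position. Summing over all
  blocks therefore gives L times the rate at which \<open>znum\<close> decreases. By
  \<open>zz_mono\<close> every contribution is nonnegative, so the weight may be replaced by 1 and L
  by M.\<close>

lemma irreversible_loss:
  assumes e: "e \<in> cfg N" and N: "N \<ge> M + 4" and L: "L \<le> M"
    and w: "\<And>y. 0 \<le> w y" "\<And>y. w y \<le> 1"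
  shows "csum N (\<lambda>y. w y * csum N (\<lambda>b. crate e b * (\<Sum>j=1..L. zz e (y + int j) - zz (cswap N b e) (y + int j))))
     \<le> real M * (- gen N (znum N) e)"
proof -
  have c: "crate e b * (zz e x - zz (cswap N b e) x) \<ge> 0" for b x
    using zz_mono[OF e, of b x] crate01[OF e, of b] N by auto
  have s: "(\<Sum>j=1..L. crate e b * (zz e (y + int j) - zz (cswap N b e) (y + int j))) \<ge> 0" for b y
    by (intro sum_nonneg c)
  have "csum N (\<lambda>y. w y * csum N (\<lambda>b. crate e b * (\<Sum>j=1..L. zz e (y + int j) - zz (cswap N b e) (y + int j))))
     \<le> csum N (\<lambda>y. csum N (\<lambda>b. (\<Sum>j=1..L. crate e b * (zz e (y + int j) - zz (cswap N b e) (y + int j)))))"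
    unfolding sum_distrib_left[symmetric]
    using w s by (intro csum_mono mult_left_le_one_le csum_nonneg) (auto simp: sum_distrib_left)
  also have "\<dots> = csum N (\<lambda>b. (\<Sum>j=1..L. csum N (\<lambda>y. crate e b * (zz e (y + int j) - zz (cswap N b e) (y + int j)))))"
    by (subst csum_swap) (simp add: csum_sum)
  also have "\<dots> = csum N (\<lambda>b. real L * (crate e b * (znum N e - znum N (cswap N b e))))"
  proof -
    have "csum N (\<lambda>y. crate e b * (zz e (y + int j) - zz (cswap N b e) (y + int j)))
        = crate e b * (znum N e - znum N (cswap N b e))" for b j
    proof -
      have "cswap N b e \<in> cfg N" using e N by (intro cswap_cfg) auto
      then have "periodic N (zz e)" "periodic N (zz (cswap N b e))" using e by auto
      then show ?thesis by (simp add: csum_cmult csum_diff znum_def csum_shift)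
    qed
    then show ?thesis by simp
  qed
  also have "\<dots> = real L * (- gen N (znum N) e)"
    unfolding csum_cmult gen_def csum_def by (simp add: sum_negf[symmetric] algebra_simps)
  also have "\<dots> \<le> real M * (- gen N (znum N) e)"
  proof -
    have "znum N e - znum N (cswap N b e) = csum N (\<lambda>x. zz e x - zz (cswap N b e) x)" for b
      by (simp add: znum_def csum_diff)
    then have "crate e b * (znum N e - znum N (cswap N b e)) \<ge> 0" for b
      using c by (simp add: csum_cmult[symmetric] csum_nonneg)
    then have "- gen N (znum N) e \<ge> 0"
      unfolding gen_def csum_def by (simp add: sum_negf[symmetric] right_diff_distrib sum_nonneg)
    then show ?thesis using L by (intro mult_right_mono) auto
  qed
  finally show ?thesis .
qed

lemma G1_bound: assumes "0 \<le> s" "s \<le> real M" shows "\<bar>G1 s\<bar> \<le> lip M"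
proof -
  have "\<bar>GG (s + 1) - GG (s - 1)\<bar> \<le> (ln (real M + 5) + 1) * \<bar>(s + 1) - (s - 1)\<bar>"
    using assms by (intro GG_lipschitz) auto
  then show ?thesis by (simp add: G1_def lip_def)
qed

lemma csum_weighted_split:
  "csum N (\<lambda>y. w y * (p y * g y + q y - l * i y)) =
     csum N (\<lambda>y. p y * (w y * g y)) + csum N (\<lambda>y. w y * q y) - l * csum N (\<lambda>y. w y * i y)"
  unfolding csum_cmult[symmetric] csum_add[symmetric] csum_diff[symmetric]
  by (rule arg_cong[where f = "csum N"]) (simp add: algebra_simps)

text \<open>Summation by parts turns the current into a product with the mass difference of
  neighbouring blocks, which involves only two sites at distance L. Each scale thus yields
  correlations of \<open>hh\<close> with \<open>qq\<close> at distance L, divided by a block mass.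
  The error 16/L^2 is 8/L^2 from \<open>G1_close\<close> plus 8/L^2 from
  \<open>G2_close\<close>.\<close>

lemma scale_estimate:
  assumes e: "e \<in> cfg N" and N: "N \<ge> M + 4" and L: "1 \<le> L" "L \<le> M"
    and w: "periodic N w" "\<And>y. 0 \<le> w y" "\<And>y. w y \<le> 1"
  shows "gen N (\<lambda>e. csum N (\<lambda>y. w y * GG (blk e y L))) e \<ge>
     csum N (\<lambda>y. w y * ((hh e y * qq e (y + int L) - AA e (y + int L)) / (blk e y L + 4)
        + (hh e y * qq e (y - int L) - AA e (y - int L)) / (blk e (y - int L) L + 4)))
     - 16 / (real L)\<^sup>2 * csum N w - (lip M + real M) * variation N w + lip M * real M * gen N (znum N) e"
proof -
  define S where "S y = blk e y L" for y
  define k where "k y = hh e y - hh e (y + int L)" for y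
  define \<epsilon> where "\<epsilon> = 8 / (real L)\<^sup>2"
  define f where "f y = (hh e y * qq e (y - int L) - AA e (y - int L)) / (S (y - int L) + 4)" for y
  have pS: "periodic N S" unfolding S_def by (rule blk_periodic[OF e])
  have pk: "periodic N k" unfolding k_def
    using periodic_comp2[OF cfg_periodic(2)[OF e] periodic_shift[OF cfg_periodic(2)[OF e]], of minus] .
  have ph: "periodic N (hh e)" and pq: "periodic N (qq e)" and pA: "periodic N (AA e)"
    using cfg_periodic[OF e] by auto
  have S: "0 \<le> S y" "S y \<le> real M" "S y \<ge> (real L - 1) / 2" for y
    using blk_bounds[OF e, of y L] blk_lower[OF e, of L y] L by (auto simp: S_def)
  have k1: "\<bar>k y\<bar> \<le> 1" for y
    using hh01[OF e, of y] hh01[OF e, of "y + int L"] by (auto simp: k_def)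
  have dS: "S y - S (y - 1) = qq e (y + int L) - qq e y" for y
    by (simp add: S_def blk_diff)
  have eps: "\<epsilon> \<ge> 0" by (simp add: \<epsilon>_def)
  let ?irr = "\<lambda>y. csum N (\<lambda>b. crate e b * (\<Sum>j=1..L. zz e (y + int j) - zz (cswap N b e) (y + int j)))"
  have "csum N (\<lambda>y. w y * ((k y - k (y + 1)) * G1 (S y) + (crate e y + crate e (y + int L)) * G2 (S y) - lip M * ?irr y))
    \<le> gen N (\<lambda>e. csum N (\<lambda>y. w y * GG (blk e y L))) e"
    unfolding gen_csum
    using gen_block[OF e N L] by (intro csum_mono mult_left_mono w) (simp add: k_def S_def algebra_simps)
  moreover have "csum N (\<lambda>y. w y * ((k y - k (y + 1)) * G1 (S y) + (crate e y + crate e (y + int L)) * G2 (S y) - lip M * ?irr y))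
     = csum N (\<lambda>y. (k y - k (y + 1)) * (w y * G1 (S y))) + csum N (\<lambda>y. w y * ((crate e y + crate e (y + int L)) * G2 (S y)))
       - lip M * csum N (\<lambda>y. w y * ?irr y)"
    by (rule csum_weighted_split)
  moreover have "lip M * csum N (\<lambda>y. w y * ?irr y) \<le> lip M * (real M * (- gen N (znum N) e))"
    using irreversible_loss[OF e N L(2) w(2,3)] lip_pos[of M] by (intro mult_left_mono) auto
  moreover have "csum N (\<lambda>y. (k y - k (y + 1)) * (w y * G1 (S y))) \<ge>
     csum N (\<lambda>y. w y * (k y * (qq e (y + int L) - qq e y) / (S y + 4) - \<epsilon>)) - lip M * variation N w"
  proof -
    have p: "periodic N (\<lambda>y. w y * G1 (S y))" using periodic_comp2[OF w(1) pS, of "\<lambda>a b. a * G1 b"] .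
    have "csum N (\<lambda>y. w y * (k y * (qq e (y + int L) - qq e y) / (S y + 4) - \<epsilon>) - lip M * \<bar>w y - w (y - 1)\<bar>)
      \<le> csum N (\<lambda>y. k y * (w y * G1 (S y) - w (y - 1) * G1 (S (y - 1))))"
    proof (rule csum_mono)
      fix y
      have "\<bar>G1 (S y) - G1 (S (y - 1)) - (S y - S (y - 1)) / (S y + 4)\<bar> \<le> \<epsilon>"
        unfolding \<epsilon>_def using S L qq_bounds[OF e, of y] qq_bounds[OF e, of "y + int L"]
        by (intro G1_close) (auto simp: dS abs_le_iff)
      then have "\<bar>k y\<bar> * \<bar>G1 (S y) - G1 (S (y - 1)) - (S y - S (y - 1)) / (S y + 4)\<bar> \<le> 1 * \<epsilon>"
        using k1 by (intro mult_mono) auto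
      then have "\<bar>k y * (G1 (S y) - G1 (S (y - 1)) - (S y - S (y - 1)) / (S y + 4))\<bar> \<le> \<epsilon>"
        by (simp add: abs_mult)
      then have "k y * (G1 (S y) - G1 (S (y - 1))) \<ge> k y * (S y - S (y - 1)) / (S y + 4) - \<epsilon>"
        by (simp add: abs_le_iff right_diff_distrib)
      then have 1: "w y * (k y * (G1 (S y) - G1 (S (y - 1)))) \<ge> w y * (k y * (qq e (y + int L) - qq e y) / (S y + 4) - \<epsilon>)"
        unfolding dS using w by (intro mult_left_mono) auto
      have "\<bar>k y * ((w y - w (y - 1)) * G1 (S (y - 1)))\<bar> \<le> 1 * (\<bar>w y - w (y - 1)\<bar> * lip M)"
        unfolding abs_mult using k1 S G1_bound by (intro mult_mono) auto
      then have 2: "k y * ((w y - w (y - 1)) * G1 (S (y - 1))) \<ge> - (lip M * \<bar>w y - w (y - 1)\<bar>)"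
        by (simp add: abs_le_iff mult.commute)
      have 3: "k y * (w y * G1 (S y) - w (y - 1) * G1 (S (y - 1))) =
         w y * (k y * (G1 (S y) - G1 (S (y - 1)))) + k y * ((w y - w (y - 1)) * G1 (S (y - 1)))"
        by (simp add: algebra_simps)
      show "w y * (k y * (qq e (y + int L) - qq e y) / (S y + 4) - \<epsilon>) - lip M * \<bar>w y - w (y - 1)\<bar>
        \<le> k y * (w y * G1 (S y) - w (y - 1) * G1 (S (y - 1)))"
        using 1 2 unfolding 3 by linarith
    qed
    then show ?thesis unfolding csum_parts[OF pk p] by (simp only: csum_diff csum_cmult variation_def)
  qed
  moreover have "csum N (\<lambda>y. w y * ((crate e y + crate e (y + int L)) * G2 (S y))) \<ge>
      csum N (\<lambda>y. w y * ((crate e y + crate e (y + int L)) / 2 / (S y + 4) - \<epsilon>))"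
  proof (intro csum_mono mult_left_mono w)
    fix y
    define c where "c = (crate e y + crate e (y + int L)) / 2"
    have c: "0 \<le> c" "c \<le> 1" using crate01[OF e, of y] crate01[OF e, of "y + int L"] by (auto simp: c_def)
    have "2 * G2 (S y) \<ge> 1 / (S y + 4) - \<epsilon>"
      using G2_close[OF S(3)[of y] L(1)] by (simp add: \<epsilon>_def abs_le_iff)
    then have "c * (2 * G2 (S y)) \<ge> c * (1 / (S y + 4) - \<epsilon>)" using c by (intro mult_left_mono)
    moreover have "c * \<epsilon> \<le> \<epsilon>" using c eps by (simp add: mult_left_le_one_le)
    ultimately show "(crate e y + crate e (y + int L)) / 2 / (S y + 4) - \<epsilon> \<le> (crate e y + crate e (y + int L)) * G2 (S y)"
    proof -
      have "(crate e y + crate e (y + int L)) * G2 (S y) = c * (2 * G2 (S y))" by (simp add: c_def)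
      moreover have "(crate e y + crate e (y + int L)) / 2 / (S y + 4) = c * (1 / (S y + 4))"
        unfolding c_def by simp
      ultimately show ?thesis using \<open>c * (2 * G2 (S y)) \<ge> _\<close> \<open>c * \<epsilon> \<le> \<epsilon>\<close>
        by (simp only: right_diff_distrib)
    qed
  qed
  moreover have "csum N (\<lambda>y. w y * (k y * (qq e (y + int L) - qq e y) / (S y + 4) - \<epsilon>))
      + csum N (\<lambda>y. w y * ((crate e y + crate e (y + int L)) / 2 / (S y + 4) - \<epsilon>))
     = csum N (\<lambda>y. w y * ((hh e y * qq e (y + int L) - AA e (y + int L)) / (S y + 4)))
       + csum N (\<lambda>y. w y * f (y + int L)) - 16 / (real L)\<^sup>2 * csum N w"
  proof -
    have "w y * (k y * (qq e (y + int L) - qq e y) / (S y + 4) - \<epsilon>) + w y * ((crate e y + crate e (y + int L)) / 2 / (S y + 4) - \<epsilon>)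
      = w y * ((hh e y * qq e (y + int L) - AA e (y + int L)) / (S y + 4)) + w y * f (y + int L) - 16 / (real L)\<^sup>2 * w y" for y
    proof -
      \<comment> \<open>Products at the same site collapse by \<open>hq\<close>. The factor 1/2 of
        the second-order term is the one in \<open>AA\<close>, so half of the jump rates completes -
        \<open>hh\<close> to - \<open>AA\<close>.\<close>
      have "k y * (qq e (y + int L) - qq e y) + (crate e y + crate e (y + int L)) / 2
        = (hh e y * qq e (y + int L) - AA e (y + int L)) + (hh e (y + int L) * qq e y - AA e y)"
        unfolding k_def AA_def right_diff_distrib left_diff_distrib hq[OF e] by simp
      then have "k y * (qq e (y + int L) - qq e y) / (S y + 4) + (crate e y + crate e (y + int L)) / 2 / (S y + 4)
        = (hh e y * qq e (y + int L) - AA e (y + int L)) / (S y + 4) + f (y + int L)"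
        by (simp only: f_def add_diff_cancel_right' add_divide_distrib[symmetric])
      moreover have "w y * (a - \<epsilon>) + w y * (b - \<epsilon>) = w y * c + w y * d - 16 / (real L)\<^sup>2 * w y"
        if "a + b = c + d" for a b c d
      proof -
        have "w y * (a - \<epsilon>) + w y * (b - \<epsilon>) = w y * (a + b) - 2 * \<epsilon> * w y" by (simp add: algebra_simps)
        then show ?thesis unfolding that by (simp add: \<epsilon>_def algebra_simps)
      qed
      ultimately show ?thesis by blast
    qed
    then show ?thesis unfolding csum_cmult[symmetric] csum_add[symmetric] csum_diff[symmetric] by simp
  qed
  \<comment> \<open>The second correlation is centred at the right end of the block. Recentring it
    at y produces the block to the left of y and costs at most M variations, as f is bounded by
    1.\<close>
  moreover have "csum N (\<lambda>y. w y * f (y + int L)) \<ge> csum N (\<lambda>y. w y * f y) - real M * variation N w"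
  proof -
    have pf: "periodic N f"
      using periodic_comp2[OF periodic_comp2[OF periodic_comp2[OF ph periodic_shift[OF pq, of "- int L"], of "(*)"]
            periodic_shift[OF pA, of "- int L"], of minus] periodic_shift[OF pS, of "- int L"], of "\<lambda>a b. a / (b + 4)"]
      by (simp add: f_def[abs_def])
    have f1: "\<bar>f y\<bar> \<le> 1" for y
    proof -
      have "\<bar>hh e y * qq e (y - int L) - AA e (y - int L)\<bar> \<le> 2"
        using hh01[OF e, of y] qq_bounds[OF e, of "y - int L"] AA_bounds[OF e, of "y - int L"] by (auto simp: abs_le_iff)
      then have "\<bar>f y\<bar> \<le> 2 / 4" unfolding f_def abs_divide using S(1)[of "y - int L"]
        by (intro frac_le) auto
      then show ?thesis by simp
    qed
    have "\<bar>csum N (\<lambda>x. w x * f (x + int L)) - csum N (\<lambda>x. w x * f x)\<bar> \<le> real L * 1 * variation N w"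
      using csum_shift_weight[OF w(1) pf f1, of "int L"] by simp
    also have "\<dots> \<le> real M * variation N w" using L variation_nonneg by (simp add: mult_right_mono)
    finally show ?thesis by (simp add: abs_le_iff)
  qed
  moreover have "csum N (\<lambda>y. w y * ((hh e y * qq e (y + int L) - AA e (y + int L)) / (blk e y L + 4)
        + (hh e y * qq e (y - int L) - AA e (y - int L)) / (blk e (y - int L) L + 4)))
    = csum N (\<lambda>y. w y * ((hh e y * qq e (y + int L) - AA e (y + int L)) / (S y + 4))) + csum N (\<lambda>y. w y * f y)"
    unfolding csum_add[symmetric] by (simp add: f_def S_def distrib_left)
  ultimately show ?thesis by (simp add: algebra_simps)
qed

section \<open>Summation over the scales\<close>

lemma sum_inverse_lower: "M \<ge> 1 \<Longrightarrow> (\<Sum>L=1..M. 1 / real L) \<ge> ln (real M)"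
  using harm_ge_ln[of M] unfolding harm_def
  by (smt (verit) inverse_eq_divide ln_le_cancel_iff of_nat_0_less_iff order_trans sum.cong zero_less_one less_le_trans of_nat_0_le_iff)

lemma sum_inverse_upper: "M \<ge> 1 \<Longrightarrow> (\<Sum>L=1..M. 1 / real L) \<le> ln (real M) + 1"
proof (induction M rule: dec_induct)
  case (step m)
  then have m: "real m > 0" by simp
  have "ln (real m / real (Suc m)) \<le> real m / real (Suc m) - 1" using m by (intro ln_le_minus_one) simp
  moreover have "ln (real m / real (Suc m)) = ln (real m) - ln (real (Suc m))" using m by (simp add: ln_div)
  moreover have "real m / real (Suc m) - 1 = - (1 / real (Suc m))" by (simp add: field_simps)
  ultimately show ?case using step by simp
qed simp

lemma sum_inverse_squares: "M \<ge> 1 \<Longrightarrow> (\<Sum>L=1..M. 1 / (real L)\<^sup>2) \<le> 2 - 1 / real M"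
proof (induction M rule: dec_induct)
  case (step m)
  then have m: "real m > 0" by simp
  have "1 / (real (Suc m))\<^sup>2 \<le> 1 / (real m * real (Suc m))"
    unfolding power2_eq_square using m by (intro divide_left_mono mult_right_mono) auto
  also have "\<dots> = 1 / real m - 1 / real (Suc m)" using m by (simp add: field_simps)
  finally show ?case using step by simp
qed simp

text \<open>Blocks to the right and to the left of each site both contribute, whence the factor 2
  before ln M. The remaining inverse masses are bounded by tangents at r, and the block masses in
  them are shifted back to the site at the cost of the variation. After division by 2 ln M the
  right-hand side is led by 2 - 2/r + q/r^2, the tangent of 2 - 1/\<rho> at r.\<close>

lemma local_inequality:
  assumes e: "e \<in> cfg N" and N: "N \<ge> M + 4" and M: "1 \<le> M"
    and w: "periodic N w" "\<And>y. 0 \<le> w y" "\<And>y. w y \<le> 1"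
    and r: "1 / 2 \<le> r"
  shows "2 * ln (real M) * csum N (\<lambda>y. w y * hh e y) \<le>
     2 * ln (real M) * csum N (\<lambda>y. w y * (2 - 2 / r + qq e y / r\<^sup>2))
     + gen N (Lyap N M w) e - lip M * (real M)\<^sup>2 * gen N (znum N) e
     + 114 * csum N w + real M * (lip M + real M + 8) * variation N w"
proof -
  define X where "X y L = (hh e y * qq e (y + int L) - AA e (y + int L)) / (blk e y L + 4)
        + (hh e y * qq e (y - int L) - AA e (y - int L)) / (blk e (y - int L) L + 4)" for y and L :: nat
  define W where "W = csum N w"
  define Q where "Q = csum N (\<lambda>y. w y * qq e y)"
  define V where "V = variation N w"
  have W0: "W \<ge> 0" and Q0: "Q \<ge> 0" and QW: "Q \<le> W" and V0: "V \<ge> 0" using w qq_bounds[OF e]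
    by (auto simp: W_def Q_def V_def csum_nonneg mult_left_le variation_nonneg intro!: csum_mono)
  have pq: "periodic N (qq e)" using cfg_periodic[OF e] by simp
  have qa: "\<bar>qq e y\<bar> \<le> 1" for y using qq_bounds[OF e, of y] by simp
  \<comment> \<open>The left block ends at y, whereas the scales count the sites y - 1, ..., y - L.
    The mismatch of one site is absorbed by the slack 1 in the hypothesis on R of
    \<open>one_sided_bound\<close>.\<close>
  have blkR: "blk e (y - int L) L + qq e (y - int L) = (\<Sum>j=1..L. qq e (y - int j)) + qq e y" for y L
  proof (induction L)
    case (Suc L)
    have "blk e (y - int (Suc L)) (Suc L) = qq e (y - int L) + blk e (y - int L) L"
      using blk_left[of e "y - int L" L] by (simp add: algebra_simps)
    then show ?case using Suc by simp
  qed (simp add: blk_def)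
  have blkQ1: "csum N (\<lambda>y. w y * blk e y L) \<le> real L * Q + (real L)\<^sup>2 * V" for L
  proof -
    have "csum N (\<lambda>y. w y * blk e y L) = (\<Sum>j=1..L. csum N (\<lambda>y. w y * qq e (y + int j)))"
      unfolding blk_def sum_distrib_left by (rule csum_sum)
    also have "\<dots> \<le> (\<Sum>j=1..L. Q + real L * V)"
    proof (intro sum_mono)
      fix j assume j: "j \<in> {1..L}"
      have "csum N (\<lambda>y. w y * qq e (y + int j)) \<le> Q + real j * V"
        using csum_shift_weight[OF w(1) pq qa, of "int j"] by (simp add: Q_def V_def)
      also have "\<dots> \<le> Q + real L * V" using j V0 by (simp add: mult_right_mono)
      finally show "csum N (\<lambda>y. w y * qq e (y + int j)) \<le> Q + real L * V" .
    qed
    finally show ?thesis by (simp add: algebra_simps power2_eq_square)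
  qed
  have blkQ2: "csum N (\<lambda>y. w y * blk e (y - int L) L) \<le> real L * Q + (real L)\<^sup>2 * V" if "L \<ge> 1" for L
  proof -
    have *: "blk e (y - int L) L = (\<Sum>j<L. qq e (y - int j))" for y
    proof (induction L)
      case (Suc L)
      then show ?case using blk_left[of e "y - int L" L] by (simp add: algebra_simps)
    qed (simp add: blk_def)
    have "csum N (\<lambda>y. w y * blk e (y - int L) L) = (\<Sum>j<L. csum N (\<lambda>y. w y * qq e (y - int j)))"
      unfolding * sum_distrib_left by (rule csum_sum)
    also have "\<dots> \<le> (\<Sum>j<L. Q + real L * V)"
    proof (intro sum_mono)
      fix j assume j: "j \<in> {..<L}"
      have "csum N (\<lambda>y. w y * qq e (y - int j)) \<le> Q + real j * V"
        using csum_shift_weight[OF w(1) pq qa, of "- int j"] by (simp add: Q_def V_def)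
      also have "\<dots> \<le> Q + real L * V" using j V0 by (simp add: mult_right_mono)
      finally show "csum N (\<lambda>y. w y * qq e (y - int j)) \<le> Q + real L * V" .
    qed
    finally show ?thesis by (simp add: algebra_simps power2_eq_square)
  qed
  have X: "(\<Sum>L=1..M. X y L) \<ge> 2 * (hh e y - 2) * ln (real M) - 10
      + (\<Sum>L=1..M. 1 / (blk e y L + 4)) + (\<Sum>L=1..M. 1 / (blk e (y - int L) L + 4))" for y
  proof -
    have h: "0 \<le> hh e y" "hh e y \<le> 1" using hh01[OF e, of y] by auto
    have A1: "AA e (y + int L) = 2 * qq e (y + int L) - 1 + (vv e (y + int (Suc L)) - vv e (y + int L))" for L
      using AA_eq[OF e, of "y + int L"] by (simp add: algebra_simps)
    \<comment> \<open>Reflection reverses the sign of the gradient; passing from \<open>vv\<close>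
      to \<open>1 - vv\<close> restores it and keeps the values in [0, 1].\<close>
    have A2: "AA e (y - int L) = 2 * qq e (y - int L) - 1 + ((1 - vv e (y - int (Suc L) + 1)) - (1 - vv e (y - int L + 1)))" for L
      using AA_eq[OF e, of "y - int L"] by (simp add: algebra_simps)
    have "(\<Sum>L=1..M. (hh e y * qq e (y + int L) - (2 * qq e (y + int L) - 1 + (vv e (y + int (Suc L)) - vv e (y + int L)))) / (blk e y L + 4))
     \<ge> (hh e y - 2) * ln (real M) - 5 + (\<Sum>L=1..M. 1 / (blk e y L + 4))"
      using h M qq_bounds[OF e] vv_bounds[OF e] blk_bounds[OF e]
      by (intro one_sided_bound) (auto simp: blk_def blk_Suc[unfolded blk_def])
    moreover have "(\<Sum>L=1..M. (hh e y * qq e (y - int L) - (2 * qq e (y - int L) - 1 + ((1 - vv e (y - int (Suc L) + 1)) - (1 - vv e (y - int L + 1))))) / (blk e (y - int L) L + 4))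
     \<ge> (hh e y - 2) * ln (real M) - 5 + (\<Sum>L=1..M. 1 / (blk e (y - int L) L + 4))"
    proof (rule one_sided_bound)
      show "(\<Sum>j=1..L. qq e (y - int j)) - 1 \<le> blk e (y - int L) L" for L
        using blkR[of y L] qq_bounds[OF e, of y] qq_bounds[OF e, of "y - int L"] by simp
      show "blk e (y - int L) L \<le> blk e (y - int (Suc L)) (Suc L)" for L
        using blk_left[of e "y - int L" L] qq_bounds[OF e, of "y - int L"] by (simp add: algebra_simps)
    qed (use h M qq_bounds[OF e] vv_bounds[OF e] blk_bounds[OF e] in auto)
    ultimately show ?thesis unfolding X_def A1[symmetric] A2[symmetric] sum.distrib
      by (simp only: mult.assoc)
  qed
  have r0: "r > 0" using r by simp
  \<comment> \<open>The shift 4 of the denominator contributes 4/(r L)^2, at most 16/L^2 because r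
    is at least 1/2.\<close>
  have tang: "1 / (blk e x L + 4) \<ge> (2 / r) * (1 / real L) - (1 / (r\<^sup>2 * (real L)\<^sup>2)) * blk e x L - 16 * (1 / (real L)\<^sup>2)" if "L \<ge> 1" for x L
  proof -
    have "1 / (blk e x L + 4) \<ge> 2 / (r * real L) - (blk e x L + 4) / (r * real L)\<^sup>2"
      using r0 that blk_bounds[OF e, of x L] by (intro inverse_tangent) auto
    also have "2 / (r * real L) - (blk e x L + 4) / (r * real L)\<^sup>2 =
       (2 / r) * (1 / real L) - (1 / (r\<^sup>2 * (real L)\<^sup>2)) * blk e x L - 4 / r\<^sup>2 * (1 / (real L)\<^sup>2)"
      by (simp add: power_mult_distrib add_divide_distrib)
    finally have "1 / (blk e x L + 4) \<ge> (2 / r) * (1 / real L) - (1 / (r\<^sup>2 * (real L)\<^sup>2)) * blk e x L - 4 / r\<^sup>2 * (1 / (real L)\<^sup>2)" .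
    moreover have "4 / r\<^sup>2 \<le> 16"
    proof -
      have "(1/2)\<^sup>2 \<le> r\<^sup>2" using r by (intro power_mono) auto
      then show ?thesis using r0 by (simp add: divide_le_eq power2_eq_square)
    qed
    then have "4 / r\<^sup>2 * (1 / (real L)\<^sup>2) \<le> 16 * (1 / (real L)\<^sup>2)" by (intro mult_right_mono) auto
    ultimately show ?thesis by linarith
  qed
  have r2: "1 / r\<^sup>2 \<le> 4"
  proof -
    have "(1/2)\<^sup>2 \<le> r\<^sup>2" using r by (intro power_mono) auto
    then show ?thesis using r0 by (simp add: divide_le_eq power2_eq_square)
  qed
  have inv: "csum N (\<lambda>y. w y * (1 / (blk e y L + 4) + 1 / (blk e (y - int L) L + 4)))
     \<ge> (4 / r) * W * (1 / real L) - (2 / r\<^sup>2) * Q * (1 / real L) - 8 * V - 32 * W * (1 / (real L)\<^sup>2)" if L: "L \<ge> 1" for L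
  proof -
    let ?c = "1 / (r\<^sup>2 * (real L)\<^sup>2)"
    have "csum N (\<lambda>y. w y * (1 / (blk e y L + 4) + 1 / (blk e (y - int L) L + 4))) \<ge>
      csum N (\<lambda>y. w y * (2 * ((2 / r) * (1 / real L) - 16 * (1 / (real L)\<^sup>2)) - ?c * blk e y L - ?c * blk e (y - int L) L))"
    proof (intro csum_mono mult_left_mono w)
      fix y
      show "2 * ((2 / r) * (1 / real L) - 16 * (1 / (real L)\<^sup>2)) - ?c * blk e y L - ?c * blk e (y - int L) L
        \<le> 1 / (blk e y L + 4) + 1 / (blk e (y - int L) L + 4)"
        using tang[OF L, of y] tang[OF L, of "y - int L"] unfolding right_diff_distrib by linarith
    qed
    also have "csum N (\<lambda>y. w y * (2 * ((2 / r) * (1 / real L) - 16 * (1 / (real L)\<^sup>2)) - ?c * blk e y L - ?c * blk e (y - int L) L))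
      = 2 * ((2 / r) * (1 / real L) - 16 * (1 / (real L)\<^sup>2)) * W
        - ?c * (csum N (\<lambda>y. w y * blk e y L) + csum N (\<lambda>y. w y * blk e (y - int L) L))"
      unfolding W_def csum_cmult[symmetric] csum_add[symmetric] csum_diff[symmetric]
      by (rule arg_cong[where f = "csum N"]) (simp add: algebra_simps)
    moreover have "?c * (csum N (\<lambda>y. w y * blk e y L) + csum N (\<lambda>y. w y * blk e (y - int L) L))
      \<le> ?c * (2 * (real L * Q + (real L)\<^sup>2 * V))"
      using blkQ1[of L] blkQ2[OF L] by (intro mult_left_mono) auto
    moreover have "?c * (2 * (real L * Q + (real L)\<^sup>2 * V)) = (2 / r\<^sup>2) * Q * (1 / real L) + 2 * (1 / r\<^sup>2) * V"
      using L r0 by (simp add: field_simps power2_eq_square)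
    moreover have "2 * (1 / r\<^sup>2) * V \<le> 8 * V" using r2 V0 by (intro mult_right_mono) auto
    ultimately show ?thesis by (simp add: algebra_simps)
  qed
  have "gen N (Lyap N M w) e = (\<Sum>L=1..M. gen N (\<lambda>e. csum N (\<lambda>y. w y * GG (blk e y L))) e)"
    using gen_sum[of N "\<lambda>L e. csum N (\<lambda>y. w y * GG (blk e y L))" "{1..M}" e] by (simp add: Lyap_def[abs_def])
  also have "\<dots> \<ge> (\<Sum>L=1..M. csum N (\<lambda>y. w y * X y L) - 16 * W * (1 / (real L)\<^sup>2) - (lip M + real M) * V + lip M * real M * gen N (znum N) e)"
  proof (rule sum_mono)
    fix L assume "L \<in> {1..M}"
    then show "csum N (\<lambda>y. w y * X y L) - 16 * W * (1 / (real L)\<^sup>2) - (lip M + real M) * V + lip M * real M * gen N (znum N) e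
      \<le> gen N (\<lambda>e. csum N (\<lambda>y. w y * GG (blk e y L))) e"
      using scale_estimate[OF e N _ _ w, of L] by (simp add: X_def W_def V_def)
  qed
  moreover have "(\<Sum>L=1..M. csum N (\<lambda>y. w y * X y L) - 16 * W * (1 / (real L)\<^sup>2) - (lip M + real M) * V + lip M * real M * gen N (znum N) e)
     = csum N (\<lambda>y. w y * (\<Sum>L=1..M. X y L)) - 16 * W * (\<Sum>L=1..M. 1 / (real L)\<^sup>2) - real M * ((lip M + real M) * V) + real M * (lip M * real M * gen N (znum N) e)"
    by (simp add: sum.distrib sum_subtractf sum_distrib_left csum_sum)
  moreover have "csum N (\<lambda>y. w y * (\<Sum>L=1..M. X y L)) \<ge> csum N (\<lambda>y. w y * (2 * (hh e y - 2) * ln (real M) - 10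
      + (\<Sum>L=1..M. 1 / (blk e y L + 4)) + (\<Sum>L=1..M. 1 / (blk e (y - int L) L + 4))))"
    by (intro csum_mono mult_left_mono w X)
  moreover have "csum N (\<lambda>y. w y * (2 * (hh e y - 2) * ln (real M) - 10
      + (\<Sum>L=1..M. 1 / (blk e y L + 4)) + (\<Sum>L=1..M. 1 / (blk e (y - int L) L + 4))))
    = 2 * ln (real M) * csum N (\<lambda>y. w y * hh e y) - (4 * ln (real M) + 10) * W
      + (\<Sum>L=1..M. csum N (\<lambda>y. w y * (1 / (blk e y L + 4) + 1 / (blk e (y - int L) L + 4))))"
    unfolding csum_sum[symmetric] W_def csum_cmult[symmetric] csum_add[symmetric] csum_diff[symmetric]
    by (rule arg_cong[where f = "csum N"]) (simp add: sum.distrib sum_distrib_left algebra_simps)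
  moreover have "(\<Sum>L=1..M. csum N (\<lambda>y. w y * (1 / (blk e y L + 4) + 1 / (blk e (y - int L) L + 4))))
     \<ge> (\<Sum>L=1..M. (4 / r) * W * (1 / real L) - (2 / r\<^sup>2) * Q * (1 / real L) - 8 * V - 32 * W * (1 / (real L)\<^sup>2))"
    by (intro sum_mono inv) auto
  moreover have "(\<Sum>L=1..M. (4 / r) * W * (1 / real L) - (2 / r\<^sup>2) * Q * (1 / real L) - 8 * V - 32 * W * (1 / (real L)\<^sup>2))
     = (4 / r) * W * (\<Sum>L=1..M. 1 / real L) - (2 / r\<^sup>2) * Q * (\<Sum>L=1..M. 1 / real L) - real M * (8 * V) - 32 * W * (\<Sum>L=1..M. 1 / (real L)\<^sup>2)"
    by (simp only: sum_subtractf sum_distrib_left[symmetric] sum_constant card_atLeastAtMost) simp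
  moreover have "(4 / r) * W * (\<Sum>L=1..M. 1 / real L) \<ge> (4 / r) * W * ln (real M)"
    using sum_inverse_lower[OF M] r0 W0 by (intro mult_left_mono) auto
  moreover have "(2 / r\<^sup>2) * Q * (\<Sum>L=1..M. 1 / real L) \<le> (2 / r\<^sup>2) * Q * (ln (real M) + 1)"
    using sum_inverse_upper[OF M] r0 Q0 by (intro mult_left_mono) auto
  moreover have "(2 / r\<^sup>2) * Q \<le> 8 * W"
  proof -
    have "(2 * (1 / r\<^sup>2)) * Q \<le> 8 * W" using r2 QW Q0 by (intro mult_mono) auto
    then show ?thesis by simp
  qed
  \<comment> \<open>Here 48 = 16 + 32, from the discretisation and from the two tangents. The
    constant 114 is 10 of the two one-sided bounds, these 96, and 8 from the extra 1 in
    \<open>sum_inverse_upper\<close>.\<close>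
  moreover have "48 * W * (\<Sum>L=1..M. 1 / (real L)\<^sup>2) \<le> 48 * W * 2"
  proof (rule mult_left_mono)
    show "(\<Sum>L=1..M. 1 / (real L)\<^sup>2) \<le> 2" using sum_inverse_squares[OF M]
      by (rule order_trans) simp
  qed (use W0 in auto)
  moreover have "csum N (\<lambda>y. w y * (2 - 2 / r + qq e y / r\<^sup>2)) = (2 - 2 / r) * W + Q / r\<^sup>2"
  proof -
    have "csum N (\<lambda>y. w y * (2 - 2 / r + qq e y / r\<^sup>2)) = csum N (\<lambda>y. (2 - 2 / r) * w y + (1 / r\<^sup>2) * (w y * qq e y))"
      by (rule arg_cong[where f = "csum N"]) (simp add: algebra_simps)
    then show ?thesis unfolding W_def Q_def csum_add csum_cmult by simp
  qed
  moreover have "2 * ln (real M) * ((2 - 2 / r) * W + Q / r\<^sup>2) = 4 * ln (real M) * W - (4 / r) * W * ln (real M) + (2 / r\<^sup>2) * Q * ln (real M)"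
    by (simp add: algebra_simps)
  moreover have "(2 / r\<^sup>2) * Q * (ln (real M) + 1) = (2 / r\<^sup>2) * Q * ln (real M) + (2 / r\<^sup>2) * Q"
    by (simp only: distrib_left mult_1_right)
  ultimately show ?thesis unfolding W_def[symmetric] V_def[symmetric]
    by (simp only: power2_eq_square distrib_left distrib_right left_diff_distrib mult.assoc mult.commute mult.left_commute)
qed

section \<open>One-time marginals of the process\<close>

definition marg :: "(real \<Rightarrow> nat \<Rightarrow> nat) measure \<Rightarrow> real \<Rightarrow> (nat \<Rightarrow> nat) \<Rightarrow> real" where
  "marg P s \<eta> = measure P {\<omega> \<in> space P. \<omega> s = \<eta>}"

definition expect :: "nat \<Rightarrow> (real \<Rightarrow> nat \<Rightarrow> nat) measure \<Rightarrow> real \<Rightarrow> ((nat \<Rightarrow> nat) \<Rightarrow> real) \<Rightarrow> real" where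
  "expect N P s f = (\<Sum>\<eta>\<in>configs N. marg P s \<eta> * f \<eta>)"

lemma finite_configs [simp]: "finite (configs N)"
  unfolding configs_def by (intro finite_PiE) auto

lemma rate_abs_le:
  assumes "a = 0 \<or> a = 1" "b = 0 \<or> b = 1" "c = 0 \<or> c = 1" "d = 0 \<or> d = 1"
  shows "\<bar>real a * real b * (1 - real c) + (1 - real b) * real c * real d\<bar> \<le> 2"
  using assms by (elim disjE) simp_all

context
  fixes T :: real and N :: nat and \<rho>ini :: "real \<Rightarrow> real" and P :: "(real \<Rightarrow> nat \<Rightarrow> nat) measure"
  assumes T: "T > 0" and N: "N \<ge> 1" and law: "FEP_law T N \<rho>ini P"
begin

interpretation prob_space P using law by (simp add: FEP_law_def)

lemma law_space: "space P = cadlag_paths T N"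
proof -
  have "space P = space (path_space T N)" using law by (intro sets_eq_imp_space_eq) (simp add: FEP_law_def)
  also have "\<dots> = cadlag_paths T N" by (auto simp: path_space_def space_restrict_space space_PiM cadlag_paths_def)
  finally show ?thesis .
qed

lemma law_configs: "\<omega> \<in> space P \<Longrightarrow> s \<in> {0..T} \<Longrightarrow> \<omega> s \<in> configs N"
  unfolding law_space cadlag_paths_def by (auto simp: PiE_iff)

lemma eval_measurable:
  assumes "s \<in> {0..T}" shows "(\<lambda>\<omega>. \<omega> s) \<in> P \<rightarrow>\<^sub>M count_space (configs N)"
proof -
  have "(\<lambda>\<omega>. \<omega> s) \<in> (\<Pi>\<^sub>M t\<in>{0..T}. count_space (configs N)) \<rightarrow>\<^sub>M count_space (configs N)"
    using assms by (rule measurable_component_singleton)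
  then have "(\<lambda>\<omega>. \<omega> s) \<in> path_space T N \<rightarrow>\<^sub>M count_space (configs N)"
    unfolding path_space_def by (rule measurable_restrict_space1)
  moreover have "sets P = sets (path_space T N)" using law by (simp add: FEP_law_def)
  ultimately show ?thesis by (subst measurable_cong_sets) auto
qed

lemma eval_event:
  assumes "s \<in> {0..T}" shows "{\<omega> \<in> space P. Q (\<omega> s)} \<in> sets P"
proof -
  have "{\<omega> \<in> space P. Q (\<omega> s)} = (\<lambda>\<omega>. \<omega> s) -` {\<eta> \<in> configs N. Q \<eta>} \<inter> space P"
    using law_configs assms by auto
  then show ?thesis using measurable_sets[OF eval_measurable[OF assms], of "{\<eta> \<in> configs N. Q \<eta>}"] by auto
qed

lemma integral_eval:
  assumes "s \<in> {0..T}"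
  shows "integrable P (\<lambda>\<omega>. f (\<omega> s))" "integral\<^sup>L P (\<lambda>\<omega>. f (\<omega> s)) = expect N P s f"
proof -
  have eq: "f (\<omega> s) = (\<Sum>\<eta>\<in>configs N. f \<eta> * indicator {\<omega> \<in> space P. \<omega> s = \<eta>} \<omega>)" if "\<omega> \<in> space P" for \<omega>
  proof -
    have "(\<Sum>\<eta>\<in>configs N. f \<eta> * indicator {\<omega> \<in> space P. \<omega> s = \<eta>} \<omega>) =
      (\<Sum>\<eta>\<in>configs N. if \<eta> = \<omega> s then f \<eta> else 0)"
      using that by (intro sum.cong) (auto simp: indicator_def)
    then show ?thesis using law_configs[OF that assms] by simp
  qed
  have i: "integrable P (\<lambda>\<omega>. \<Sum>\<eta>\<in>configs N. f \<eta> * indicator {\<omega> \<in> space P. \<omega> s = \<eta>} \<omega>)"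
    using eval_event[OF assms] by (intro Bochner_Integration.integrable_sum integrable_mult_right integrable_real_indicator)
      (auto simp: emeasure_eq_measure)
  then show "integrable P (\<lambda>\<omega>. f (\<omega> s))" by (subst Bochner_Integration.integrable_cong[OF refl eq]) auto
  have "integral\<^sup>L P (\<lambda>\<omega>. f (\<omega> s)) = integral\<^sup>L P (\<lambda>\<omega>. \<Sum>\<eta>\<in>configs N. f \<eta> * indicator {\<omega> \<in> space P. \<omega> s = \<eta>} \<omega>)"
    by (intro Bochner_Integration.integral_cong eq) auto
  also have "\<dots> = (\<Sum>\<eta>\<in>configs N. f \<eta> * measure P {\<omega> \<in> space P. \<omega> s = \<eta>})"
    using eval_event[OF assms] by (subst Bochner_Integration.integral_sum)
      (auto intro!: integrable_mult_right integrable_real_indicator simp: emeasure_eq_measure Int_absorb1)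
  finally show "integral\<^sup>L P (\<lambda>\<omega>. f (\<omega> s)) = expect N P s f" by (simp add: expect_def marg_def mult.commute)
qed

lemma marg_sum: "s \<in> {0..T} \<Longrightarrow> (\<Sum>\<eta>\<in>configs N. marg P s \<eta>) = 1"
  using integral_eval(2)[of s "\<lambda>_. 1"] by (simp add: expect_def prob_space)

lemma past_subalgebra: "subalgebra P (past T N 0)"
proof -
  have sub: "{{\<omega> \<in> cadlag_paths T N. \<omega> r = \<eta>} | r \<eta>. r \<in> {0..0} \<and> \<eta> \<in> configs N} \<subseteq> Pow (cadlag_paths T N)"
    by auto
  have "sets (past T N 0) \<subseteq> sets P"
    unfolding past_def sets_measure_of[OF sub]
  proof (rule sets.sigma_sets_subset')
    show "{{\<omega> \<in> cadlag_paths T N. \<omega> r = \<eta>} | r \<eta>. r \<in> {0..0} \<and> \<eta> \<in> configs N} \<subseteq> sets P"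
      using eval_event T by (auto simp: law_space[symmetric])
    show "cadlag_paths T N \<in> sets P" using sets.top[of P] by (simp add: law_space)
  qed
  moreover have "space (past T N 0) = space P"
    unfolding past_def space_measure_of[OF sub] by (simp add: law_space)
  ultimately show ?thesis by (simp add: subalgebra_def)
qed

text \<open>Integrating the Markov property from time 0 removes the conditioning, so each one-time
  marginal is the initial law acted on by the semigroup.\<close>

lemma expect_semigroup:
  assumes t: "t \<in> {0..T}"
  shows "expect N P t f = expect N P 0 (semigroup_of (accelerated_generator N) t f)"
proof -
  have "finite_measure_subalgebra P (past T N 0)"
    by (intro finite_measure_subalgebra.intro finite_measure_subalgebra_axioms.intro past_subalgebra) unfold_locales
  then interpret sigma_finite_subalgebra P "past T N 0" by (rule finite_measure_subalgebra_is_sigma_finite)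
  have 0: "0 \<in> {0..T}" using T by simp
  let ?S = "semigroup_of (accelerated_generator N) t f"
  have ae: "AE \<omega> in P. real_cond_exp P (past T N 0) (\<lambda>\<omega>. f (\<omega> t)) \<omega> = ?S (\<omega> 0)"
  proof -
    have "\<forall>s t. 0 \<le> s \<and> s \<le> t \<and> t \<le> T \<longrightarrow>
        (\<forall>f. AE \<omega> in P. real_cond_exp P (past T N s) (\<lambda>\<omega>. f (\<omega> t)) \<omega>
                 = semigroup_of (accelerated_generator N) (t - s) f (\<omega> s))"
      using law unfolding FEP_law_def by (elim conjE) assumption
    from this[rule_format, of 0 t f] t show ?thesis by simp
  qed
  have "expect N P t f = integral\<^sup>L P (\<lambda>\<omega>. f (\<omega> t))" using integral_eval[OF t] by simp
  also have "\<dots> = integral\<^sup>L P (real_cond_exp P (past T N 0) (\<lambda>\<omega>. f (\<omega> t)))"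
    using real_cond_exp_int(2)[OF integral_eval(1)[OF t]] by simp
  also have "\<dots> = integral\<^sup>L P (\<lambda>\<omega>. ?S (\<omega> 0))"
    using ae integral_eval(1)[OF 0, of ?S] by (intro integral_cong_AE) auto
  finally show ?thesis using integral_eval(2)[OF 0] by simp
qed

text \<open>The factor N^2, the N bonds, the rate bound 2 and the difference bound 2B multiply to
  the constant.\<close>

lemma accelerated_bound:
  assumes "\<And>\<eta>. \<eta> \<in> configs N \<Longrightarrow> \<bar>f \<eta>\<bar> \<le> B" "\<eta> \<in> configs N"
  shows "\<bar>accelerated_generator N f \<eta>\<bar> \<le> (4 * (real N)^3) * B"
proof -
  have s: "shift N x k < N" for x k using N by (simp add: shift_def nat_less_iff)
  have v: "\<eta> x = 0 \<or> \<eta> x = 1" if "x < N" for x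
    using assms(2) that by (auto simp: configs_def)
  have r: "\<bar>rate N x \<eta>\<bar> \<le> 2" if "x < N" for x
    unfolding rate_def by (rule rate_abs_le) (use v[OF that] v[OF s] in \<open>blast+\<close>)
  have "\<bar>generator N f \<eta>\<bar> \<le> (\<Sum>x<N. \<bar>rate N x \<eta> * (f (swap_sites x (shift N x 1) \<eta>) - f \<eta>)\<bar>)"
    unfolding generator_def by (rule sum_abs)
  also have "\<dots> \<le> (\<Sum>x<N. 2 * (2 * B))"
  proof (intro sum_mono)
    fix x assume x: "x \<in> {..<N}"
    have "\<bar>f (swap_sites x (shift N x 1) \<eta>) - f \<eta>\<bar> \<le> 2 * B"
      using assms(1)[OF assms(2)] assms(1)[OF swap_configs[OF _ s assms(2)], of x x 1] x by (auto simp: abs_le_iff)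
    then show "\<bar>rate N x \<eta> * (f (swap_sites x (shift N x 1) \<eta>) - f \<eta>)\<bar> \<le> 2 * (2 * B)"
      unfolding abs_mult using r[of x] x by (intro mult_mono) auto
  qed
  finally have "\<bar>generator N f \<eta>\<bar> \<le> 4 * real N * B" by simp
  then have "(real N)\<^sup>2 * \<bar>generator N f \<eta>\<bar> \<le> (real N)\<^sup>2 * (4 * real N * B)" by (intro mult_left_mono) auto
  then show ?thesis by (simp add: accelerated_generator_def abs_mult power2_eq_square power3_eq_cube algebra_simps)
qed

lemma iterate_bound:
  assumes "\<And>\<eta>. \<eta> \<in> configs N \<Longrightarrow> \<bar>f \<eta>\<bar> \<le> B" "\<eta> \<in> configs N"
  shows "\<bar>(accelerated_generator N ^^ n) f \<eta>\<bar> \<le> (4 * (real N)^3)^n * B"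
  using assms(2)
proof (induction n arbitrary: \<eta>)
  case 0 then show ?case using assms(1) by simp
next
  case (Suc n)
  then show ?case using accelerated_bound[OF Suc.IH Suc.prems] by (simp add: mult.assoc)
qed

text \<open>The iterates of the generator grow at most geometrically, so the expectation is an
  everywhere convergent power series in time, with coefficients computed from the initial
  law.\<close>

lemma expect_series:
  assumes t: "t \<in> {0..T}"
  shows "expect N P t f = (\<Sum>n. (expect N P 0 ((accelerated_generator N ^^ n) f) / fact n) * t ^ n)"
    and "summable (\<lambda>n. (expect N P 0 ((accelerated_generator N ^^ n) f) / fact n) * y ^ n)"
proof -
  let ?G = "accelerated_generator N"
  define B where "B = (\<Sum>\<eta>\<in>configs N. \<bar>f \<eta>\<bar>)"
  define C where "C = 4 * (real N)^3"
  have B: "\<bar>f \<eta>\<bar> \<le> B" if "\<eta> \<in> configs N" for \<eta>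
    unfolding B_def using that by (intro member_le_sum) auto
  have s: "summable (\<lambda>n. y ^ n / fact n * (?G ^^ n) f \<eta>)" if "\<eta> \<in> configs N" for \<eta> y
  proof (rule summable_comparison_test'[where N = 0])
    show "summable (\<lambda>n. B * ((C * \<bar>y\<bar>) ^ n / fact n))"
      using summable_exp[of "C * \<bar>y\<bar>"] by (intro summable_mult) (simp add: field_simps inverse_eq_divide)
    fix n
    have "\<bar>(?G ^^ n) f \<eta>\<bar> \<le> C ^ n * B" unfolding C_def by (rule iterate_bound[OF B that])
    then have "\<bar>y\<bar> ^ n / fact n * \<bar>(?G ^^ n) f \<eta>\<bar> \<le> \<bar>y\<bar> ^ n / fact n * (C ^ n * B)"
      by (intro mult_left_mono) auto
    then show "norm (y ^ n / fact n * (?G ^^ n) f \<eta>) \<le> B * ((C * \<bar>y\<bar>) ^ n / fact n)"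
      by (simp add: abs_mult power_abs power_mult_distrib mult_ac)
  qed
  have e: "(expect N P 0 ((?G ^^ n) f) / fact n) * y ^ n = (\<Sum>\<eta>\<in>configs N. marg P 0 \<eta> * (y ^ n / fact n * (?G ^^ n) f \<eta>))" for n y
    by (simp add: expect_def sum_divide_distrib sum_distrib_right) (simp add: mult_ac)
  show "summable (\<lambda>n. (expect N P 0 ((?G ^^ n) f) / fact n) * y ^ n)"
    unfolding e by (intro summable_sum summable_mult s)
  have "expect N P t f = (\<Sum>\<eta>\<in>configs N. \<Sum>n. marg P 0 \<eta> * (t ^ n / fact n * (?G ^^ n) f \<eta>))"
    unfolding expect_semigroup[OF t] unfolding expect_def semigroup_of_def using s
    by (intro sum.cong refl suminf_mult[symmetric]) auto
  also have "\<dots> = (\<Sum>n. (expect N P 0 ((?G ^^ n) f) / fact n) * t ^ n)"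
    unfolding e by (intro suminf_sum[symmetric] summable_mult s)
  finally show "expect N P t f = (\<Sum>n. (expect N P 0 ((?G ^^ n) f) / fact n) * t ^ n)" .
qed

text \<open>Termwise differentiation shifts the coefficients by one application of the generator.
  The series represents the expectation on [0, T], so the derivative is taken within this
  interval.\<close>

lemma expect_deriv:
  assumes t: "t \<in> {0..T}"
  shows "((\<lambda>t. expect N P t f) has_real_derivative expect N P t (accelerated_generator N f)) (at t within {0..T})"
proof -
  let ?G = "accelerated_generator N"
  let ?c = "\<lambda>n. expect N P 0 ((?G ^^ n) f) / fact n"
  have "((\<lambda>x. \<Sum>n. ?c n * x^n) has_field_derivative (\<Sum>n. diffs ?c n * t^n)) (at t)"
    by (rule termdiffs_strong_converges_everywhere) (rule expect_series(2)[OF t])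
  moreover have "diffs ?c n = expect N P 0 ((?G ^^ n) (?G f)) / fact n" for n
    by (simp add: diffs_def funpow_swap1 field_simps del: of_nat_Suc)
  then have "(\<Sum>n. diffs ?c n * t^n) = expect N P t (?G f)"
    using expect_series(1)[OF t, of "?G f"] by simp
  ultimately have "((\<lambda>x. \<Sum>n. ?c n * x^n) has_field_derivative expect N P t (?G f)) (at t)"
    by (simp only:)
  then have "((\<lambda>x. \<Sum>n. ?c n * x^n) has_field_derivative expect N P t (?G f)) (at t within {0..T})"
    by (rule has_field_derivative_at_within)
  then show ?thesis
    by (rule has_field_derivative_transform_within[OF _ zero_less_one t]) (rule expect_series(1)[symmetric])
qed

lemma expect_initial: "expect N P 0 f = (\<Sum>\<eta>\<in>configs N. init_weight \<rho>ini N \<eta> * f \<eta>)"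
  using law unfolding expect_def marg_def FEP_law_def by simp

lemma markov:
  assumes t: "t \<in> {0..T}" and d: "\<delta> > 0"
  shows "measure P {\<omega> \<in> space P. \<bar>f (\<omega> t)\<bar> > \<delta>} \<le> expect N P t (\<lambda>\<eta>. (f \<eta>)\<^sup>2) / \<delta>\<^sup>2"
proof -
  have "measure P {\<omega> \<in> space P. \<bar>f (\<omega> t)\<bar> > \<delta>} \<le> measure P {\<omega> \<in> space P. (f (\<omega> t))\<^sup>2 \<ge> \<delta>\<^sup>2}"
    using eval_event[OF t] d by (intro finite_measure_mono) (auto intro: power2_mono_abs simp: abs_le_square_iff[symmetric])
  also have "\<dots> \<le> integral\<^sup>L P (\<lambda>\<omega>. (f (\<omega> t))\<^sup>2) / \<delta>\<^sup>2"
    using integral_eval(1)[OF t, of "\<lambda>\<eta>. (f \<eta>)\<^sup>2"] d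
    by (intro integral_Markov_inequality_measure[where A = "{}"]) auto
  also have "\<dots> = expect N P t (\<lambda>\<eta>. (f \<eta>)\<^sup>2) / \<delta>\<^sup>2" using integral_eval(2)[OF t, of "\<lambda>\<eta>. (f \<eta>)\<^sup>2"] by simp
  finally show ?thesis .
qed

end

section \<open>Primitives of bounded functions\<close>

text \<open>f is Lipschitz with bounded measurable density f'. The weak equation gives the lattice
  averages of the solution only in this integrated form, so energy identities cannot rely on
  pointwise derivatives. The indicator is present because f' carries information only on
  [0, t].\<close>

definition prim :: "real \<Rightarrow> (real \<Rightarrow> real) \<Rightarrow> (real \<Rightarrow> real) \<Rightarrow> bool" where
  "prim t f f' \<longleftrightarrow> (\<lambda>s. indicator {0..t} s * f' s) \<in> borel_measurable lborel \<and>
     (\<exists>B. \<forall>s\<in>{0..t}. \<bar>f' s\<bar> \<le> B) \<and>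
     (\<forall>s\<in>{0..t}. f s = f 0 + (LINT r:{0..s}|lborel. f' r))"

lemma primI:
  assumes "(\<lambda>s. indicator {0..t} s * f' s) \<in> borel_measurable lborel" "\<And>s. s \<in> {0..t} \<Longrightarrow> \<bar>f' s\<bar> \<le> B"
    "\<And>s. s \<in> {0..t} \<Longrightarrow> f s = f 0 + (LINT r:{0..s}|lborel. f' r)"
  shows "prim t f f'"
  unfolding prim_def using assms by blast

lemma primD:
  assumes "prim t f f'"
  shows "(\<lambda>s. indicator {0..t} s * f' s) \<in> borel_measurable lborel" "\<exists>B. \<forall>s\<in>{0..t}. \<bar>f' s\<bar> \<le> B"
    "s \<in> {0..t} \<Longrightarrow> f s = f 0 + (LINT r:{0..s}|lborel. f' r)"
  using assms unfolding prim_def by blast+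

lemma bounded_set_integrable:
  fixes g :: "real \<Rightarrow> real"
  assumes m: "(\<lambda>s. indicator {0..t} s * g s) \<in> borel_measurable lborel" and b: "\<And>s. s \<in> {0..t} \<Longrightarrow> \<bar>g s\<bar> \<le> B"
    and A: "A \<in> sets borel" "A \<subseteq> {0..t}"
  shows "set_integrable lborel A g"
proof -
  have "set_integrable lborel {0..t} (\<lambda>_. B)"
    unfolding set_integrable_def by (intro integrable_scaleR_left) (simp add: integrable_indicator_iff emeasure_lborel_Icc_eq)
  moreover have "set_borel_measurable lborel {0..t} g" using m by (simp add: set_borel_measurable_def)
  moreover have "AE x in lborel. x \<in> {0..t} \<longrightarrow> norm (g x) \<le> norm B"
    by (intro AE_I2 impI) (use b in \<open>auto intro: order_trans[OF b abs_ge_self]\<close>)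
  ultimately have "set_integrable lborel {0..t} g" by (rule set_integrable_bound)
  then show ?thesis by (rule set_integrable_subset) (use A in auto)
qed

lemma prim_integrable:
  assumes "prim t f f'" "0 \<le> a" "b \<le> t"
  shows "set_integrable lborel {a..b} f'"
proof -
  obtain B where "\<forall>s\<in>{0..t}. \<bar>f' s\<bar> \<le> B" using primD(2)[OF assms(1)] by blast
  then show ?thesis using assms(2,3) by (intro bounded_set_integrable[of t f' B] primD(1)[OF assms(1)]) auto
qed

lemma set_integral_split:
  fixes g :: "real \<Rightarrow> real"
  assumes "set_integrable lborel {a..c} g" "a \<le> b" "b \<le> c"
  shows "(LINT r:{a..c}|lborel. g r) = (LINT r:{a..b}|lborel. g r) + (LINT r:{b..c}|lborel. g r)"
proof -
  have i: "set_integrable lborel {a..b} g" "set_integrable lborel {b<..c} g"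
    using assms by (auto intro: set_integrable_subset)
  have "(LINT r:{a..c}|lborel. g r) = (LINT r:{a..b} \<union> {b<..c}|lborel. g r)"
    using assms by (simp add: ivl_disj_un)
  also have "\<dots> = (LINT r:{a..b}|lborel. g r) + (LINT r:{b<..c}|lborel. g r)"
    by (rule set_integral_Un) (use i in auto)
  also have "(LINT r:{b<..c}|lborel. g r) = (LINT r:{b..c}|lborel. g r)"
  proof -
    have m: "set_borel_measurable lborel {b<..c} g" "set_borel_measurable lborel {b..c} g"
      using i(2) set_integrable_subset[OF assms(1), of "{b..c}"] assms(2)
      by (auto simp: set_borel_measurable_def set_integrable_def)
    have "AE x in lborel. (x \<in> {b<..c}) = (x \<in> {b..c})"
      using AE_lborel_singleton[of b] by eventually_elim auto
    with m have "(LINT r:{b..c}|lborel. g r) = (LINT r:{b<..c}|lborel. g r)" by (rule set_integral_cong_set)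
    then show ?thesis by simp
  qed
  finally show ?thesis .
qed

lemma prim_increment:
  assumes "prim t f f'" "0 \<le> a" "a \<le> b" "b \<le> t"
  shows "f b - f a = (LINT r:{a..b}|lborel. f' r)"
proof -
  have ab: "a \<in> {0..t}" "b \<in> {0..t}" using assms by auto
  show ?thesis
    using set_integral_split[OF prim_integrable[OF assms(1), of 0 b], of a] assms(2-4)
      primD(3)[OF assms(1) ab(1)] primD(3)[OF assms(1) ab(2)] by linarith
qed

lemma set_integral_abs_bound:
  fixes g :: "real \<Rightarrow> real"
  assumes "set_integrable lborel {a..b} g" "\<And>r. r \<in> {a..b} \<Longrightarrow> \<bar>g r\<bar> \<le> B" "a \<le> b"
  shows "\<bar>LINT r:{a..b}|lborel. g r\<bar> \<le> B * (b - a)"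
proof -
  have "\<bar>LINT r:{a..b}|lborel. g r\<bar> \<le> (LINT r:{a..b}|lborel. \<bar>g r\<bar>)"
    using set_integral_norm_bound[OF assms(1)] by simp
  also have "\<dots> \<le> (LINT r:{a..b}|lborel. B)"
    using assms by (intro set_integral_mono set_integrable_abs) (auto simp: set_integrable_def)
  also have "\<dots> = B * (b - a)" using assms(3) by (simp add: set_lebesgue_integral_def)
  finally show ?thesis .
qed

text \<open>Increments of second order force derivative zero. This yields the product rule for
  primitives without differentiation almost everywhere.\<close>

lemma quadratic_increment_const:
  fixes h :: "real \<Rightarrow> real"
  assumes "\<And>a b. 0 \<le> a \<Longrightarrow> a \<le> b \<Longrightarrow> b \<le> t \<Longrightarrow> \<bar>h b - h a\<bar> \<le> C * (b - a)\<^sup>2" "s \<in> {0..t}"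
  shows "h s = h 0"
proof -
  have d: "(h has_derivative (\<lambda>_. 0)) (at x within {0..t})" if x: "x \<in> {0..t}" for x
  proof -
    have "(h has_field_derivative 0) (at x within {0..t})"
      unfolding has_field_derivative_iff
    proof (rule Lim_null_comparison)
      have "\<bar>(h y - h x) / (y - x)\<bar> \<le> \<bar>C\<bar> * \<bar>y - x\<bar>" if "y \<in> {0..t}" "y \<noteq> x" for y
      proof -
        have "\<bar>h y - h x\<bar> \<le> C * (y - x)\<^sup>2"
          using assms(1)[of x y] assms(1)[of y x] x that by (cases "x \<le> y") (auto simp: abs_minus_commute power2_commute)
        also have "\<dots> \<le> \<bar>C\<bar> * (y - x)\<^sup>2" by (intro mult_right_mono) auto
        also have "\<dots> = (\<bar>C\<bar> * \<bar>y - x\<bar>) * \<bar>y - x\<bar>"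
          using power2_abs[of "y - x"] by (simp only: power2_eq_square mult.assoc)
        finally have "\<bar>h y - h x\<bar> / \<bar>y - x\<bar> \<le> \<bar>C\<bar> * \<bar>y - x\<bar>"
          using that(2) by (subst pos_divide_le_eq) auto
        then show ?thesis by (simp only: abs_divide)
      qed
      then show "\<forall>\<^sub>F y in at x within {0..t}. norm ((h y - h x) / (y - x)) \<le> \<bar>C\<bar> * \<bar>y - x\<bar>"
        by (auto simp: eventually_at intro!: exI[of _ 1])
      show "((\<lambda>y. \<bar>C\<bar> * \<bar>y - x\<bar>) \<longlongrightarrow> 0) (at x within {0..t})"
        by (auto intro!: tendsto_eq_intros)
    qed
    then show ?thesis by (simp add: has_field_derivative_def lambda_zero)
  qed
  have "0 \<in> {0..t}" using assms(2) by simp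
  moreover obtain c where "\<forall>x\<in>{0..t}. h x = c"
    using has_derivative_zero_constant[OF _ d] by (auto simp: convex_real_interval)
  ultimately show ?thesis using assms(2) by simp
qed

lemma prim_bound: "prim t f f' \<Longrightarrow> \<exists>B\<ge>0. (\<forall>s\<in>{0..t}. \<bar>f s\<bar> \<le> B) \<and> (\<forall>s\<in>{0..t}. \<bar>f' s\<bar> \<le> B)"
proof -
  assume p: "prim t f f'"
  then obtain B where B: "\<forall>s\<in>{0..t}. \<bar>f' s\<bar> \<le> B" using primD(2) by blast
  have "\<bar>f s\<bar> \<le> \<bar>f 0\<bar> + \<bar>B\<bar> * t" if s: "s \<in> {0..t}" for s
  proof -
    have "f s = f 0 + (LINT r:{0..s}|lborel. f' r)" by (rule primD(3)[OF p s])
    moreover have "\<bar>LINT r:{0..s}|lborel. f' r\<bar> \<le> \<bar>B\<bar> * (s - 0)"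
      using s B prim_integrable[OF p, of 0 s] by (intro set_integral_abs_bound) (auto intro: order_trans[OF _ abs_ge_self])
    moreover have "\<bar>B\<bar> * s \<le> \<bar>B\<bar> * t" using s by (intro mult_left_mono) auto
    ultimately show ?thesis unfolding diff_zero by linarith
  qed
  then have "\<bar>f s\<bar> \<le> max \<bar>B\<bar> (\<bar>f 0\<bar> + \<bar>B\<bar> * t)" "\<bar>f' s\<bar> \<le> max \<bar>B\<bar> (\<bar>f 0\<bar> + \<bar>B\<bar> * t)" if "s \<in> {0..t}" for s
    using B that by (auto simp: le_max_iff_disj intro: order_trans[OF _ abs_ge_self])
  then show ?thesis by (intro exI[of _ "max \<bar>B\<bar> (\<bar>f 0\<bar> + \<bar>B\<bar> * t)"]) (auto simp: le_max_iff_disj)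
qed

lemma prim_lipschitz:
  assumes p: "prim t f f'" and B: "\<And>s. s \<in> {0..t} \<Longrightarrow> \<bar>f' s\<bar> \<le> B" and "0 \<le> a" "a \<le> b" "b \<le> t"
  shows "\<bar>f b - f a\<bar> \<le> B * (b - a)"
  unfolding prim_increment[OF p assms(3-5)]
  using prim_integrable[OF p] assms by (intro set_integral_abs_bound) auto

lemma prim_continuous:
  assumes p: "prim t f f'" shows "continuous_on {0..t} f"
proof -
  obtain B where B: "B \<ge> 0" "\<forall>s\<in>{0..t}. \<bar>f' s\<bar> \<le> B" using prim_bound[OF p] by blast
  have "dist (f x) (f y) \<le> B * dist x y" if "x \<in> {0..t}" "y \<in> {0..t}" for x y
    using prim_lipschitz[OF p, of B x y] prim_lipschitz[OF p, of B y x] B that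
    by (cases "x \<le> y") (auto simp: dist_real_def abs_minus_commute)
  then have "B-lipschitz_on {0..t} f" using B by (intro lipschitz_onI) auto
  then show ?thesis by (rule lipschitz_on_continuous_on)
qed

lemma prim_measurable: "prim t f f' \<Longrightarrow> (\<lambda>s. indicator {0..t} s * f s) \<in> borel_measurable lborel"
  using borel_measurable_continuous_on_indicator[OF _ prim_continuous, of "t" f f'] by simp

text \<open>The difference h between the product and the candidate primitive has increments of order
  (b - a)^2, since both factors are Lipschitz; hence h is constant.\<close>

lemma prim_mult:
  assumes f: "prim t f f'" and g: "prim t g g'"
  shows "prim t (\<lambda>s. f s * g s) (\<lambda>s. f' s * g s + f s * g' s)"
proof -
  obtain B1 where B1: "B1 \<ge> 0" "\<forall>s\<in>{0..t}. \<bar>f s\<bar> \<le> B1" "\<forall>s\<in>{0..t}. \<bar>f' s\<bar> \<le> B1" using prim_bound[OF f] by blast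
  obtain B2 where B2: "B2 \<ge> 0" "\<forall>s\<in>{0..t}. \<bar>g s\<bar> \<le> B2" "\<forall>s\<in>{0..t}. \<bar>g' s\<bar> \<le> B2" using prim_bound[OF g] by blast
  let ?d = "\<lambda>s. f' s * g s + f s * g' s"
  have m1: "(\<lambda>s. indicator {0..t} s * f' s) \<in> borel_measurable lborel" "(\<lambda>s. indicator {0..t} s * g' s) \<in> borel_measurable lborel"
    by (rule primD(1)[OF f], rule primD(1)[OF g])
  note m2 = prim_measurable[OF f] prim_measurable[OF g]
  have "(\<lambda>s. (indicator {0..t} s * f' s) * (indicator {0..t} s * g s) + (indicator {0..t} s * f s) * (indicator {0..t} s * g' s)) \<in> borel_measurable lborel"
    by (rule borel_measurable_add[OF borel_measurable_times[OF m1(1) m2(2)] borel_measurable_times[OF m2(1) m1(2)]])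
  also have "(\<lambda>s. (indicator {0..t} s * f' s) * (indicator {0..t} s * g s) + (indicator {0..t} s * f s) * (indicator {0..t} s * g' s))
     = (\<lambda>s. indicator {0..t} s * ?d s)" by (auto simp: indicator_def fun_eq_iff)
  finally have m: "(\<lambda>s. indicator {0..t} s * ?d s) \<in> borel_measurable lborel" .
  have b: "\<bar>?d s\<bar> \<le> 2 * (B1 * B2)" if "s \<in> {0..t}" for s
  proof -
    have "\<bar>f' s * g s\<bar> \<le> B1 * B2" "\<bar>f s * g' s\<bar> \<le> B1 * B2"
      unfolding abs_mult using B1 B2 that by (auto intro!: mult_mono)
    then show ?thesis by linarith
  qed
  have di: "set_integrable lborel {a..b} ?d" if "0 \<le> a" "b \<le> t" for a b
    by (rule bounded_set_integrable[OF m b]) (use that in auto)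
  define h where "h s = f s * g s - (LINT r:{0..s}|lborel. ?d r)" for s
  have hc: "h s = h 0" if "s \<in> {0..t}" for s
  proof (rule quadratic_increment_const[OF _ that])
    fix a b :: real assume ab: "0 \<le> a" "a \<le> b" "b \<le> t"
    have i: "set_integrable lborel {a..b} f'" "set_integrable lborel {a..b} g'"
      using prim_integrable[OF f] prim_integrable[OF g] ab by auto
    have "h b - h a = (f b - f a) * g b + f a * (g b - g a) - (LINT r:{a..b}|lborel. ?d r)"
      using set_integral_split[OF di[of 0 b], of a] ab by (simp add: h_def algebra_simps)
    also have "\<dots> = (LINT r:{a..b}|lborel. f' r * g b + f a * g' r) - (LINT r:{a..b}|lborel. ?d r)"
      unfolding prim_increment[OF f ab] prim_increment[OF g ab] using i by (subst set_integral_add) auto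
    also have "\<dots> = (LINT r:{a..b}|lborel. (f' r * g b + f a * g' r) - ?d r)"
      using i di ab by (subst set_integral_diff) (auto intro!: set_integral_add)
    also have "\<bar>\<dots>\<bar> \<le> (2 * (B1 * B2) * (b - a)) * (b - a)"
    proof (rule set_integral_abs_bound)
      show "set_integrable lborel {a..b} (\<lambda>r. (f' r * g b + f a * g' r) - ?d r)"
      proof (rule set_integral_diff(1)[OF _ di])
        show "set_integrable lborel {a..b} (\<lambda>r. f' r * g b + f a * g' r)"
          using i by (intro set_integral_add(1)) auto
      qed (use ab in auto)
      fix r assume r: "r \<in> {a..b}"
      have "\<bar>g b - g r\<bar> \<le> B2 * (b - r)" using prim_lipschitz[OF g, of B2 r b] B2 r ab by auto
      also have "\<dots> \<le> B2 * (b - a)" using r B2 by (intro mult_left_mono) auto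
      finally have 1: "\<bar>g b - g r\<bar> \<le> B2 * (b - a)" .
      have "\<bar>f r - f a\<bar> \<le> B1 * (r - a)" using prim_lipschitz[OF f, of B1 a r] B1 r ab by auto
      also have "\<dots> \<le> B1 * (b - a)" using r B1 by (intro mult_left_mono) auto
      finally have 2: "\<bar>f r - f a\<bar> \<le> B1 * (b - a)" .
      have "\<bar>f' r * (g b - g r)\<bar> \<le> B1 * (B2 * (b - a))" "\<bar>(f r - f a) * g' r\<bar> \<le> (B1 * (b - a)) * B2"
        unfolding abs_mult using 1 2 B1 B2 r ab by (auto intro!: mult_mono)
      \<comment> \<open>Freezing g at b and f at a makes the increment of the product exact; what
        remains contains an increment of f or of g, hence a factor b - a.\<close>
      moreover have "(f' r * g b + f a * g' r) - ?d r = f' r * (g b - g r) - (f r - f a) * g' r"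
        by (simp add: algebra_simps)
      ultimately show "\<bar>(f' r * g b + f a * g' r) - ?d r\<bar> \<le> 2 * (B1 * B2) * (b - a)"
        by (simp add: algebra_simps)
    qed (use ab in auto)
    finally show "\<bar>h b - h a\<bar> \<le> 2 * (B1 * B2) * (b - a)\<^sup>2" by (simp add: power2_eq_square mult.assoc)
  qed
  have h0: "h 0 = f 0 * g 0"
  proof -
    have "(LINT r:{0..0}|lborel. ?d r) = 0"
      unfolding set_lebesgue_integral_def
      by (rule integral_eq_zero_AE) (use AE_lborel_singleton[of "0::real"] in \<open>eventually_elim, auto\<close>)
    then show ?thesis by (simp add: h_def)
  qed
  have "f s * g s = f 0 * g 0 + (LINT r:{0..s}|lborel. ?d r)" if "s \<in> {0..t}" for s
    using hc[OF that] h0 h_def[of s] by linarith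
  then show ?thesis by (intro primI[OF m b])
qed

lemma prim_cmult:
  assumes p: "prim t f f'" shows "prim t (\<lambda>s. c * f s) (\<lambda>s. c * f' s)"
proof -
  obtain B where B: "B \<ge> 0" "\<forall>s\<in>{0..t}. \<bar>f' s\<bar> \<le> B" using prim_bound[OF p] by blast
  show ?thesis
  proof (rule primI)
    have "(\<lambda>s. c * (indicator {0..t} s * f' s)) \<in> borel_measurable lborel"
      by (rule borel_measurable_times[OF borel_measurable_const primD(1)[OF p]])
    then show "(\<lambda>s. indicator {0..t} s * (c * f' s)) \<in> borel_measurable lborel" by (simp add: mult.left_commute)
    show "\<bar>c * f' s\<bar> \<le> \<bar>c\<bar> * B" if "s \<in> {0..t}" for s
      using B that by (simp add: abs_mult mult_left_mono)
    show "c * f s = c * f 0 + (LINT r:{0..s}|lborel. c * f' r)" if "s \<in> {0..t}" for s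
      using primD(3)[OF p that] by (simp add: distrib_left[symmetric])
  qed
qed

lemma prim_add: assumes f: "prim t f f'" and g: "prim t g g'"
  shows "prim t (\<lambda>s. f s + g s) (\<lambda>s. f' s + g' s)"
proof -
  obtain B1 where B1: "\<forall>s\<in>{0..t}. \<bar>f' s\<bar> \<le> B1" using prim_bound[OF f] by blast
  obtain B2 where B2: "\<forall>s\<in>{0..t}. \<bar>g' s\<bar> \<le> B2" using prim_bound[OF g] by blast
  show ?thesis
  proof (rule primI)
    have "(\<lambda>s. (indicator {0..t} s * f' s) + (indicator {0..t} s * g' s)) \<in> borel_measurable lborel"
      by (rule borel_measurable_add[OF primD(1)[OF f] primD(1)[OF g]])
    then show "(\<lambda>s. indicator {0..t} s * (f' s + g' s)) \<in> borel_measurable lborel" by (simp add: distrib_left)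
    show "\<bar>f' s + g' s\<bar> \<le> B1 + B2" if "s \<in> {0..t}" for s
      using B1[rule_format, OF that] B2[rule_format, OF that] by linarith
    show "f s + g s = f 0 + g 0 + (LINT r:{0..s}|lborel. f' r + g' r)" if "s \<in> {0..t}" for s
    proof -
      have "set_integrable lborel {0..s} f'" "set_integrable lborel {0..s} g'"
        using prim_integrable[OF f, of 0 s] prim_integrable[OF g, of 0 s] that by auto
      then have "(LINT r:{0..s}|lborel. f' r + g' r) = (LINT r:{0..s}|lborel. f' r) + (LINT r:{0..s}|lborel. g' r)"
        by (rule set_integral_add)
      then show ?thesis using primD(3)[OF f that] primD(3)[OF g that] by linarith
    qed
  qed
qed

lemma prim_const: "prim t (\<lambda>_. c) (\<lambda>_. 0)"
  by (rule primI[where B = 0]) (simp_all add: set_lebesgue_integral_def)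

lemma prim_sum: "finite I \<Longrightarrow> (\<And>i. i \<in> I \<Longrightarrow> prim t (f i) (f' i)) \<Longrightarrow> prim t (\<lambda>s. \<Sum>i\<in>I. f i s) (\<lambda>s. \<Sum>i\<in>I. f' i s)"
  by (induction I rule: finite_induct) (auto intro: prim_add prim_const)

lemma prim_deriv:
  assumes d: "\<And>s. s \<in> {0..t} \<Longrightarrow> (f has_real_derivative f' s) (at s within {0..t})" and c: "continuous_on {0..t} f'"
  shows "prim t f f'"
proof -
  have "(\<lambda>s. indicator {0..t} s * f' s) \<in> borel_measurable lborel"
    using borel_measurable_continuous_on_indicator[OF _ c] by simp
  moreover have "\<exists>B. \<forall>s\<in>{0..t}. \<bar>f' s\<bar> \<le> B"
    using compact_imp_bounded[OF compact_continuous_image[OF c compact_Icc]] by (auto simp: bounded_iff)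
  moreover have "f s = f 0 + (LINT r:{0..s}|lborel. f' r)" if s: "s \<in> {0..t}" for s
  proof -
    have "integral\<^sup>L lborel (\<lambda>x. indicator {0..s} x *\<^sub>R f' x) = f s - f 0"
    proof (rule integral_FTC_atLeastAtMost)
      show "continuous_on {0..s} f'" by (rule continuous_on_subset[OF c]) (use s in auto)
      fix x assume "0 \<le> x" "x \<le> s"
      then have "(f has_real_derivative f' x) (at x within {0..s})"
        using s by (intro has_field_derivative_subset[OF d]) auto
      then show "(f has_vector_derivative f' x) (at x within {0..s})"
        by (simp add: has_real_derivative_iff_has_vector_derivative)
    qed (use s in auto)
    then show ?thesis by (simp add: set_lebesgue_integral_def)
  qed
  ultimately show ?thesis unfolding prim_def by blast
qed

section \<open>Lattice averages of the solution\<close>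

text \<open>The window rescaled to width 4/N and made periodic by \<open>frac\<close>. The argument
  decreases in u, which explains the sign in \<open>bump_deriv\<close> and the reflections in
  \<open>bump_integral_eq\<close>.\<close>

definition bump :: "(real \<Rightarrow> real) \<Rightarrow> nat \<Rightarrow> int \<Rightarrow> real \<Rightarrow> real" where
  "bump f N x u = f (real N * frac (of_int x / real N - u))"

definition window :: "(real \<Rightarrow> real) \<Rightarrow> bool" where
  "window f \<longleftrightarrow> (\<forall>v. v \<le> 0 \<or> 4 \<le> v \<longrightarrow> f v = 0)"

lemma windowD: "window f \<Longrightarrow> v \<le> 0 \<or> 4 \<le> v \<Longrightarrow> f v = 0"
  by (auto simp: window_def)

text \<open>Rounding N u up separates the argument into an integer residue and a remainder in [0,
  1), so sums over sites become sums over integer translates of f.\<close>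

lemma bump_index:
  assumes "N \<ge> 1"
  shows "bump f N x u = f (of_int ((x - \<lceil>real N * u\<rceil>) mod int N) + (of_int \<lceil>real N * u\<rceil> - real N * u))"
proof -
  define m where "m = \<lceil>real N * u\<rceil>"
  define v where "v = of_int m - real N * u"
  define z where "z = (x - m) mod int N"
  define k where "k = (x - m) div int N"
  have N: "real N > 0" using assms by simp
  have v: "0 \<le> v" "v < 1" unfolding v_def m_def by linarith+
  have z: "0 \<le> z" "z \<le> int N - 1" using assms by (auto simp: z_def)
  have xm: "x - m = k * int N + z" by (simp add: k_def z_def)
  have "of_int x / real N - u = of_int k + (of_int z + v) / real N"
  proof -
    have "x = k * int N + z + m" using xm by simp
    then have "real_of_int x = real_of_int (k * int N + z + m)" by simp
    then have "real_of_int x = of_int k * real N + of_int z + of_int m" by simp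
    then have "of_int z + v = (of_int x / real N - u - of_int k) * real N"
      using N by (simp add: v_def left_diff_distrib)
    then show ?thesis using N by simp
  qed
  moreover have "0 \<le> (of_int z + v) / real N" "(of_int z + v) / real N < 1"
  proof -
    have "real_of_int z \<le> real N - 1" using z(2) by linarith
    then show "(of_int z + v) / real N < 1" using N v by (simp add: divide_less_eq)
    show "0 \<le> (of_int z + v) / real N" using N v z by simp
  qed
  ultimately have "frac (of_int x / real N - u) = (of_int z + v) / real N"
    by (simp add: frac_unique_iff)
  then show ?thesis using N by (simp add: bump_def z_def[symmetric] m_def[symmetric] v_def[symmetric])
qed

lemma bump_periodic:
  assumes "N \<ge> 1" shows "periodic N (\<lambda>x. bump f N x u)"
  unfolding periodic_def
proof
  fix x
  have "of_int (x + int N) / real N - u = (of_int x / real N - u) + 1"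
    using assms by (simp add: add_divide_distrib)
  then show "bump f N (x + int N) u = bump f N x u"
    by (simp only: bump_def frac_def one_add_floor[symmetric] of_int_add of_int_1) simp
qed

lemma bump_periodic1: "bump f N x (u + 1) = bump f N x u"
proof -
  have "frac (of_int x / real N - (u + 1)) = frac (of_int x / real N - u)"
  proof -
    have "of_int x / real N - (u + 1) = (of_int x / real N - u) - 1" by simp
    then show ?thesis by (simp only: frac_def floor_diff_one of_int_diff of_int_1)
  qed
  then show ?thesis by (simp add: bump_def)
qed

text \<open>Where \<open>frac\<close> jumps, both one-sided arguments lie outside the support of the
  window, so near every point the bump is the window composed with an affine map. Since 4/N < 1, a
  neighbourhood can be chosen that meets at most one jump.\<close>

lemma bump_local:
  assumes N: "N \<ge> 5"
  shows "\<exists>S n. open S \<and> u \<in> S \<and>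
    (\<forall>f v. window f \<longrightarrow> v \<in> S \<longrightarrow> bump f N x v = f (real N * (of_int x / real N - v - of_int n)))"
proof -
  define y where "y = of_int x / real N - u"
  define n where "n = \<lfloor>y\<rfloor>"
  define S where "S = (\<lambda>v. of_int x / real N - v) -` {of_int n - 1 + 4 / real N <..< of_int n + (1::real)}"
  have N0: "4 / real N < 1" using N by simp
  have "open S" unfolding S_def by (intro continuous_open_vimage) (auto intro!: continuous_intros)
  moreover have "u \<in> S" using N0 by (auto simp: S_def y_def[symmetric] n_def) linarith+
  moreover have "bump f N x v = f (real N * (of_int x / real N - v - of_int n))" if f: "window f" and v: "v \<in> S" for f v
  proof -
    define w where "w = of_int x / real N - v"
    have w: "of_int n - 1 + 4 / real N < w" "w < of_int n + 1" using v by (auto simp: S_def w_def)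
    show ?thesis
    proof (cases "of_int n \<le> w")
      case True
      then have "frac w = w - of_int n" using w by (simp add: frac_unique_iff)
      then show ?thesis by (simp add: bump_def w_def[symmetric])
    next
      case False
      have "0 \<le> 4 / real N" by simp
      then have "0 \<le> w - of_int n + 1" "w - of_int n + 1 < 1" using w False by linarith+
      moreover have "w - (w - of_int n + 1) \<in> \<int>" using Ints_of_int[of "n - 1"] by simp
      ultimately have "frac w = w - of_int n + 1" by (simp only: frac_unique_iff)
      moreover have "real N * (w - of_int n + 1) \<ge> 4"
      proof -
        have "4 / real N \<le> w - of_int n + 1" using w by simp
        then show ?thesis using N by (simp add: divide_le_eq mult.commute)
      qed
      moreover have "real N * (w - of_int n) \<le> 0" using False by (simp add: mult_le_0_iff)
      ultimately show ?thesis using windowD[OF f] by (simp add: bump_def w_def[symmetric])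
    qed
  qed
  ultimately show ?thesis by blast
qed

lemma bump_deriv:
  assumes N: "N \<ge> 5" and f: "window f" and f': "window f'" and d: "\<And>v. (f has_real_derivative f' v) (at v)"
  shows "(bump f N x has_real_derivative (- real N * bump f' N x u)) (at u)"
proof -
  obtain S n where S: "open S" "u \<in> S"
    "\<And>f v. window f \<Longrightarrow> v \<in> S \<Longrightarrow> bump f N x v = f (real N * (of_int x / real N - v - of_int n))"
    using bump_local[OF N, of u x] by blast
  have "((\<lambda>v. f (real N * (of_int x / real N - v - of_int n))) has_real_derivative
     f' (real N * (of_int x / real N - u - of_int n)) * (- real N)) (at u)"
    by (rule DERIV_chain2[where g = "\<lambda>v. real N * (of_int x / real N - v - of_int n)", OF d])
      (auto intro!: derivative_eq_intros)
  then have "((\<lambda>v. f (real N * (of_int x / real N - v - of_int n))) has_real_derivative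
     - real N * bump f' N x u) (at u)"
    using S(3) f' S(2) by (simp add: mult.commute)
  then show ?thesis
    by (rule has_field_derivative_transform_within_open[OF _ S(1,2)]) (use S(3) f in auto)
qed

lemma bump_continuous:
  assumes N: "N \<ge> 5" and f: "window f" and c: "continuous_on UNIV f"
  shows "continuous_on UNIV (bump f N x)"
proof -
  have "isCont (bump f N x) u" for u
  proof -
    obtain S n where S: "open S" "u \<in> S"
      "\<And>f v. window f \<Longrightarrow> v \<in> S \<Longrightarrow> bump f N x v = f (real N * (of_int x / real N - v - of_int n))"
      using bump_local[OF N, of u x] by blast
    have "continuous_on S (\<lambda>v. f (real N * (of_int x / real N - v - of_int n)))"
      by (intro continuous_on_compose2[OF c] continuous_intros) auto
    then have "continuous_on S (bump f N x)" by (rule continuous_on_eq) (use S(3) f in auto)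
    then show ?thesis using S(1,2) by (simp add: continuous_on_eq_continuous_at)
  qed
  then show ?thesis by (simp add: continuous_on_eq_continuous_at)
qed

section \<open>Truncated powers and B-splines\<close>

definition pos :: "real \<Rightarrow> real" where "pos v = max 0 v"

text \<open>
  The linear and the cubic B-spline. The second derivative of \<open>spline\<close> is the second difference of \<open>hat\<close>,
  which is what turns the weak equation into an exact equation on the lattice.
\<close>

definition hat :: "real \<Rightarrow> real" where
  "hat v = pos (v - 1) - 2 * pos (v - 2) + pos (v - 3)"

definition spline :: "real \<Rightarrow> real" where
  "spline v = (pos v ^ 3 - 4 * pos (v - 1) ^ 3 + 6 * pos (v - 2) ^ 3 - 4 * pos (v - 3) ^ 3 + pos (v - 4) ^ 3) / 6"
definition spline1 :: "real \<Rightarrow> real" where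
  "spline1 v = (pos v ^ 2 - 4 * pos (v - 1) ^ 2 + 6 * pos (v - 2) ^ 2 - 4 * pos (v - 3) ^ 2 + pos (v - 4) ^ 2) / 2"
definition spline2 :: "real \<Rightarrow> real" where
  "spline2 v = hat (v + 1) - 2 * hat v + hat (v - 1)"

lemma pos_simps: "v \<ge> 0 \<Longrightarrow> pos v = v" "v \<le> 0 \<Longrightarrow> pos v = 0"
  by (auto simp: pos_def)

lemma pos_deriv:
  assumes "n \<ge> 1" shows "((\<lambda>v. pos v ^ (n + 1)) has_real_derivative real (n + 1) * pos v ^ n) (at v)"
proof (cases v "0::real" rule: linorder_cases)
  case less
  have "((\<lambda>v::real. 0) has_real_derivative 0) (at v)" by simp
  then have "((\<lambda>v. pos v ^ (n + 1)) has_real_derivative 0) (at v)"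
    by (rule has_field_derivative_transform_within_open[of _ _ _ "{..<0}"]) (use less in \<open>auto simp: pos_def\<close>)
  moreover have "real (n + 1) * pos v ^ n = 0" using less assms by (simp add: pos_def power_0_left)
  ultimately show ?thesis by (simp only:)
next
  case greater
  have "((\<lambda>v::real. v ^ (n + 1)) has_real_derivative real (n + 1) * v ^ n) (at v)"
    using DERIV_pow[of "n + 1" v] by simp
  then have "((\<lambda>v. pos v ^ (n + 1)) has_real_derivative real (n + 1) * v ^ n) (at v)"
    by (rule has_field_derivative_transform_within_open[of _ _ _ "{0<..}"]) (use greater in \<open>auto simp: pos_def\<close>)
  moreover have "pos v = v" using greater by (simp add: pos_def)
  ultimately show ?thesis by (simp only:)
next
  case equal
  have "((\<lambda>y. (pos y ^ (n + 1) - pos 0 ^ (n + 1)) / (y - 0)) \<longlongrightarrow> 0) (at (0::real))"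
  proof (rule Lim_null_comparison)
    show "\<forall>\<^sub>F y in at 0. norm ((pos y ^ (n + 1) - pos 0 ^ (n + 1)) / (y - 0)) \<le> \<bar>y\<bar> ^ n"
    proof (intro always_eventually allI)
      fix y :: real
      show "norm ((pos y ^ (n + 1) - pos 0 ^ (n + 1)) / (y - 0)) \<le> \<bar>y\<bar> ^ n"
        by (cases "y > 0") (simp_all add: pos_def)
    qed
    show "((\<lambda>y::real. \<bar>y\<bar> ^ n) \<longlongrightarrow> 0) (at 0)" using assms by (auto intro!: tendsto_eq_intros)
  qed
  moreover have "real (n + 1) * pos v ^ n = 0" using equal assms by (simp add: pos_def power_0_left)
  ultimately show ?thesis by (simp only: has_field_derivative_iff equal)
qed

lemma spline_deriv: "(spline has_real_derivative spline1 v) (at v)"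
proof -
  have d: "((\<lambda>v. pos (v - c) ^ 3) has_real_derivative 3 * pos (v - c) ^ 2) (at v)" for c
    using pos_deriv[of 2 "v - c"] DERIV_shift[of "\<lambda>v. pos v ^ 3" "3 * pos (v - c) ^ 2" v "-c"] by simp
  have e: "spline = (\<lambda>v. (pos (v - 0) ^ 3 - 4 * pos (v - 1) ^ 3 + 6 * pos (v - 2) ^ 3 - 4 * pos (v - 3) ^ 3 + pos (v - 4) ^ 3) / 6)"
    by (simp add: spline_def[abs_def])
  have "(spline has_real_derivative (3 * pos (v - 0) ^ 2 - 4 * (3 * pos (v - 1) ^ 2) + 6 * (3 * pos (v - 2) ^ 2)
     - 4 * (3 * pos (v - 3) ^ 2) + 3 * pos (v - 4) ^ 2) / 6) (at v)"
    unfolding e by (intro DERIV_cdivide DERIV_add DERIV_diff DERIV_cmult d)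
  then show ?thesis by (rule DERIV_cong) (simp add: spline1_def)
qed

lemma spline1_deriv: "(spline1 has_real_derivative spline2 v) (at v)"
proof -
  have d: "((\<lambda>v. pos (v - c) ^ 2) has_real_derivative 2 * pos (v - c)) (at v)" for c
    using pos_deriv[of 1 "v - c"] DERIV_shift[of "\<lambda>v. pos v ^ 2" "2 * pos (v - c)" v "-c"]
    by (simp add: numeral_2_eq_2)
  have e: "spline1 = (\<lambda>v. (pos (v - 0) ^ 2 - 4 * pos (v - 1) ^ 2 + 6 * pos (v - 2) ^ 2 - 4 * pos (v - 3) ^ 2 + pos (v - 4) ^ 2) / 2)"
    by (simp add: spline1_def[abs_def])
  have "(spline1 has_real_derivative (2 * pos (v - 0) - 4 * (2 * pos (v - 1)) + 6 * (2 * pos (v - 2))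
     - 4 * (2 * pos (v - 3)) + 2 * pos (v - 4)) / 2) (at v)"
    unfolding e by (intro DERIV_cdivide DERIV_add DERIV_diff DERIV_cmult d)
  then show ?thesis by (rule DERIV_cong) (simp add: spline2_def hat_def)
qed

lemma hat_zero: "v \<le> 1 \<or> 3 \<le> v \<Longrightarrow> hat v = 0"
  by (elim disjE) (simp_all add: hat_def pos_simps)

lemma window_hat: "window hat"
  unfolding window_def by (auto intro!: hat_zero)
lemma window_spline2: "window spline2"
proof -
  have "spline2 v = 0" if "v \<le> 0 \<or> 4 \<le> v" for v
    using that hat_zero[of "v + 1"] hat_zero[of v] hat_zero[of "v - 1"] by (simp add: spline2_def) linarith
  then show ?thesis by (simp add: window_def)
qed
lemma window_spline: "window spline"
proof -
  have "spline v = 0" if "v \<le> 0" for v using that by (simp add: spline_def pos_simps)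
  moreover have "spline v = 0" if "4 \<le> v" for v using that
    by (simp add: spline_def pos_simps power3_eq_cube algebra_simps)
  ultimately show ?thesis by (auto simp: window_def)
qed
lemma window_spline1: "window spline1"
proof -
  have "spline1 v = 0" if "v \<le> 0" for v using that by (simp add: spline1_def pos_simps)
  moreover have "spline1 v = 0" if "4 \<le> v" for v using that
    by (simp add: spline1_def pos_simps power2_eq_square algebra_simps)
  ultimately show ?thesis by (auto simp: window_def)
qed

lemma continuous_pos: "continuous_on S pos" unfolding pos_def[abs_def] by (intro continuous_intros)
lemma continuous_hat: "continuous_on UNIV hat"
  unfolding hat_def[abs_def] by (intro continuous_intros continuous_on_compose2[OF continuous_pos[of UNIV]]) auto
lemma continuous_spline: "continuous_on UNIV spline"
  using spline_deriv by (auto intro!: DERIV_continuous_on)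
lemma continuous_spline1: "continuous_on UNIV spline1"
  using spline1_deriv by (auto intro!: DERIV_continuous_on)
lemma continuous_spline2: "continuous_on UNIV spline2"
  unfolding spline2_def[abs_def] by (intro continuous_intros continuous_on_compose2[OF continuous_hat]) auto

text \<open>Nonnegative windows whose integer translates form a partition of unity; four translates
  suffice on a support of length 4. This makes \<open>kavg\<close> a genuine average with values in
  [0, 1].\<close>

definition unity :: "(real \<Rightarrow> real) \<Rightarrow> bool" where
  "unity f \<longleftrightarrow> window f \<and> continuous_on UNIV f \<and> (\<forall>v. 0 \<le> f v) \<and>
     (\<forall>v\<in>{0..<1}. f v + f (v + 1) + f (v + 2) + f (v + 3) = 1)"

lemma hat_nonneg: "0 \<le> hat v"
proof -
  consider "v \<le> 1" | "1 \<le> v" "v \<le> 2" | "2 \<le> v" "v \<le> 3" | "3 \<le> v" by linarith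
  then show ?thesis by cases (simp_all add: hat_def pos_simps)
qed

lemma hat_pieces:
  assumes "0 \<le> v" "v \<le> 1"
  shows "hat v = 0" "hat (v + 1) = v" "hat (v + 2) = 1 - v" "hat (v + 3) = 0"
  using assms unfolding hat_def by (simp_all add: pos_simps)

lemma unity_hat: "unity hat"
  unfolding unity_def using window_hat continuous_hat hat_nonneg by (auto simp: hat_pieces)

lemma spline_pieces:
  assumes "0 \<le> v" "v \<le> 1"
  shows "spline v = v ^ 3 / 6" "spline (v + 1) = (1 + 3 * v + 3 * v\<^sup>2 - 3 * v ^ 3) / 6"
    "spline (v + 2) = (4 - 6 * v\<^sup>2 + 3 * v ^ 3) / 6" "spline (v + 3) = (1 - v) ^ 3 / 6"
  using assms unfolding spline_def by (simp_all add: pos_simps power2_eq_square power3_eq_cube algebra_simps)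

lemma spline_nonneg: "0 \<le> spline v"
proof -
  have sq: "w ^ 3 \<le> w\<^sup>2" "w\<^sup>2 \<le> 1" "0 \<le> w ^ 3" if "0 \<le> w" "w \<le> 1" for w :: real
    using that by (auto simp: power2_eq_square power3_eq_cube mult_le_one mult_left_le)
  consider "v \<le> 0 \<or> 4 \<le> v" | "0 \<le> v" "v \<le> 1" | "1 \<le> v" "v \<le> 2" | "2 \<le> v" "v \<le> 3" | "3 \<le> v" "v \<le> 4" by linarith
  then show ?thesis
  proof cases
    case 1 then show ?thesis using windowD[OF window_spline] by simp
  next
    case 2 then show ?thesis by (simp add: spline_pieces)
  next
    case 3 then show ?thesis using spline_pieces(2)[of "v - 1"] sq[of "v - 1"] by simp
  next
    case 4
    define a where "a = 3 - v"
    have "spline v = (1 + 3 * a + 3 * a\<^sup>2 - 3 * a ^ 3) / 6"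
      using spline_pieces(3)[of "v - 2"] 4 by (simp add: a_def power2_eq_square power3_eq_cube algebra_simps)
    then show ?thesis using sq[of a] 4 by (simp add: a_def)
  next
    case 5
    then have "0 \<le> (4 - v) ^ 3" by simp
    moreover have "spline v = (4 - v) ^ 3 / 6" using spline_pieces(4)[of "v - 3"] 5 by simp
    ultimately show ?thesis by (simp only: zero_le_divide_iff) simp
  qed
qed

lemma unity_spline: "unity spline"
  unfolding unity_def using window_spline continuous_spline spline_nonneg
  by (auto simp: spline_pieces) (simp add: power2_eq_square power3_eq_cube field_simps)

lemma bump_nonneg: "unity f \<Longrightarrow> 0 \<le> bump f N x u" by (simp add: unity_def bump_def)

lemma bump_sum:
  assumes f: "unity f" and N: "N \<ge> 5"
  shows "csum N (\<lambda>x. bump f N x u) = 1"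
proof -
  define m where "m = \<lceil>real N * u\<rceil>"
  define v where "v = of_int m - real N * u"
  have v: "0 \<le> v" "v < 1" unfolding v_def m_def by linarith+
  define g where "g z = f (of_int (z mod int N) + v)" for z
  have pg: "periodic N g" by (simp add: g_def[abs_def] periodic_def)
  have "csum N (\<lambda>x. bump f N x u) = csum N (\<lambda>x. g (x - m))"
    using N by (simp add: bump_index g_def m_def v_def)
  also have "\<dots> = csum N g" by (rule csum_shift_diff[OF pg])
  also have "\<dots> = (\<Sum>x<N. f (real x + v))" unfolding csum_def g_def by (intro sum.cong) auto
  also have "\<dots> = (\<Sum>x<4. f (real x + v))"
  proof (rule sum.mono_neutral_right)
    have "f (real i + v) = 0" if "i \<ge> 4" for i
      using windowD[of f "real i + v"] f that v by (simp add: unity_def)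
    then show "\<forall>i\<in>{..<N} - {..<4}. f (real i + v) = 0" by auto
  qed (use N in auto)
  also have "\<dots> = f v + f (v + 1) + f (v + 2) + f (v + 3)" by (simp add: eval_nat_numeral add.commute)
  also have "\<dots> = 1" using f v by (simp add: unity_def)
  finally show ?thesis .
qed

text \<open>\<open>hat\<close> is supported in [1, 3], one unit inside the window on either side. A
  shift by one site therefore stays inside, and at the seam of the residues both formulas give
  zero.\<close>

lemma bump_spline2:
  assumes N: "N \<ge> 5"
  shows "bump spline2 N x u = bump hat N (x + 1) u + bump hat N (x - 1) u - 2 * bump hat N x u"
proof -
  define m where "m = \<lceil>real N * u\<rceil>"
  define v where "v = of_int m - real N * u"
  have v: "0 \<le> v" "v < 1" unfolding v_def m_def by linarith+
  define z where "z = (x - m) mod int N"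
  have z: "0 \<le> z" "z < int N" using N by (auto simp: z_def)
  have b: "bump f N y u = f (of_int ((y - m) mod int N) + v)" for f y using N by (simp add: bump_index m_def v_def)
  have 1: "hat (of_int ((x + 1 - m) mod int N) + v) = hat (of_int z + v + 1)"
  proof -
    have "(x + 1 - m) mod int N = (z + 1) mod int N"
    proof -
      have "x + 1 - m = (x - m) + 1" by simp
      then show ?thesis by (simp only: z_def mod_add_left_eq)
    qed
    moreover have "hat (of_int z + v + 1) = 0" if "z + 1 = int N"
    proof -
      have "real_of_int z \<ge> 3" using that N by simp
      then show ?thesis using v by (intro hat_zero) simp
    qed
    moreover have "hat (0 + v) = 0" using v by (intro hat_zero) simp
    moreover have "(z + 1) mod int N = z + 1" if "z + 1 \<noteq> int N" using that z by simp
    moreover have "of_int (z + 1) + v = of_int z + v + 1" by simp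
    ultimately show ?thesis by (cases "z + 1 = int N") (simp_all only: mod_self of_int_0 simp_thms)
  qed
  have 2: "hat (of_int ((x - 1 - m) mod int N) + v) = hat (of_int z + v - 1)"
  proof -
    have e: "(x - 1 - m) mod int N = (z - 1) mod int N"
    proof -
      have "x - 1 - m = (x - m) - 1" by simp
      then show ?thesis by (simp only: z_def mod_diff_left_eq)
    qed
    show ?thesis
    proof (cases "z = 0")
      case True
      then have "(x - 1 - m) mod int N = int N - 1" using N e by (simp add: zmod_minus1)
      then show ?thesis using True N v hat_zero[of "v - 1"] hat_zero[of "real N - 1 + v"] by simp
    next
      case False
      then have "(x - 1 - m) mod int N = z - 1" using z e by simp
      then show ?thesis by (simp only: of_int_diff of_int_1) (simp add: algebra_simps)
    qed
  qed
  show ?thesis unfolding b 1 2 z_def[symmetric] spline2_def by simp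
qed

text \<open>Truncating the density at 1/2 absorbs the indicator and exposes the concave function 2 -
  1/\<rho>; bounds and the Lipschitz constant then need no separate phases.\<close>

lemma H_eq: "\<H> r = 2 - 1 / max r (1 / 2)"
  by (cases "r > 1 / 2") (auto simp: \<H>_def max_def field_simps)

lemma H_bounds: assumes "r \<le> 1" shows "0 \<le> \<H> r" "\<H> r \<le> 1"
proof -
  have m: "1 / 2 \<le> max r (1 / 2)" "max r (1 / 2) \<le> 1" using assms by auto
  have "1 / max r (1 / 2) \<le> 1 / (1 / 2)" using m by (intro divide_left_mono) auto
  moreover have "1 / 1 \<le> 1 / max r (1 / 2)" using m by (intro divide_left_mono) auto
  ultimately show "0 \<le> \<H> r" "\<H> r \<le> 1" by (simp_all add: H_eq)
qed

lemma H_lipschitz: "\<bar>\<H> a - \<H> b\<bar> \<le> 4 * \<bar>a - b\<bar>"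
proof -
  define x where "x = max a (1 / 2)"
  define y where "y = max b (1 / 2)"
  have xy: "x \<ge> 1 / 2" "y \<ge> 1 / 2" "\<bar>x - y\<bar> \<le> \<bar>a - b\<bar>" by (auto simp: x_def y_def)
  have "\<H> a - \<H> b = (x - y) / (x * y)" using xy by (simp add: H_eq x_def[symmetric] y_def[symmetric] field_simps)
  then have "\<bar>\<H> a - \<H> b\<bar> = \<bar>x - y\<bar> / (x * y)" using xy by (simp add: abs_mult)
  also have "\<dots> \<le> \<bar>a - b\<bar> / ((1 / 2) * (1 / 2))" using xy by (intro frac_le mult_mono) auto
  finally show ?thesis by simp
qed

lemma H_measurable [measurable]: "\<H> \<in> borel_measurable borel"
proof -
  have e: "\<H> = (\<lambda>r. 2 - 1 / max r (1 / 2))" by (simp add: fun_eq_iff H_eq)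
  show ?thesis unfolding e by measurable
qed

section \<open>Averages of bounded profiles over lattice windows\<close>

definition profile :: "(real \<Rightarrow> real) \<Rightarrow> bool" where
  "profile f \<longleftrightarrow> (\<lambda>u. indicator {0..<1} u * f u) \<in> borel_measurable borel \<and> (\<forall>u\<in>{0..<1}. 0 \<le> f u \<and> f u \<le> 1)"

definition kavg :: "(real \<Rightarrow> real) \<Rightarrow> (real \<Rightarrow> real) \<Rightarrow> nat \<Rightarrow> int \<Rightarrow> real" where
  "kavg f K N x = real N * (LINT u:{0..<1}|lborel. f u * bump K N x u)"

lemma unit_integrable:
  fixes g :: "real \<Rightarrow> real"
  assumes m: "(\<lambda>u. indicator {0..<1} u * g u) \<in> borel_measurable borel" and b: "\<And>u. u \<in> {0..<1} \<Longrightarrow> \<bar>g u\<bar> \<le> B"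
  shows "set_integrable lborel {0..<1} g"
proof -
  have "set_integrable lborel {0..<1::real} (\<lambda>_. B)"
    unfolding set_integrable_def by (intro integrable_scaleR_left) (simp add: integrable_indicator_iff)
  moreover have "set_borel_measurable lborel {0..<1} g" using m by (simp add: set_borel_measurable_def)
  moreover have "AE x in lborel. x \<in> {0..<1} \<longrightarrow> norm (g x) \<le> norm B"
    by (intro AE_I2 impI) (use b in \<open>auto intro: order_trans[OF b abs_ge_self]\<close>)
  ultimately show ?thesis by (rule set_integrable_bound)
qed

lemma profile_times:
  assumes f: "profile f" and g: "g \<in> borel_measurable borel" and b: "\<And>u. u \<in> {0..<1} \<Longrightarrow> \<bar>g u\<bar> \<le> B"
  shows "set_integrable lborel {0..<1} (\<lambda>u. f u * g u)"
proof (rule unit_integrable)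
  have "(\<lambda>u. (indicator {0..<1} u * f u) * g u) \<in> borel_measurable borel"
    by (rule borel_measurable_times[OF _ g]) (use f in \<open>simp add: profile_def\<close>)
  then show "(\<lambda>u. indicator {0..<1} u * (f u * g u)) \<in> borel_measurable borel" by (simp add: mult.assoc)
  fix u :: real assume u: "u \<in> {0..<1}"
  have "\<bar>f u * g u\<bar> \<le> 1 * B" unfolding abs_mult using f u b[OF u] by (intro mult_mono) (auto simp: profile_def)
  then show "\<bar>f u * g u\<bar> \<le> B" by simp
qed

lemma profile_const_one: "profile (\<lambda>_. 1)"
  by (simp add: profile_def)

lemma continuous_times:
  assumes f: "profile f" and g: "continuous_on UNIV g"
  shows "set_integrable lborel {0..<1} (\<lambda>u. f u * g u)"
proof -
  have "bounded (g ` {0..1})" by (intro compact_imp_bounded compact_continuous_image continuous_on_subset[OF g]) auto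
  then obtain B where B: "\<forall>u\<in>{0..1}. \<bar>g u\<bar> \<le> B" by (auto simp: bounded_iff)
  show ?thesis
    by (rule profile_times[OF f, of _ B]) (use B in \<open>auto intro: borel_measurable_continuous_onI[OF g]\<close>)
qed

lemma unity_continuous: "unity K \<Longrightarrow> N \<ge> 5 \<Longrightarrow> continuous_on UNIV (bump K N x)"
  by (intro bump_continuous) (auto simp: unity_def)

lemma set_integral_finite_sum:
  fixes f :: "'b \<Rightarrow> real \<Rightarrow> real"
  assumes "\<And>i. i \<in> I \<Longrightarrow> set_integrable lborel A (f i)"
  shows "(LINT u:A|lborel. \<Sum>i\<in>I. f i u) = (\<Sum>i\<in>I. LINT u:A|lborel. f i u)"
  using assms unfolding set_lebesgue_integral_def set_integrable_def scaleR_sum_right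
  by (rule Bochner_Integration.integral_sum)

lemma reflect_integral:
  fixes F :: "real \<Rightarrow> real"
  shows "(LINT u|lborel. indicator {a..b} (a + b - u) * F (a + b - u)) = (LINT u|lborel. indicator {a..b} u * F u)"
  using lborel_integral_real_affine[of "-1" "\<lambda>u. indicator {a..b} u * F u" "a + b"] by simp

text \<open>\<open>frac\<close> jumps at u = x/N. On either side of this point the integrand is a
  reflection of the window, and the two pieces fit together to [0, 1].\<close>

lemma bump_integral_eq:
  assumes K: "unity K" and N: "N \<ge> 5" and x: "x < N"
  shows "(LINT u:{0..<1}|lborel. bump K N (int x) u) = (LINT u:{0..1}|lborel. K (real N * u))"
proof -
  define c where "c = real x / real N"
  define F where "F w = K (real N * w)" for w
  have c: "0 \<le> c" "c < 1" using x by (auto simp: c_def)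
  have "continuous_on UNIV K" using K by (simp add: unity_def)
  from continuous_on_compose2[OF this, of UNIV "\<lambda>w. real N * w"]
  have cK: "continuous_on UNIV F" unfolding F_def[abs_def] by (simp add: continuous_intros)
  have cB: "continuous_on UNIV (bump K N (int x))" by (rule unity_continuous[OF K N])
  have iF: "set_integrable lborel {a..b} F" for a b
    by (rule borel_integrable_atLeastAtMost') (rule continuous_on_subset[OF cK], simp)
  have iB: "set_integrable lborel {a..b} (bump K N (int x))" for a b
    by (rule borel_integrable_atLeastAtMost') (rule continuous_on_subset[OF cB], simp)
  have "(LINT u:{0..<1}|lborel. bump K N (int x) u) = (LINT u:{0..1}|lborel. bump K N (int x) u)"
  proof -
    have m: "set_borel_measurable lborel {0..1} (bump K N (int x))" "set_borel_measurable lborel {0..<1} (bump K N (int x))"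
      using iB[of 0 1] continuous_times[OF profile_const_one cB] by (auto simp: set_borel_measurable_def set_integrable_def)
    have "AE u in lborel. (u \<in> {0..1}) = (u \<in> {0..<1::real})"
      using AE_lborel_singleton[of 1] by eventually_elim auto
    with m show ?thesis by (rule set_integral_cong_set)
  qed
  also have "\<dots> = (LINT u:{0..c}|lborel. bump K N (int x) u) + (LINT u:{c..1}|lborel. bump K N (int x) u)"
    by (rule set_integral_split[OF iB]) (use c in auto)
  also have "(LINT u:{0..c}|lborel. bump K N (int x) u) = (LINT u:{0..c}|lborel. F u)"
  proof -
    have "(LINT u:{0..c}|lborel. bump K N (int x) u) = (LINT u:{0..c}|lborel. F (0 + c - u))"
    proof (rule set_lebesgue_integral_cong)
      show "\<forall>u. u \<in> {0..c} \<longrightarrow> bump K N (int x) u = F (0 + c - u)"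
      proof (intro allI impI)
        fix u assume "u \<in> {0..c}"
        then have "frac (c - u) = c - u" using c by (simp add: frac_eq)
        then show "bump K N (int x) u = F (0 + c - u)" by (simp add: bump_def F_def c_def)
      qed
    qed simp
    also have "\<dots> = (LINT u|lborel. indicator {0..c} (0 + c - u) * F (0 + c - u))"
      unfolding set_lebesgue_integral_def by (intro Bochner_Integration.integral_cong) (auto simp: indicator_def)
    also have "\<dots> = (LINT u:{0..c}|lborel. F u)" unfolding reflect_integral by (simp add: set_lebesgue_integral_def)
    finally show ?thesis .
  qed
  also have "(LINT u:{c..1}|lborel. bump K N (int x) u) = (LINT u:{c..1}|lborel. F u)"
  proof -
    have "(LINT u:{c..1}|lborel. bump K N (int x) u) = (LINT u:{c..1}|lborel. F (c + 1 - u))"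
    proof (rule set_lebesgue_integral_cong)
      show "\<forall>u. u \<in> {c..1} \<longrightarrow> bump K N (int x) u = F (c + 1 - u)"
      proof (intro allI impI)
        fix u assume u: "u \<in> {c..1}"
        show "bump K N (int x) u = F (c + 1 - u)"
        proof (cases "u = c")
          case True
          \<comment> \<open>At the jump itself \<open>frac\<close> gives 0 while the reflected
            formula gives 1; the window vanishes at both arguments 0 and N.\<close>
          have "K 0 = 0" "K (real N) = 0" using K N by (auto simp: unity_def window_def)
          then show ?thesis using True by (simp add: bump_def F_def c_def)
        next
          case False
          then have "frac (c - u) = c + 1 - u" using u c by (auto simp: frac_unique_iff)
          then show ?thesis by (simp only: bump_def F_def of_int_of_nat_eq c_def[symmetric])
        qed
      qed
    qed simp
    also have "\<dots> = (LINT u|lborel. indicator {c..1} (c + 1 - u) * F (c + 1 - u))"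
      unfolding set_lebesgue_integral_def by (intro Bochner_Integration.integral_cong) (auto simp: indicator_def)
    also have "\<dots> = (LINT u:{c..1}|lborel. F u)" unfolding reflect_integral by (simp add: set_lebesgue_integral_def)
    finally show ?thesis .
  qed
  also have "(LINT u:{0..c}|lborel. F u) + (LINT u:{c..1}|lborel. F u) = (LINT u:{0..1}|lborel. F u)"
    by (rule set_integral_split[symmetric, OF iF]) (use c in auto)
  finally show ?thesis by (simp add: F_def)
qed

text \<open>The window itself is never integrated: all sites give the same integral, and by the
  partition of unity the N integrals add up to 1.\<close>

lemma bump_integral:
  assumes K: "unity K" and N: "N \<ge> 5"
  shows "(LINT u:{0..<1}|lborel. bump K N x u) = 1 / real N"
proof -
  let ?I = "LINT u:{0..1}|lborel. K (real N * u)"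
  have i: "set_integrable lborel {0..<1} (bump K N (int x))" for x :: nat
    using continuous_times[OF profile_const_one unity_continuous[OF K N]] by simp
  have "1 = (LINT u:{0..<1::real}|lborel. 1)" by (simp add: set_lebesgue_integral_def)
  also have "\<dots> = (LINT u:{0..<1}|lborel. csum N (\<lambda>x. bump K N x u))" by (simp add: bump_sum[OF K N])
  also have "\<dots> = (\<Sum>x<N. LINT u:{0..<1}|lborel. bump K N (int x) u)"
    unfolding csum_def using i by (rule set_integral_finite_sum)
  also have "\<dots> = real N * ?I" by (simp add: bump_integral_eq[OF K N])
  finally have I: "?I = 1 / real N" using N by (simp add: field_simps)
  have "bump K N x = bump K N (int (nat (x mod int N)))"
  proof
    fix u show "bump K N x u = bump K N (int (nat (x mod int N))) u"
      using periodic_mod[OF bump_periodic[of N K u], of x] N by simp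
  qed
  then show ?thesis using bump_integral_eq[OF K N, of "nat (x mod int N)"] I N by (simp add: nat_less_iff)
qed

lemma kavg_integrable: "profile f \<Longrightarrow> unity K \<Longrightarrow> N \<ge> 5 \<Longrightarrow> set_integrable lborel {0..<1} (\<lambda>u. f u * bump K N x u)"
  by (intro continuous_times unity_continuous)

lemma kavg_bounds:
  assumes f: "profile f" and K: "unity K" and N: "N \<ge> 5"
  shows "0 \<le> kavg f K N x" "kavg f K N x \<le> 1"
proof -
  note i = kavg_integrable[OF f K N, of x] kavg_integrable[OF profile_const_one K N, of x]
  show "0 \<le> kavg f K N x" unfolding kavg_def set_lebesgue_integral_def
    using f bump_nonneg[OF K] by (intro mult_nonneg_nonneg integral_nonneg) (auto simp: profile_def indicator_def)
  have "(LINT u:{0..<1}|lborel. f u * bump K N x u) \<le> (LINT u:{0..<1}|lborel. 1 * bump K N x u)"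
  proof (intro set_integral_mono i)
    fix u :: real assume "u \<in> {0..<1}"
    then show "f u * bump K N x u \<le> 1 * bump K N x u"
      using f bump_nonneg[OF K] by (intro mult_right_mono) (auto simp: profile_def)
  qed
  also have "\<dots> = 1 / real N" by (simp add: bump_integral[OF K N])
  finally show "kavg f K N x \<le> 1" unfolding kavg_def using N by (simp add: field_simps)
qed

lemma kavg_periodic: "N \<ge> 1 \<Longrightarrow> periodic N (kavg f K N)"
  using bump_periodic[of N K] by (simp add: periodic_def kavg_def)

lemma kavg_csum:
  assumes f: "profile f" and K: "unity K" and N: "N \<ge> 5"
  shows "csum N (\<lambda>x. w x * kavg f K N x) = real N * (LINT u:{0..<1}|lborel. f u * csum N (\<lambda>x. w x * bump K N x u))"
proof -
  have "csum N (\<lambda>x. w x * kavg f K N x) = (\<Sum>x<N. real N * (LINT u:{0..<1}|lborel. w (int x) * (f u * bump K N (int x) u)))"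
    unfolding csum_def kavg_def by (intro sum.cong refl) simp
  also have "\<dots> = real N * (\<Sum>x<N. LINT u:{0..<1}|lborel. w (int x) * (f u * bump K N (int x) u))"
    by (simp only: sum_distrib_left)
  also have "(\<Sum>x<N. LINT u:{0..<1}|lborel. w (int x) * (f u * bump K N (int x) u)) =
     (LINT u:{0..<1}|lborel. (\<Sum>x<N. w (int x) * (f u * bump K N (int x) u)))"
    using kavg_integrable[OF f K N] by (intro set_integral_finite_sum[symmetric]) auto
  also have "(\<lambda>u. \<Sum>x<N. w (int x) * (f u * bump K N (int x) u)) = (\<lambda>u. f u * csum N (\<lambda>x. w x * bump K N x u))"
    by (simp add: csum_def sum_distrib_left mult.left_commute)
  finally show ?thesis .
qed

text \<open>By duality the average is moved from f to the test function. Its lattice interpolation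
  uses only sites within distance 4/N of u, so it differs from \<phi> by at most 4 L / N.\<close>

lemma kavg_test:
  assumes f: "profile f" and K: "unity K" and N: "N \<ge> 5" and p: "\<And>u. \<phi> (u + 1) = \<phi> u" and c: "continuous_on UNIV \<phi>"
    and L: "\<And>u v. \<bar>\<phi> u - \<phi> v\<bar> \<le> L * \<bar>u - v\<bar>"
  shows "\<bar>csum N (\<lambda>x. \<phi> (of_int x / real N) * kavg f K N x) / real N - (LINT u:{0..<1}|lborel. f u * \<phi> u)\<bar> \<le> 4 * L / real N"
proof -
  have L0: "L \<ge> 0" using L[of 0 1] by (simp add: order_trans[OF abs_ge_zero])
  define \<psi> where "\<psi> u = csum N (\<lambda>x. \<phi> (of_int x / real N) * bump K N x u)" for u
  have close: "\<bar>\<psi> u - \<phi> u\<bar> \<le> 4 * L / real N" for u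
  proof -
    have pi: "\<phi> (v + of_int k) = \<phi> v" for v k
    proof (induction k rule: int_induct[where k = 0])
      case (step1 i) then show ?case using p[of "v + of_int i"] by (simp add: add.assoc)
    next
      case (step2 i) then show ?case using p[of "v + of_int (i - 1)"] by (simp add: algebra_simps)
    qed simp
    have "\<psi> u - \<phi> u = csum N (\<lambda>x. (\<phi> (of_int x / real N) - \<phi> u) * bump K N x u)"
      using csum_cmult[of N "\<phi> u" "\<lambda>x. bump K N x u"] bump_sum[OF K N, of u]
      by (simp add: \<psi>_def left_diff_distrib csum_diff)
    also have "\<bar>\<dots>\<bar> \<le> csum N (\<lambda>x. (4 * L / real N) * bump K N x u)"
    proof (rule order_trans[OF csum_abs], rule csum_mono)
      fix x
      define w where "w = of_int x / real N - u"
      show "\<bar>(\<phi> (of_int x / real N) - \<phi> u) * bump K N x u\<bar> \<le> (4 * L / real N) * bump K N x u"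
      proof (cases "bump K N x u = 0")
        case False
        then have "real N * frac w < 4" using K by (auto simp: bump_def w_def[symmetric] unity_def window_def not_le[symmetric])
        then have fr: "frac w \<le> 4 / real N" using N by (simp add: field_simps)
        have "\<phi> (of_int x / real N) = \<phi> (u + frac w)"
          using pi[of "u + frac w" "\<lfloor>w\<rfloor>"] by (simp add: frac_def w_def)
        then have "\<bar>\<phi> (of_int x / real N) - \<phi> u\<bar> \<le> L * \<bar>frac w\<bar>" using L[of "u + frac w" u] by simp
        also have "\<dots> \<le> L * (4 / real N)" using fr L0 by (intro mult_left_mono) auto
        also have "\<dots> = 4 * L / real N" by simp
        finally have "\<bar>\<phi> (of_int x / real N) - \<phi> u\<bar> * bump K N x u \<le> (4 * L / real N) * bump K N x u"
          using bump_nonneg[OF K, of N x u] by (rule mult_right_mono)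
        then show ?thesis using bump_nonneg[OF K, of N x u] by (simp only: abs_mult abs_of_nonneg)
      qed simp
    qed
    finally show ?thesis unfolding csum_cmult bump_sum[OF K N] by simp
  qed
  have c\<psi>: "continuous_on UNIV \<psi>" unfolding \<psi>_def csum_def
    by (intro continuous_intros unity_continuous K N)
  have N0: "real N > 0" using N by simp
  have "csum N (\<lambda>x. \<phi> (of_int x / real N) * kavg f K N x) / real N - (LINT u:{0..<1}|lborel. f u * \<phi> u)
     = (LINT u:{0..<1}|lborel. f u * \<psi> u) - (LINT u:{0..<1}|lborel. f u * \<phi> u)"
    unfolding kavg_csum[OF f K N] \<psi>_def using N0 by simp
  also have "\<dots> = (LINT u:{0..<1}|lborel. f u * \<psi> u - f u * \<phi> u)"
    using continuous_times[OF f c\<psi>] continuous_times[OF f c] by (rule set_integral_diff(2)[symmetric])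
  also have "\<bar>\<dots>\<bar> \<le> (LINT u:{0..<1::real}|lborel. 4 * L / real N)"
  proof -
    have i: "set_integrable lborel {0..<1} (\<lambda>u. f u * \<psi> u - f u * \<phi> u)"
      using continuous_times[OF f c\<psi>] continuous_times[OF f c] by (rule set_integral_diff(1))
    have "\<bar>LINT u:{0..<1}|lborel. f u * \<psi> u - f u * \<phi> u\<bar> \<le> (LINT u:{0..<1}|lborel. \<bar>f u * \<psi> u - f u * \<phi> u\<bar>)"
      using set_integral_norm_bound[OF i] by simp
    also have "\<dots> \<le> (LINT u:{0..<1::real}|lborel. 4 * L / real N)"
    proof (intro set_integral_mono set_integrable_abs[OF i])
      show "set_integrable lborel {0..<1::real} (\<lambda>u. 4 * L / real N)"
        unfolding set_integrable_def by (intro integrable_scaleR_left) (simp add: integrable_indicator_iff)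
      fix u :: real assume u: "u \<in> {0..<1}"
      have "\<bar>f u * (\<psi> u - \<phi> u)\<bar> \<le> 1 * (4 * L / real N)" unfolding abs_mult
        using close[of u] f u by (intro mult_mono) (auto simp: profile_def)
      then show "\<bar>f u * \<psi> u - f u * \<phi> u\<bar> \<le> 4 * L / real N" by (simp add: right_diff_distrib)
    qed
    finally show ?thesis .
  qed
  also have "\<dots> = 4 * L / real N" by (simp add: set_lebesgue_integral_def)
  finally show ?thesis .
qed

definition lattice_step :: "nat \<Rightarrow> (nat \<Rightarrow> real) \<Rightarrow> nat \<Rightarrow> int \<Rightarrow> real" where
  "lattice_step k \<gamma> N x = \<gamma> (nat \<lfloor>real k * (of_int (x mod int N) / real N)\<rfloor>)"

lemma step_neq_near_grid:
  assumes N: "N \<ge> 5" and k: "k \<ge> 1" and u: "u \<in> {0..<1}" and c: "c \<in> {0..<1}"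
    and f: "frac (c - u) < 4 / real N" and ne: "nat \<lfloor>real k * u\<rfloor> \<noteq> nat \<lfloor>real k * c\<rfloor>"
  shows "\<exists>j\<in>{1..k}. u \<in> {real j / real k - 4 / real N..real j / real k}"
proof (cases "u \<le> c")
  case True
  then have fr: "c < u + 4 / real N" using f u c by (simp add: frac_eq)
  have k0: "real k > 0" using k by simp
  define j where "j = nat \<lfloor>real k * c\<rfloor>"
  have "\<lfloor>real k * u\<rfloor> \<le> \<lfloor>real k * c\<rfloor>" using True by (intro floor_mono mult_left_mono) auto
  then have lt: "\<lfloor>real k * u\<rfloor> < \<lfloor>real k * c\<rfloor>" using ne by force
  have u0: "\<lfloor>real k * u\<rfloor> \<ge> 0" using u by simp
  have jj: "real j = of_int \<lfloor>real k * c\<rfloor>"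
  proof -
    have "0 \<le> \<lfloor>real k * c\<rfloor>" using lt u0 by linarith
    then show ?thesis unfolding j_def by (rule of_nat_nat)
  qed
  have j1: "real j \<le> real k * c" "real k * u < real j" using lt unfolding jj by linarith+
  have "real k * c \<le> real k" using c by (simp add: mult_left_le)
  then have "j \<le> k" using j1 by simp
  moreover have "j \<ge> 1" using lt u0 jj by linarith
  moreover have "real j / real k \<le> c" "u < real j / real k" using j1 k0 by (simp_all add: field_simps)
  ultimately show ?thesis using fr by (intro bexI[of _ j]) auto
next
  \<comment> \<open>Here the distance is small only across the seam of the torus, so u lies within
    4/N of 1, the grid point with j = k.\<close>
  case False
  then have "frac (c - u) = c + 1 - u" using u c by (auto simp: frac_unique_iff)
  then have "1 - 4 / real N < u" using f c by simp
  then show ?thesis using u k by (intro bexI[of _ k]) auto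
qed

text \<open>For each u, the step function at a contributing site differs from its value at u only if
  u is at most 4/N to the left of one of the k grid points. The intervals \<open>?I j\<close> of
  such u have total length at most 4 k / N, and elsewhere the error is that of the approximation
  itself.\<close>

lemma kavg_step:
  assumes f: "profile f" and K: "unity K" and N: "N \<ge> 5" and k: "k \<ge> 1" and g: "\<And>i. 0 \<le> \<gamma> i" "\<And>i. \<gamma> i \<le> 1"
  shows "csum N (\<lambda>x. \<bar>kavg f K N x - lattice_step k \<gamma> N x\<bar>) / real N
    \<le> (LINT u:{0..<1}|lborel. \<bar>f u - \<gamma> (nat \<lfloor>real k * u\<rfloor>)\<bar>) + 4 * real k / real N"
proof -
  have N0: "real N > 0" using N by simp
  let ?I = "\<lambda>j. {real j / real k - 4 / real N..real j / real k}"
  let ?r = "\<lambda>x. \<gamma> (nat \<lfloor>real k * (real x / real N)\<rfloor>)"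
  let ?g = "\<lambda>u. \<gamma> (nat \<lfloor>real k * u\<rfloor>)"
  have st: "lattice_step k \<gamma> N (int x) = ?r x" if "x < N" for x using that by (simp add: lattice_step_def)
  have gm: "?g \<in> borel_measurable borel" by measurable
  have if1: "set_integrable lborel {0..<1} (\<lambda>u. f u * bump K N x u)" for x by (rule kavg_integrable[OF f K N])
  have ib: "set_integrable lborel {0..<1} (bump K N x)" for x using kavg_integrable[OF profile_const_one K N] by simp
  have bb: "0 \<le> bump K N x u" "bump K N x u \<le> 1" for x u
  proof -
    show "0 \<le> bump K N x u" by (rule bump_nonneg[OF K])
    define m where "m = nat (x mod int N)"
    have m: "m < N" using N by (simp add: m_def nat_less_iff)
    have "bump K N x u = bump K N (int m) u" using periodic_mod[OF bump_periodic[of N K], of x u] N by (simp add: m_def)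
    also have "\<dots> \<le> csum N (\<lambda>x. bump K N x u)" unfolding csum_def
      using m by (intro member_le_sum) (auto simp: bump_nonneg[OF K])
    finally show "bump K N x u \<le> 1" by (simp add: bump_sum[OF K N])
  qed
  have mb: "bump K N x \<in> borel_measurable borel" for x
    by (intro borel_measurable_continuous_onI unity_continuous K N)
  have mf: "(\<lambda>u. indicator {0..<1} u * f u) \<in> borel_measurable borel" using f by (simp add: profile_def)
  have iabs: "set_integrable lborel {0..<1} (\<lambda>u. \<bar>f u - c\<bar> * bump K N x u)" for c x
  proof (rule unit_integrable)
    have "(\<lambda>u. indicator {0..<1} u * \<bar>indicator {0..<1} u * f u - c\<bar> * bump K N x u) \<in> borel_measurable borel"
      by (intro borel_measurable_times borel_measurable_abs borel_measurable_diff mf mb) auto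
    also have "(\<lambda>u. indicator {0..<1} u * \<bar>indicator {0..<1} u * f u - c\<bar> * bump K N x u) =
        (\<lambda>u. indicator {0..<1} u * (\<bar>f u - c\<bar> * bump K N x u))"
      by (auto simp: fun_eq_iff indicator_def)
    finally show "(\<lambda>u. indicator {0..<1} u * (\<bar>f u - c\<bar> * bump K N x u)) \<in> borel_measurable borel" .
    fix u :: real assume u: "u \<in> {0..<1}"
    have "0 \<le> f u" "f u \<le> 1" using f u by (auto simp: profile_def)
    then have "\<bar>f u - c\<bar> \<le> 1 + \<bar>c\<bar>" by linarith
    then have "\<bar>f u - c\<bar> * bump K N x u \<le> (1 + \<bar>c\<bar>) * 1" using bb by (intro mult_mono) auto
    then show "\<bar>\<bar>f u - c\<bar> * bump K N x u\<bar> \<le> 1 + \<bar>c\<bar>" using bb[of x u] by (simp add: abs_mult)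
  qed
  have ig: "set_integrable lborel {0..<1} (\<lambda>u. \<bar>f u - ?g u\<bar>)"
  proof (rule unit_integrable)
    have "(\<lambda>u. indicator {0..<1} u * \<bar>indicator {0..<1} u * f u - ?g u\<bar>) \<in> borel_measurable borel"
      by (intro borel_measurable_times borel_measurable_abs borel_measurable_diff mf gm) auto
    also have "(\<lambda>u. indicator {0..<1} u * \<bar>indicator {0..<1} u * f u - ?g u\<bar>) =
        (\<lambda>u. indicator {0..<1} u * \<bar>f u - ?g u\<bar>)"
      by (auto simp: fun_eq_iff indicator_def)
    finally show "(\<lambda>u. indicator {0..<1} u * \<bar>f u - ?g u\<bar>) \<in> borel_measurable borel" .
    fix u :: real assume u: "u \<in> {0..<1}"
    have "0 \<le> f u" "f u \<le> 1" using f u by (auto simp: profile_def)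
    then show "\<bar>\<bar>f u - ?g u\<bar>\<bar> \<le> 1" using g[of "nat \<lfloor>real k * u\<rfloor>"] by linarith
  qed
  have iI: "set_integrable lborel {0..<1} (indicator (?I j) :: real \<Rightarrow> real)" for j
    by (rule unit_integrable[of _ 1]) (auto simp: indicator_def)
  have 1: "\<bar>kavg f K N (int x) - c\<bar> \<le> real N * (LINT u:{0..<1}|lborel. \<bar>f u - c\<bar> * bump K N (int x) u)" for x c
  proof -
    have "c = real N * (LINT u:{0..<1}|lborel. c * bump K N (int x) u)"
      using N0 by (simp add: bump_integral[OF K N])
    then have "kavg f K N (int x) - c = real N * ((LINT u:{0..<1}|lborel. f u * bump K N (int x) u) - (LINT u:{0..<1}|lborel. c * bump K N (int x) u))"
      unfolding kavg_def right_diff_distrib by simp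
    also have "(LINT u:{0..<1}|lborel. f u * bump K N (int x) u) - (LINT u:{0..<1}|lborel. c * bump K N (int x) u)
      = (LINT u:{0..<1}|lborel. f u * bump K N (int x) u - c * bump K N (int x) u)"
      using if1 ib by (intro set_integral_diff(2)[symmetric]) auto
    finally have e: "kavg f K N (int x) - c = real N * (LINT u:{0..<1}|lborel. f u * bump K N (int x) u - c * bump K N (int x) u)" .
    have i: "set_integrable lborel {0..<1} (\<lambda>u. f u * bump K N (int x) u - c * bump K N (int x) u)"
      using if1 ib by (intro set_integral_diff(1)) auto
    have "\<bar>LINT u:{0..<1}|lborel. f u * bump K N (int x) u - c * bump K N (int x) u\<bar>
      \<le> (LINT u:{0..<1}|lborel. \<bar>f u * bump K N (int x) u - c * bump K N (int x) u\<bar>)"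
      using set_integral_norm_bound[OF i] by simp
    also have "\<dots> = (LINT u:{0..<1}|lborel. \<bar>f u - c\<bar> * bump K N (int x) u)"
      using bb by (simp add: left_diff_distrib[symmetric] abs_mult)
    finally show ?thesis unfolding e abs_mult using N0 by simp
  qed
  have "csum N (\<lambda>x. \<bar>kavg f K N x - lattice_step k \<gamma> N x\<bar>) \<le> (\<Sum>x<N. real N * (LINT u:{0..<1}|lborel. \<bar>f u - ?r x\<bar> * bump K N (int x) u))"
    unfolding csum_def using 1 st by (intro sum_mono) simp
  also have "\<dots> = real N * (LINT u:{0..<1}|lborel. \<Sum>x<N. \<bar>f u - ?r x\<bar> * bump K N (int x) u)"
    using iabs by (subst set_integral_finite_sum) (auto simp: sum_distrib_left)
  also have "\<dots> \<le> real N * (LINT u:{0..<1}|lborel. \<bar>f u - ?g u\<bar> + (\<Sum>j=1..k. indicator (?I j) u))"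
  proof (intro mult_left_mono set_integral_mono)
    show "set_integrable lborel {0..<1} (\<lambda>u. \<Sum>x<N. \<bar>f u - ?r x\<bar> * bump K N (int x) u)"
      using iabs unfolding set_integrable_def scaleR_sum_right by (intro Bochner_Integration.integrable_sum) auto
    show "set_integrable lborel {0..<1} (\<lambda>u. \<bar>f u - ?g u\<bar> + (\<Sum>j=1..k. indicator (?I j) u))"
    proof (rule set_integral_add(1)[OF ig])
      show "set_integrable lborel {0..<1} (\<lambda>u. \<Sum>j=1..k. indicator (?I j) u :: real)"
        using iI unfolding set_integrable_def scaleR_sum_right by (intro Bochner_Integration.integrable_sum) auto
    qed
    fix u :: real assume u: "u \<in> {0..<1}"
    have "(\<Sum>x<N. \<bar>f u - ?r x\<bar> * bump K N (int x) u) \<le> (\<Sum>x<N. (\<bar>f u - ?g u\<bar> + (\<Sum>j=1..k. indicator (?I j) u)) * bump K N (int x) u)"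
    proof (intro sum_mono)
      fix x assume x: "x \<in> {..<N}"
      show "\<bar>f u - ?r x\<bar> * bump K N (int x) u \<le> (\<bar>f u - ?g u\<bar> + (\<Sum>j=1..k. indicator (?I j) u)) * bump K N (int x) u"
      proof (cases "bump K N (int x) u = 0")
        case False
        have "\<bar>?g u - ?r x\<bar> \<le> (\<Sum>j=1..k. indicator (?I j) u)"
        proof (cases "nat \<lfloor>real k * u\<rfloor> = nat \<lfloor>real k * (real x / real N)\<rfloor>")
          case True then show ?thesis by (simp add: sum_nonneg)
        next
          case ne: False
          from False have "real N * frac (real x / real N - u) < 4"
            using K by (auto simp: bump_def unity_def window_def not_le[symmetric])
          then have fr: "frac (real x / real N - u) < 4 / real N" using N0 by (simp add: field_simps)
          have "real x / real N \<in> {0..<1}" using x by simp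
          from step_neq_near_grid[OF N k u this fr ne] obtain j where j: "j \<in> {1..k}" "u \<in> ?I j" by blast
          have "\<bar>?g u - ?r x\<bar> \<le> 1" using g[of "nat \<lfloor>real k * u\<rfloor>"] g[of "nat \<lfloor>real k * (real x / real N)\<rfloor>"] by linarith
          also have "1 = (indicator (?I j) u :: real)" using j by simp
          also have "\<dots> \<le> (\<Sum>j=1..k. indicator (?I j) u)" using j by (intro member_le_sum) auto
          finally show ?thesis .
        qed
        then have "\<bar>f u - ?r x\<bar> \<le> \<bar>f u - ?g u\<bar> + (\<Sum>j=1..k. indicator (?I j) u)" by linarith
        then show ?thesis by (rule mult_right_mono) (rule bb)
      qed simp
    qed
    also have "\<dots> = (\<bar>f u - ?g u\<bar> + (\<Sum>j=1..k. indicator (?I j) u)) * csum N (\<lambda>x. bump K N x u)"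
      by (simp only: csum_def sum_distrib_left)
    also have "\<dots> = \<bar>f u - ?g u\<bar> + (\<Sum>j=1..k. indicator (?I j) u)" by (simp only: bump_sum[OF K N] mult_1_right)
    finally show "(\<Sum>x<N. \<bar>f u - ?r x\<bar> * bump K N (int x) u) \<le> \<bar>f u - ?g u\<bar> + (\<Sum>j=1..k. indicator (?I j) u)" .
  qed (use N0 in auto)
  also have "(LINT u:{0..<1}|lborel. \<bar>f u - ?g u\<bar> + (\<Sum>j=1..k. indicator (?I j) u)) =
     (LINT u:{0..<1}|lborel. \<bar>f u - ?g u\<bar>) + (\<Sum>j=1..k. LINT u:{0..<1}|lborel. indicator (?I j) u)"
  proof -
    have "set_integrable lborel {0..<1} (\<lambda>u. \<Sum>j=1..k. indicator (?I j) u :: real)"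
      using iI unfolding set_integrable_def scaleR_sum_right by (intro Bochner_Integration.integrable_sum) auto
    then show ?thesis using set_integral_add(2)[OF ig] iI by (simp add: set_integral_finite_sum)
  qed
  also have "(\<Sum>j=1..k. LINT u:{0..<1}|lborel. indicator (?I j) u :: real) \<le> (\<Sum>j=1..k. 4 / real N)"
  proof (intro sum_mono)
    fix j
    have "(LINT u:{0..<1}|lborel. indicator (?I j) u :: real) = measure lborel ({0..<1} \<inter> ?I j)"
      unfolding set_lebesgue_integral_def by (simp add: indicator_inter_arith[symmetric])
    also have "\<dots> \<le> measure lborel (?I j)"
      by (intro measure_mono_fmeasurable) (auto intro!: fmeasurableI simp: emeasure_lborel_Icc_eq)
    also have "\<dots> = 4 / real N" using N0 by simp
    finally show "(LINT u:{0..<1}|lborel. indicator (?I j) u :: real) \<le> 4 / real N" .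
  qed
  finally have "csum N (\<lambda>x. \<bar>kavg f K N x - lattice_step k \<gamma> N x\<bar>) \<le>
     real N * ((LINT u:{0..<1}|lborel. \<bar>f u - ?g u\<bar>) + (\<Sum>j=1..k. 4 / real N))" using N0 by simp
  then show ?thesis unfolding pos_divide_le_eq[OF N0] by (simp add: mult.commute)
qed

section \<open>The weak equation tested with splines\<close>

definition clipped :: "real \<Rightarrow> (real \<Rightarrow> real \<Rightarrow> real) \<Rightarrow> real \<times> real \<Rightarrow> real" where
  "clipped T \<rho> p = indicator ({0..T} \<times> {0..<1}) p * \<rho> (fst p) (snd p)"

lemma clipped_measurable:
  assumes "weak_solution T \<rho>ini \<rho>" shows "clipped T \<rho> \<in> borel_measurable borel"
proof -
  have "(\<lambda>(t, u). \<rho> t u) \<in> borel_measurable (restrict_space borel ({0..T} \<times> {0..<1}))"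
    using assms by (simp add: weak_solution_def)
  moreover have "({0..T} \<times> {0..<1::real}) \<inter> space borel \<in> sets borel"
    by (auto simp: borel_prod[symmetric])
  ultimately have "(\<lambda>p. indicator ({0..T} \<times> {0..<1}) p *\<^sub>R (case p of (t, u) \<Rightarrow> \<rho> t u)) \<in> borel_measurable borel"
    by (simp add: borel_measurable_restrict_space_iff)
  also have "(\<lambda>p. indicator ({0..T} \<times> {0..<1}) p *\<^sub>R (case p of (t, u) \<Rightarrow> \<rho> t u)) = clipped T \<rho>"
    by (auto simp: clipped_def fun_eq_iff)
  finally show ?thesis .
qed

lemma weak_profile:
  assumes w: "weak_solution T \<rho>ini \<rho>" and s: "s \<in> {0..T}"
  shows "profile (\<rho> s)" "profile (\<lambda>u. \<H> (\<rho> s u))"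
proof -
  have m: "(\<lambda>u. clipped T \<rho> (s, u)) \<in> borel_measurable borel"
    by (rule measurable_compose[OF _ clipped_measurable[OF w]]) (auto intro!: borel_measurable_continuous_onI continuous_intros)
  have e: "clipped T \<rho> (s, u) = indicator {0..<1} u * \<rho> s u" for u using s by (simp add: clipped_def indicator_def)
  have b: "\<forall>u\<in>{0..<1}. 0 \<le> \<rho> s u \<and> \<rho> s u \<le> 1" using w s by (auto simp: weak_solution_def)
  show "profile (\<rho> s)" using m b by (simp add: profile_def e)
  have "(\<lambda>u. indicator {0..<1} u * \<H> (clipped T \<rho> (s, u))) \<in> borel_measurable borel"
    by (intro borel_measurable_times measurable_compose[OF m H_measurable]) auto
  also have "(\<lambda>u. indicator {0..<1} u * \<H> (clipped T \<rho> (s, u))) = (\<lambda>u. indicator {0..<1} u * \<H> (\<rho> s u))"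
    by (auto simp: e indicator_def fun_eq_iff)
  finally show "profile (\<lambda>u. \<H> (\<rho> s u))" using b H_bounds by (simp add: profile_def)
qed

lemma C12_bump:
  assumes N: "N \<ge> 5"
  shows "C12_test s (\<lambda>_. bump spline N x) (\<lambda>_ _. 0) (\<lambda>_ u. - real N * bump spline1 N x u) (\<lambda>_ u. (real N)\<^sup>2 * bump spline2 N x u)"
proof -
  have c: "continuous_on UNIV (bump spline N x)" "continuous_on UNIV (bump spline1 N x)" "continuous_on UNIV (bump spline2 N x)"
    using bump_continuous[OF N] window_spline window_spline1 window_spline2 continuous_spline continuous_spline1 continuous_spline2
    by auto
  have c': "continuous_on ({0..s} \<times> UNIV) (\<lambda>(t, u). a * f u)" if "continuous_on UNIV f" for a and f :: "real \<Rightarrow> real"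
    unfolding case_prod_beta by (intro continuous_intros continuous_on_compose2[OF that]) auto
  have d2: "((\<lambda>u. - real N * bump spline1 N x u) has_real_derivative (real N)\<^sup>2 * bump spline2 N x u) (at u)" for u
    using DERIV_cmult[OF bump_deriv[OF N window_spline1 window_spline2 spline1_deriv], of "- real N" x u]
    by (simp add: power2_eq_square mult.assoc)
  show ?thesis unfolding C12_test_def
    using c'[OF c(1), of 1] c'[OF c(2), of "- real N"] c'[OF c(3), of "(real N)\<^sup>2"] c'[OF c(1), of 0]
      bump_deriv[OF N window_spline window_spline1 spline_deriv] d2
    by (auto simp: bump_periodic1)
qed

lemma lattice_equation:
  assumes w: "weak_solution s \<rho>ini \<rho>" and N: "N \<ge> 5"
  shows "kavg (\<rho> s) spline N x = kavg \<rho>ini spline N x + (LINT r:{0..s}|lborel. (real N)\<^sup>2 *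
     (kavg (\<lambda>u. \<H> (\<rho> r u)) hat N (x + 1) + kavg (\<lambda>u. \<H> (\<rho> r u)) hat N (x - 1) - 2 * kavg (\<lambda>u. \<H> (\<rho> r u)) hat N x))"
proof -
  have "torus_inner (\<rho> s) (bump spline N x) = torus_inner \<rho>ini (bump spline N x)
          + (LINT t:{0..s}|lborel. torus_inner (\<rho> t) (\<lambda>_. 0))
          + (LINT t:{0..s}|lborel. torus_inner (\<lambda>u. \<H> (\<rho> t u)) (\<lambda>u. (real N)\<^sup>2 * bump spline2 N x u))"
    using w C12_bump[OF N, of s x] unfolding weak_solution_def by fast
  moreover have "(LINT t:{0..s}|lborel. torus_inner (\<rho> t) (\<lambda>_. 0)) = 0"
    by (simp add: torus_inner_def torus_integral_def set_lebesgue_integral_def)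
  moreover have "(LINT t:{0..s}|lborel. real N * torus_inner (\<lambda>u. \<H> (\<rho> t u)) (\<lambda>u. (real N)\<^sup>2 * bump spline2 N x u))
    = (LINT r:{0..s}|lborel. (real N)\<^sup>2 *
     (kavg (\<lambda>u. \<H> (\<rho> r u)) hat N (x + 1) + kavg (\<lambda>u. \<H> (\<rho> r u)) hat N (x - 1) - 2 * kavg (\<lambda>u. \<H> (\<rho> r u)) hat N x))"
  proof (rule set_lebesgue_integral_cong, simp, intro allI impI)
    fix r assume r: "r \<in> {0..s}"
    have p: "profile (\<lambda>u. \<H> (\<rho> r u))" by (rule weak_profile(2)[OF w r])
    define f where "f u = \<H> (\<rho> r u)" for u
    note i = kavg_integrable[OF p[folded f_def] unity_hat N]
    have "torus_inner (\<lambda>u. \<H> (\<rho> r u)) (\<lambda>u. (real N)\<^sup>2 * bump spline2 N x u) =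
       (LINT u:{0..<1}|lborel. (real N)\<^sup>2 * (f u * bump hat N (x + 1) u + f u * bump hat N (x - 1) u - 2 * (f u * bump hat N x u)))"
      unfolding torus_inner_def torus_integral_def bump_spline2[OF N] f_def by (simp add: algebra_simps)
    also have "\<dots> = (real N)\<^sup>2 * (LINT u:{0..<1}|lborel. f u * bump hat N (x + 1) u + f u * bump hat N (x - 1) u - 2 * (f u * bump hat N x u))"
      by simp
    also have "(LINT u:{0..<1}|lborel. f u * bump hat N (x + 1) u + f u * bump hat N (x - 1) u - 2 * (f u * bump hat N x u))
      = (LINT u:{0..<1}|lborel. f u * bump hat N (x + 1) u + f u * bump hat N (x - 1) u) - (LINT u:{0..<1}|lborel. 2 * (f u * bump hat N x u))"
      by (rule set_integral_diff(2)) (use i set_integral_add(1)[OF i i] in auto)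
    also have "(LINT u:{0..<1}|lborel. f u * bump hat N (x + 1) u + f u * bump hat N (x - 1) u) =
       (LINT u:{0..<1}|lborel. f u * bump hat N (x + 1) u) + (LINT u:{0..<1}|lborel. f u * bump hat N (x - 1) u)"
      by (rule set_integral_add(2)[OF i i])
    also have "(LINT u:{0..<1}|lborel. 2 * (f u * bump hat N x u)) = 2 * (LINT u:{0..<1}|lborel. f u * bump hat N x u)"
      by (rule set_integral_mult_right)
    finally have e: "torus_inner (\<lambda>u. \<H> (\<rho> r u)) (\<lambda>u. (real N)\<^sup>2 * bump spline2 N x u) = (real N)\<^sup>2 *
       ((LINT u:{0..<1}|lborel. f u * bump hat N (x + 1) u) + (LINT u:{0..<1}|lborel. f u * bump hat N (x - 1) u)
         - 2 * (LINT u:{0..<1}|lborel. f u * bump hat N x u))" .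
    have alg: "n * (n2 * (a + b - 2 * c)) = n2 * (n * a + n * b - 2 * (n * c))" for n n2 a b c :: real
      by (simp add: algebra_simps)
    show "real N * torus_inner (\<lambda>u. \<H> (\<rho> r u)) (\<lambda>u. (real N)\<^sup>2 * bump spline2 N x u) = (real N)\<^sup>2 *
     (kavg (\<lambda>u. \<H> (\<rho> r u)) hat N (x + 1) + kavg (\<lambda>u. \<H> (\<rho> r u)) hat N (x - 1) - 2 * kavg (\<lambda>u. \<H> (\<rho> r u)) hat N x)"
      unfolding e kavg_def f_def by (rule alg)
  qed
  ultimately show ?thesis
    by (simp add: kavg_def torus_inner_def torus_integral_def distrib_left)
qed

lemma kavg_measurable:
  assumes w: "weak_solution T \<rho>ini \<rho>" and K: "unity K" and N: "N \<ge> 5" and g: "g \<in> borel_measurable borel"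
  shows "(\<lambda>s. indicator {0..T} s * kavg (\<lambda>u. g (\<rho> s u)) K N x) \<in> borel_measurable borel"
proof -
  have c: "continuous_on UNIV (bump K N x)" by (rule unity_continuous[OF K N])
  have m2: "(\<lambda>p::real \<times> real. bump K N x (snd p)) \<in> borel_measurable borel"
    by (intro borel_measurable_continuous_onI continuous_on_compose2[OF c] continuous_intros) auto
  have "(\<lambda>p. indicator ({0..T} \<times> {0..<1}) p * g (clipped T \<rho> p) * bump K N x (snd p)) \<in> borel_measurable borel"
    using measurable_compose[OF clipped_measurable[OF w] g] m2
    by (intro borel_measurable_times) (auto intro!: borel_measurable_indicator simp: borel_prod[symmetric])
  then have "(\<lambda>(s, u). indicator ({0..T} \<times> {0..<1}) (s, u) * g (clipped T \<rho> (s, u)) * bump K N x u) \<in> borel_measurable (lborel \<Otimes>\<^sub>M lborel)"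
  proof -
    assume m: "(\<lambda>p. indicator ({0..T} \<times> {0..<1}) p * g (clipped T \<rho> p) * bump K N x (snd p)) \<in> borel_measurable borel"
    have e: "(\<lambda>(s, u). indicator ({0..T} \<times> {0..<1}) (s, u) * g (clipped T \<rho> (s, u)) * bump K N x u) =
      (\<lambda>p. indicator ({0..T} \<times> {0..<1}) p * g (clipped T \<rho> p) * bump K N x (snd p))"
      by (auto simp: fun_eq_iff)
    show ?thesis unfolding e lborel_prod using m by simp
  qed
  then have "(\<lambda>s. LINT u|lborel. indicator ({0..T} \<times> {0..<1}) (s, u) * g (clipped T \<rho> (s, u)) * bump K N x u) \<in> borel_measurable lborel"
    by (rule lborel.borel_measurable_lebesgue_integral)
  then have "(\<lambda>s. real N * (LINT u|lborel. indicator ({0..T} \<times> {0..<1}) (s, u) * g (clipped T \<rho> (s, u)) * bump K N x u)) \<in> borel_measurable borel"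
    by simp
  also have "(\<lambda>s. real N * (LINT u|lborel. indicator ({0..T} \<times> {0..<1}) (s, u) * g (clipped T \<rho> (s, u)) * bump K N x u))
     = (\<lambda>s. indicator {0..T} s * kavg (\<lambda>u. g (\<rho> s u)) K N x)"
  proof
    fix s
    show "real N * (LINT u|lborel. indicator ({0..T} \<times> {0..<1}) (s, u) * g (clipped T \<rho> (s, u)) * bump K N x u)
     = indicator {0..T} s * kavg (\<lambda>u. g (\<rho> s u)) K N x"
    proof (cases "s \<in> {0..T}")
      case True
      then have "(LINT u|lborel. indicator ({0..T} \<times> {0..<1}) (s, u) * g (clipped T \<rho> (s, u)) * bump K N x u) =
         (LINT u:{0..<1}|lborel. g (\<rho> s u) * bump K N x u)"
        unfolding set_lebesgue_integral_def by (intro Bochner_Integration.integral_cong) (auto simp: indicator_def clipped_def)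
      then show ?thesis using True by (simp add: kavg_def)
    next
      case False
      then have "indicator ({0..T} \<times> {0..<1}) (s, u) = (0::real)" for u :: real by (auto simp: indicator_def)
      then show ?thesis using False by simp
    qed
  qed
  finally show ?thesis .
qed

text \<open>Every s in [0, T] serves as terminal time of the weak identity, and this family of
  identities is the integrated lattice equation. At s = 0 the integral is over a null set, which
  identifies the value at time 0 with the average of the initial profile.\<close>

lemma lattice_prim:
  assumes w: "weak_solution_at_all_times T \<rho>ini \<rho>" and T: "T \<ge> 0" and N: "N \<ge> 5"
  shows "prim T (\<lambda>s. kavg (\<rho> s) spline N x) (\<lambda>r. (real N)\<^sup>2 *
     (kavg (\<lambda>u. \<H> (\<rho> r u)) hat N (x + 1) + kavg (\<lambda>u. \<H> (\<rho> r u)) hat N (x - 1) - 2 * kavg (\<lambda>u. \<H> (\<rho> r u)) hat N x))"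
proof (rule primI)
  have wT: "weak_solution T \<rho>ini \<rho>" using w T by (simp add: weak_solution_at_all_times_def)
  let ?k = "\<lambda>r x. kavg (\<lambda>u. \<H> (\<rho> r u)) hat N x"
  note m = kavg_measurable[OF wT unity_hat N H_measurable]
  have "(\<lambda>r. (real N)\<^sup>2 * (indicator {0..T} r * ?k r (x + 1) + indicator {0..T} r * ?k r (x - 1) - 2 * (indicator {0..T} r * ?k r x))) \<in> borel_measurable borel"
    by (intro borel_measurable_times borel_measurable_diff borel_measurable_add m borel_measurable_const)
  then show "(\<lambda>s. indicator {0..T} s * ((real N)\<^sup>2 * (?k s (x + 1) + ?k s (x - 1) - 2 * ?k s x))) \<in> borel_measurable lborel"
    by (simp add: algebra_simps)
  show "\<bar>(real N)\<^sup>2 * (?k s (x + 1) + ?k s (x - 1) - 2 * ?k s x)\<bar> \<le> (real N)\<^sup>2 * 2" if s: "s \<in> {0..T}" for s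
  proof -
    note b = kavg_bounds[OF weak_profile(2)[OF wT s] unity_hat N]
    have "\<bar>?k s (x + 1) + ?k s (x - 1) - 2 * ?k s x\<bar> \<le> 2" using b[of "x + 1"] b[of "x - 1"] b[of x] by linarith
    then show ?thesis by (simp add: abs_mult mult_left_mono)
  qed
  have eq: "kavg (\<rho> s) spline N x = kavg \<rho>ini spline N x + (LINT r:{0..s}|lborel. (real N)\<^sup>2 * (?k r (x + 1) + ?k r (x - 1) - 2 * ?k r x))"
    if "s \<in> {0..T}" for s
    by (rule lattice_equation[OF _ N]) (use w that in \<open>auto simp: weak_solution_at_all_times_def\<close>)
  have "(LINT r:{0..0}|lborel. (real N)\<^sup>2 * (?k r (x + 1) + ?k r (x - 1) - 2 * ?k r x)) = 0"
    unfolding set_lebesgue_integral_def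
    by (rule integral_eq_zero_AE) (use AE_lborel_singleton[of "0::real"] in \<open>eventually_elim, auto\<close>)
  with eq[of 0] T have "kavg (\<rho> 0) spline N x = kavg \<rho>ini spline N x" by simp
  with eq show "kavg (\<rho> s) spline N x = kavg (\<rho> 0) spline N x + (LINT r:{0..s}|lborel. (real N)\<^sup>2 * (?k r (x + 1) + ?k r (x - 1) - 2 * ?k r x))"
    if "s \<in> {0..T}" for s using that by simp
qed

lemma lattice_initial:
  assumes w: "weak_solution_at_all_times T \<rho>ini \<rho>" and T: "T \<ge> 0" and N: "N \<ge> 5"
  shows "kavg (\<rho> 0) spline N x = kavg \<rho>ini spline N x"
proof -
  have "(LINT r:{0..0}|lborel. (real N)\<^sup>2 *
     (kavg (\<lambda>u. \<H> (\<rho> r u)) hat N (x + 1) + kavg (\<lambda>u. \<H> (\<rho> r u)) hat N (x - 1) - 2 * kavg (\<lambda>u. \<H> (\<rho> r u)) hat N x)) = 0"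
    unfolding set_lebesgue_integral_def
    by (rule integral_eq_zero_AE) (use AE_lborel_singleton[of "0::real"] in \<open>eventually_elim, auto\<close>)
  then show ?thesis using lattice_equation[OF _ N, of 0 \<rho>ini \<rho> x] w T by (simp add: weak_solution_at_all_times_def)
qed

section \<open>Approximation by step functions\<close>

text \<open>A measurable function is an almost everywhere limit of continuous ones. Clipping these
  to [0, 1] makes the indicator of B an integrable majorant.\<close>

lemma continuous_approximation:
  fixes F :: "real \<times> real \<Rightarrow> real"
  assumes m: "F \<in> borel_measurable borel" and b: "\<And>p. 0 \<le> F p" "\<And>p. F p \<le> 1"
    and B: "B \<in> sets borel" "emeasure lborel B < \<infinity>" and e: "\<epsilon> > 0"
  shows "\<exists>g. continuous_on UNIV g \<and> (\<forall>p. 0 \<le> g p \<and> g p \<le> 1) \<and> (LINT p:B|lborel. \<bar>F p - g p\<bar>) < \<epsilon>"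
proof -
  have "F \<in> borel_measurable lebesgue" using m by (auto intro: measurable_completion)
  then have "F measurable_on UNIV" by (simp add: measurable_on_iff_borel_measurable)
  then obtain N g where N: "negligible N" and c: "\<And>n. continuous_on UNIV (g n)"
    and lim: "\<And>x. x \<notin> N \<Longrightarrow> (\<lambda>n. g n x) \<longlonglongrightarrow> F x"
    unfolding measurable_on_def by auto
  define G where "G n p = max 0 (min 1 (g n p))" for n :: nat and p
  have Gc: "continuous_on UNIV (G n)" for n unfolding G_def[abs_def] by (intro continuous_intros c)
  have Gb: "0 \<le> G n p" "G n p \<le> 1" for n p by (auto simp: G_def)
  have ae: "AE p in lborel. p \<notin> N"
  proof -
    have "N \<in> null_sets lebesgue" using N by (simp add: negligible_iff_null_sets)
    then have "AE p in lebesgue. p \<notin> N" by (rule AE_not_in)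
    then show ?thesis by (simp add: AE_completion_iff)
  qed
  have iB: "integrable lborel (indicator B :: real \<times> real \<Rightarrow> real)" using B by (simp add: integrable_indicator_iff)
  have mG: "G n \<in> borel_measurable lborel" for n using borel_measurable_continuous_onI[OF Gc] by simp
  have "(\<lambda>n. LINT p|lborel. indicator B p *\<^sub>R \<bar>F p - G n p\<bar>) \<longlonglongrightarrow> (LINT p|(lborel :: (real \<times> real) measure). (0::real))"
  proof (rule integral_dominated_convergence[where w = "indicator B"])
    show "(\<lambda>p. indicator B p *\<^sub>R \<bar>F p - G n p\<bar>) \<in> borel_measurable lborel" for n
      using B m mG by (intro borel_measurable_scaleR borel_measurable_abs borel_measurable_diff) auto
    show "AE p in lborel. (\<lambda>n. indicator B p *\<^sub>R \<bar>F p - G n p\<bar>) \<longlonglongrightarrow> 0"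
      using ae
    proof eventually_elim
      case (elim p)
      have "(\<lambda>n. max 0 (min 1 (g n p))) \<longlonglongrightarrow> max 0 (min 1 (F p))"
        using lim[OF elim] by (intro tendsto_intros)
      then have "(\<lambda>n. G n p) \<longlonglongrightarrow> F p" using b[of p] by (simp add: G_def)
      then have "(\<lambda>n. \<bar>F p - G n p\<bar>) \<longlonglongrightarrow> \<bar>F p - F p\<bar>" by (intro tendsto_intros)
      then show ?case using tendsto_scaleR[OF tendsto_const, of _ _ sequentially "indicator B p"] by fastforce
    qed
    show "AE p in lborel. norm (indicator B p *\<^sub>R \<bar>F p - G n p\<bar>) \<le> indicator B p" for n
    proof (intro AE_I2)
      fix p
      have "\<bar>F p - G n p\<bar> \<le> 1" using b[of p] Gb[of n p] by (simp add: abs_le_iff)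
      then show "norm (indicator B p *\<^sub>R \<bar>F p - G n p\<bar>) \<le> indicator B p" by (simp add: indicator_def)
    qed
  qed (use iB in auto)
  then have "(\<lambda>n. LINT p:B|lborel. \<bar>F p - G n p\<bar>) \<longlonglongrightarrow> 0" by (simp add: set_lebesgue_integral_def)
  then have "\<forall>\<^sub>F n in sequentially. (LINT p:B|lborel. \<bar>F p - G n p\<bar>) < \<epsilon>"
    using e by (rule order_tendstoD(2))
  then obtain n where "(LINT p:B|lborel. \<bar>F p - G n p\<bar>) < \<epsilon>" by (auto simp: eventually_sequentially)
  then show ?thesis using Gc Gb by blast
qed

lemma step_approximation:
  fixes F :: "real \<times> real \<Rightarrow> real"
  assumes m: "F \<in> borel_measurable borel" and b: "\<And>p. 0 \<le> F p" "\<And>p. F p \<le> 1"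
    and t: "t > 0" and e: "\<epsilon> > 0"
  shows "\<exists>k\<ge>1. \<exists>\<gamma>. (\<forall>i j. 0 \<le> \<gamma> i j \<and> \<gamma> i j \<le> (1::real)) \<and>
    (LINT s:{0..t}|lborel. LINT u:{0..<1}|lborel. \<bar>F (s, u) - \<gamma> (nat \<lfloor>real k * (s / t)\<rfloor>) (nat \<lfloor>real k * u\<rfloor>)\<bar>) \<le> \<epsilon>"
proof -
  define B :: "(real \<times> real) set" where "B = {0..t} \<times> {0..<1}"
  have Bs: "B \<in> sets borel" by (auto simp: B_def borel_prod[symmetric])
  have eB: "emeasure lborel B = ennreal t"
  proof -
    have "emeasure lborel B = emeasure (lborel \<Otimes>\<^sub>M lborel) ({0..t} \<times> {0..<1::real})" by (simp add: lborel_prod B_def)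
    also have "\<dots> = ennreal t" using t by (simp add: lborel.emeasure_pair_measure_Times)
    finally show ?thesis .
  qed
  have mB: "measure lborel B = t" using t by (simp add: measure_def eB)
  obtain g where gc: "continuous_on UNIV g" and gb: "\<And>p. 0 \<le> g p" "\<And>p. g p \<le> 1"
    and g: "(LINT p:B|lborel. \<bar>F p - g p\<bar>) < \<epsilon> / 2"
    using continuous_approximation[OF m b Bs _ half_gt_zero[OF e]] eB by auto
  define \<epsilon>' where "\<epsilon>' = \<epsilon> / (2 * t)"
  have e': "\<epsilon>' > 0" using e t by (simp add: \<epsilon>'_def)
  have "uniformly_continuous_on ({0..t} \<times> {0..1}) g"
    by (intro compact_uniformly_continuous compact_Times continuous_on_subset[OF gc]) auto
  then obtain d where d: "d > 0"
    "\<And>p q. p \<in> {0..t} \<times> {0..1} \<Longrightarrow> q \<in> {0..t} \<times> {0..1} \<Longrightarrow> dist q p < d \<Longrightarrow> dist (g q) (g p) < \<epsilon>'"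
    unfolding uniformly_continuous_on_def using e' by metis
  \<comment> \<open>With this k the sum of the two side lengths t/k and 1/k of a cell is below d, so
    g varies by less than the tolerance on each cell. The step value is g at the lower left
    corner.\<close>
  obtain k :: nat where k: "real k > (t + 1) / d" using reals_Archimedean2 by blast
  have "(t + 1) / d > 0" using t d by simp
  then have k0: "real k > 0" using k by linarith
  have kd: "t / real k + 1 / real k < d"
  proof -
    have "(t + 1) < real k * d" using k d by (simp add: divide_less_eq)
    then show ?thesis using k0 by (simp add: add_divide_distrib[symmetric] divide_less_eq mult.commute)
  qed
  define \<gamma> where "\<gamma> i j = g (real i * t / real k, real j / real k)" for i j :: nat
  define \<Gamma> where "\<Gamma> p = \<gamma> (nat \<lfloor>real k * (fst p / t)\<rfloor>) (nat \<lfloor>real k * snd p\<rfloor>)" for p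
  have close: "\<bar>g p - \<Gamma> p\<bar> \<le> \<epsilon>'" if "p \<in> B" for p
  proof -
    obtain s u where p: "p = (s, u)" by (cases p)
    have s: "0 \<le> s" "s \<le> t" and u: "0 \<le> u" "u < 1" using that by (auto simp: p B_def)
    define s' where "s' = real (nat \<lfloor>real k * (s / t)\<rfloor>) * t / real k"
    define u' where "u' = real (nat \<lfloor>real k * u\<rfloor>) / real k"
    have fl: "real (nat \<lfloor>x\<rfloor>) \<le> x" "x < real (nat \<lfloor>x\<rfloor>) + 1" if "x \<ge> 0" for x :: real using that by linarith+
    have "0 \<le> real k * (s / t)" using s t by simp
    note f1 = fl[OF this]
    have "0 \<le> real k * u" using u by simp
    note f2 = fl[OF this]
    have s1: "s' \<le> s" "s < s' + t / real k" "0 \<le> s'" using f1 t k0 unfolding s'_def by (simp_all add: field_simps)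
    have u1: "u' \<le> u" "u < u' + 1 / real k" "0 \<le> u'" using f2 k0 unfolding u'_def by (simp_all add: field_simps)
    have "dist (s', u') (s, u) \<le> dist s' s + dist u' u" unfolding dist_Pair_Pair
      by (rule sqrt_sum_squares_le_sum_abs[THEN order_trans]) simp
    also have "\<dots> < d" using s1 u1 kd by (simp add: dist_real_def)
    finally have "dist (s', u') (s, u) < d" .
    then have "dist (g (s', u')) (g (s, u)) < \<epsilon>'" using s1 u1 s u by (intro d(2)) auto
    then show ?thesis by (simp add: p \<Gamma>_def \<gamma>_def s'_def u'_def dist_real_def abs_minus_commute)
  qed
  have mi: "(\<lambda>p::real \<times> real. nat \<lfloor>real k * (fst p / t)\<rfloor>) \<in> measurable borel (count_space UNIV)"
    and mj: "(\<lambda>p::real \<times> real. nat \<lfloor>real k * snd p\<rfloor>) \<in> measurable borel (count_space UNIV)"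
  proof -
    have c: "(\<lambda>p::real \<times> real. real k * (fst p / t)) \<in> borel_measurable borel" "(\<lambda>p::real \<times> real. real k * snd p) \<in> borel_measurable borel"
      using t by (auto intro!: borel_measurable_continuous_onI continuous_intros)
    have f: "(\<lambda>x::real. nat \<lfloor>x\<rfloor>) \<in> measurable borel (count_space UNIV)" by measurable
    show "(\<lambda>p::real \<times> real. nat \<lfloor>real k * (fst p / t)\<rfloor>) \<in> measurable borel (count_space UNIV)"
      "(\<lambda>p::real \<times> real. nat \<lfloor>real k * snd p\<rfloor>) \<in> measurable borel (count_space UNIV)"
      by (rule measurable_compose[OF c(1) f], rule measurable_compose[OF c(2) f])
  qed
  have mG: "\<Gamma> \<in> borel_measurable borel" unfolding \<Gamma>_def[abs_def]
    by (rule measurable_compose_countable[OF _ mi]) (rule measurable_compose[OF mj], simp)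
  have mg: "g \<in> borel_measurable borel" by (rule borel_measurable_continuous_onI[OF gc])
  have Gb: "0 \<le> \<Gamma> p" "\<Gamma> p \<le> 1" for p by (auto simp: \<Gamma>_def \<gamma>_def gb)
  have i0: "set_integrable lborel B (\<lambda>p. c)" for c :: real
    unfolding set_integrable_def using Bs eB by (intro integrable_scaleR_left) (simp add: integrable_indicator_iff)
  have i1: "set_integrable lborel B (\<lambda>p. \<bar>F p - h p\<bar>)" if "h \<in> borel_measurable borel" "\<And>p. 0 \<le> h p" "\<And>p. h p \<le> 1" for h
  proof (rule set_integrable_bound[OF i0[of 1]])
    show "set_borel_measurable lborel B (\<lambda>p. \<bar>F p - h p\<bar>)" unfolding set_borel_measurable_def
      using Bs m that by (intro borel_measurable_scaleR borel_measurable_abs borel_measurable_diff) auto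
    have "\<bar>F p - h p\<bar> \<le> 1" for p using b[of p] that(2,3)[of p] by (simp add: abs_le_iff)
    then show "AE p in lborel. p \<in> B \<longrightarrow> norm \<bar>F p - h p\<bar> \<le> norm (1::real)" by simp
  qed
  have "(LINT s:{0..t}|lborel. LINT u:{0..<1}|lborel. \<bar>F (s, u) - \<Gamma> (s, u)\<bar>) =
     (LINT s|lborel. LINT u|lborel. indicator B (s, u) *\<^sub>R \<bar>F (s, u) - \<Gamma> (s, u)\<bar>)"
    unfolding set_lebesgue_integral_def
    by (intro Bochner_Integration.integral_cong refl) (auto simp: B_def indicator_def)
  also have "\<dots> = (LINT p:B|lborel. \<bar>F p - \<Gamma> p\<bar>)"
  proof -
    have "integrable (lborel \<Otimes>\<^sub>M lborel) (\<lambda>p. indicator B p *\<^sub>R \<bar>F p - \<Gamma> p\<bar>)"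
      unfolding lborel_prod using i1[OF mG Gb] by (simp add: set_integrable_def)
    from lborel_pair.integral_fst'[OF this] show ?thesis by (simp add: set_lebesgue_integral_def lborel_prod)
  qed
  also have "\<dots> \<le> (LINT p:B|lborel. \<bar>F p - g p\<bar> + \<epsilon>')"
  proof (rule set_integral_mono[OF i1[OF mG Gb] set_integral_add(1)[OF i1[OF mg gb] i0]])
    fix p assume "p \<in> B"
    from close[OF this] show "\<bar>F p - \<Gamma> p\<bar> \<le> \<bar>F p - g p\<bar> + \<epsilon>'" by linarith
  qed
  also have "\<dots> = (LINT p:B|lborel. \<bar>F p - g p\<bar>) + (LINT p:B|lborel. \<epsilon>')"
    by (rule set_integral_add(2)[OF i1[OF mg gb] i0])
  also have "(LINT p:B|lborel. \<epsilon>') = \<epsilon> / 2"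
    using t mB Bs by (simp add: set_lebesgue_integral_def \<epsilon>'_def)
  finally have "(LINT s:{0..t}|lborel. LINT u:{0..<1}|lborel. \<bar>F (s, u) - \<Gamma> (s, u)\<bar>) \<le> \<epsilon>"
    using g by simp
  moreover have "\<forall>i j. 0 \<le> \<gamma> i j \<and> \<gamma> i j \<le> 1" by (simp add: \<gamma>_def gb)
  moreover have "k \<ge> 1" using k0 by simp
  ultimately show ?thesis unfolding \<Gamma>_def by auto
qed

section \<open>The initial energy\<close>

text \<open>The hypothesis on the initial profile concerns smooth test functions, but
  \<open>kern\<close> has a kink at 0. This class contains smooth substitutes for it. Only cosines
  are generators: a sine is a cosine translated by a quarter period, so the class is closed under
  derivatives.\<close>

inductive trig :: "(real \<Rightarrow> real) \<Rightarrow> bool" where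
  trig_const: "trig (\<lambda>_. c)"
| trig_cos: "trig (\<lambda>u. cos (2 * pi * (u - c)))"
| trig_add: "trig f \<Longrightarrow> trig g \<Longrightarrow> trig (\<lambda>u. f u + g u)"
| trig_mult: "trig f \<Longrightarrow> trig g \<Longrightarrow> trig (\<lambda>u. f u * g u)"

lemma trig_deriv: "trig f \<Longrightarrow> \<exists>f'. trig f' \<and> (\<forall>u. (f has_real_derivative f' u) (at u))"
proof (induction rule: trig.induct)
  case (trig_const c)
  show ?case by (intro exI[of _ "\<lambda>_. 0"]) (auto intro: trig.trig_const)
next
  case (trig_cos c)
  have "((\<lambda>u. cos (2 * pi * (u - c))) has_real_derivative 2 * pi * cos (2 * pi * (u - (c - 1 / 4)))) (at u)" for u
  proof -
    have "cos (2 * pi * (u - (c - 1 / 4))) = cos (2 * pi * (u - c) + pi / 2)" by (simp add: algebra_simps)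
    also have "\<dots> = - sin (2 * pi * (u - c))" by (simp add: cos_add)
    finally show ?thesis by (auto intro!: derivative_eq_intros)
  qed
  then show ?case
    by (intro exI[of _ "\<lambda>u. 2 * pi * cos (2 * pi * (u - (c - 1 / 4)))"] conjI trig.trig_mult trig.trig_const trig.trig_cos allI)
next
  case (trig_add f g)
  then obtain f' g' where "trig f'" "\<forall>u. (f has_real_derivative f' u) (at u)" "trig g'" "\<forall>u. (g has_real_derivative g' u) (at u)"
    by blast
  then show ?case by (intro exI[of _ "\<lambda>u. f' u + g' u"]) (auto intro: trig.trig_add DERIV_add)
next
  case (trig_mult f g)
  then obtain f' g' where "trig f'" "\<forall>u. (f has_real_derivative f' u) (at u)" "trig g'" "\<forall>u. (g has_real_derivative g' u) (at u)"
    by blast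
  then show ?case using trig_mult.hyps
    by (intro exI[of _ "\<lambda>u. f' u * g u + g' u * f u"]) (auto intro: trig.trig_mult trig.trig_add DERIV_mult)
qed

lemma trig_periodic: "trig f \<Longrightarrow> f (u + 1) = f u"
proof (induction rule: trig.induct)
  case (trig_cos c)
  have "cos (2 * pi * (u + 1 - c)) = cos (2 * pi * (u - c) + 2 * pi)" by (simp add: algebra_simps)
  then show ?case by simp
qed auto

lemma trig_iterate: "trig f \<Longrightarrow> trig ((deriv ^^ n) f)"
proof (induction n)
  case (Suc n)
  then obtain g where g: "trig g" "\<forall>u. ((deriv ^^ n) f has_real_derivative g u) (at u)" using trig_deriv by blast
  then have "deriv ((deriv ^^ n) f) = g" by (auto intro: DERIV_imp_deriv)
  then show ?case using g by simp
qed simp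

lemma trig_continuous: "trig f \<Longrightarrow> continuous_on S f"
  using trig_deriv by (blast intro: DERIV_continuous_on has_field_derivative_at_within)

lemma trig_smooth: "trig f \<Longrightarrow> smooth_on_torus f"
  unfolding smooth_on_torus_def
proof (intro conjI allI)
  fix n assume "trig f"
  then obtain g where "\<forall>u. ((deriv ^^ n) f has_real_derivative g u) (at u)" using trig_deriv trig_iterate by blast
  then show "(deriv ^^ n) f differentiable_on UNIV"
    unfolding differentiable_on_def real_differentiable_def by auto
qed (rule trig_periodic)

lemma periodic_bounded:
  assumes c: "continuous_on UNIV f" and p: "\<And>u. f (u + 1) = f (u::real)"
  shows "\<exists>B. \<forall>u. \<bar>f u :: real\<bar> \<le> B"
proof -
  have pi: "f (v + of_int k) = f v" for v k
  proof (induction k rule: int_induct[where k = 0])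
    case (step1 i) then show ?case using p[of "v + of_int i"] by (simp add: add.assoc)
  next
    case (step2 i) then show ?case using p[of "v + of_int (i - 1)"] by (simp add: algebra_simps)
  qed simp
  have "bounded (f ` {0..1})" by (intro compact_imp_bounded compact_continuous_image continuous_on_subset[OF c]) auto
  then obtain B where B: "\<forall>u\<in>{0..1}. \<bar>f u\<bar> \<le> B" by (auto simp: bounded_iff)
  have "\<bar>f u\<bar> \<le> B" for u
  proof -
    have "f u = f (frac u)" using pi[of "frac u" "\<lfloor>u\<rfloor>"] by (simp add: frac_def)
    moreover have "frac u \<in> {0..1}" using frac_ge_0[of u] frac_lt_1[of u] by simp
    ultimately show ?thesis using B by simp
  qed
  then show ?thesis by blast
qed

lemma smooth_lipschitz:
  assumes s: "smooth_on_torus \<phi>"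
  shows "\<exists>B L. (\<forall>u. \<bar>\<phi> u\<bar> \<le> B) \<and> (\<forall>u v. \<bar>\<phi> u - \<phi> v\<bar> \<le> L * \<bar>u - v\<bar>)"
proof -
  have p: "\<phi> (u + 1) = \<phi> u" for u using s by (simp add: smooth_on_torus_def)
  have d0: "(deriv ^^ 0) \<phi> differentiable_on UNIV" and d1: "(deriv ^^ 1) \<phi> differentiable_on UNIV"
    using s unfolding smooth_on_torus_def by blast+
  have D: "(\<phi> has_real_derivative deriv \<phi> u) (at u)" for u
    using d0 by (auto simp: differentiable_on_def real_differentiable_def DERIV_deriv_iff_real_differentiable)
  have c0: "continuous_on UNIV \<phi>" using differentiable_imp_continuous_on[OF d0] by simp
  have c1: "continuous_on UNIV (deriv \<phi>)" using differentiable_imp_continuous_on[OF d1] by simp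
  have p1: "deriv \<phi> (u + 1) = deriv \<phi> u" for u
  proof -
    have "((\<lambda>v. \<phi> (v + 1)) has_real_derivative deriv \<phi> (u + 1)) (at u)"
      using DERIV_shift[of \<phi> "deriv \<phi> (u + 1)" u 1] D[of "u + 1"] by simp
    then have "(\<phi> has_real_derivative deriv \<phi> (u + 1)) (at u)" by (simp add: p)
    then show ?thesis using D[of u] by (rule DERIV_unique)
  qed
  obtain B where B: "\<forall>u. \<bar>\<phi> u\<bar> \<le> B" using periodic_bounded[OF c0 p] by blast
  obtain L where L: "\<forall>u. \<bar>deriv \<phi> u\<bar> \<le> L" using periodic_bounded[OF c1 p1] by blast
  have "\<bar>\<phi> u - \<phi> v\<bar> \<le> L * \<bar>u - v\<bar>" for u v
  proof -
    have "norm (\<phi> u - \<phi> v) \<le> L * norm (u - v)"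
      by (rule field_differentiable_bound[of UNIV \<phi> "deriv \<phi>"]) (use D L in auto)
    then show ?thesis by simp
  qed
  then show ?thesis using B by blast
qed

lemma trig_lipschitz: "trig f \<Longrightarrow> \<exists>L. \<forall>u v. \<bar>f u - f v\<bar> \<le> L * \<bar>u - v\<bar>"
  using smooth_lipschitz[OF trig_smooth] by blast

lemma polynomial_cos_trig:
  assumes "real_polynomial_function (p :: real \<Rightarrow> real)"
  shows "trig (\<lambda>u. p (cos (2 * pi * (u - c))))"
  using assms
proof (induction rule: real_polynomial_function.induct)
  case (linear f)
  then have f: "f x = x * f 1" for x using linear_scale[of f x 1] by (simp add: bounded_linear.linear)
  have "trig (\<lambda>u. cos (2 * pi * (u - c)) * f 1)" by (intro trig.intros)
  then show ?case by (subst f)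
qed (auto intro: trig.intros)

text \<open>\<open>kern\<close> is a continuous function of the cosine, so the Weierstrass theorem gives its uniform approximation by trigonometric polynomials.\<close>

definition kappa :: "real \<Rightarrow> real" where
  "kappa c = (let a = arccos c / (2 * pi) in (a\<^sup>2 - a) / 2 + 1 / 12)"

lemma mod_fraction:
  assumes "N \<ge> 1" shows "of_int (z mod int N) / real N \<in> {0..<1}"
proof -
  have "z mod int N < int N" using assms by simp
  then have "real_of_int (z mod int N) < real_of_int (int N)" by (simp only: of_int_less_iff)
  then show ?thesis using assms by simp
qed

text \<open>The inverse cosine recovers m or 1 - m, and m^2 - m takes the same value at
  both.\<close>

lemma kern_kappa:
  assumes "N \<ge> 1" shows "kern N z = kappa (cos (2 * pi * (of_int z / real N)))"
proof -
  define m where "m = of_int (z mod int N) / real N"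
  have m: "0 \<le> m" "m < 1" using mod_fraction[OF assms, of z] by (auto simp: m_def)
  have "of_int z = of_int (z mod int N) + real N * of_int (z div int N)"
    by (metis mod_mult_div_eq of_int_add of_int_mult of_int_of_nat_eq)
  then have "of_int z / real N = m + of_int (z div int N)" using assms by (simp add: m_def field_simps)
  then have "2 * pi * (of_int z / real N) = 2 * pi * m + 2 * pi * of_int (z div int N)" by (simp only: distrib_left)
  then have c: "cos (2 * pi * (of_int z / real N)) = cos (2 * pi * m)"
    by (simp only: cos_add sin_int_2pin cos_int_2pin)
  have a: "arccos (cos (2 * pi * m)) / (2 * pi) = (if m \<le> 1 / 2 then m else 1 - m)"
  proof (cases "m \<le> 1 / 2")
    case True
    then have "2 * pi * m \<le> pi" by simp
    then show ?thesis using True m by (simp add: arccos_cos)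
  next
    case False
    have "cos (2 * pi * m) = cos (2 * pi * (1 - m))" by (simp add: right_diff_distrib cos_diff)
    moreover have "arccos (cos (2 * pi * (1 - m))) = 2 * pi * (1 - m)"
      using False m by (intro arccos_cos) auto
    ultimately show ?thesis using False by simp
  qed
  have "(1 - m)\<^sup>2 - (1 - m) = m\<^sup>2 - m" by (simp add: power2_eq_square algebra_simps)
  then have "kappa (cos (2 * pi * m)) = (m\<^sup>2 - m) / 2 + 1 / 12" unfolding kappa_def Let_def a by simp
  then show ?thesis unfolding c kern_def m_def[symmetric] by (simp add: Let_def)
qed

lemma kappa_continuous: "continuous_on {-1..1} kappa"
  unfolding kappa_def[abs_def] Let_def by (intro continuous_intros continuous_on_arccos) auto

lemma kappa_modulus:
  assumes e: "\<epsilon> > 0"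
  shows "\<exists>d>0. \<forall>u v. \<bar>u - v\<bar> < d \<longrightarrow> \<bar>kappa (cos (2 * pi * u)) - kappa (cos (2 * pi * v))\<bar> < \<epsilon>"
proof -
  have "uniformly_continuous_on {-1..1} kappa" by (intro compact_uniformly_continuous kappa_continuous compact_Icc)
  then obtain d where d: "d > 0" "\<And>x y. x \<in> {-1..1} \<Longrightarrow> y \<in> {-1..1} \<Longrightarrow> dist y x < d \<Longrightarrow> dist (kappa y) (kappa x) < \<epsilon>"
    unfolding uniformly_continuous_on_def using e by meson
  have "\<bar>kappa (cos (2 * pi * u)) - kappa (cos (2 * pi * v))\<bar> < \<epsilon>" if "\<bar>u - v\<bar> < d / (2 * pi)" for u v
  proof -
    have "\<bar>cos x - cos y\<bar> \<le> 1 * \<bar>x - y\<bar>" for x y :: real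
    proof -
      have "norm (cos x - cos y) \<le> 1 * norm (x - y)"
        by (rule field_differentiable_bound[of UNIV cos "\<lambda>x. - sin x"]) (auto intro!: derivative_eq_intros)
      then show ?thesis by simp
    qed
    from this[of "2 * pi * u" "2 * pi * v"] have "\<bar>cos (2 * pi * u) - cos (2 * pi * v)\<bar> \<le> \<bar>2 * pi * (u - v)\<bar>"
      by (simp add: right_diff_distrib)
    also have "\<dots> = 2 * pi * \<bar>u - v\<bar>" by (simp add: abs_mult)
    also have "\<dots> < d" using that by (simp add: field_simps)
    finally show ?thesis using d(2)[of "cos (2 * pi * v)" "cos (2 * pi * u)"] by (simp add: dist_real_def)
  qed
  then show ?thesis using d(1) by (intro exI[of _ "d / (2 * pi)"]) auto
qed

definition site_density :: "(real \<Rightarrow> real) \<Rightarrow> nat \<Rightarrow> int \<Rightarrow> real" where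
  "site_density \<rho>ini N x = \<rho>ini (of_int (x mod int N) / real N)"

text \<open>Both lattice sums converge to the integral of f against the profile: the first by
  \<open>lattice_representative\<close>, the second by \<open>kavg_test\<close>.\<close>

lemma trig_discrepancy:
  assumes lr: "lattice_representative \<rho>ini" and p: "profile \<rho>ini" and f: "trig f"
  shows "(\<lambda>N. csum N (\<lambda>x. f (of_int x / real N) * (site_density \<rho>ini N x - kavg \<rho>ini spline N x)) / real N) \<longlonglongrightarrow> 0"
proof -
  obtain L where L: "\<And>u v. \<bar>f u - f v\<bar> \<le> L * \<bar>u - v\<bar>" using trig_lipschitz[OF f] by blast
  let ?I = "torus_integral (\<lambda>u. f u * \<rho>ini u)"
  have 1: "(\<lambda>N. 1 / real N * (\<Sum>x<N. f (real x / real N) * \<rho>ini (real x / real N))) \<longlonglongrightarrow> ?I"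
    using lr trig_smooth[OF f] by (simp add: lattice_representative_def)
  have 2: "(\<lambda>N. csum N (\<lambda>x. f (of_int x / real N) * kavg \<rho>ini spline N x) / real N) \<longlonglongrightarrow> ?I"
  proof (rule LIM_zero_cancel, rule Lim_null_comparison)
    show "\<forall>\<^sub>F N in sequentially. norm (csum N (\<lambda>x. f (of_int x / real N) * kavg \<rho>ini spline N x) / real N - ?I) \<le> 4 * L / real N"
    proof (rule eventually_sequentiallyI[of 5])
      fix N :: nat assume "5 \<le> N"
      then show "norm (csum N (\<lambda>x. f (of_int x / real N) * kavg \<rho>ini spline N x) / real N - ?I) \<le> 4 * L / real N"
        using kavg_test[OF p unity_spline _ trig_periodic[OF f] trig_continuous[OF f] L, of N]
        by (simp add: torus_integral_def mult.commute)
    qed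
    show "(\<lambda>N. 4 * L / real N) \<longlonglongrightarrow> 0" by (rule lim_const_over_n)
  qed
  have "(\<lambda>N. 1 / real N * (\<Sum>x<N. f (real x / real N) * \<rho>ini (real x / real N)) - csum N (\<lambda>x. f (of_int x / real N) * kavg \<rho>ini spline N x) / real N) \<longlonglongrightarrow> ?I - ?I"
    by (rule tendsto_diff[OF 1 2])
  moreover have "1 / real N * (\<Sum>x<N. f (real x / real N) * \<rho>ini (real x / real N)) - csum N (\<lambda>x. f (of_int x / real N) * kavg \<rho>ini spline N x) / real N
    = csum N (\<lambda>x. f (of_int x / real N) * (site_density \<rho>ini N x - kavg \<rho>ini spline N x)) / real N" for N
  proof -
    have "(\<Sum>x<N. f (real x / real N) * \<rho>ini (real x / real N)) = csum N (\<lambda>x. f (of_int x / real N) * site_density \<rho>ini N x)"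
      unfolding csum_def site_density_def by (intro sum.cong) auto
    then show ?thesis by (simp add: right_diff_distrib csum_diff diff_divide_distrib)
  qed
  ultimately show ?thesis by simp
qed

text \<open>The potential must be small uniformly in its base point, whereas
  \<open>trig_discrepancy\<close> concerns one test function at a time. The base point is therefore
  moved to one of finitely many grid points j/J. Moving it and the polynomial approximation cost
  \<epsilon> each, the discrepancy a third \<epsilon>, and \<epsilon> is a quarter of the
  tolerance.\<close>

lemma initial_energy:
  assumes lr: "lattice_representative \<rho>ini" and p: "profile \<rho>ini"
  shows "(\<lambda>N. energy N (\<lambda>x. site_density \<rho>ini N x - kavg \<rho>ini spline N x)) \<longlonglongrightarrow> 0"
proof (rule LIMSEQ_I)
  fix \<epsilon>0 :: real assume e0: "\<epsilon>0 > 0"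
  define \<epsilon> where "\<epsilon> = \<epsilon>0 / 4"
  have e: "\<epsilon> > 0" using e0 by (simp add: \<epsilon>_def)
  let ?m = "\<lambda>N x. site_density \<rho>ini N x - kavg \<rho>ini spline N x"
  obtain d where d: "d > 0" "\<And>u v. \<bar>u - v\<bar> < d \<Longrightarrow> \<bar>kappa (cos (2 * pi * u)) - kappa (cos (2 * pi * v))\<bar> < \<epsilon>"
    using kappa_modulus[OF e] by blast
  \<comment> \<open>The mesh 1/J is below the modulus of continuity of the kernel, so rounding the
    base point changes it by less than \<epsilon>.\<close>
  obtain J :: nat where "real J > 1 / d" using reals_Archimedean2 by blast
  then have J: "J \<ge> 1" "1 / real J < d"
  proof -
    assume a: "real J > 1 / d"
    moreover have "1 / d > 0" using d by simp
    ultimately have J0: "real J > 0" by linarith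
    then show "J \<ge> 1" by simp
    show "1 / real J < d" using a J0 d by (simp add: field_simps)
  qed
  obtain q :: "real \<Rightarrow> real" where q: "real_polynomial_function q" "\<And>c. c \<in> {-1..1} \<Longrightarrow> \<bar>kappa c - q c\<bar> < \<epsilon>"
    using Stone_Weierstrass_real_polynomial_function[OF compact_Icc kappa_continuous e] by auto
  define f where "f j u = q (cos (2 * pi * (u - real j / real J)))" for j :: nat and u
  have ft: "trig (f j)" for j unfolding f_def[abs_def] by (rule polynomial_cos_trig[OF q(1)])
  have "\<forall>\<^sub>F N in sequentially. \<forall>j\<in>{..<J}. \<bar>csum N (\<lambda>x. f j (of_int x / real N) * ?m N x) / real N\<bar> < \<epsilon>"
  proof (rule eventually_ball_finite)
    show "\<forall>j\<in>{..<J}. \<forall>\<^sub>F N in sequentially. \<bar>csum N (\<lambda>x. f j (of_int x / real N) * ?m N x) / real N\<bar> < \<epsilon>"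
    proof
      fix j
      have "(\<lambda>N. \<bar>csum N (\<lambda>x. f j (of_int x / real N) * ?m N x) / real N\<bar>) \<longlonglongrightarrow> \<bar>0\<bar>"
        by (intro tendsto_rabs trig_discrepancy[OF lr p ft])
      then show "\<forall>\<^sub>F N in sequentially. \<bar>csum N (\<lambda>x. f j (of_int x / real N) * ?m N x) / real N\<bar> < \<epsilon>"
        using e by (intro order_tendstoD(2)) auto
    qed
  qed simp
  then obtain N0 where N0: "\<And>N j. N \<ge> N0 \<Longrightarrow> j < J \<Longrightarrow> \<bar>csum N (\<lambda>x. f j (of_int x / real N) * ?m N x) / real N\<bar> < \<epsilon>"
    unfolding eventually_sequentially by blast
  have "norm (energy N (?m N) - 0) < \<epsilon>0" if N: "N \<ge> max 5 N0" for N
  proof -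
    have N5: "N \<ge> 5" "real N > 0" using N by auto
    have m1: "\<bar>?m N x\<bar> \<le> 1" for x
    proof -
      have "0 \<le> kavg \<rho>ini spline N x" "kavg \<rho>ini spline N x \<le> 1" using kavg_bounds[OF p unity_spline N5(1)] by auto
      moreover have "of_int (x mod int N) / real N \<in> {0..<1}" using N5 by (intro mod_fraction) simp
      then have "0 \<le> site_density \<rho>ini N x" "site_density \<rho>ini N x \<le> 1"
        using p unfolding profile_def site_density_def by blast+
      ultimately show ?thesis by linarith
    qed
    have pot: "\<bar>pot N (?m N) (int y)\<bar> \<le> real N * (3 * \<epsilon>)" if y: "y < N" for y
    proof -
      define j where "j = nat \<lfloor>real J * (real y / real N)\<rfloor>"
      have y1: "0 \<le> real y / real N" "real y / real N < 1" using y by auto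
      have jf: "real j \<le> real J * (real y / real N)" "real J * (real y / real N) < real j + 1"
      proof -
        have "0 \<le> real J * (real y / real N)" by simp
        then show "real j \<le> real J * (real y / real N)" "real J * (real y / real N) < real j + 1"
          unfolding j_def by linarith+
      qed
      have "real J * (real y / real N) < real J * 1" using y1 J(1) by (intro mult_strict_left_mono) auto
      then have jJ: "j < J" using jf by linarith
      have close: "\<bar>real y / real N - real j / real J\<bar> < d"
      proof -
        have "real j / real J \<le> real y / real N" using jf(1) J(1) by (simp add: divide_le_eq mult.commute)
        moreover have "real y / real N < (real j + 1) / real J" using jf(2) J(1) by (simp add: less_divide_eq mult.commute)
        ultimately show ?thesis using J(2) by (simp add: add_divide_distrib)
      qed
      have k: "\<bar>kern N (x - int y) - f j (of_int x / real N)\<bar> \<le> 2 * \<epsilon>" for x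
      proof -
        let ?c = "cos (2 * pi * (of_int x / real N - real j / real J))"
        have "kern N (x - int y) = kappa (cos (2 * pi * (of_int x / real N - real y / real N)))"
          using N5 by (simp add: kern_kappa diff_divide_distrib)
        moreover have "\<bar>kappa (cos (2 * pi * (of_int x / real N - real y / real N))) - kappa ?c\<bar> < \<epsilon>"
          using close by (intro d(2)) (simp add: abs_minus_commute)
        moreover have "\<bar>kappa ?c - q ?c\<bar> < \<epsilon>" by (rule q(2)) simp
        ultimately show ?thesis unfolding f_def by linarith
      qed
      have "pot N (?m N) (int y) = csum N (\<lambda>x. (kern N (x - int y) - f j (of_int x / real N)) * ?m N x) + csum N (\<lambda>x. f j (of_int x / real N) * ?m N x)"
        unfolding pot_def csum_add[symmetric] by (simp add: algebra_simps)
      moreover have "\<bar>csum N (\<lambda>x. (kern N (x - int y) - f j (of_int x / real N)) * ?m N x)\<bar> \<le> csum N (\<lambda>x. 2 * \<epsilon>)"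
      proof (rule order_trans[OF csum_abs], rule csum_mono)
        fix x
        have "\<bar>kern N (x - int y) - f j (of_int x / real N)\<bar> * \<bar>?m N x\<bar> \<le> (2 * \<epsilon>) * 1"
          using k m1 e by (intro mult_mono) auto
        then show "\<bar>(kern N (x - int y) - f j (of_int x / real N)) * ?m N x\<bar> \<le> 2 * \<epsilon>" by (simp add: abs_mult)
      qed
      moreover have "\<bar>csum N (\<lambda>x. f j (of_int x / real N) * ?m N x)\<bar> \<le> real N * \<epsilon>"
        using N0[of N j] N jJ N5 by (simp add: divide_less_eq mult.commute)
      ultimately show ?thesis by (simp add: csum_const algebra_simps)
    qed
    have "\<bar>csum N (\<lambda>x. ?m N x * pot N (?m N) x)\<bar> \<le> (\<Sum>x<N. \<bar>?m N (int x) * pot N (?m N) (int x)\<bar>)"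
      unfolding csum_def by (rule sum_abs)
    also have "\<dots> \<le> (\<Sum>x<N. 1 * (real N * (3 * \<epsilon>)))"
      unfolding abs_mult using m1 pot by (intro sum_mono mult_mono) auto
    also have "\<dots> = (real N)\<^sup>2 * (3 * \<epsilon>)" by (simp add: power2_eq_square)
    finally have "\<bar>energy N (?m N)\<bar> \<le> 3 * \<epsilon>"
      using N5 unfolding energy_def by (simp add: abs_div divide_le_eq mult.commute)
    then show ?thesis using e unfolding \<epsilon>_def by simp
  qed
  then show "\<exists>no. \<forall>n\<ge>no. norm (energy n (?m n) - 0) < \<epsilon>0" by blast
qed

section \<open>Second moments under the product measure\<close>

definition ini_expect :: "(real \<Rightarrow> real) \<Rightarrow> nat \<Rightarrow> ((nat \<Rightarrow> nat) \<Rightarrow> real) \<Rightarrow> real" where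
  "ini_expect \<rho>ini N f = (\<Sum>\<eta>\<in>configs N. init_weight \<rho>ini N \<eta> * f \<eta>)"

lemma ini_product:
  "ini_expect \<rho>ini N (\<lambda>\<eta>. \<Prod>z<N. g z (\<eta> z)) =
     (\<Prod>z<N. \<rho>ini (real z / real N) * g z 1 + (1 - \<rho>ini (real z / real N)) * g z 0)"
proof -
  let ?w = "\<lambda>z v. (\<rho>ini (real z / real N) * real v + (1 - \<rho>ini (real z / real N)) * (1 - real v)) * g z v"
  have "ini_expect \<rho>ini N (\<lambda>\<eta>. \<Prod>z<N. g z (\<eta> z)) = (\<Sum>\<eta>\<in>{..<N} \<rightarrow>\<^sub>E {0, 1}. \<Prod>z<N. ?w z (\<eta> z))"
    unfolding ini_expect_def configs_def init_weight_def prod.distrib[symmetric] ..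
  also have "\<dots> = (\<Prod>z<N. \<Sum>v\<in>{0, 1}. ?w z v)"
    by (rule prod_sum_PiE[symmetric]) auto
  also have "\<dots> = (\<Prod>z<N. \<rho>ini (real z / real N) * g z 1 + (1 - \<rho>ini (real z / real N)) * g z 0)"
    by (intro prod.cong) auto
  finally show ?thesis .
qed

lemma ini_sites:
  assumes A: "A \<subseteq> {..<N}"
  shows "ini_expect \<rho>ini N (\<lambda>\<eta>. \<Prod>z\<in>A. real (\<eta> z)) = (\<Prod>z\<in>A. \<rho>ini (real z / real N))"
proof -
  have r: "(\<Prod>z<N. if z \<in> A then f z else 1) = (\<Prod>z\<in>A. f z)" for f :: "nat \<Rightarrow> real"
    using A by (subst prod.mono_neutral_right[of "{..<N}" A]) (auto intro: prod.cong)
  have "ini_expect \<rho>ini N (\<lambda>\<eta>. \<Prod>z\<in>A. real (\<eta> z)) = ini_expect \<rho>ini N (\<lambda>\<eta>. \<Prod>z<N. if z \<in> A then real (\<eta> z) else 1)"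
    unfolding ini_expect_def by (simp only: r)
  also have "\<dots> = (\<Prod>z<N. \<rho>ini (real z / real N) * (if z \<in> A then real (1::nat) else 1) + (1 - \<rho>ini (real z / real N)) * (if z \<in> A then real (0::nat) else 1))"
    by (rule ini_product)
  also have "\<dots> = (\<Prod>z<N. if z \<in> A then \<rho>ini (real z / real N) else 1)" by (intro prod.cong) auto
  finally show ?thesis by (simp only: r)
qed

lemma ini_one: "ini_expect \<rho>ini N (\<lambda>\<eta>. 1) = 1"
  using ini_sites[of "{}" N \<rho>ini] by simp

lemma ini_site: "x < N \<Longrightarrow> ini_expect \<rho>ini N (\<lambda>\<eta>. real (\<eta> x)) = \<rho>ini (real x / real N)"
  using ini_sites[of "{x}" N \<rho>ini] by simp

lemma ini_pair:
  assumes "x < N" "y < N"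
  shows "ini_expect \<rho>ini N (\<lambda>\<eta>. real (\<eta> x) * real (\<eta> y)) =
    (if x = y then \<rho>ini (real x / real N) else \<rho>ini (real x / real N) * \<rho>ini (real y / real N))"
proof (cases "x = y")
  case True
  have "ini_expect \<rho>ini N (\<lambda>\<eta>. real (\<eta> x) * real (\<eta> y)) = ini_expect \<rho>ini N (\<lambda>\<eta>. real (\<eta> x))"
    unfolding ini_expect_def
  proof (intro sum.cong refl)
    fix \<eta> assume "\<eta> \<in> configs N"
    then have "\<eta> x = 0 \<or> \<eta> x = 1" using assms by (auto simp: configs_def)
    then show "init_weight \<rho>ini N \<eta> * (real (\<eta> x) * real (\<eta> y)) = init_weight \<rho>ini N \<eta> * real (\<eta> x)"
      using True by auto
  qed
  then show ?thesis using True ini_site[OF assms(1)] by simp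
next
  case False
  then show ?thesis using ini_sites[of "{x, y}" N \<rho>ini] assms by simp
qed

lemma ini_lin:
  "ini_expect \<rho>ini N (\<lambda>\<eta>. a * f \<eta> + g \<eta>) = a * ini_expect \<rho>ini N f + ini_expect \<rho>ini N g"
  by (simp add: ini_expect_def sum.distrib[symmetric] sum_distrib_left algebra_simps)

lemma ini_sum: "ini_expect \<rho>ini N (\<lambda>\<eta>. \<Sum>i\<in>I. f i \<eta>) = (\<Sum>i\<in>I. ini_expect \<rho>ini N (f i))"
  unfolding ini_expect_def sum_distrib_left by (rule sum.swap)

text \<open>Sites are independent, so beyond the square of the means only the diagonal survives,
  with a variance at most 1 at each of the N sites.\<close>

lemma ini_quadratic:
  assumes N: "N \<ge> 1" and p: "profile \<rho>ini" and r: "periodic N r" and k: "\<And>x. \<bar>k x x\<bar> \<le> C"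
  shows "ini_expect \<rho>ini N (\<lambda>\<eta>. csum N (\<lambda>x. csum N (\<lambda>y. k x y * ((occ N \<eta> x - r x) * (occ N \<eta> y - r y))))) \<le>
    csum N (\<lambda>x. csum N (\<lambda>y. k x y * ((site_density \<rho>ini N x - r x) * (site_density \<rho>ini N y - r y)))) + real N * C"
proof -
  let ?p = "\<lambda>x. \<rho>ini (real x / real N)"
  have o: "occ N \<eta> (int x) = real (\<eta> x)" "site_density \<rho>ini N (int x) = ?p x" if "x < N" for x \<eta>
    using that by (auto simp: occ_def site_density_def)
  have pair: "ini_expect \<rho>ini N (\<lambda>\<eta>. (occ N \<eta> (int x) - r (int x)) * (occ N \<eta> (int y) - r (int y))) =
     (?p x - r (int x)) * (?p y - r (int y)) + (if x = y then ?p x * (1 - ?p x) else 0)" if "x < N" "y < N" for x y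
  proof -
    have "ini_expect \<rho>ini N (\<lambda>\<eta>. (occ N \<eta> (int x) - r (int x)) * (occ N \<eta> (int y) - r (int y))) =
      ini_expect \<rho>ini N (\<lambda>\<eta>. 1 * (real (\<eta> x) * real (\<eta> y)) + ((- r (int y)) * real (\<eta> x) + ((- r (int x)) * real (\<eta> y) + ((r (int x) * r (int y)) * 1 + 0))))"
      using that by (simp add: o algebra_simps)
    also have "\<dots> = 1 * ini_expect \<rho>ini N (\<lambda>\<eta>. real (\<eta> x) * real (\<eta> y)) + ((- r (int y)) * ?p x + ((- r (int x)) * ?p y + ((r (int x) * r (int y)) * 1 + ini_expect \<rho>ini N (\<lambda>_. 0))))"
      unfolding ini_lin ini_site[OF that(1)] ini_site[OF that(2)] ini_one ..
    also have "\<dots> = (?p x - r (int x)) * (?p y - r (int y)) + (if x = y then ?p x * (1 - ?p x) else 0)"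
      unfolding ini_pair[OF that] by (simp add: ini_expect_def algebra_simps)
    finally show ?thesis .
  qed
  have cm: "ini_expect \<rho>ini N (\<lambda>\<eta>. c * f \<eta>) = c * ini_expect \<rho>ini N f" for c f
    using ini_lin[of \<rho>ini N c f "\<lambda>_. 0"] by (simp add: ini_expect_def)
  have "ini_expect \<rho>ini N (\<lambda>\<eta>. csum N (\<lambda>x. csum N (\<lambda>y. k x y * ((occ N \<eta> x - r x) * (occ N \<eta> y - r y))))) =
    (\<Sum>x<N. \<Sum>y<N. k (int x) (int y) * ((?p x - r (int x)) * (?p y - r (int y)) + (if x = y then ?p x * (1 - ?p x) else 0)))"
    unfolding csum_def ini_sum cm by (intro sum.cong refl) (simp add: pair)
  also have "\<dots> = (\<Sum>x<N. \<Sum>y<N. k (int x) (int y) * ((?p x - r (int x)) * (?p y - r (int y)))) + (\<Sum>x<N. k (int x) (int x) * (?p x * (1 - ?p x)))"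
    by (simp add: distrib_left sum.distrib if_distrib[of "(*) _"] cong: if_cong)
  also have "(\<Sum>x<N. k (int x) (int x) * (?p x * (1 - ?p x))) \<le> (\<Sum>x<N. C)"
  proof (intro sum_mono)
    fix x assume x: "x \<in> {..<N}"
    then have "real x / real N \<in> {0..<1}" by simp
    then have p01: "0 \<le> ?p x" "?p x \<le> 1" using p by (auto simp: profile_def)
    have "\<bar>k (int x) (int x)\<bar> * \<bar>?p x * (1 - ?p x)\<bar> \<le> C * 1"
      using p01 k[of "int x"] by (intro mult_mono) (auto simp: abs_mult intro!: mult_le_one)
    then show "k (int x) (int x) * (?p x * (1 - ?p x)) \<le> C" by (simp add: abs_mult[symmetric])
  qed
  also have "(\<Sum>x<N. \<Sum>y<N. k (int x) (int y) * ((?p x - r (int x)) * (?p y - r (int y)))) =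
    csum N (\<lambda>x. csum N (\<lambda>y. k x y * ((site_density \<rho>ini N x - r x) * (site_density \<rho>ini N y - r y))))"
    unfolding csum_def by (intro sum.cong refl) (simp add: o)
  finally show ?thesis by simp
qed

lemma energy_quadratic: "energy N a = csum N (\<lambda>x. csum N (\<lambda>y. (kern N (y - x) / (real N)\<^sup>2) * (a x * a y)))"
  unfolding energy_def pot_def csum_def by (simp add: sum_distrib_left sum_divide_distrib mult_ac)

lemma initial_energy_bound:
  assumes N: "N \<ge> 5" and p: "profile \<rho>ini"
  shows "ini_expect \<rho>ini N (\<lambda>\<eta>. energy N (\<lambda>x. occ N \<eta> x - kavg \<rho>ini spline N x)) \<le>
    energy N (\<lambda>x. site_density \<rho>ini N x - kavg \<rho>ini spline N x) + 1 / real N"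
proof -
  have k: "\<bar>kern N (x - x) / (real N)\<^sup>2\<bar> \<le> 1 / (real N)\<^sup>2" for x
    using kern_bound[of N "x - x"] N by (simp add: abs_div divide_right_mono)
  show ?thesis
    using ini_quadratic[OF _ p kavg_periodic, of N "\<lambda>x y. kern N (y - x) / (real N)\<^sup>2" "1 / (real N)\<^sup>2" \<rho>ini spline] k N
    unfolding energy_quadratic by (simp add: power2_eq_square)
qed

lemma initial_mass_bound:
  assumes N: "N \<ge> 5" and p: "profile \<rho>ini"
  shows "ini_expect \<rho>ini N (\<lambda>\<eta>. (csum N (\<lambda>x. occ N \<eta> x - kavg \<rho>ini spline N x) / real N)\<^sup>2) \<le>
    (csum N (\<lambda>x. site_density \<rho>ini N x - kavg \<rho>ini spline N x) / real N)\<^sup>2 + 1 / real N"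
proof -
  have e: "(csum N a / real N)\<^sup>2 = csum N (\<lambda>x. csum N (\<lambda>y. (1 / (real N)\<^sup>2) * (a x * a y)))" for a
    unfolding csum_def power2_eq_square by (simp add: sum_product sum_divide_distrib mult_ac)
  show ?thesis
    using ini_quadratic[OF _ p kavg_periodic, of N "\<lambda>x y. 1 / (real N)\<^sup>2" "1 / (real N)\<^sup>2" \<rho>ini spline] N
    unfolding e by (simp add: power2_eq_square)
qed

section \<open>Dissipation on space-time cells\<close>

definition Mean :: "nat \<Rightarrow> (real \<Rightarrow> nat \<Rightarrow> nat) measure \<Rightarrow> real \<Rightarrow> ((int \<Rightarrow> real) \<Rightarrow> real) \<Rightarrow> real" where
  "Mean N P s \<Phi> = expect N P s (\<lambda>\<eta>. \<Phi> (occ N \<eta>))"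

lemma Mean_add: "Mean N P s (\<lambda>e. \<Phi> e + \<Psi> e) = Mean N P s \<Phi> + Mean N P s \<Psi>"
  by (simp add: Mean_def expect_def distrib_left sum.distrib)
lemma Mean_diff: "Mean N P s (\<lambda>e. \<Phi> e - \<Psi> e) = Mean N P s \<Phi> - Mean N P s \<Psi>"
  by (simp add: Mean_def expect_def right_diff_distrib sum_subtractf)
lemma Mean_cmult: "Mean N P s (\<lambda>e. c * \<Phi> e) = c * Mean N P s \<Phi>"
  by (simp add: Mean_def expect_def sum_distrib_left mult.left_commute)
lemma Mean_csum: "Mean N P s (\<lambda>e. csum m (\<lambda>x. \<Phi> x e)) = csum m (\<lambda>x. Mean N P s (\<Phi> x))"
  unfolding Mean_def expect_def csum_def sum_distrib_left by (rule sum.swap)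

lemma Mean_cong:
  assumes "N \<ge> 1" "\<And>e. e \<in> cfg N \<Longrightarrow> \<Phi> e = \<Psi> e" shows "Mean N P s \<Phi> = Mean N P s \<Psi>"
  unfolding Mean_def expect_def using assms occ_cfg by (intro sum.cong) auto

lemma Mean_mono:
  assumes "N \<ge> 1" "\<And>e. e \<in> cfg N \<Longrightarrow> \<Phi> e \<le> \<Psi> e" shows "Mean N P s \<Phi> \<le> Mean N P s \<Psi>"
  unfolding Mean_def expect_def marg_def using assms occ_cfg by (intro sum_mono mult_left_mono) auto

lemma square_cancel:
  assumes n: "n > (0::real)" and le: "n\<^sup>2 * x \<le> n * c" shows "x \<le> c * (1 / n)"
proof -
  have "n * (n * x) \<le> n * c" using le by (simp add: power2_eq_square mult.assoc)
  then have "n * x \<le> c" using n by simp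
  then show ?thesis using n by (simp add: pos_le_divide_eq mult.commute)
qed

text \<open>Collects the M-dependent errors: the two boundary values of \<open>Lyap\<close>, the
  destruction of pairs, and the variation of the weight. The final 1 is reserved for the gradient of
  \<open>vv\<close> in \<open>cell_dissipation\<close>.\<close>

definition cell_const :: "nat \<Rightarrow> real" where
  "cell_const M = 2 * (real M * ((real M + 4) * ln (real M + 4))) + lip M * (real M)\<^sup>2 + real M * (lip M + real M + 8) + 1"

context
  fixes T :: real and N :: nat and \<rho>ini :: "real \<Rightarrow> real" and P :: "(real \<Rightarrow> nat \<Rightarrow> nat) measure"
  assumes T: "T > 0" and N: "N \<ge> 5" and law: "FEP_law T N \<rho>ini P"
begin

lemma Mean_const: "s \<in> {0..T} \<Longrightarrow> Mean N P s (\<lambda>_. c) = c"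
  using marg_sum[OF T _ law, of s] N by (simp add: Mean_def expect_def sum_distrib_right[symmetric])

lemma Mean_deriv:
  assumes t: "s \<in> {0..T}"
  shows "((\<lambda>s. Mean N P s \<Phi>) has_real_derivative (real N)\<^sup>2 * Mean N P s (gen N \<Phi>)) (at s within {0..T})"
proof -
  have "accelerated_generator N (\<lambda>\<eta>. \<Phi> (occ N \<eta>)) = (\<lambda>\<eta>. (real N)\<^sup>2 * gen N \<Phi> (occ N \<eta>))"
    unfolding accelerated_generator_def[abs_def] using N by (simp add: generator_occ)
  then show ?thesis using expect_deriv[OF T _ law t, of "\<lambda>\<eta>. \<Phi> (occ N \<eta>)"] N
    by (simp add: Mean_def Mean_cmult[unfolded Mean_def])
qed

lemma Mean_continuous: "continuous_on {0..T} (\<lambda>s. Mean N P s \<Phi>)"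
  using Mean_deriv by (rule DERIV_continuous_on)

lemma Mean_prim: "prim T (\<lambda>s. Mean N P s \<Phi>) (\<lambda>s. (real N)\<^sup>2 * Mean N P s (gen N \<Phi>))"
  by (rule prim_deriv[OF Mean_deriv]) (auto intro!: continuous_intros Mean_continuous)

lemma Mean_integrable:
  assumes "0 \<le> a" "b \<le> T" shows "set_integrable lborel {a..b} (\<lambda>s. Mean N P s \<Phi>)"
  by (rule borel_integrable_atLeastAtMost') (rule continuous_on_subset[OF Mean_continuous], use assms in auto)

lemma Mean_increment:
  assumes "0 \<le> a" "a \<le> b" "b \<le> T"
  shows "(real N)\<^sup>2 * (LINT s:{a..b}|lborel. Mean N P s (gen N \<Phi>)) = Mean N P b \<Phi> - Mean N P a \<Phi>"
  using prim_increment[OF Mean_prim assms, of \<Phi>] by simp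

lemma Mean_set_integral_mono:
  assumes "0 \<le> a" "b \<le> T" "\<And>e. e \<in> cfg N \<Longrightarrow> \<Phi> e \<le> \<Psi> e"
  shows "(LINT s:{a..b}|lborel. Mean N P s \<Phi>) \<le> (LINT s:{a..b}|lborel. Mean N P s \<Psi>)"
  using assms N by (intro set_integral_mono Mean_integrable Mean_mono) auto

lemma Mean_int_add:
  assumes "0 \<le> a" "b \<le> T"
  shows "(LINT s:{a..b}|lborel. Mean N P s (\<lambda>e. \<Phi> e + \<Psi> e)) = (LINT s:{a..b}|lborel. Mean N P s \<Phi>) + (LINT s:{a..b}|lborel. Mean N P s \<Psi>)"
  unfolding Mean_add using Mean_integrable[OF assms] by (intro set_integral_add) auto

lemma Mean_int_cmult: "(LINT s:{a..b}|lborel. Mean N P s (\<lambda>e. c * \<Phi> e)) = c * (LINT s:{a..b}|lborel. Mean N P s \<Phi>)"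
  unfolding Mean_cmult by simp

lemma Mean_int_const:
  assumes "0 \<le> a" "a \<le> b" "b \<le> T"
  shows "(LINT s:{a..b}|lborel. Mean N P s (\<lambda>_. c)) = c * (b - a)"
proof -
  have "(LINT s:{a..b}|lborel. Mean N P s (\<lambda>_. c)) = (LINT s:{a..b}|lborel. c)"
    by (rule set_lebesgue_integral_cong) (use assms Mean_const in auto)
  then show ?thesis using assms by (simp add: set_lebesgue_integral_def)
qed

text \<open>Time integration of \<open>local_inequality\<close>. The functionals \<open>Lyap\<close>
  and \<open>znum\<close> are of order N at fixed M, so after division by the acceleration N^2 their
  increments cost only O(1/N). Division by 2 ln M halves 114 to 57.\<close>

lemma cell_estimate:
  assumes ab: "0 \<le> a" "a \<le> b" "b \<le> T" and M: "M \<ge> 3" and NM: "N \<ge> M + 4"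
    and w: "periodic N w" "\<And>y. 0 \<le> w y" "\<And>y. w y \<le> 1" and r: "1 / 2 \<le> r"
  shows "(LINT s:{a..b}|lborel. Mean N P s (\<lambda>e. csum N (\<lambda>y. w y * hh e y)))
    \<le> (LINT s:{a..b}|lborel. Mean N P s (\<lambda>e. csum N (\<lambda>y. w y * (2 - 2 / r + qq e y / r\<^sup>2))))
      + 57 / ln (real M) * real N * (b - a) + (cell_const M - 1) * (1 / real N + variation N w * (b - a))"
proof -
  let ?I = "\<lambda>\<Phi>. LINT s:{a..b}|lborel. Mean N P s \<Phi>"
  define V where "V = variation N w"
  have V0: "V \<ge> 0" by (simp add: V_def variation_nonneg)
  have M1: "1 \<le> M" and M3: "real M \<ge> 3" using M by auto
  have N0: "real N > 0" using N by simp
  \<comment> \<open>Since 3 exceeds e, the error E may be left undivided in the final step.\<close>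
  have lnM: "ln (real M) \<ge> 1"
  proof -
    have "ln (3::real) \<ge> 1" using exp_le by (subst ln_ge_iff) auto
    also have "ln (3::real) \<le> ln (real M)" using M3 by (subst ln_le_cancel_iff) auto
    finally (order_trans) show ?thesis by simp
  qed
  have W: "csum N w \<le> real N" using w csum_mono[of w "\<lambda>_. 1" N] by (simp add: csum_const)
  have pw: "2 * ln (real M) * csum N (\<lambda>y. w y * hh e y) \<le>
     2 * ln (real M) * csum N (\<lambda>y. w y * (2 - 2 / r + qq e y / r\<^sup>2))
     + (gen N (Lyap N M w) e + ((- lip M * (real M)\<^sup>2) * gen N (znum N) e
     + (114 * real N + real M * (lip M + real M + 8) * V)))" if "e \<in> cfg N" for e
    using local_inequality[OF that NM M1 w r] W by (simp add: V_def)
  have "?I (\<lambda>e. 2 * ln (real M) * csum N (\<lambda>y. w y * hh e y)) \<le> ?I (\<lambda>e. 2 * ln (real M) * csum N (\<lambda>y. w y * (2 - 2 / r + qq e y / r\<^sup>2))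
     + (gen N (Lyap N M w) e + ((- lip M * (real M)\<^sup>2) * gen N (znum N) e
     + (114 * real N + real M * (lip M + real M + 8) * V))))"
    by (rule Mean_set_integral_mono[OF ab(1,3) pw])
  also have "\<dots> = 2 * ln (real M) * ?I (\<lambda>e. csum N (\<lambda>y. w y * (2 - 2 / r + qq e y / r\<^sup>2)))
     + (?I (gen N (Lyap N M w)) + ((- lip M * (real M)\<^sup>2) * ?I (gen N (znum N))
     + (114 * real N + real M * (lip M + real M + 8) * V) * (b - a)))"
    unfolding Mean_int_add[OF ab(1,3)] Mean_int_cmult Mean_int_const[OF ab] by (simp only: distrib_right mult.assoc)
  finally have main: "2 * ln (real M) * ?I (\<lambda>e. csum N (\<lambda>y. w y * hh e y)) \<le>
     2 * ln (real M) * ?I (\<lambda>e. csum N (\<lambda>y. w y * (2 - 2 / r + qq e y / r\<^sup>2)))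
     + (?I (gen N (Lyap N M w)) + ((- lip M * (real M)\<^sup>2) * ?I (gen N (znum N))
     + (114 * real N + real M * (lip M + real M + 8) * V) * (b - a)))"
    unfolding Mean_int_cmult .
  let ?c = "(real M + 4) * ln (real M + 4)"
  have c0: "?c \<ge> 0" by simp
  have G: "\<bar>GG s\<bar> \<le> ?c" if "0 \<le> s" "s \<le> real M" for s
  proof -
    have "0 \<le> ln (s + 4)" "ln (s + 4) \<le> ln (real M + 4)" using that by auto
    then have "(s + 4) * ln (s + 4) \<le> ?c" "0 \<le> (s + 4) * ln (s + 4)" using that by (auto intro!: mult_mono)
    then show ?thesis by (simp add: GG_def)
  qed
  have Ly: "\<bar>Lyap N M w e\<bar> \<le> real M * (real N * ?c)" if e: "e \<in> cfg N" for e
  proof -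
    have "\<bar>Lyap N M w e\<bar> \<le> (\<Sum>L=1..M. \<bar>csum N (\<lambda>y. w y * GG (blk e y L))\<bar>)"
      unfolding Lyap_def by (rule sum_abs)
    also have "\<dots> \<le> (\<Sum>L=1..M. real N * ?c)"
    proof (intro sum_mono)
      fix L assume L: "L \<in> {1..M}"
      have "\<bar>csum N (\<lambda>y. w y * GG (blk e y L))\<bar> \<le> csum N (\<lambda>y. ?c)"
      proof (rule order_trans[OF csum_abs], rule csum_mono)
        fix y
        have "\<bar>w y\<bar> * \<bar>GG (blk e y L)\<bar> \<le> 1 * ?c"
          using w(2,3)[of y] blk_bounds[OF e, of y L] L G by (intro mult_mono) auto
        then show "\<bar>w y * GG (blk e y L)\<bar> \<le> ?c" by (simp add: abs_mult)
      qed
      then show "\<bar>csum N (\<lambda>y. w y * GG (blk e y L))\<bar> \<le> real N * ?c" by (simp add: csum_const)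
    qed
    finally show ?thesis by simp
  qed
  have EL: "\<bar>Mean N P s (Lyap N M w)\<bar> \<le> real M * (real N * ?c)" if s: "s \<in> {0..T}" for s
  proof -
    have "Mean N P s (Lyap N M w) \<le> Mean N P s (\<lambda>_. real M * (real N * ?c))"
      using Ly N by (intro Mean_mono) (auto simp: abs_le_iff)
    moreover have "Mean N P s (\<lambda>_. - (real M * (real N * ?c))) \<le> Mean N P s (Lyap N M w)"
      using Ly N by (intro Mean_mono) (auto simp: abs_le_iff minus_le_iff)
    ultimately show ?thesis unfolding Mean_const[OF s] by (simp add: abs_le_iff)
  qed
  have EZ: "0 \<le> Mean N P s (znum N)" "Mean N P s (znum N) \<le> real N" if s: "s \<in> {0..T}" for s
  proof -
    have z: "0 \<le> znum N e" "znum N e \<le> real N" if "e \<in> cfg N" for e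
      using zz_bounds[OF that] csum_mono[of "zz e" "\<lambda>_. 1" N] by (auto simp: znum_def csum_nonneg csum_const)
    have "Mean N P s (\<lambda>_. 0) \<le> Mean N P s (znum N)" "Mean N P s (znum N) \<le> Mean N P s (\<lambda>_. real N)"
      using z N by (auto intro!: Mean_mono)
    then show "0 \<le> Mean N P s (znum N)" "Mean N P s (znum N) \<le> real N" unfolding Mean_const[OF s] by auto
  qed
  have sab: "a \<in> {0..T}" "b \<in> {0..T}" using ab by auto
  have "(real N)\<^sup>2 * ?I (gen N (Lyap N M w)) \<le> 2 * (real M * (real N * ?c))"
    unfolding Mean_increment[OF ab] using EL[OF sab(1)] EL[OF sab(2)] by linarith
  also have "\<dots> = real N * (2 * (real M * ?c))" by (simp only: mult.left_commute)
  finally have i1: "?I (gen N (Lyap N M w)) \<le> 2 * (real M * ?c) * (1 / real N)"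
    by (rule square_cancel[OF N0])
  have "(real N)\<^sup>2 * ?I (gen N (znum N)) \<ge> - real N"
    unfolding Mean_increment[OF ab] using EZ[OF sab(1)] EZ[OF sab(2)] by linarith
  then have "(real N)\<^sup>2 * (- ?I (gen N (znum N))) \<le> real N * 1" by simp
  from square_cancel[OF N0 this] have "?I (gen N (znum N)) \<ge> - (1 / real N)" by simp
  then have "(lip M * (real M)\<^sup>2) * ?I (gen N (znum N)) \<ge> (lip M * (real M)\<^sup>2) * (- (1 / real N))"
    using lip_pos[of M] by (intro mult_left_mono) auto
  then have i2: "(- lip M * (real M)\<^sup>2) * ?I (gen N (znum N)) \<le> (lip M * (real M)\<^sup>2) * (1 / real N)" by simp
  define X where "X = ?I (\<lambda>e. csum N (\<lambda>y. w y * hh e y))"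
  define Y where "Y = ?I (\<lambda>e. csum N (\<lambda>y. w y * (2 - 2 / r + qq e y / r\<^sup>2)))"
  define E where "E = (cell_const M - 1) * (1 / real N + V * (b - a))"
  have k1: "0 \<le> 2 * (real M * ?c)" "0 \<le> lip M * (real M)\<^sup>2" "0 \<le> real M * (lip M + real M + 8)"
    using lip_pos[of M] c0 by auto
  have vb: "0 \<le> V * (b - a)" using V0 ab by simp
  have cc: "cell_const M - 1 = 2 * (real M * ?c) + lip M * (real M)\<^sup>2 + real M * (lip M + real M + 8)"
    by (simp add: cell_const_def)
  have "0 \<le> cell_const M - 1" unfolding cc using k1 by linarith
  moreover have "0 \<le> 1 / real N + V * (b - a)" using vb by simp
  ultimately have E0: "E \<ge> 0" unfolding E_def by (rule mult_nonneg_nonneg)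
  have "2 * (real M * ?c) * (1 / real N) + (lip M * (real M)\<^sup>2) * (1 / real N) + real M * (lip M + real M + 8) * (V * (b - a)) \<le> E"
  proof -
    have "2 * (real M * ?c) * (1 / real N) \<le> 2 * (real M * ?c) * (1 / real N + V * (b - a))"
      using k1 vb by (intro mult_left_mono) auto
    moreover have "(lip M * (real M)\<^sup>2) * (1 / real N) \<le> (lip M * (real M)\<^sup>2) * (1 / real N + V * (b - a))"
      using k1 vb by (intro mult_left_mono) auto
    moreover have "real M * (lip M + real M + 8) * (V * (b - a)) \<le> real M * (lip M + real M + 8) * (1 / real N + V * (b - a))"
      using k1 vb N0 by (intro mult_left_mono) auto
    ultimately show ?thesis unfolding E_def cc by (simp only: distrib_right)
  qed
  with main i1 i2 have "2 * ln (real M) * X \<le> 2 * ln (real M) * Y + (E + 114 * real N * (b - a))"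
    unfolding X_def Y_def by (simp only: distrib_right mult.assoc)
  then have "2 * ln (real M) * (X - Y) \<le> E + 114 * real N * (b - a)" by (simp add: right_diff_distrib)
  then have "X - Y \<le> (E + 114 * real N * (b - a)) / (2 * ln (real M))" using lnM by (subst pos_le_divide_eq) (auto simp: mult.commute)
  also have "\<dots> = E / (2 * ln (real M)) + 57 / ln (real M) * real N * (b - a)" by (simp add: add_divide_distrib)
  also have "E / (2 * ln (real M)) \<le> E / 1" using E0 lnM by (intro divide_left_mono) auto
  finally show ?thesis unfolding X_def Y_def E_def V_def by simp
qed

text \<open>The tangent is taken at R, the density truncated at 1/2. For r below 1/2 the
  nonlinearity vanishes at r and at R, so r H(r) = R H(R) still holds, and enlarging the factor of
  the nonnegative \<open>hh\<close> only lowers the expression.\<close>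

lemma cell_dissipation:
  assumes ab: "0 \<le> a" "a \<le> b" "b \<le> T" and M: "M \<ge> 3" and NM: "N \<ge> M + 4"
    and w: "periodic N w" "\<And>y. 0 \<le> w y" "\<And>y. w y \<le> 1" and r: "0 \<le> r" "r \<le> 1"
  shows "(LINT s:{a..b}|lborel. Mean N P s (\<lambda>e. csum N (\<lambda>y. w y * (AA e y - r * hh e y - \<H> r * e y + r * \<H> r))))
    \<ge> - (57 / ln (real M) * real N * (b - a) + cell_const M * (1 / real N + variation N w * (b - a)))"
proof -
  let ?I = "\<lambda>\<Phi>. LINT s:{a..b}|lborel. Mean N P s \<Phi>"
  define V where "V = variation N w"
  define R where "R = max r (1 / 2)"
  have R: "1 / 2 \<le> R" "R \<le> 1" "r \<le> R" using r by (auto simp: R_def)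
  have HR: "\<H> r = \<H> R" "\<H> R = 2 - 1 / R" by (auto simp: H_eq R_def)
  have H0: "\<H> R \<ge> 0" using R by (intro H_bounds) auto
  have rH: "r * \<H> R = R * \<H> R" using R by (cases "r \<le> 1 / 2") (auto simp: R_def H_eq max_def)
  let ?\<alpha> = "\<H> R"
  have pw: "R * csum N (\<lambda>y. w y * (2 - 2 / R + qq e y / R\<^sup>2)) + ((- R) * csum N (\<lambda>y. w y * hh e y) + (- V)) \<le>
     csum N (\<lambda>y. w y * (AA e y - r * hh e y - \<H> r * e y + r * \<H> r))" if e: "e \<in> cfg N" for e
  proof -
    have pv: "periodic N (vv e)" using cfg_periodic[OF e] by simp
    have vb: "\<bar>vv e y\<bar> \<le> 1" for y using vv_bounds[OF e, of y] by simp
    have "\<bar>csum N (\<lambda>y. w y * vv e (y + 1)) - csum N (\<lambda>y. w y * vv e y)\<bar> \<le> V"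
      using csum_shift_weight[OF w(1) pv vb, of 1] by (simp add: V_def)
    then have v: "csum N (\<lambda>y. w y * vv e (y + 1)) - csum N (\<lambda>y. w y * vv e y) \<ge> - V" by linarith
    have "R * csum N (\<lambda>y. w y * (2 - 2 / R + qq e y / R\<^sup>2)) + (- R) * csum N (\<lambda>y. w y * hh e y)
       + (csum N (\<lambda>y. w y * vv e (y + 1)) - csum N (\<lambda>y. w y * vv e y))
      = csum N (\<lambda>y. w y * (R * (2 - 2 / R + qq e y / R\<^sup>2) - R * hh e y + vv e (y + 1) - vv e y))"
      unfolding csum_cmult[symmetric] csum_diff[symmetric] csum_add[symmetric]
      by (rule arg_cong[where f = "csum N"]) (simp add: algebra_simps)
    also have "\<dots> \<le> csum N (\<lambda>y. w y * (AA e y - r * hh e y - \<H> r * e y + r * \<H> r))"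
    proof (intro csum_mono mult_left_mono w)
      fix y
      have hb: "0 \<le> hh e y" using hh01[OF e, of y] by auto
      have "r * hh e y \<le> R * hh e y" using R hb by (intro mult_right_mono) auto
      moreover have "R * (2 - 2 / R + qq e y / R\<^sup>2) = 2 * R - 2 + qq e y / R" using R
        by (simp add: field_simps power2_eq_square)
      \<comment> \<open>With the tangent inserted, everything else cancels and this nonnegative
        product, the surplus of \<open>qq\<close> over the occupation times H(R), is what remains of
        the gap.\<close>
      moreover have "?\<alpha> * (qq e y - e y) \<ge> 0" using H0 zz_bounds[OF e, of y] by (simp add: qq_def)
      moreover have "?\<alpha> * (qq e y - e y) = 2 * qq e y - qq e y / R - ?\<alpha> * e y" by (simp add: HR(2) algebra_simps)
      moreover have "R * \<H> R = 2 * R - 1" using R by (simp add: HR(2) right_diff_distrib)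
      ultimately show "R * (2 - 2 / R + qq e y / R\<^sup>2) - R * hh e y + vv e (y + 1) - vv e y
        \<le> AA e y - r * hh e y - \<H> r * e y + r * \<H> r"
        unfolding HR(1) rH AA_eq[OF e] by linarith
    qed
    finally show ?thesis using v by linarith
  qed
  let ?X = "?I (\<lambda>e. csum N (\<lambda>y. w y * hh e y))" and ?Y = "?I (\<lambda>e. csum N (\<lambda>y. w y * (2 - 2 / R + qq e y / R\<^sup>2)))"
  have "?I (\<lambda>e. R * csum N (\<lambda>y. w y * (2 - 2 / R + qq e y / R\<^sup>2)) + ((- R) * csum N (\<lambda>y. w y * hh e y) + (- V)))
     \<le> ?I (\<lambda>e. csum N (\<lambda>y. w y * (AA e y - r * hh e y - \<H> r * e y + r * \<H> r)))"
    by (rule Mean_set_integral_mono[OF ab(1,3) pw])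
  then have 1: "R * ?Y + ((- R) * ?X + (- V) * (b - a)) \<le> ?I (\<lambda>e. csum N (\<lambda>y. w y * (AA e y - r * hh e y - \<H> r * e y + r * \<H> r)))"
    unfolding Mean_int_add[OF ab(1,3)] Mean_int_cmult Mean_int_const[OF ab] .
  define E where "E = 57 / ln (real M) * real N * (b - a) + (cell_const M - 1) * (1 / real N + V * (b - a))"
  have V0: "V \<ge> 0" by (simp add: V_def variation_nonneg)
  have E0: "E \<ge> 0"
  proof -
    have "ln (real M) \<ge> 0" using M by simp
    moreover have "cell_const M - 1 \<ge> 0" using lip_pos[of M] by (simp add: cell_const_def)
    ultimately show ?thesis unfolding E_def using ab V0 by (intro add_nonneg_nonneg mult_nonneg_nonneg) auto
  qed
  have "?X \<le> ?Y + E" using cell_estimate[OF ab M NM w R(1)] by (simp add: E_def V_def)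
  then have "R * (?X - ?Y) \<le> R * E" using R by (intro mult_left_mono) auto
  also have "R * E \<le> E" using R E0 by (simp add: mult_left_le_one_le)
  finally have "R * ?X - R * ?Y \<le> E" by (simp add: right_diff_distrib)
  moreover have "E + V * (b - a) \<le> 57 / ln (real M) * real N * (b - a) + cell_const M * (1 / real N + V * (b - a))"
    unfolding E_def by (simp add: left_diff_distrib)
  ultimately show ?thesis using 1 unfolding V_def[symmetric] by simp
qed

end

section \<open>The energy balance\<close>

lemma prim_cong:
  assumes p: "prim t f f'" and e: "\<And>s. s \<in> {0..t} \<Longrightarrow> f s = g s" "\<And>s. s \<in> {0..t} \<Longrightarrow> f' s = g' s"
  shows "prim t g g'"
proof -
  have "indicator {0..t} s * f' s = indicator {0..t} s * g' s" for s
    by (cases "s \<in> {0..t}") (simp_all only: e(2), simp add: indicator_def)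
  then have i: "(\<lambda>s. indicator {0..t} s * f' s) = (\<lambda>s. indicator {0..t} s * g' s)" by (rule ext)
  have int: "(LINT r:{0..s}|lborel. f' r) = (LINT r:{0..s}|lborel. g' r)" if "s \<in> {0..t}" for s
  proof (rule set_lebesgue_integral_cong)
    show "\<forall>r. r \<in> {0..s} \<longrightarrow> f' r = g' r" using that e(2) by simp
  qed simp
  have "g s = g 0 + (LINT r:{0..s}|lborel. g' r)" if s: "s \<in> {0..t}" for s
  proof -
    have z: "0 \<in> {0..t}" using s by simp
    have "\<forall>s\<in>{0..t}. f s = f 0 + (LINT r:{0..s}|lborel. f' r)" using p unfolding prim_def by blast
    from bspec[OF this s] show ?thesis unfolding e(1)[OF z] e(1)[OF s] int[OF s] .
  qed
  moreover obtain B where "\<forall>s\<in>{0..t}. \<bar>f' s\<bar> \<le> B" using p unfolding prim_def by blast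
  then have "\<exists>B. \<forall>s\<in>{0..t}. \<bar>g' s\<bar> \<le> B" using e(2) by metis
  ultimately show ?thesis using p unfolding prim_def i by blast
qed

lemma prim_csum: "(\<And>x. prim t (\<lambda>s. f s x) (\<lambda>s. f' s x)) \<Longrightarrow> prim t (\<lambda>s. csum N (f s)) (\<lambda>s. csum N (f' s))"
  unfolding csum_def by (intro prim_sum) auto

lemma csum_lap:
  assumes f: "periodic N f" shows "csum N (\<lambda>x. c * (f (x + 1) + f (x - 1) - 2 * f x)) = 0"
  using csum_shift[OF f, of 1] csum_shift_diff[OF f, of 1]
  unfolding csum_cmult csum_diff csum_add by simp

lemma csum_lap_pot:
  assumes f: "periodic N f" and b: "periodic N b" and N: "N \<ge> 2"
  shows "csum N (\<lambda>x. (real N)\<^sup>2 * (f (x + 1) + f (x - 1) - 2 * f x) * pot N b x) =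
    csum N f * csum N b - real N * csum N (\<lambda>x. f x * b x)"
proof -
  let ?w = "pot N b"
  have N0: "real N > 0" using N by simp
  have p1: "periodic N (\<lambda>x. f x * ?w (x - 1))"
    using periodic_comp2[OF f periodic_shift[OF pot_periodic[of N b], of "-1"], of "(*)"] by simp
  have p2: "periodic N (\<lambda>x. f x * ?w (x + 1))"
    using periodic_comp2[OF f periodic_shift[OF pot_periodic[of N b], of "1"], of "(*)"] by simp
  have s1: "csum N (\<lambda>x. f (x + 1) * ?w x) = csum N (\<lambda>x. f x * ?w (x - 1))" using csum_shift[OF p1, of 1] by simp
  have s2: "csum N (\<lambda>x. f (x - 1) * ?w x) = csum N (\<lambda>x. f x * ?w (x + 1))" using csum_shift_diff[OF p2, of 1] by simp
  have "csum N (\<lambda>x. (real N)\<^sup>2 * (f (x + 1) + f (x - 1) - 2 * f x) * ?w x)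
    = (real N)\<^sup>2 * (csum N (\<lambda>x. f (x + 1) * ?w x) + csum N (\<lambda>x. f (x - 1) * ?w x) - 2 * csum N (\<lambda>x. f x * ?w x))"
    unfolding csum_cmult[symmetric] csum_diff[symmetric] csum_add[symmetric] by (simp add: algebra_simps)
  also have "\<dots> = (real N)\<^sup>2 * csum N (\<lambda>x. f x * (?w (x + 1) + ?w (x - 1) - 2 * ?w x))"
    unfolding s1 s2 unfolding csum_cmult[symmetric] csum_diff[symmetric] csum_add[symmetric] by (simp add: algebra_simps)
  also have "csum N (\<lambda>x. f x * (?w (x + 1) + ?w (x - 1) - 2 * ?w x)) =
     csum N (\<lambda>x. f x * (csum N b / (real N)\<^sup>2) - 1 / real N * (f x * b x))"
    unfolding pot_lap[OF b N] by (simp add: algebra_simps)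
  also have "\<dots> = csum N f * (csum N b / (real N)\<^sup>2) - 1 / real N * csum N (\<lambda>x. f x * b x)"
    unfolding csum_diff csum_cmult csum_multc ..
  also have "(real N)\<^sup>2 * \<dots> = csum N f * csum N b - real N * csum N (\<lambda>x. f x * b x)"
    using N0 by (simp add: field_simps power2_eq_square)
  finally show ?thesis .
qed

lemma prim_bilinear:
  assumes a: "\<And>x. prim t (\<lambda>s. a s x) (\<lambda>s. (real N)\<^sup>2 * (f s (x + 1) + f s (x - 1) - 2 * f s x))"
    and b: "\<And>x. prim t (\<lambda>s. b s x) (\<lambda>s. (real N)\<^sup>2 * (g s (x + 1) + g s (x - 1) - 2 * g s x))"
    and p: "\<And>s. periodic N (a s)" "\<And>s. periodic N (b s)" "\<And>s. periodic N (f s)" "\<And>s. periodic N (g s)" and N: "N \<ge> 2"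
  shows "prim t (\<lambda>s. csum N (\<lambda>x. a s x * pot N (b s) x)) (\<lambda>s. csum N (f s) * csum N (b s) + csum N (a s) * csum N (g s)
     - real N * (csum N (\<lambda>x. f s x * b s x) + csum N (\<lambda>x. g s x * a s x)))"
proof -
  let ?lf = "\<lambda>s x. (real N)\<^sup>2 * (f s (x + 1) + f s (x - 1) - 2 * f s x)"
  let ?lg = "\<lambda>s x. (real N)\<^sup>2 * (g s (x + 1) + g s (x - 1) - 2 * g s x)"
  have N1: "N \<ge> 1" using N by simp
  have "prim t (\<lambda>s. csum N (\<lambda>x. csum N (\<lambda>y. kern N (y - x) * (a s x * b s y))))
      (\<lambda>s. csum N (\<lambda>x. csum N (\<lambda>y. kern N (y - x) * (?lf s x * b s y + a s x * ?lg s y))))"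
    by (intro prim_csum prim_cmult prim_mult a b)
  then show ?thesis
  proof (rule prim_cong)
    fix s
    show "csum N (\<lambda>x. csum N (\<lambda>y. kern N (y - x) * (a s x * b s y))) = csum N (\<lambda>x. a s x * pot N (b s) x)"
      unfolding pot_def csum_cmult[symmetric] by (simp add: algebra_simps)
    have "csum N (\<lambda>x. csum N (\<lambda>y. kern N (y - x) * (?lf s x * b s y + a s x * ?lg s y))) =
       csum N (\<lambda>x. ?lf s x * pot N (b s) x) + csum N (\<lambda>x. a s x * pot N (?lg s) x)"
      unfolding pot_def csum_cmult[symmetric] csum_add[symmetric]
      by (simp only: distrib_left mult.left_commute mult.assoc)
    also have "csum N (\<lambda>x. a s x * pot N (?lg s) x) = csum N (\<lambda>x. ?lg s x * pot N (a s) x)"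
      by (rule pot_symmetric[OF N1])
    finally show "csum N (\<lambda>x. csum N (\<lambda>y. kern N (y - x) * (?lf s x * b s y + a s x * ?lg s y))) =
      csum N (f s) * csum N (b s) + csum N (a s) * csum N (g s)
      - real N * (csum N (\<lambda>x. f s x * b s x) + csum N (\<lambda>x. g s x * a s x))"
      unfolding csum_lap_pot[OF p(3,2) N] csum_lap_pot[OF p(4,1) N] by (simp add: algebra_simps)
  qed
qed

lemma energy_expand:
  assumes N: "N \<ge> 1"
  shows "(real N)\<^sup>2 * energy N (\<lambda>x. e x - r x) = quad N e - 2 * csum N (\<lambda>x. r x * pot N e x) + csum N (\<lambda>x. r x * pot N r x)"
proof -
  have pd: "pot N (\<lambda>x. e x - r x) x = pot N e x - pot N r x" for x
    unfolding pot_def csum_diff[symmetric] by (simp add: right_diff_distrib)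
  have "(real N)\<^sup>2 * energy N (\<lambda>x. e x - r x) = csum N (\<lambda>x. (e x - r x) * pot N (\<lambda>x. e x - r x) x)"
    using N by (simp add: energy_def)
  also have "\<dots> = csum N (\<lambda>x. e x * pot N e x) - csum N (\<lambda>x. e x * pot N r x)
     - csum N (\<lambda>x. r x * pot N e x) + csum N (\<lambda>x. r x * pot N r x)"
    unfolding pd csum_add[symmetric] csum_diff[symmetric] by (simp add: algebra_simps)
  also have "csum N (\<lambda>x. e x * pot N r x) = csum N (\<lambda>x. r x * pot N e x)" by (rule pot_symmetric[OF N])
  finally show ?thesis by (simp add: quad_pot)
qed

text \<open>Were \<open>hh\<close> and \<open>AA\<close> replaced by H(\<rho>) and \<rho> H(\<rho>),
  the summand would factor as (\<rho> - r)(H(\<rho>) - h), nonnegative for h = H(r) because H is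
  increasing.\<close>

definition flux_gap :: "nat \<Rightarrow> (int \<Rightarrow> real) \<Rightarrow> (int \<Rightarrow> real) \<Rightarrow> (int \<Rightarrow> real) \<Rightarrow> real" where
  "flux_gap N r h e = csum N (\<lambda>x. AA e x - r x * hh e x - h x * e x + r x * h x)"

context
  fixes T :: real and N :: nat and \<rho>ini :: "real \<Rightarrow> real" and P :: "(real \<Rightarrow> nat \<Rightarrow> nat) measure"
    and r h :: "real \<Rightarrow> int \<Rightarrow> real"
  assumes T: "T > 0" and N: "N \<ge> 5" and law: "FEP_law T N \<rho>ini P"
    and r: "\<And>x. prim T (\<lambda>s. r s x) (\<lambda>s. (real N)\<^sup>2 * (h s (x + 1) + h s (x - 1) - 2 * h s x))"
    and p: "\<And>s. periodic N (r s)" "\<And>s. periodic N (h s)"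
begin

lemma Mean_periodic:
  assumes "\<And>e. e \<in> cfg N \<Longrightarrow> periodic N (\<lambda>x. \<Phi> x e)" shows "periodic N (\<lambda>x. Mean N P s (\<Phi> x))"
  unfolding periodic_def
proof
  fix x
  have "\<Phi> (x + int N) e = \<Phi> x e" if "e \<in> cfg N" for e using periodicD[OF assms[OF that], of x] .
  then show "Mean N P s (\<Phi> (x + int N)) = Mean N P s (\<Phi> x)" using N by (intro Mean_cong) auto
qed

lemma density_prim:
  "prim T (\<lambda>s. Mean N P s (\<lambda>e. e x)) (\<lambda>s. (real N)\<^sup>2 *
     (Mean N P s (\<lambda>e. hh e (x + 1)) + Mean N P s (\<lambda>e. hh e (x - 1)) - 2 * Mean N P s (\<lambda>e. hh e x)))"
proof (rule prim_cong[OF Mean_prim[OF T N law, of "\<lambda>e. e x"]])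
  fix s
  have "Mean N P s (gen N (\<lambda>e. e x)) = Mean N P s (\<lambda>e. hh e (x + 1) + hh e (x - 1) - 2 * hh e x)"
    using N by (intro Mean_cong gen_linear) auto
  then show "(real N)\<^sup>2 * Mean N P s (gen N (\<lambda>e. e x)) = (real N)\<^sup>2 *
     (Mean N P s (\<lambda>e. hh e (x + 1)) + Mean N P s (\<lambda>e. hh e (x - 1)) - 2 * Mean N P s (\<lambda>e. hh e x))"
    by (simp add: Mean_diff Mean_add Mean_cmult)
qed simp

lemma Mean_weighted: "Mean N P s (\<lambda>e. csum N (\<lambda>x. c x * \<Phi> x e)) = csum N (\<lambda>x. c x * Mean N P s (\<Phi> x))"
  unfolding Mean_csum Mean_cmult ..

lemma Mean_pot: "Mean N P s (\<lambda>e. csum N (\<lambda>x. c x * pot N e x)) = csum N (\<lambda>x. c x * pot N (\<lambda>x. Mean N P s (\<lambda>e. e x)) x)"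
  unfolding Mean_csum Mean_cmult pot_def ..

text \<open>The square is expanded by \<open>energy_expand\<close>. Only the pure
  \<open>quad\<close> term requires the generator; in the mixed term the configuration enters
  linearly, so the equation of its mean is enough. The last, nonpositive term is the 1/N^2
  correction of the self-interaction in \<open>kern_01\<close>.\<close>

lemma energy_balance:
  "prim T (\<lambda>s. Mean N P s (\<lambda>e. energy N (\<lambda>x. e x - r s x)))
     (\<lambda>s. 2 / (real N)\<^sup>2 * Mean N P s (\<lambda>e. (csum N (hh e) - csum N (h s)) * (csum N e - csum N (r s)))
        - 2 / real N * Mean N P s (flux_gap N (r s) (h s))
        - Mean N P s (\<lambda>e. csum N (crate e)) / (real N)\<^sup>2)"
proof -
  define m where "m s x = Mean N P s (\<lambda>e. e x)" for s x
  define g where "g s x = Mean N P s (\<lambda>e. hh e x)" for s x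
  have N2: "N \<ge> 2" and N1: "N \<ge> 1" and N0: "real N > 0" using N by auto
  have mp: "periodic N (m s)" for s unfolding m_def by (rule Mean_periodic) auto
  have gp: "periodic N (g s)" for s unfolding g_def by (rule Mean_periodic) auto
  have md: "prim T (\<lambda>s. m s x) (\<lambda>s. (real N)\<^sup>2 * (g s (x + 1) + g s (x - 1) - 2 * g s x))" for x
    unfolding m_def g_def by (rule density_prim)
  define Q where "Q s = Mean N P s (\<lambda>e. csum N (hh e) * csum N e)" for s
  define K where "K s = Mean N P s (\<lambda>e. csum N (crate e))" for s
  define c1 where "c1 s = csum N (\<lambda>x. g s x * r s x)" for s
  define c2 where "c2 s = csum N (\<lambda>x. h s x * m s x)" for s
  define c3 where "c3 s = csum N (\<lambda>x. h s x * r s x)" for s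
  have qd: "prim T (\<lambda>s. Mean N P s (quad N)) (\<lambda>s. 2 * Q s - 2 * real N * csum N (g s) + (real N - 1) * K s)"
  proof (rule prim_cong[OF Mean_prim[OF T N law, of "quad N"]])
    fix s
    have "Mean N P s (gen N (quad N)) = Mean N P s (\<lambda>e. 2 / (real N)\<^sup>2 * (csum N (hh e) * csum N e) - 2 / real N * csum N (hh e)
     + (1 / real N - 1 / (real N)\<^sup>2) * csum N (crate e))"
      using N1 N2 by (intro Mean_cong) (auto simp: gen_quad)
    also have "\<dots> = 2 / (real N)\<^sup>2 * Q s - 2 / real N * csum N (g s) + (1 / real N - 1 / (real N)\<^sup>2) * K s"
      unfolding Mean_add Mean_diff Mean_cmult Q_def K_def by (simp add: Mean_csum g_def[abs_def])
    finally have eq: "Mean N P s (gen N (quad N)) = \<dots>" .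
    show "(real N)\<^sup>2 * Mean N P s (gen N (quad N)) = 2 * Q s - 2 * real N * csum N (g s) + (real N - 1) * K s"
      unfolding eq using N0 by (simp add: field_simps power2_eq_square)
  qed simp
  \<comment> \<open>Twice the product rule of \<open>prim_bilinear\<close>: once for the mean
    occupation against r, once for r against itself.\<close>
  have "prim T (\<lambda>s. Mean N P s (quad N) + (-2) * csum N (\<lambda>x. r s x * pot N (m s) x) + csum N (\<lambda>x. r s x * pot N (r s) x))
   (\<lambda>s. 2 * Q s - 2 * real N * csum N (g s) + (real N - 1) * K s
     + (-2) * (csum N (h s) * csum N (m s) + csum N (r s) * csum N (g s) - real N * (c2 s + c1 s))
     + (csum N (h s) * csum N (r s) + csum N (r s) * csum N (h s) - real N * (c3 s + c3 s)))"
    unfolding c1_def c2_def c3_def by (intro prim_add qd prim_cmult prim_bilinear r md p mp gp N2)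
  from prim_cmult[OF this, of "1 / (real N)\<^sup>2"] show ?thesis
  proof (rule prim_cong)
    fix s assume s: "s \<in> {0..T}"
    have "Mean N P s (\<lambda>e. energy N (\<lambda>x. e x - r s x)) = Mean N P s (\<lambda>e. 1 / (real N)\<^sup>2 *
       (quad N e - 2 * csum N (\<lambda>x. r s x * pot N e x) + csum N (\<lambda>x. r s x * pot N (r s) x)))"
      unfolding energy_expand[OF N1, symmetric] using N0 by simp
    also have "\<dots> = 1 / (real N)\<^sup>2 * (Mean N P s (quad N) - 2 * csum N (\<lambda>x. r s x * pot N (m s) x)
        + Mean N P s (\<lambda>e. csum N (\<lambda>x. r s x * pot N (r s) x)))"
      unfolding Mean_cmult Mean_add Mean_diff Mean_pot m_def[abs_def] ..
    finally have eq: "Mean N P s (\<lambda>e. energy N (\<lambda>x. e x - r s x)) = \<dots>" .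
    show "1 / (real N)\<^sup>2 * (Mean N P s (quad N) + (-2) * csum N (\<lambda>x. r s x * pot N (m s) x) + csum N (\<lambda>x. r s x * pot N (r s) x))
      = Mean N P s (\<lambda>e. energy N (\<lambda>x. e x - r s x))"
      unfolding eq Mean_const[OF T N law s] by simp
  next
    fix s assume s: "s \<in> {0..T}"
    have M1: "Mean N P s (\<lambda>e. (csum N (hh e) - csum N (h s)) * (csum N e - csum N (r s))) =
       Mean N P s (\<lambda>e. csum N (hh e) * csum N e - csum N (r s) * csum N (hh e) - csum N (h s) * csum N e + csum N (h s) * csum N (r s))"
      by (simp add: algebra_simps)
    also have "\<dots> = Q s - csum N (r s) * csum N (g s) - csum N (h s) * csum N (m s) + csum N (h s) * csum N (r s)"
      unfolding Mean_add Mean_diff Mean_cmult Mean_const[OF T N law s] Q_def by (simp add: Mean_csum g_def[abs_def] m_def[abs_def])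
    finally have M1: "Mean N P s (\<lambda>e. (csum N (hh e) - csum N (h s)) * (csum N e - csum N (r s))) = \<dots>" .
    have "Mean N P s (flux_gap N (r s) (h s)) = Mean N P s (\<lambda>e. csum N (hh e) - (1 / 2) * csum N (crate e)
       - csum N (\<lambda>x. r s x * hh e x) - csum N (\<lambda>x. h s x * e x) + c3 s)"
      unfolding flux_gap_def AA_def c3_def csum_add csum_diff csum_cmult[symmetric] by (simp add: mult.commute)
    also have "\<dots> = csum N (g s) - (1 / 2) * K s - c1 s - c2 s + c3 s"
      unfolding Mean_add Mean_diff Mean_cmult Mean_const[OF T N law s] K_def Mean_weighted c1_def c2_def
      by (simp add: Mean_csum g_def[abs_def] m_def[abs_def] mult.commute)
    finally have M2: "Mean N P s (flux_gap N (r s) (h s)) = \<dots>" .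
    show "1 / (real N)\<^sup>2 * (2 * Q s - 2 * real N * csum N (g s) + (real N - 1) * K s
     + (-2) * (csum N (h s) * csum N (m s) + csum N (r s) * csum N (g s) - real N * (c2 s + c1 s))
     + (csum N (h s) * csum N (r s) + csum N (r s) * csum N (h s) - real N * (c3 s + c3 s)))
     = 2 / (real N)\<^sup>2 * Mean N P s (\<lambda>e. (csum N (hh e) - csum N (h s)) * (csum N e - csum N (r s)))
        - 2 / real N * Mean N P s (flux_gap N (r s) (h s))
        - Mean N P s (\<lambda>e. csum N (crate e)) / (real N)\<^sup>2"
      unfolding M1 M2 K_def[symmetric] using N0 by (simp add: field_simps power2_eq_square)
  qed
qed
end

section \<open>Partition of space-time into cells\<close>

definition time_cell :: "real \<Rightarrow> nat \<Rightarrow> nat \<Rightarrow> real set" where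
  "time_cell t k i = {real i * t / real k..real (Suc i) * t / real k}"

lemma set_integral_cells:
  fixes g :: "real \<Rightarrow> real"
  assumes g: "set_integrable lborel {0..t} g" and t: "t > 0" and k: "k \<ge> 1"
  shows "(LINT s:{0..t}|lborel. g s) = (\<Sum>i<k. LINT s:time_cell t k i|lborel. g s)"
proof -
  have "j \<le> k \<Longrightarrow> (LINT s:{0..real j * t / real k}|lborel. g s) = (\<Sum>i<j. LINT s:time_cell t k i|lborel. g s)" for j
  proof (induction j)
    case 0
    have "AE s in lborel. indicator {0..0::real} s *\<^sub>R g s = 0"
      using AE_lborel_singleton[of 0] by eventually_elim simp
    then show ?case unfolding set_lebesgue_integral_def by (simp add: integral_eq_zero_AE)
  next
    case (Suc j)
    have "real (Suc j) * t / real k \<le> real k * t / real k"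
      using Suc.prems t by (intro divide_right_mono mult_right_mono) auto
    then have "real (Suc j) * t / real k \<le> t" using k by simp
    then have "set_integrable lborel {0..real (Suc j) * t / real k} g"
      by (intro set_integrable_subset[OF g]) auto
    moreover have "real j * t / real k \<le> real (Suc j) * t / real k"
      using t by (intro divide_right_mono mult_right_mono) auto
    ultimately show ?case using set_integral_split[of 0 "real (Suc j) * t / real k" g "real j * t / real k"] Suc t
      by (simp add: time_cell_def)
  qed
  from this[of k] show ?thesis using k by simp
qed

lemma time_cell_bounds:
  assumes "t > 0" "i < k"
  shows "0 \<le> real i * t / real k" "real i * t / real k \<le> real (Suc i) * t / real k" "real (Suc i) * t / real k \<le> t"
    "real (Suc i) * t / real k - real i * t / real k = t / real k"
proof -
  show "0 \<le> real i * t / real k" using assms by simp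
  show "real i * t / real k \<le> real (Suc i) * t / real k"
    using assms by (intro divide_right_mono mult_right_mono) auto
  have "real (Suc i) * t / real k \<le> real k * t / real k"
    using assms by (intro divide_right_mono mult_right_mono) auto
  then show "real (Suc i) * t / real k \<le> t" using assms by simp
  show "real (Suc i) * t / real k - real i * t / real k = t / real k"
    unfolding diff_divide_distrib[symmetric] by (simp add: algebra_simps)
qed

text \<open>\<open>step_approximation\<close> with the time index frozen on each time cell, since
  the energy estimate works with one spatial step function per cell.\<close>

lemma cell_approximation:
  fixes F :: "real \<times> real \<Rightarrow> real"
  assumes m: "F \<in> borel_measurable borel" and b: "\<And>p. 0 \<le> F p" "\<And>p. F p \<le> 1"
    and t: "t > 0" and e: "\<epsilon> > 0"
  shows "\<exists>k\<ge>1. \<exists>\<gamma>. (\<forall>i j. 0 \<le> \<gamma> i j \<and> \<gamma> i j \<le> (1::real)) \<and>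
    (\<forall>i<k. set_integrable lborel (time_cell t k i) (\<lambda>s. LINT u:{0..<1}|lborel. \<bar>F (s, u) - \<gamma> i (nat \<lfloor>real k * u\<rfloor>)\<bar>)) \<and>
    (\<Sum>i<k. LINT s:time_cell t k i|lborel. LINT u:{0..<1}|lborel. \<bar>F (s, u) - \<gamma> i (nat \<lfloor>real k * u\<rfloor>)\<bar>) \<le> \<epsilon>"
proof -
  obtain k \<gamma> where k: "k \<ge> 1" and g: "\<And>i j. 0 \<le> \<gamma> i j" "\<And>i j. \<gamma> i j \<le> (1::real)"
    and le: "(LINT s:{0..t}|lborel. LINT u:{0..<1}|lborel. \<bar>F (s, u) - \<gamma> (nat \<lfloor>real k * (s / t)\<rfloor>) (nat \<lfloor>real k * u\<rfloor>)\<bar>) \<le> \<epsilon>"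
    using step_approximation[OF m b t e] by blast
  define A where "A i s = (LINT u:{0..<1}|lborel. \<bar>F (s, u) - \<gamma> i (nat \<lfloor>real k * u\<rfloor>)\<bar>)" for i s
  define c where "c s = nat \<lfloor>real k * (s / t)\<rfloor>" for s
  have Am: "A i \<in> borel_measurable borel" for i
  proof -
    have "(\<lambda>p. indicator {0..<1} (snd p) *\<^sub>R \<bar>F p - \<gamma> i (nat \<lfloor>real k * snd p\<rfloor>)\<bar>) \<in> borel_measurable (borel :: (real \<times> real) measure)"
    proof -
      have s: "snd \<in> borel_measurable (borel :: (real \<times> real) measure)"
        by (intro borel_measurable_continuous_onI continuous_intros)
      have "(\<lambda>u. \<gamma> i (nat \<lfloor>real k * u\<rfloor>)) \<in> borel_measurable borel" by measurable
      from measurable_compose[OF s this] have 1: "(\<lambda>p::real\<times>real. \<gamma> i (nat \<lfloor>real k * snd p\<rfloor>)) \<in> borel_measurable borel" .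
      have "(indicator {0..<1} :: real \<Rightarrow> real) \<in> borel_measurable borel" by measurable
      from measurable_compose[OF s this] have 2: "(\<lambda>p::real\<times>real. indicator {0..<1} (snd p) :: real) \<in> borel_measurable borel" .
      show ?thesis by (intro borel_measurable_scaleR 2 borel_measurable_abs borel_measurable_diff m 1)
    qed
    then have "(\<lambda>p. indicator {0..<1} (snd p) *\<^sub>R \<bar>F p - \<gamma> i (nat \<lfloor>real k * snd p\<rfloor>)\<bar>) \<in> borel_measurable (lborel \<Otimes>\<^sub>M lborel)"
      by (simp add: lborel_prod)
    then have "(\<lambda>(s, u). indicator {0..<1} u *\<^sub>R \<bar>F (s, u) - \<gamma> i (nat \<lfloor>real k * u\<rfloor>)\<bar>) \<in> borel_measurable (lborel \<Otimes>\<^sub>M lborel)"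
      by (simp only: split_beta' prod.collapse)
    from lborel.borel_measurable_lebesgue_integral[OF this]
    show ?thesis by (simp add: A_def[abs_def] set_lebesgue_integral_def)
  qed
  have Ab: "\<bar>A i s\<bar> \<le> 1" for i s
  proof -
    have gm: "(\<lambda>u. \<gamma> i (nat \<lfloor>real k * u\<rfloor>)) \<in> borel_measurable borel" by measurable
    have Fm: "(\<lambda>u. F (s, u)) \<in> borel_measurable borel"
      by (rule measurable_compose[OF _ m]) (intro borel_measurable_continuous_onI continuous_intros)
    have lb: "\<bar>F (s, u) - \<gamma> i j\<bar> \<le> 1" for u j using b[of "(s, u)"] g[of i j] by (simp add: abs_le_iff)
    have "set_integrable lborel {0..<1} (\<lambda>u. \<bar>F (s, u) - \<gamma> i (nat \<lfloor>real k * u\<rfloor>)\<bar>)"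
      by (rule unit_integrable[where B = 1])
        (use lb in \<open>auto intro!: borel_measurable_times borel_measurable_abs borel_measurable_diff Fm gm\<close>)
    moreover have "set_integrable lborel {0..<1::real} (\<lambda>u. 1::real)"
      by (rule unit_integrable[where B = 1]) auto
    ultimately have "A i s \<le> (LINT u:{0..<1::real}|lborel. (1::real))" unfolding A_def
      using lb by (intro set_integral_mono) auto
    moreover have "0 \<le> A i s" unfolding A_def set_lebesgue_integral_def by (rule Bochner_Integration.integral_nonneg) simp
    ultimately show ?thesis by (simp add: set_lebesgue_integral_def)
  qed
  have Ai: "set_integrable lborel {a..b} (A i)" if "0 \<le> a" for i a b
    by (rule bounded_set_integrable[where B = 1 and t = b])
      (use that in \<open>auto intro!: Ab borel_measurable_times Am\<close>)
  have cm: "c \<in> measurable borel (count_space UNIV)" unfolding c_def by measurable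
  have gm: "(\<lambda>s. A (c s) s) \<in> borel_measurable borel"
    by (rule measurable_compose_countable[OF Am cm])
  have gi: "set_integrable lborel {0..t} (\<lambda>s. A (c s) s)"
    by (rule bounded_set_integrable[where B = 1 and t = t])
      (auto intro!: Ab borel_measurable_times gm)
  have "(LINT s:{0..t}|lborel. A (c s) s) = (\<Sum>i<k. LINT s:time_cell t k i|lborel. A (c s) s)"
    by (rule set_integral_cells[OF gi t k])
  also have "\<dots> = (\<Sum>i<k. LINT s:time_cell t k i|lborel. A i s)"
  proof (rule sum.cong)
    fix i assume "i \<in> {..<k}"
    show "(LINT s:time_cell t k i|lborel. A (c s) s) = (LINT s:time_cell t k i|lborel. A i s)"
      unfolding set_lebesgue_integral_def
    proof (rule integral_cong_AE)
      show "(\<lambda>s. indicator (time_cell t k i) s *\<^sub>R A (c s) s) \<in> borel_measurable lborel"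
        "(\<lambda>s. indicator (time_cell t k i) s *\<^sub>R A i s) \<in> borel_measurable lborel"
        unfolding time_cell_def by (auto intro!: borel_measurable_times gm Am)
      \<comment> \<open>At the right endpoint the floor already gives the next index; this single
        point is negligible.\<close>
      have ci: "c s = i" if s: "s \<in> time_cell t k i" "s \<noteq> real (Suc i) * t / real k" for s
      proof -
        have "real i * t / real k \<le> s" "s < real (Suc i) * t / real k" using s by (auto simp: time_cell_def)
        then have "real i \<le> real k * (s / t)" "real k * (s / t) < real i + 1"
          using t k by (simp_all add: field_simps)
        then have "\<lfloor>real k * (s / t)\<rfloor> = int i" by (intro floor_unique) auto
        then show ?thesis by (simp add: c_def)
      qed
      show "AE s in lborel. indicator (time_cell t k i) s *\<^sub>R A (c s) s = indicator (time_cell t k i) s *\<^sub>R A i s"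
        using AE_lborel_singleton[of "real (Suc i) * t / real k"]
      proof eventually_elim
        case (elim s)
        then show ?case using ci[of s] by (cases "s \<in> time_cell t k i") auto
      qed
    qed
  qed simp
  finally have "(\<Sum>i<k. LINT s:time_cell t k i|lborel. A i s) \<le> \<epsilon>" using le by (simp add: A_def c_def)
  moreover have "\<forall>i<k. set_integrable lborel (time_cell t k i) (A i)" using Ai t by (simp add: time_cell_def)
  ultimately show ?thesis using k g unfolding A_def by blast
qed

definition site_cell :: "nat \<Rightarrow> nat \<Rightarrow> nat \<Rightarrow> int \<Rightarrow> real" where
  "site_cell k j = lattice_step k (\<lambda>i. of_bool (i = j))"

lemma lattice_step_periodic: "periodic N (lattice_step k \<gamma> N)"
  by (simp add: periodic_def lattice_step_def)

lemma site_cell_sum: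
  assumes k: "k \<ge> 1" and N: "N \<ge> 1"
  shows "(\<Sum>j<k. site_cell k j N x * G j) = G (nat \<lfloor>real k * (of_int (x mod int N) / real N)\<rfloor>)"
proof -
  let ?c = "of_int (x mod int N) / real N"
  have c: "0 \<le> ?c" "?c < 1" using mod_fraction[OF N, of x] by auto
  have "real k * ?c < real k * 1" using c k by (intro mult_strict_left_mono) auto
  moreover have "0 \<le> real k * ?c" using c k by (intro mult_nonneg_nonneg) auto
  ultimately have "nat \<lfloor>real k * ?c\<rfloor> < k" by (simp add: nat_less_iff floor_less_iff)
  then show ?thesis by (simp add: site_cell_def lattice_step_def of_bool_def if_distrib[of "\<lambda>y. y * _"] cong: if_cong)
qed

text \<open>The cell index is monotone in the site, so g is nondecreasing with total increase at
  most 2, and each change of the indicator is charged to an increase of g. The seam at site 0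
  accounts for the third unit; there the natural number x - 1 is again 0, so g contributes
  nothing.\<close>

lemma variation_site_cell:
  assumes N: "N \<ge> 1" shows "variation N (site_cell k j N) \<le> 3"
proof -
  define c where "c x = nat \<lfloor>real k * (real x / real N)\<rfloor>" for x :: nat
  have mono: "c x \<le> c (Suc x)" for x
    unfolding c_def by (intro nat_mono floor_mono mult_left_mono divide_right_mono) auto
  define g where "g x = (of_bool (j \<le> c x) + of_bool (Suc j \<le> c x) :: real)" for x
  have val: "site_cell k j N (int x) = of_bool (c x = j)" if "x < N" for x
    using that by (simp add: site_cell_def lattice_step_def c_def)
  have "\<bar>site_cell k j N (int x) - site_cell k j N (int x - 1)\<bar> \<le> of_bool (x = 0) + (g x - g (x - 1))" if x: "x < N" for x
  proof (cases x)
    case 0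
    have "\<bar>site_cell k j N y - site_cell k j N z\<bar> \<le> 1" for y z by (simp add: site_cell_def lattice_step_def)
    then show ?thesis using 0 by simp
  next
    case (Suc y)
    have "site_cell k j N (int x - 1) = of_bool (c y = j)" using val[of y] Suc x by simp
    then show ?thesis using val[OF x] mono[of y] Suc by (auto simp: g_def)
  qed
  then have "variation N (site_cell k j N) \<le> (\<Sum>x<N. of_bool (x = 0) + (g x - g (x - 1)))"
    unfolding variation_def csum_def by (intro sum_mono) auto
  also have "\<dots> = 1 + (\<Sum>x<N. g x - g (x - 1))" using N by (simp add: sum.distrib of_bool_def)
  also have "(\<Sum>x<N. g x - g (x - 1)) = g (N - 1) - g 0" using N
  proof (induction N rule: dec_induct)
    case (step n) then show ?case by (cases n) auto
  qed simp
  also have "1 + (g (N - 1) - g 0) \<le> 3" by (simp add: g_def)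
  finally show ?thesis by simp
qed

text \<open>The gap is affine in r and in h separately. The factors multiplying the two replacements
  are differences of numbers in [0, 1], so each costs its L1 distance.\<close>

lemma flux_gap_compare:
  assumes e: "e \<in> cfg N"
    and b: "\<And>x. 0 \<le> h x" "\<And>x. h x \<le> 1" "\<And>x. 0 \<le> r' x" "\<And>x. r' x \<le> 1"
  shows "flux_gap N r' h' e - (csum N (\<lambda>x. \<bar>r x - r' x\<bar>) + csum N (\<lambda>x. \<bar>h x - h' x\<bar>)) \<le> flux_gap N r h e"
  unfolding flux_gap_def csum_add[symmetric] csum_diff[symmetric]
proof (rule csum_mono)
  fix x
  have i: "AA e x - r x * hh e x - h x * e x + r x * h x - (AA e x - r' x * hh e x - h' x * e x + r' x * h' x)
     = (r x - r' x) * (h x - hh e x) + (h x - h' x) * (r' x - e x)" by (simp add: algebra_simps)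
  have "\<bar>h x - hh e x\<bar> \<le> 1" using b[of x] hh01[OF e, of x] by (auto simp: abs_le_iff)
  then have "\<bar>(r x - r' x) * (h x - hh e x)\<bar> \<le> \<bar>r x - r' x\<bar>" unfolding abs_mult by (intro mult_left_le) auto
  moreover have "\<bar>r' x - e x\<bar> \<le> 1" using b[of x] cfg01[OF e, of x] by (auto simp: abs_le_iff)
  then have "\<bar>(h x - h' x) * (r' x - e x)\<bar> \<le> \<bar>h x - h' x\<bar>" unfolding abs_mult by (intro mult_left_le) auto
  ultimately show "AA e x - r' x * hh e x - h' x * e x + r' x * h' x - (\<bar>r x - r' x\<bar> + \<bar>h x - h' x\<bar>)
    \<le> AA e x - r x * hh e x - h x * e x + r x * h x" using i by linarith
qed

lemma unit_L1_integrable: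
  assumes f: "profile f" and g: "\<And>i. 0 \<le> \<gamma> i" "\<And>i. \<gamma> i \<le> (1::real)"
  shows "set_integrable lborel {0..<1} (\<lambda>u. \<bar>f u - \<gamma> (nat \<lfloor>real k * u\<rfloor>)\<bar>)"
proof (rule unit_integrable[where B = 1])
  have m: "(\<lambda>u. \<gamma> (nat \<lfloor>real k * u\<rfloor>)) \<in> borel_measurable borel" by measurable
  have "(\<lambda>u. indicator {0..<1} u * \<bar>indicator {0..<1} u * f u - \<gamma> (nat \<lfloor>real k * u\<rfloor>)\<bar>) \<in> borel_measurable borel"
    by (intro borel_measurable_times[OF _ borel_measurable_abs[OF borel_measurable_diff[OF _ m]]]) (use f in \<open>auto simp: profile_def\<close>)
  also have "(\<lambda>u. indicator {0..<1} u * \<bar>indicator {0..<1} u * f u - \<gamma> (nat \<lfloor>real k * u\<rfloor>)\<bar>) =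
     (\<lambda>u. indicator {0..<1} u * \<bar>f u - \<gamma> (nat \<lfloor>real k * u\<rfloor>)\<bar>)" by (auto simp: fun_eq_iff indicator_def)
  finally show "(\<lambda>u. indicator {0..<1} u * \<bar>f u - \<gamma> (nat \<lfloor>real k * u\<rfloor>)\<bar>) \<in> borel_measurable borel" .
  fix u :: real assume u: "u \<in> {0..<1}"
  then have "0 \<le> f u" "f u \<le> 1" using f by (auto simp: profile_def)
  then show "\<bar>\<bar>f u - \<gamma> (nat \<lfloor>real k * u\<rfloor>)\<bar>\<bar> \<le> 1" using g[of "nat \<lfloor>real k * u\<rfloor>"] by (simp add: abs_le_iff)
qed

lemma H_L1:
  assumes f: "profile f" "profile (\<lambda>u. \<H> (f u))" and g: "\<And>i. 0 \<le> \<gamma> i" "\<And>i. \<gamma> i \<le> (1::real)"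
  shows "(LINT u:{0..<1}|lborel. \<bar>\<H> (f u) - \<H> (\<gamma> (nat \<lfloor>real k * u\<rfloor>))\<bar>) \<le> 4 * (LINT u:{0..<1}|lborel. \<bar>f u - \<gamma> (nat \<lfloor>real k * u\<rfloor>)\<bar>)"
proof -
  have "set_integrable lborel {0..<1} (\<lambda>u. 4 * \<bar>f u - \<gamma> (nat \<lfloor>real k * u\<rfloor>)\<bar>)"
    using unit_L1_integrable[of f \<gamma> k] f g by simp
  moreover have "set_integrable lborel {0..<1} (\<lambda>u. \<bar>\<H> (f u) - \<H> (\<gamma> (nat \<lfloor>real k * u\<rfloor>))\<bar>)"
    using unit_L1_integrable[of "\<lambda>u. \<H> (f u)" "\<lambda>i. \<H> (\<gamma> i)" k] f g H_bounds by simp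
  ultimately have "(LINT u:{0..<1}|lborel. \<bar>\<H> (f u) - \<H> (\<gamma> (nat \<lfloor>real k * u\<rfloor>))\<bar>) \<le> (LINT u:{0..<1}|lborel. 4 * \<bar>f u - \<gamma> (nat \<lfloor>real k * u\<rfloor>)\<bar>)"
    by (intro set_integral_mono H_lipschitz)
  then show ?thesis by simp
qed

lemma Mean_sum: "Mean N P s (\<lambda>e. \<Sum>i\<in>I. \<Phi> i e) = (\<Sum>i\<in>I. Mean N P s (\<Phi> i))"
  unfolding Mean_def expect_def sum_distrib_left by (rule sum.swap)

context
  fixes T :: real and N :: nat and \<rho>ini :: "real \<Rightarrow> real" and P :: "(real \<Rightarrow> nat \<Rightarrow> nat) measure"
  assumes T: "T > 0" and N: "N \<ge> 5" and law: "FEP_law T N \<rho>ini P"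
begin

text \<open>The indicators of the k site cells form a partition, and each is a weight for
  \<open>cell_dissipation\<close>. The mass of each weight is there bounded by N, which loses a
  factor k; this is harmless because M is chosen after k.\<close>

lemma step_dissipation:
  assumes t: "0 < t" "t \<le> T" and i: "i < k" and M: "M \<ge> 3" and NM: "N \<ge> M + 4"
    and g: "\<And>j. 0 \<le> \<gamma> j" "\<And>j. \<gamma> j \<le> (1::real)"
  shows "(LINT s:time_cell t k i|lborel. Mean N P s (flux_gap N (lattice_step k \<gamma> N) (\<lambda>x. \<H> (lattice_step k \<gamma> N x))))
    \<ge> - (57 / ln (real M) * real N * t + cell_const M * (real k / real N + 3 * t))"
proof -
  let ?a = "real i * t / real k" and ?b = "real (Suc i) * t / real k"
  have tb: "0 \<le> ?a" "?a \<le> ?b" "?b \<le> T" "?b - ?a = t / real k"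
    using time_cell_bounds[OF t(1) i] t(2) by auto
  have k: "k \<ge> 1" using i by simp
  have N1: "N \<ge> 1" using N by simp
  define G where "G j e y = AA e y - \<gamma> j * hh e y - \<H> (\<gamma> j) * e y + \<gamma> j * \<H> (\<gamma> j)" for j e y
  have eq: "flux_gap N (lattice_step k \<gamma> N) (\<lambda>x. \<H> (lattice_step k \<gamma> N x)) = (\<lambda>e. \<Sum>j<k. csum N (\<lambda>y. site_cell k j N y * G j e y))"
    unfolding flux_gap_def csum_sum[symmetric] site_cell_sum[OF k N1, of _ "\<lambda>j. G j _ _"] by (simp add: lattice_step_def G_def)
  have C: "cell_const M \<ge> 0" using lip_pos[of M] by (simp add: cell_const_def)
  have "(LINT s:time_cell t k i|lborel. Mean N P s (flux_gap N (lattice_step k \<gamma> N) (\<lambda>x. \<H> (lattice_step k \<gamma> N x))))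
    = (\<Sum>j<k. LINT s:{?a..?b}|lborel. Mean N P s (\<lambda>e. csum N (\<lambda>y. site_cell k j N y * G j e y)))"
    unfolding eq Mean_sum time_cell_def
    by (rule set_integral_finite_sum) (rule Mean_integrable[OF T N law tb(1,3)])
  also have "\<dots> \<ge> (\<Sum>j<k. - (57 / ln (real M) * real N * (t / real k) + cell_const M * (1 / real N + 3 * (t / real k))))"
  proof (rule sum_mono)
    fix j assume "j \<in> {..<k}"
    have "periodic N (site_cell k j N)" "\<And>y. 0 \<le> site_cell k j N y" "\<And>y. site_cell k j N y \<le> 1"
      unfolding site_cell_def using lattice_step_periodic by (auto simp: lattice_step_def)
    note * = cell_dissipation[OF T N law tb(1,2,3) M NM this g(1)[of j] g(2)[of j], unfolded tb(4), folded G_def]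
    have "cell_const M * (1 / real N + variation N (site_cell k j N) * (t / real k)) \<le> cell_const M * (1 / real N + 3 * (t / real k))"
      using variation_site_cell[OF N1, of k j] t C by (intro mult_left_mono add_left_mono mult_right_mono) auto
    then show "- (57 / ln (real M) * real N * (t / real k) + cell_const M * (1 / real N + 3 * (t / real k))) \<le>
      (LINT s:{?a..?b}|lborel. Mean N P s (\<lambda>e. csum N (\<lambda>y. site_cell k j N y * G j e y)))" using * by linarith
  qed
  also have "(\<Sum>j<k. - (57 / ln (real M) * real N * (t / real k) + cell_const M * (1 / real N + 3 * (t / real k)))) =
    - (57 / ln (real M) * real N * t + cell_const M * (real k / real N + 3 * t))"
    using k by (simp add: distrib_left algebra_simps)
  finally show ?thesis .
qed

end

section \<open>Integrated energy estimate\<close>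

lemma prim_zero_const: "prim T f (\<lambda>_. 0) \<Longrightarrow> s \<in> {0..T} \<Longrightarrow> f s = f 0"
  using prim_increment[of T f "\<lambda>_. 0" 0 s] by (simp add: set_lebesgue_integral_def)

context
  fixes T :: real and N :: nat and \<rho>ini :: "real \<Rightarrow> real" and P :: "(real \<Rightarrow> nat \<Rightarrow> nat) measure"
    and r h :: "real \<Rightarrow> int \<Rightarrow> real"
  assumes T: "T > 0" and N: "N \<ge> 5" and law: "FEP_law T N \<rho>ini P"
    and r: "\<And>x. prim T (\<lambda>s. r s x) (\<lambda>s. (real N)\<^sup>2 * (h s (x + 1) + h s (x - 1) - 2 * h s x))"
    and p: "\<And>s. periodic N (r s)" "\<And>s. periodic N (h s)"
begin

text \<open>Exchanges preserve the total occupation, and the Laplacian in the equation of r has sum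
  zero; so the difference of totals keeps its initial law.\<close>

lemma mass_fluctuation:
  assumes s: "s \<in> {0..T}"
  shows "Mean N P s (\<lambda>e. (csum N (\<lambda>x. e x - r s x) / real N)\<^sup>2) = Mean N P 0 (\<lambda>e. (csum N (\<lambda>x. e x - r 0 x) / real N)\<^sup>2)"
proof -
  have "prim T (\<lambda>s. csum N (r s)) (\<lambda>_. 0)"
    using prim_csum[of T r "\<lambda>s x. (real N)\<^sup>2 * (h s (x + 1) + h s (x - 1) - 2 * h s x)" N] r unfolding csum_lap[OF p(2)] by blast
  then have c: "csum N (r s) = csum N (r 0)" using s by (rule prim_zero_const)
  define \<Phi> where "\<Phi> e = ((csum N e - csum N (r 0)) / real N)\<^sup>2" for e
  have "Mean N P s (gen N \<Phi>) = 0" if "s \<in> {0..T}" for s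
  proof -
    have "Mean N P s (gen N \<Phi>) = Mean N P s (\<lambda>_. 0)"
      unfolding \<Phi>_def[abs_def] using N by (intro Mean_cong gen_total) auto
    then show ?thesis using Mean_const[OF T N law that] by simp
  qed
  then have "prim T (\<lambda>s. Mean N P s \<Phi>) (\<lambda>_. 0)"
    by (intro prim_cong[OF Mean_prim[OF T N law]]) auto
  then have "Mean N P s \<Phi> = Mean N P 0 \<Phi>" using s by (rule prim_zero_const)
  then show ?thesis unfolding \<Phi>_def[abs_def] csum_diff c .
qed

text \<open>The flux difference is at most N, so after normalisation the term is at most 2|y|, with
  y the mass density discrepancy. Young's inequality with free \<eta> leaves a small constant plus a
  second moment that is conserved in time.\<close>

lemma mass_term:
  assumes \<eta>: "\<eta> > 0" and s: "s \<in> {0..T}" and b: "\<And>x. 0 \<le> h s x" "\<And>x. h s x \<le> 1"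
  shows "2 / (real N)\<^sup>2 * Mean N P s (\<lambda>e. (csum N (hh e) - csum N (h s)) * (csum N e - csum N (r s)))
    \<le> \<eta> + Mean N P 0 (\<lambda>e. (csum N (\<lambda>x. e x - r 0 x) / real N)\<^sup>2) / \<eta>"
proof -
  have N0: "real N > 0" using N by simp
  have "Mean N P s (\<lambda>e. 2 / (real N)\<^sup>2 * ((csum N (hh e) - csum N (h s)) * (csum N e - csum N (r s)))) \<le>
    Mean N P s (\<lambda>e. \<eta> + 1 / \<eta> * (csum N (\<lambda>x. e x - r s x) / real N)\<^sup>2)"
  proof (rule Mean_mono)
    fix e assume e: "e \<in> cfg N"
    define y where "y = csum N (\<lambda>x. e x - r s x) / real N"
    define z where "z = csum N (\<lambda>x. hh e x - h s x) / real N"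
    have "\<bar>csum N (\<lambda>x. hh e x - h s x)\<bar> \<le> csum N (\<lambda>x. 1)"
    proof (rule order_trans[OF csum_abs], rule csum_mono)
      fix x show "\<bar>hh e x - h s x\<bar> \<le> 1" using hh01[OF e, of x] b[of x] by (auto simp: abs_le_iff)
    qed
    then have z: "\<bar>z\<bar> \<le> 1" using N0 by (simp add: z_def csum_const)
    have "2 / (real N)\<^sup>2 * ((csum N (hh e) - csum N (h s)) * (csum N e - csum N (r s))) = 2 * (z * y)"
      using N0 by (simp add: y_def z_def csum_diff power2_eq_square)
    also have "z * y \<le> \<bar>z\<bar> * \<bar>y\<bar>" by (simp add: abs_mult[symmetric])
    also have "\<bar>z\<bar> * \<bar>y\<bar> \<le> \<bar>y\<bar>" using z by (intro mult_left_le_one_le) auto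
    also have "2 * \<bar>y\<bar> \<le> \<eta> + 1 / \<eta> * y\<^sup>2"
    proof -
      have "0 \<le> (\<bar>y\<bar> - \<eta>)\<^sup>2 / \<eta>" using \<eta> by simp
      also have "(\<bar>y\<bar> - \<eta>)\<^sup>2 / \<eta> = 1 / \<eta> * y\<^sup>2 - 2 * \<bar>y\<bar> + \<eta>" using \<eta> by (simp add: power2_diff field_simps power2_eq_square)
      finally show ?thesis by simp
    qed
    finally show "2 / (real N)\<^sup>2 * ((csum N (hh e) - csum N (h s)) * (csum N e - csum N (r s))) \<le> \<eta> + 1 / \<eta> * (csum N (\<lambda>x. e x - r s x) / real N)\<^sup>2"
      by (simp add: y_def)
  qed (use N in simp)
  then show ?thesis unfolding Mean_add Mean_cmult mass_fluctuation[OF s] Mean_const[OF T N law s] by simp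
qed

text \<open>r' and h' are to be the constants of the cells, C and C' their L1 errors. The jump-rate
  term of the balance is dropped by its sign.\<close>

lemma energy_rate:
  assumes \<eta>: "\<eta> > 0" and s: "s \<in> {0..T}" and b: "\<And>x. 0 \<le> h s x" "\<And>x. h s x \<le> 1"
    and b': "\<And>x. 0 \<le> r' x" "\<And>x. r' x \<le> 1"
    and c: "csum N (\<lambda>x. \<bar>r s x - r' x\<bar>) / real N \<le> C" "csum N (\<lambda>x. \<bar>h s x - h' x\<bar>) / real N \<le> C'"
  shows "2 / (real N)\<^sup>2 * Mean N P s (\<lambda>e. (csum N (hh e) - csum N (h s)) * (csum N e - csum N (r s)))
        - 2 / real N * Mean N P s (flux_gap N (r s) (h s))
        - Mean N P s (\<lambda>e. csum N (crate e)) / (real N)\<^sup>2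
    \<le> \<eta> + Mean N P 0 (\<lambda>e. (csum N (\<lambda>x. e x - r 0 x) / real N)\<^sup>2) / \<eta> + 2 * (C + C')
      - 2 / real N * Mean N P s (flux_gap N r' h')"
proof -
  have N0: "real N > 0" using N by simp
  define D where "D = csum N (\<lambda>x. \<bar>r s x - r' x\<bar>) + csum N (\<lambda>x. \<bar>h s x - h' x\<bar>)"
  have "Mean N P s (\<lambda>e. flux_gap N r' h' e - D) \<le> Mean N P s (flux_gap N (r s) (h s))"
    unfolding D_def using N by (intro Mean_mono flux_gap_compare b b') auto
  then have 1: "Mean N P s (flux_gap N r' h') - D \<le> Mean N P s (flux_gap N (r s) (h s))"
    unfolding Mean_diff Mean_const[OF T N law s] .
  have "Mean N P s (\<lambda>_. 0) \<le> Mean N P s (\<lambda>e. csum N (crate e))"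
  proof (rule Mean_mono)
    fix e assume "e \<in> cfg N"
    then show "0 \<le> csum N (crate e)" using crate01[of e N] by (intro csum_nonneg) (metis order_refl zero_le_one)
  qed (use N in simp)
  then have 2: "0 \<le> Mean N P s (\<lambda>e. csum N (crate e)) / (real N)\<^sup>2"
    unfolding Mean_const[OF T N law s] by simp
  have "2 / real N * (Mean N P s (flux_gap N r' h') - D) \<le> 2 / real N * Mean N P s (flux_gap N (r s) (h s))"
    using 1 by (intro mult_left_mono) auto
  moreover have "2 / real N * D \<le> 2 * (C + C')" using c N0 by (simp add: D_def add_divide_distrib)
  ultimately show ?thesis using mass_term[OF \<eta> s b] 2 unfolding right_diff_distrib by linarith
qed

end

lemma energy_estimate:
  assumes T: "T > 0" and N: "N \<ge> 5" and law: "FEP_law T N \<rho>ini P" and w: "weak_solution_at_all_times T \<rho>ini \<rho>"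
    and t: "0 < t" "t \<le> T" and M: "M \<ge> 3" and NM: "N \<ge> M + 4" and \<eta>: "\<eta> > 0" and k: "k \<ge> 1"
    and g: "\<And>i j. 0 \<le> \<gamma> i j" "\<And>i j. \<gamma> i j \<le> 1"
    and Ai: "\<And>i. i < k \<Longrightarrow> set_integrable lborel (time_cell t k i) (\<lambda>s. LINT u:{0..<1}|lborel. \<bar>\<rho> s u - \<gamma> i (nat \<lfloor>real k * u\<rfloor>)\<bar>)"
    and Ae: "(\<Sum>i<k. LINT s:time_cell t k i|lborel. LINT u:{0..<1}|lborel. \<bar>\<rho> s u - \<gamma> i (nat \<lfloor>real k * u\<rfloor>)\<bar>) \<le> \<epsilon>"
  shows "Mean N P t (\<lambda>e. energy N (\<lambda>x. e x - kavg (\<rho> t) spline N x)) \<le>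
    Mean N P 0 (\<lambda>e. energy N (\<lambda>x. e x - kavg \<rho>ini spline N x))
    + t * (\<eta> + Mean N P 0 (\<lambda>e. (csum N (\<lambda>x. e x - kavg \<rho>ini spline N x) / real N)\<^sup>2) / \<eta>)
    + 114 * real k * t / ln (real M) + 10 * \<epsilon> + (2 * real k * cell_const M * (real k / real N + 3 * t) + 16 * real k * t) / real N"
proof -
  define r where "r s = kavg (\<rho> s) spline N" for s
  define h where "h s = kavg (\<lambda>u. \<H> (\<rho> s u)) hat N" for s
  define A where "A i s = (LINT u:{0..<1}|lborel. \<bar>\<rho> s u - \<gamma> i (nat \<lfloor>real k * u\<rfloor>)\<bar>)" for i s
  have N1: "N \<ge> 1" and N0: "real N > 0" and k0: "real k > 0" using N k by auto
  have rp: "prim T (\<lambda>s. r s x) (\<lambda>s. (real N)\<^sup>2 * (h s (x + 1) + h s (x - 1) - 2 * h s x))" for x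
    unfolding r_def h_def by (rule lattice_prim[OF w _ N]) (use T in simp)
  have p: "periodic N (r s)" "periodic N (h s)" for s unfolding r_def h_def by (rule kavg_periodic[OF N1])+
  have r0: "r 0 = kavg \<rho>ini spline N" unfolding r_def by (rule ext, rule lattice_initial[OF w _ N]) (use T in simp)
  have wT: "weak_solution T \<rho>ini \<rho>" using w T by (simp add: weak_solution_at_all_times_def)
  note pr = weak_profile[OF wT]
  have hb: "0 \<le> h s x" "h s x \<le> 1" if "s \<in> {0..T}" for s x
    unfolding h_def using kavg_bounds[OF pr(2)[OF that] unity_hat N, of x] by auto
  define \<mu> where "\<mu> = Mean N P 0 (\<lambda>e. (csum N (\<lambda>x. e x - r 0 x) / real N)\<^sup>2)"
  define R where "R i = lattice_step k (\<gamma> i) N" for i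
  define J where "J i = flux_gap N (R i) (\<lambda>x. \<H> (R i x))" for i
  define Dd where "Dd s = 2 / (real N)\<^sup>2 * Mean N P s (\<lambda>e. (csum N (hh e) - csum N (h s)) * (csum N e - csum N (r s)))
        - 2 / real N * Mean N P s (flux_gap N (r s) (h s))
        - Mean N P s (\<lambda>e. csum N (crate e)) / (real N)\<^sup>2" for s
  have bal: "prim T (\<lambda>s. Mean N P s (\<lambda>e. energy N (\<lambda>x. e x - r s x))) Dd"
    unfolding Dd_def[abs_def] by (rule energy_balance[OF T N law rp p])
  \<comment> \<open>The factor 10 is 2 (1 + 4), where 4 is the Lipschitz constant of H; 16 is 2 (4 +
    4), from the two grid errors of \<open>kavg_step\<close>.\<close>
  define B where "B i s = (\<eta> + \<mu> / \<eta> + 16 * real k / real N) + (10 * A i s - 2 / real N * Mean N P s (J i))" for i s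
  have rate: "Dd s \<le> B i s" if s: "s \<in> {0..T}" for i s
  proof -
    have "csum N (\<lambda>x. \<bar>r s x - R i x\<bar>) / real N \<le> A i s + 4 * real k / real N"
      unfolding r_def R_def A_def by (rule kavg_step[OF pr(1)[OF s] unity_spline N k g])
    moreover have "csum N (\<lambda>x. \<bar>h s x - \<H> (R i x)\<bar>) / real N \<le> 4 * A i s + 4 * real k / real N"
    proof -
      have "csum N (\<lambda>x. \<bar>h s x - \<H> (R i x)\<bar>) / real N \<le>
         (LINT u:{0..<1}|lborel. \<bar>\<H> (\<rho> s u) - \<H> (\<gamma> i (nat \<lfloor>real k * u\<rfloor>))\<bar>) + 4 * real k / real N"
        using kavg_step[OF pr(2)[OF s] unity_hat N k, of "\<lambda>j. \<H> (\<gamma> i j)"] g H_bounds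
        by (simp add: h_def R_def lattice_step_def)
      also have "\<dots> \<le> 4 * A i s + 4 * real k / real N"
        unfolding A_def by (rule add_right_mono[OF H_L1[OF pr(1)[OF s] pr(2)[OF s] g]])
      finally show ?thesis .
    qed
    moreover have "0 \<le> R i x" "R i x \<le> 1" for x using g by (auto simp: R_def lattice_step_def)
    ultimately have "Dd s \<le> \<eta> + \<mu> / \<eta> + 2 * ((A i s + 4 * real k / real N) + (4 * A i s + 4 * real k / real N)) - 2 / real N * Mean N P s (J i)"
      unfolding Dd_def \<mu>_def J_def using hb[OF s] by (intro energy_rate[OF T N law rp p \<eta> s]) auto
    then show ?thesis unfolding B_def by (simp add: algebra_simps)
  qed
  let ?E = "57 / ln (real M) * real N * t + cell_const M * (real k / real N + 3 * t)"
  have cell: "(LINT s:time_cell t k i|lborel. Dd s) \<le> (\<eta> + \<mu> / \<eta> + 16 * real k / real N) * (t / real k) +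
     (10 * (LINT s:time_cell t k i|lborel. A i s) + 2 / real N * ?E)" if i: "i < k" for i
  proof -
    note tb = time_cell_bounds[OF t(1) i]
    have tT: "real (Suc i) * t / real k \<le> T" using tb(3) t(2) by simp
    have iD: "set_integrable lborel (time_cell t k i) Dd"
      unfolding time_cell_def by (rule prim_integrable[OF bal tb(1) tT])
    have iA: "set_integrable lborel (time_cell t k i) (A i)" unfolding A_def by (rule Ai[OF i])
    have iJ: "set_integrable lborel (time_cell t k i) (\<lambda>s. Mean N P s (J i))"
      unfolding time_cell_def by (rule Mean_integrable[OF T N law tb(1) tT])
    have ic: "set_integrable lborel (time_cell t k i) (\<lambda>s. c)" for c :: real
      unfolding time_cell_def by (rule borel_integrable_atLeastAtMost') (rule continuous_on_const)
    have lc: "(LINT s:time_cell t k i|lborel. c) = c * (t / real k)" for c :: real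
      unfolding time_cell_def using tb(2) tb(4) by (simp add: set_lebesgue_integral_def)
    have iAJ: "set_integrable lborel (time_cell t k i) (\<lambda>s. 10 * A i s - 2 / real N * Mean N P s (J i))"
      using iA iJ by (intro set_integral_diff) auto
    have iB: "set_integrable lborel (time_cell t k i) (B i)"
      unfolding B_def by (intro set_integral_add ic iAJ)
    have "(LINT s:time_cell t k i|lborel. Dd s) \<le> (LINT s:time_cell t k i|lborel. B i s)"
    proof (rule set_integral_mono[OF iD iB])
      fix s assume "s \<in> time_cell t k i"
      then have "s \<in> {0..T}" using tb(1) tT by (auto simp: time_cell_def)
      then show "Dd s \<le> B i s" by (rule rate)
    qed
    also have "(LINT s:time_cell t k i|lborel. B i s) = (LINT s:time_cell t k i|lborel. \<eta> + \<mu> / \<eta> + 16 * real k / real N)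
       + (LINT s:time_cell t k i|lborel. 10 * A i s - 2 / real N * Mean N P s (J i))"
      unfolding B_def by (rule set_integral_add(2)[OF ic iAJ])
    also have "(LINT s:time_cell t k i|lborel. 10 * A i s - 2 / real N * Mean N P s (J i)) =
       (LINT s:time_cell t k i|lborel. 10 * A i s) - (LINT s:time_cell t k i|lborel. 2 / real N * Mean N P s (J i))"
      using iA iJ by (intro set_integral_diff) auto
    also have "\<dots> = 10 * (LINT s:time_cell t k i|lborel. A i s) - 2 / real N * (LINT s:time_cell t k i|lborel. Mean N P s (J i))"
      by simp
    finally have "(LINT s:time_cell t k i|lborel. Dd s) \<le> (LINT s:time_cell t k i|lborel. \<eta> + \<mu> / \<eta> + 16 * real k / real N)
      + (10 * (LINT s:time_cell t k i|lborel. A i s) - 2 / real N * (LINT s:time_cell t k i|lborel. Mean N P s (J i)))" .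
    moreover have "10 * (LINT s:time_cell t k i|lborel. A i s) - 2 / real N * (LINT s:time_cell t k i|lborel. Mean N P s (J i))
       \<le> 10 * (LINT s:time_cell t k i|lborel. A i s) - 2 / real N * (- ?E)"
      using step_dissipation[OF T N law t i M NM g] unfolding J_def R_def
      by (intro diff_left_mono mult_left_mono) auto
    ultimately show ?thesis unfolding lc mult_minus_right diff_minus_eq_add by linarith
  qed
  have "Mean N P t (\<lambda>e. energy N (\<lambda>x. e x - r t x)) - Mean N P 0 (\<lambda>e. energy N (\<lambda>x. e x - r 0 x)) = (LINT s:{0..t}|lborel. Dd s)"
    using t by (intro prim_increment[OF bal]) auto
  also have "\<dots> = (\<Sum>i<k. LINT s:time_cell t k i|lborel. Dd s)"
    by (rule set_integral_cells[OF prim_integrable[OF bal] t(1) k]) (use t in auto)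
  also have "\<dots> \<le> (\<Sum>i<k. (\<eta> + \<mu> / \<eta> + 16 * real k / real N) * (t / real k) +
     (10 * (LINT s:time_cell t k i|lborel. A i s) + 2 / real N * ?E))"
    by (rule sum_mono) (use cell in auto)
  also have "\<dots> = real k * ((\<eta> + \<mu> / \<eta> + 16 * real k / real N) * (t / real k)) +
     (10 * (\<Sum>i<k. LINT s:time_cell t k i|lborel. A i s) + real k * (2 / real N * ?E))"
  proof -
    have "(\<Sum>i<k. a + (10 * f i + b)) = real k * a + (10 * (\<Sum>i<k. f i) + real k * b)" for a b and f :: "nat \<Rightarrow> real"
      by (simp add: sum.distrib sum_distrib_left)
    then show ?thesis .
  qed
  also have "\<dots> \<le> real k * ((\<eta> + \<mu> / \<eta> + 16 * real k / real N) * (t / real k)) +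
     (10 * \<epsilon> + real k * (2 / real N * ?E))"
    using Ae by (intro add_left_mono add_right_mono mult_left_mono) (auto simp: A_def)
  also have "\<dots> = t * (\<eta> + \<mu> / \<eta>) + 114 * real k * t / ln (real M) + 10 * \<epsilon>
     + (2 * real k * cell_const M * (real k / real N + 3 * t) + 16 * real k * t) / real N"
  proof -
    define l where "l = ln (real M)"
    have l: "l > 0" using M by (simp add: l_def)
    have 1: "real k * ((\<eta> + \<mu> / \<eta> + 16 * real k / real N) * (t / real k)) = t * (\<eta> + \<mu> / \<eta>) + 16 * real k * t / real N"
      using k0 by (simp add: algebra_simps)
    have 2: "real k * (2 / real N * (57 / l * real N * t + cell_const M * (real k / real N + 3 * t))) =
       114 * real k * t / l + 2 * real k * cell_const M * (real k / real N + 3 * t) / real N"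
    proof -
      have 3: "real k * (2 / real N * (57 / l * real N * t)) = 114 * real k * t / l" using N0 l by simp
      have 4: "real k * (2 / real N * (cell_const M * (real k / real N + 3 * t))) = 2 * real k * cell_const M * (real k / real N + 3 * t) / real N"
        by simp
      show ?thesis unfolding distrib_left[of "2 / real N"] distrib_left[of "real k"] 3 4 ..
    qed
    show ?thesis unfolding l_def[symmetric] 1 2 by (simp add: add_divide_distrib)
  qed
  finally show ?thesis unfolding r0 \<mu>_def by (simp add: r_def)
qed

section \<open>The hydrodynamic limit\<close>

lemma lattice_profile:
  assumes "\<rho>ini \<in> borel_measurable (restrict_space borel {0..<1})" and "\<And>u. u \<in> {0..<1} \<Longrightarrow> \<rho>ini u \<in> {0..1}"
  shows "profile \<rho>ini"
  using assms by (simp add: profile_def borel_measurable_restrict_space_iff)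

context
  fixes T t :: real and \<rho>ini :: "real \<Rightarrow> real" and \<rho> :: "real \<Rightarrow> real \<Rightarrow> real" and P :: "nat \<Rightarrow> (real \<Rightarrow> nat \<Rightarrow> nat) measure"
  assumes T: "T > 0" and pi: "profile \<rho>ini" and lr: "lattice_representative \<rho>ini"
    and law: "\<And>N. N \<ge> 1 \<Longrightarrow> FEP_law T N \<rho>ini (P N)" and w: "weak_solution_at_all_times T \<rho>ini \<rho>"
begin

lemma initial_energy_limit: "(\<lambda>N. Mean N (P N) 0 (\<lambda>e. energy N (\<lambda>x. e x - kavg \<rho>ini spline N x))) \<longlonglongrightarrow> 0"
proof (rule tendsto_sandwich[OF _ _ tendsto_const])
  show "\<forall>\<^sub>F N in sequentially. 0 \<le> Mean N (P N) 0 (\<lambda>e. energy N (\<lambda>x. e x - kavg \<rho>ini spline N x))"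
    using eventually_ge_at_top[of 5]
  proof eventually_elim
    case (elim N)
    then have N: "N \<ge> 5" "N \<ge> 1" "N \<ge> 2" by auto
    have "Mean N (P N) 0 (\<lambda>_. 0) \<le> Mean N (P N) 0 (\<lambda>e. energy N (\<lambda>x. e x - kavg \<rho>ini spline N x))"
    proof (rule Mean_mono[OF N(2)])
      fix e assume "e \<in> cfg N"
      then show "0 \<le> energy N (\<lambda>x. e x - kavg \<rho>ini spline N x)"
        using periodic_comp2[OF cfg_periodic(1) kavg_periodic[OF N(2)], of e "\<lambda>a b. a - b"] N by (intro energy_nonneg) auto
    qed
    then show ?case using Mean_const[OF T N(1) law[OF N(2)], of 0] T by simp
  qed
  show "\<forall>\<^sub>F N in sequentially. Mean N (P N) 0 (\<lambda>e. energy N (\<lambda>x. e x - kavg \<rho>ini spline N x))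
     \<le> energy N (\<lambda>x. site_density \<rho>ini N x - kavg \<rho>ini spline N x) + 1 / real N"
    using eventually_ge_at_top[of 5]
  proof eventually_elim
    case (elim N)
    then have N: "N \<ge> 5" "N \<ge> 1" by auto
    show ?case using initial_energy_bound[OF N(1) pi]
      by (simp add: Mean_def expect_initial[OF T N(2) law[OF N(2)]] ini_expect_def)
  qed
  show "(\<lambda>N. energy N (\<lambda>x. site_density \<rho>ini N x - kavg \<rho>ini spline N x) + 1 / real N) \<longlonglongrightarrow> 0"
    using tendsto_add[OF initial_energy[OF lr pi] lim_1_over_n] by simp
qed

lemma initial_mass_limit: "(\<lambda>N. Mean N (P N) 0 (\<lambda>e. (csum N (\<lambda>x. e x - kavg \<rho>ini spline N x) / real N)\<^sup>2)) \<longlonglongrightarrow> 0"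
proof (rule tendsto_sandwich[OF _ _ tendsto_const])
  show "\<forall>\<^sub>F N in sequentially. 0 \<le> Mean N (P N) 0 (\<lambda>e. (csum N (\<lambda>x. e x - kavg \<rho>ini spline N x) / real N)\<^sup>2)"
    by (intro always_eventually allI) (simp add: Mean_def expect_def marg_def sum_nonneg)
  show "\<forall>\<^sub>F N in sequentially. Mean N (P N) 0 (\<lambda>e. (csum N (\<lambda>x. e x - kavg \<rho>ini spline N x) / real N)\<^sup>2)
     \<le> (csum N (\<lambda>x. site_density \<rho>ini N x - kavg \<rho>ini spline N x) / real N)\<^sup>2 + 1 / real N"
    using eventually_ge_at_top[of 5]
  proof eventually_elim
    case (elim N)
    then have N: "N \<ge> 5" "N \<ge> 1" by auto
    show ?case using initial_mass_bound[OF N(1) pi]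
      by (simp add: Mean_def expect_initial[OF T N(2) law[OF N(2)]] ini_expect_def)
  qed
  have "(\<lambda>N. csum N (\<lambda>x. site_density \<rho>ini N x - kavg \<rho>ini spline N x) / real N) \<longlonglongrightarrow> 0"
    using trig_discrepancy[OF lr pi trig_const[of 1]] by simp
  from tendsto_add[OF tendsto_power[OF this, of 2] lim_1_over_n]
  show "(\<lambda>N. (csum N (\<lambda>x. site_density \<rho>ini N x - kavg \<rho>ini spline N x) / real N)\<^sup>2 + 1 / real N) \<longlonglongrightarrow> 0" by simp
qed

lemma energy_limit:
  assumes t: "t \<in> {0..T}"
  shows "(\<lambda>N. Mean N (P N) t (\<lambda>e. energy N (\<lambda>x. e x - kavg (\<rho> t) spline N x))) \<longlonglongrightarrow> 0" (is "?E \<longlonglongrightarrow> 0")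
proof (cases "t = 0")
  case True
  have "\<forall>\<^sub>F N in sequentially. Mean N (P N) 0 (\<lambda>e. energy N (\<lambda>x. e x - kavg \<rho>ini spline N x)) = ?E N"
    using eventually_ge_at_top[of 5] by eventually_elim (use lattice_initial[OF w] T True in simp)
  from Lim_transform_eventually[OF initial_energy_limit this] show ?thesis .
next
  case False
  then have t0: "0 < t" "t \<le> T" using t by auto
  have E0: "0 \<le> ?E N" if N: "N \<ge> 5" for N
  proof -
    have N': "N \<ge> 1" "N \<ge> 2" using N by auto
    have "Mean N (P N) t (\<lambda>_. 0) \<le> ?E N"
    proof (rule Mean_mono[OF N'(1)])
      fix e assume "e \<in> cfg N"
      then show "0 \<le> energy N (\<lambda>x. e x - kavg (\<rho> t) spline N x)"
        using periodic_comp2[OF cfg_periodic(1) kavg_periodic[OF N'(1)], of e "\<lambda>a b. a - b"] N' by (intro energy_nonneg) auto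
    qed
    then show ?thesis using Mean_const[OF T N law[OF N'(1)] t] by simp
  qed
  define F where "F p = clipped T \<rho> p" for p
  have wT: "weak_solution T \<rho>ini \<rho>" using w T by (simp add: weak_solution_at_all_times_def)
  have Fm: "F \<in> borel_measurable borel" unfolding F_def[abs_def] using clipped_measurable[OF wT] by simp
  have "\<rho> s u \<in> {0..1}" if "s \<in> {0..T}" "u \<in> {0..<1}" for s u using wT that by (auto simp: weak_solution_def)
  then have Fb: "0 \<le> F p" "F p \<le> 1" for p by (cases p; auto simp: F_def clipped_def indicator_def)+
  have Fe: "F (s, u) = \<rho> s u" if "s \<in> {0..T}" "u \<in> {0..<1}" for s u using that by (simp add: F_def clipped_def)
  show ?thesis
  proof (rule LIMSEQ_I)
    fix e :: real assume e: "e > 0"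
    \<comment> \<open>Budget: e/6 each for \<eta>, for the step approximation (10 times e/60) and
      for the term with ln M. The rest vanishes as N grows with \<eta>, k and M fixed, so the limit
      of U is at most e/2.\<close>
    define \<eta> where "\<eta> = e / (6 * t)"
    have \<eta>: "\<eta> > 0" "t * \<eta> = e / 6" using e t0 by (auto simp: \<eta>_def)
    obtain k \<gamma> where k: "k \<ge> 1" and g: "\<And>i j. 0 \<le> \<gamma> i j" "\<And>i j. \<gamma> i j \<le> (1::real)"
      and i0: "\<And>i. i < k \<Longrightarrow> set_integrable lborel (time_cell t k i) (\<lambda>s. LINT u:{0..<1}|lborel. \<bar>F (s, u) - \<gamma> i (nat \<lfloor>real k * u\<rfloor>)\<bar>)"
      and s0: "(\<Sum>i<k. LINT s:time_cell t k i|lborel. LINT u:{0..<1}|lborel. \<bar>F (s, u) - \<gamma> i (nat \<lfloor>real k * u\<rfloor>)\<bar>) \<le> e / 60"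
      using cell_approximation[OF Fm Fb t0(1), of "e / 60"] e by auto
    have AF: "(LINT u:{0..<1}|lborel. \<bar>F (s, u) - \<gamma> i (nat \<lfloor>real k * u\<rfloor>)\<bar>) = (LINT u:{0..<1}|lborel. \<bar>\<rho> s u - \<gamma> i (nat \<lfloor>real k * u\<rfloor>)\<bar>)"
      if "s \<in> time_cell t k i" "i < k" for s i
    proof -
      have "s \<in> {0..T}" using time_cell_bounds[OF t0(1) that(2)] that(1) t0(2) by (auto simp: time_cell_def)
      then show ?thesis by (intro set_lebesgue_integral_cong) (auto simp: Fe)
    qed
    have i1: "set_integrable lborel (time_cell t k i) (\<lambda>s. LINT u:{0..<1}|lborel. \<bar>\<rho> s u - \<gamma> i (nat \<lfloor>real k * u\<rfloor>)\<bar>)" if i: "i < k" for i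
      using i0[OF i] by (subst set_integrable_cong[OF refl refl AF[symmetric]]) (use i in auto)
    have s1: "(\<Sum>i<k. LINT s:time_cell t k i|lborel. LINT u:{0..<1}|lborel. \<bar>\<rho> s u - \<gamma> i (nat \<lfloor>real k * u\<rfloor>)\<bar>) \<le> e / 60"
    proof -
      have "(\<Sum>i<k. LINT s:time_cell t k i|lborel. LINT u:{0..<1}|lborel. \<bar>\<rho> s u - \<gamma> i (nat \<lfloor>real k * u\<rfloor>)\<bar>) =
        (\<Sum>i<k. LINT s:time_cell t k i|lborel. LINT u:{0..<1}|lborel. \<bar>F (s, u) - \<gamma> i (nat \<lfloor>real k * u\<rfloor>)\<bar>)"
      proof (rule sum.cong)
        fix i assume "i \<in> {..<k}"
        then show "(LINT s:time_cell t k i|lborel. LINT u:{0..<1}|lborel. \<bar>\<rho> s u - \<gamma> i (nat \<lfloor>real k * u\<rfloor>)\<bar>) =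
          (LINT s:time_cell t k i|lborel. LINT u:{0..<1}|lborel. \<bar>F (s, u) - \<gamma> i (nat \<lfloor>real k * u\<rfloor>)\<bar>)"
          by (intro set_lebesgue_integral_cong allI impI AF[symmetric]) (auto simp: time_cell_def)
      qed simp
      then show ?thesis using s0 by simp
    qed
    define q where "q = 114 * real k * t"
    obtain M where M: "M \<ge> 3" "q / ln (real M) \<le> e / 6"
    proof
      \<comment> \<open>The exponential makes ln M at least 6 q / e, and the maximum with 3 makes M
        admissible for \<open>cell_estimate\<close>.\<close>
      define a where "a = max 3 (exp (6 * q / e))"
      let ?M = "nat \<lceil>a\<rceil>"
      have a: "a \<ge> 3" "exp (6 * q / e) \<le> a" by (auto simp: a_def)
      have Ma: "real ?M \<ge> a" by linarith
      then have "real ?M \<ge> 3" using a by linarith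
      then show "?M \<ge> 3" by simp
      have "exp (6 * q / e) \<le> real ?M" "real ?M > 0" using a Ma by linarith+
      then have "ln (exp (6 * q / e)) \<le> ln (real ?M)" by (subst ln_le_cancel_iff) simp_all
      then have "6 * q / e \<le> ln (real ?M)" by simp
      moreover have "real ?M > 1" using a Ma by linarith
      then have "ln (real ?M) > 0" by (rule ln_gt_zero)
      ultimately show "q / ln (real ?M) \<le> e / 6" using e by (simp add: field_simps)
    qed
    define \<mu> where "\<mu> N = Mean N (P N) 0 (\<lambda>e. (csum N (\<lambda>x. e x - kavg \<rho>ini spline N x) / real N)\<^sup>2)" for N
    define U where "U N = Mean N (P N) 0 (\<lambda>e. energy N (\<lambda>x. e x - kavg \<rho>ini spline N x))
      + t * (\<eta> + \<mu> N / \<eta>) + q / ln (real M) + 10 * (e / 60)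
      + (2 * real k * cell_const M * (real k * (1 / real N) + 3 * t) + 16 * real k * t) * (1 / real N)" for N
    have "U \<longlonglongrightarrow> 0 + t * (\<eta> + 0 / \<eta>) + q / ln (real M) + 10 * (e / 60)
       + (2 * real k * cell_const M * (real k * 0 + 3 * t) + 16 * real k * t) * 0"
      unfolding U_def[abs_def] \<mu>_def
      by (intro tendsto_intros initial_energy_limit initial_mass_limit lim_1_over_n) (use \<eta> in auto)
    then have "U \<longlonglongrightarrow> e / 6 + q / ln (real M) + e / 6" using \<eta>(2) by simp
    moreover have "e / 6 + q / ln (real M) + e / 6 < e" using M e by linarith
    ultimately have "\<forall>\<^sub>F N in sequentially. U N < e" by (rule order_tendstoD(2))
    moreover have "\<forall>\<^sub>F N in sequentially. N \<ge> M + 5" by (rule eventually_ge_at_top)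
    ultimately have "\<forall>\<^sub>F N in sequentially. norm (?E N - 0) < e"
    proof eventually_elim
      case (elim N)
      then have N: "N \<ge> 5" "N \<ge> 1" "N \<ge> M + 4" by auto
      have "?E N \<le> U N"
        using energy_estimate[OF T N(1) law[OF N(2)] w t0 M(1) N(3) \<eta>(1) k g i1 s1]
        by (simp add: U_def \<mu>_def q_def)
      then show ?case using E0[OF N(1)] elim(1) by simp
    qed
    then show "\<exists>no. \<forall>n\<ge>no. norm (?E n - 0) < e" by (simp add: eventually_sequentially)
  qed
qed

lemma mass_limit:
  assumes t: "t \<in> {0..T}"
  shows "(\<lambda>N. Mean N (P N) t (\<lambda>e. (csum N (\<lambda>x. e x - kavg (\<rho> t) spline N x) / real N)\<^sup>2)) \<longlonglongrightarrow> 0"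
proof -
  have "\<forall>\<^sub>F N in sequentially. Mean N (P N) 0 (\<lambda>e. (csum N (\<lambda>x. e x - kavg \<rho>ini spline N x) / real N)\<^sup>2)
    = Mean N (P N) t (\<lambda>e. (csum N (\<lambda>x. e x - kavg (\<rho> t) spline N x) / real N)\<^sup>2)"
    using eventually_ge_at_top[of 5]
  proof eventually_elim
    case (elim N)
    then have N: "N \<ge> 5" "N \<ge> 1" by auto
    have T0: "T \<ge> 0" using T by simp
    show ?case
      using mass_fluctuation[OF T N(1) law[OF N(2)] lattice_prim[OF w T0 N(1)] kavg_periodic[OF N(2)] kavg_periodic[OF N(2)] t]
      unfolding lattice_initial[OF w T0 N(1)] by simp
  qed
  from Lim_transform_eventually[OF initial_mass_limit this] show ?thesis .
qed

end

theorem theorem2p4: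
  fixes T t \<delta> :: real
    and \<rho>ini \<phi> :: "real \<Rightarrow> real"
    and \<rho> :: "real \<Rightarrow> real \<Rightarrow> real"
    and P :: "nat \<Rightarrow> (real \<Rightarrow> nat \<Rightarrow> nat) measure"
  assumes "T > 0"
    and "\<rho>ini \<in> borel_measurable (restrict_space borel {0..<1})"
    and "\<And>u. u \<in> {0..<1} \<Longrightarrow> \<rho>ini u \<in> {0..1}"
    and "lattice_representative \<rho>ini"
    and "\<And>N. N \<ge> 1 \<Longrightarrow> FEP_law T N \<rho>ini (P N)"
    and "weak_solution_at_all_times T \<rho>ini \<rho>"
    and "t \<in> {0..T}"
    and "\<delta> > 0"
    and "smooth_on_torus \<phi>"
  shows "(\<lambda>N. measure (P N) {\<omega> \<in> space (P N).
            \<bar>1 / real N * (\<Sum>x<N. \<phi> (real x / real N) * real (\<omega> t x))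
             - torus_integral (\<lambda>u. \<phi> u * \<rho> t u)\<bar> > \<delta>}) \<longlonglongrightarrow> 0"
proof -
  note T = assms(1) and lr = assms(4) and law = assms(5) and w = assms(6) and t = assms(7) and \<delta> = assms(8)
  have pi: "profile \<rho>ini" using assms(2,3) by (rule lattice_profile)
  have wT: "weak_solution T \<rho>ini \<rho>" using w T by (simp add: weak_solution_at_all_times_def)
  have pt: "profile (\<rho> t)" by (rule weak_profile(1)[OF wT t])
  obtain B L where B: "\<And>u. \<bar>\<phi> u\<bar> \<le> B" and L: "\<And>u v. \<bar>\<phi> u - \<phi> v\<bar> \<le> L * \<bar>u - v\<bar>"
    using smooth_lipschitz[OF assms(9)] by blast
  have per: "\<phi> (u + 1) = \<phi> u" for u using assms(9) by (simp add: smooth_on_torus_def)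
  have "(deriv ^^ 0) \<phi> differentiable_on UNIV" using assms(9) unfolding smooth_on_torus_def by blast
  then have cont: "continuous_on UNIV \<phi>" by (simp add: differentiable_imp_continuous_on)
  define E where "E N = Mean N (P N) t (\<lambda>e. energy N (\<lambda>x. e x - kavg (\<rho> t) spline N x))" for N
  define m where "m N = Mean N (P N) t (\<lambda>e. (csum N (\<lambda>x. e x - kavg (\<rho> t) spline N x) / real N)\<^sup>2)" for N
  have lim: "E \<longlonglongrightarrow> 0" "m \<longlonglongrightarrow> 0" unfolding E_def[abs_def] m_def[abs_def]
    by (rule energy_limit[OF T pi lr law w t] mass_limit[OF T pi lr law w t]; assumption)+
  define X where "X N \<eta> = 1 / real N * (\<Sum>x<N. \<phi> (real x / real N) * real (\<eta> x)) - torus_integral (\<lambda>u. \<phi> u * \<rho> t u)" for N \<eta>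
  \<comment> \<open>The integral is replaced by a lattice sum of spline averages, a deterministic
    error below \<delta>/2 for large N. The other half of \<delta> is left for Y, whose second
    moment is controlled by energy and mass.\<close>
  define Y where "Y N e = csum N (\<lambda>x. \<phi> (of_int x / real N) * (e x - kavg (\<rho> t) spline N x)) / real N" for N e
  have bound: "measure (P N) {\<omega> \<in> space (P N). \<bar>X N (\<omega> t)\<bar> > \<delta>} \<le> (2 * B\<^sup>2 * m N + 2 * L\<^sup>2 * E N) / (\<delta> / 2)\<^sup>2"
    if N: "N \<ge> 5" and NL: "4 * L / real N < \<delta> / 2" for N
  proof -
    have N1: "N \<ge> 1" and N2: "N \<ge> 2" and N0: "real N > 0" using N by auto
    note lawN = law[OF N1]
    interpret prob_space "P N" using lawN by (simp add: FEP_law_def)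
    have XY: "\<bar>X N \<eta> - Y N (occ N \<eta>)\<bar> < \<delta> / 2" for \<eta>
    proof -
      have "(\<Sum>x<N. \<phi> (real x / real N) * real (\<eta> x)) = csum N (\<lambda>x. \<phi> (of_int x / real N) * occ N \<eta> x)"
        unfolding csum_def by (intro sum.cong) (auto simp: occ_def)
      then have "X N \<eta> - Y N (occ N \<eta>) = csum N (\<lambda>x. \<phi> (of_int x / real N) * kavg (\<rho> t) spline N x) / real N - (LINT u:{0..<1}|lborel. \<rho> t u * \<phi> u)"
        unfolding X_def Y_def right_diff_distrib csum_diff torus_integral_def by (simp add: diff_divide_distrib mult.commute)
      then show ?thesis using kavg_test[OF pt unity_spline N per cont L] NL by simp
    qed
    have "measure (P N) {\<omega> \<in> space (P N). \<bar>X N (\<omega> t)\<bar> > \<delta>} \<le> measure (P N) {\<omega> \<in> space (P N). \<bar>Y N (occ N (\<omega> t))\<bar> > \<delta> / 2}"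
    proof (rule finite_measure_mono)
      show "{\<omega> \<in> space (P N). \<bar>X N (\<omega> t)\<bar> > \<delta>} \<subseteq> {\<omega> \<in> space (P N). \<bar>Y N (occ N (\<omega> t))\<bar> > \<delta> / 2}"
      proof (intro subsetI CollectI conjI)
        fix \<omega> assume \<omega>: "\<omega> \<in> {\<omega> \<in> space (P N). \<bar>X N (\<omega> t)\<bar> > \<delta>}"
        then show "\<omega> \<in> space (P N)" by simp
        from \<omega> have "\<bar>X N (\<omega> t)\<bar> > \<delta>" by simp
        then show "\<bar>Y N (occ N (\<omega> t))\<bar> > \<delta> / 2" using XY[of "\<omega> t"] by linarith
      qed
    qed (rule eval_event[OF T N1 lawN t])
    also have "\<dots> \<le> Mean N (P N) t (\<lambda>e. (Y N e)\<^sup>2) / (\<delta> / 2)\<^sup>2"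
      unfolding Mean_def using \<delta> by (intro markov[OF T N1 lawN t]) simp
    also have "\<dots> \<le> (2 * B\<^sup>2 * m N + 2 * L\<^sup>2 * E N) / (\<delta> / 2)\<^sup>2"
    proof (rule divide_right_mono)
      have "Mean N (P N) t (\<lambda>e. (Y N e)\<^sup>2) \<le> Mean N (P N) t (\<lambda>e. 2 * B\<^sup>2 * (csum N (\<lambda>x. e x - kavg (\<rho> t) spline N x) / real N)\<^sup>2
          + 2 * L\<^sup>2 * energy N (\<lambda>x. e x - kavg (\<rho> t) spline N x))"
      proof (rule Mean_mono[OF N1])
        fix e assume e: "e \<in> cfg N"
        have p: "periodic N (\<lambda>x. e x - kavg (\<rho> t) spline N x)"
          using periodic_comp2[OF cfg_periodic(1)[OF e] kavg_periodic[OF N1], of "\<lambda>a b. a - b"] .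
        have b: "periodic N (\<lambda>x. \<phi> (of_int x / real N))" unfolding periodic_def
        proof
          fix x show "\<phi> (of_int (x + int N) / real N) = \<phi> (of_int x / real N)"
            using per[of "of_int x / real N"] N0 by (simp add: add_divide_distrib)
        qed
        have "\<bar>\<phi> (of_int (x + 1) / real N) - \<phi> (of_int x / real N)\<bar> \<le> L / real N" for x
          using L[of "of_int (x + 1) / real N" "of_int x / real N"] N0 by (simp add: diff_divide_distrib[symmetric])
        from energy_controls[OF p b N2 B this]
        show "(Y N e)\<^sup>2 \<le> 2 * B\<^sup>2 * (csum N (\<lambda>x. e x - kavg (\<rho> t) spline N x) / real N)\<^sup>2
          + 2 * L\<^sup>2 * energy N (\<lambda>x. e x - kavg (\<rho> t) spline N x)" by (simp add: Y_def)
      qed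
      then show "Mean N (P N) t (\<lambda>e. (Y N e)\<^sup>2) \<le> 2 * B\<^sup>2 * m N + 2 * L\<^sup>2 * E N"
        unfolding Mean_add Mean_cmult m_def E_def .
    qed simp
    finally show ?thesis .
  qed
  have "(\<lambda>N. 4 * L * (1 / real N)) \<longlonglongrightarrow> 4 * L * 0" by (intro tendsto_intros lim_1_over_n)
  then have "\<forall>\<^sub>F N in sequentially. 4 * L / real N < \<delta> / 2" using \<delta> by (intro order_tendstoD(2)) auto
  then have ub: "\<forall>\<^sub>F N in sequentially. measure (P N) {\<omega> \<in> space (P N). \<bar>X N (\<omega> t)\<bar> > \<delta>} \<le> (2 * B\<^sup>2 * m N + 2 * L\<^sup>2 * E N) / (\<delta> / 2)\<^sup>2"
    using eventually_ge_at_top[of 5] by eventually_elim (rule bound)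
  have "(\<lambda>N. (2 * B\<^sup>2 * m N + 2 * L\<^sup>2 * E N) / (\<delta> / 2)\<^sup>2) \<longlonglongrightarrow> (2 * B\<^sup>2 * 0 + 2 * L\<^sup>2 * 0) / (\<delta> / 2)\<^sup>2"
    using \<delta> by (intro tendsto_intros lim) auto
  then have "(\<lambda>N. (2 * B\<^sup>2 * m N + 2 * L\<^sup>2 * E N) / (\<delta> / 2)\<^sup>2) \<longlonglongrightarrow> 0" by simp
  from tendsto_sandwich[OF _ ub tendsto_const this]
  show ?thesis unfolding X_def by simp
qed

end
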